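(* Let $\mathfrak g=\mathfrak{so}(8,\mathbb C)$ be the complex simple Lie algebra of type $D_4$ and let $\mathfrak q=\mathfrak l\oplus\mathfrak n$ be its parabolic subalgebra of Heisenberg type. Then the $\tilde\Omega_3$ system is conformally invariant on the line bundle $\mathcal L_1$; that is, for a basis $Y_1,\dots,Y_m$ of $V^-$, the list of differential operators $\tilde\Omega_3(Y_1),\dots,\tilde\Omega_3(Y_m)\in\mathbb D(\mathcal L_1)$ is a conformally invariant system on $\mathcal L_1$ with respect to $\Pi$.
   Context: Lie algebra. $\mathfrak g=\mathfrak{so}(8,\mathbb C)$, $\mathfrak h$ a Cartan subalgebra, $\Delta$ the roots, $\Delta^+$ a positive system, $S$ the simple roots, $\gamma$ the highest root. $B_{\mathfrak g}$ is the positive multiple of the Killing form, and $(\cdot,\cdot)$ the induced form on $\mathfrak h^*$, for which root vectors $X_\alpha\in\mathfrak g_\alpha$ and $H_\alpha\in\mathfrak h$ ($\alpha\in\Delta$) can be and are chosen with: $\{X_{-\alpha},H_\alpha,X_\alpha\}$ an $\mathfrak{sl}(2)$-triple with $[X_\alpha,X_{-\alpha}]=H_\alpha$ for $\alpha\in\Delta^+$; $[H_\alpha,X_\beta]=\beta(H_\alpha)X_\beta$; $B_{\mathfrak g}(X_\alpha,X_{-\alpha})=1$, so $(\alpha,\alpha)=2$; $\beta(H_\alpha)=(\beta,\alpha)$. $\mathfrak q=\mathfrak l\oplus\mathfrak n$ is the standard parabolic subalgebra corresponding to $\{\alpha\in S:(\alpha,\gamma)=0\}$ (Heisenberg type), with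 Levi factor $\mathfrak l\supset\mathfrak h$ and nilradical $\mathfrak n$; $\bar{\mathfrak n}$ is the opposite nilradical. The decomposition of $\mathfrak g$ into eigenspaces of $\mathrm{ad}(H_\gamma)$ for the eigenvalues $-2,-1,0,1,2$ is $\mathfrak g=\mathfrak z(\bar{\mathfrak n})\oplus V^-\oplus\mathfrak l\oplus V^+\oplus\mathfrak z(\mathfrak n)$. $\Delta(V^+)$ is the set of roots $\alpha$ with $\mathfrak g_\alpha\subset V^+$. For $Y\in\mathfrak g$ write $Y=Y_{\bar{\mathfrak n}}+Y_{\mathfrak q}$ along $\mathfrak g=\bar{\mathfrak n}\oplus\mathfrak q$. Groups and actions. $G_0$ is a connected real form of $SO(8,\mathbb C)$, with Lie algebra $\mathfrak g_0$ whose complexification is $\mathfrak g$, containing a real parabolic subgroup $Q_0=L_0N_0$ (Levi decomposition) such that the complexified Lie algebras of $Q_0,L_0,N_0$ are $\mathfrak q,\mathfrak l,\mathfrak n$; $\bar N_0$ is the opposite nilpotent subgroup, with Lie algebra $\bar{\mathfrak n}_0$ whose complexification is $\bar{\mathfrak n}$. $\chi$ is the character of $L_0$ defined by $\mathrm{Ad}(l)X_\gamma=\chi(l)X_\gamma$, extended trivially over $N_0$ to $Q_0$; $d\chi$ is its differential, extended complex linearly to $\mathfrak q$ (so $d\chi|_{\mathfrak h}=\gamma$ and $d\chi|_{\mathfrak n}=0$). $\mathcal L_1$ is the trivial line bundle over $\bar N_0$ with fiber $\mathbb C_\chi$; its sections are $C^\infty(\bar N_0,\mathbb C_\chi)$,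 and $\mathbb D(\mathcal L_1)$ is the algebra of differential operators (smooth coefficients) on these sections. For $X\in\bar{\mathfrak n}_0$, $(R(X)f)(\bar n)=\frac{d}{dt}f(\bar n\exp(tX))|_{t=0}$; $R$ is extended to $\mathcal U(\bar{\mathfrak n})$. For $Y\in\mathfrak g$, $\Pi(Y)\in\mathbb D(\mathcal L_1)$ is $$(\Pi(Y)f)(\bar n)=d\chi\big((\mathrm{Ad}(\bar n^{-1})Y)_{\mathfrak q}\big)f(\bar n)-\big(R((\mathrm{Ad}(\bar n^{-1})Y)_{\bar{\mathfrak n}})f\big)(\bar n).$$ (This is the action coming from left translation on functions $F$ on $G_0$ with $F(gq)=\chi(q^{-1})F(g)$ for $q\in Q_0$.) Operators. For $\beta\in\Delta(V^+)$ put $\beta'=\gamma-\beta$, define $N_{\beta,\beta'}$ by $[X_\beta,X_{\beta'}]=N_{\beta,\beta'}X_\gamma$, and for $Z\in\mathfrak l$ define $M_{\alpha,\beta}(Z)$ by $[Z,X_\alpha]=\sum_{\beta\in\Delta(V^+)}M_{\alpha,\beta}(Z)X_\beta$. The linear map $\Omega_2:\mathfrak l\to\mathbb D(\mathcal L_1)$ is given, using $\mathfrak l=[\mathfrak l,\mathfrak l]\oplus\mathbb CH_\gamma$, by $\Omega_2(H_\gamma)=0$ and $$\Omega_2(Z)=-\tfrac12\sum_{\alpha,\beta\in\Delta(V^+)}N_{\beta,\beta'}M_{\alpha,\beta'}(Z)R(X_{-\alpha})R(X_{-\beta})\quad(Z\in[\mathfrak l,\mathfrak l]).$$ For $Y\in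 V^-$, $\tilde\Omega_3(Y)=\sum_{\epsilon\in\Delta(V^+)}R(X_{-\epsilon})\,\Omega_2([X_\epsilon,Y])$. Conformal invariance. A list $D_1,\dots,D_m\in\mathbb D(\mathcal L_1)$ is a conformally invariant system on $\mathcal L_1$ with respect to $\Pi$ if (i) the list is linearly independent at each point of $\bar N_0$, i.e. for each $\bar n\in\bar N_0$ the linear functionals $f\mapsto(D_jf)(\bar n)$ are linearly independent; and (ii) for each $Y\in\mathfrak g$ there is an $m\times m$ matrix $C(Y)$ of smooth functions on $\bar N_0$ with $[\Pi(Y),D_j]=\sum_iC_{ij}(Y)D_i$ in $\mathbb D(\mathcal L_1)$ for all $j$. *)

theory Defs
  imports "HOL-Analysis.Analysis" "HOL-Library.Function_Algebras"
begin

type_synonym mat8 = "complex^8^8"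

definition cscale :: "complex \<Rightarrow> mat8 \<Rightarrow> mat8" (infixr \<open>*\<^sub>C\<close> 75)
  where "c *\<^sub>C A = (\<chi> i j. c * A $ i $ j)"

global_interpretation cmat: vector_space cscale
  by unfold_locales (simp_all add: cscale_def vec_eq_iff algebra_simps)

definition lbr :: "mat8 \<Rightarrow> mat8 \<Rightarrow> mat8"
  where "lbr A B = A ** B - B ** A"

definition Ad :: "mat8 \<Rightarrow> mat8 \<Rightarrow> mat8"
  where "Ad g Y = g ** Y ** matrix_inv g"

definition mexp :: "mat8 \<Rightarrow> mat8"
  where "mexp A = (\<Sum>n. (1 / fact n) *\<^sub>R (((**) A ^^ n) (mat 1)))"

definition so8 :: "mat8 set"
  where "so8 = {A. transpose A = - A}"

definition SO8 :: "mat8 set"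
  where "SO8 = {A. transpose A ** A = mat 1 \<and> det A = 1}"

definition matrix_group :: "mat8 set \<Rightarrow> bool"
  where "matrix_group G \<longleftrightarrow> mat 1 \<in> G \<and>
    (\<forall>a\<in>G. invertible a \<and> matrix_inv a \<in> G) \<and> (\<forall>a\<in>G. \<forall>b\<in>G. a ** b \<in> G)"

definition lie_alg :: "mat8 set \<Rightarrow> mat8 set"
  where "lie_alg G = {A. \<forall>t::real. mexp (t *\<^sub>R A) \<in> G}"

text \<open>The connected Lie subgroup with a given Lie algebra \<open>V\<close> is the group generated by
  the exponentials of the elements of \<open>V\<close>.\<close>

definition connected_lie_group :: "mat8 set \<Rightarrow> mat8 set"
  where "connected_lie_group V = \<Inter>{G. matrix_group G \<and> mexp ` V \<subseteq> G}"

definition proj_along :: "mat8 set \<Rightarrow> mat8 set \<Rightarrow> mat8 \<Rightarrow> mat8"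
  where "proj_along V W Y = (THE v. v \<in> V \<and> (\<exists>w\<in>W. Y = v + w))"

definition lin_trace :: "mat8 set \<Rightarrow> (mat8 \<Rightarrow> mat8) \<Rightarrow> complex"
  where "lin_trace V T =
    (let B = (SOME B. \<not> cmat.dependent B \<and> cmat.span B = V)
     in \<Sum>b\<in>B. cmat.representation B (T b) b)"

definition killing_form :: "mat8 \<Rightarrow> mat8 \<Rightarrow> complex"
  where "killing_form Y Z = lin_trace so8 (\<lambda>W. lbr Y (lbr Z W))"

definition complexifies_to :: "mat8 set \<Rightarrow> mat8 set \<Rightarrow> bool"
  where "complexifies_to V0 V \<longleftrightarrow>
    subspace V0 \<and> bij_betw (\<lambda>(A, B). A + \<i> *\<^sub>C B) (V0 \<times> V0) V"

text \<open>Complex linear extension to \<open>V0 \<oplus> \<i> V0\<close> of a real linear map on \<open>V0\<close>.\<close>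

definition clin_ext :: "mat8 set \<Rightarrow> (mat8 \<Rightarrow> complex) \<Rightarrow> mat8 \<Rightarrow> complex"
  where "clin_ext V0 \<phi> Z =
    (let (A, B) = inv_into (V0 \<times> V0) (\<lambda>(A, B). A + \<i> *\<^sub>C B) Z in \<phi> A + \<i> * \<phi> B)"

fun Ck_on :: "nat \<Rightarrow> 'a::real_normed_vector set \<Rightarrow> ('a \<Rightarrow> 'b::real_normed_vector) \<Rightarrow> bool"
  where
    "Ck_on 0 U f \<longleftrightarrow> continuous_on U f"
  | "Ck_on (Suc k) U f \<longleftrightarrow> f differentiable_on U \<and>
       (\<forall>v. Ck_on k U (\<lambda>x. frechet_derivative f (at x) v))"

text \<open>Smooth complex-valued functions on a submanifold \<open>M\<close> of the space of matrices (real
  smoothness, via local smooth extensions to open sets of matrices).  They are made total by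
  the value \<open>0\<close> off \<open>M\<close>, so that equal functions on \<open>M\<close> are equal.\<close>

definition smooth_funs :: "mat8 set \<Rightarrow> (mat8 \<Rightarrow> complex) set"
  where "smooth_funs M = {f.
    (\<forall>x\<in>M. \<exists>U F. open U \<and> x \<in> U \<and> (\<forall>k. Ck_on k U F) \<and> (\<forall>y\<in>M \<inter> U. F y = f y)) \<and>
    (\<forall>x. x \<notin> M \<longrightarrow> f x = 0)}"

text \<open>Smooth complex vector fields, as derivations of the algebra of smooth functions.\<close>

definition vector_fields :: "mat8 set \<Rightarrow> ((mat8 \<Rightarrow> complex) \<Rightarrow> mat8 \<Rightarrow> complex) set"
  where "vector_fields M = {v.
    (\<forall>f\<in>smooth_funs M. v f \<in> smooth_funs M) \<and>
    (\<forall>f\<in>smooth_funs M. \<forall>g\<in>smooth_funs M. v (\<lambda>x. f x + g x) = (\<lambda>x. v f x + v g x)) \<and>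
    (\<forall>c. \<forall>f\<in>smooth_funs M. v (\<lambda>x. c * f x) = (\<lambda>x. c * v f x)) \<and>
    (\<forall>f\<in>smooth_funs M. \<forall>g\<in>smooth_funs M.
       v (\<lambda>x. f x * g x) = (\<lambda>x. v f x * g x + f x * v g x))}"

text \<open>The algebra of differential operators with smooth coefficients, generated by
  multiplications by smooth functions and by vector fields.  Only the action of an operator on
  smooth functions is relevant, which is the content of the last rule.\<close>

inductive_set diff_ops :: "mat8 set \<Rightarrow> ((mat8 \<Rightarrow> complex) \<Rightarrow> mat8 \<Rightarrow> complex) set"
  for M :: "mat8 set"
  where
    mult: "a \<in> smooth_funs M \<Longrightarrow> (\<lambda>f x. a x * f x) \<in> diff_ops M"
  | field: "v \<in> vector_fields M \<Longrightarrow> v \<in> diff_ops M"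
  | add: "P \<in> diff_ops M \<Longrightarrow> Q \<in> diff_ops M \<Longrightarrow> (\<lambda>f x. P f x + Q f x) \<in> diff_ops M"
  | comp: "P \<in> diff_ops M \<Longrightarrow> Q \<in> diff_ops M \<Longrightarrow> (\<lambda>f. P (Q f)) \<in> diff_ops M"
  | cong: "P \<in> diff_ops M \<Longrightarrow> (\<And>f. f \<in> smooth_funs M \<Longrightarrow> Q f = P f) \<Longrightarrow> Q \<in> diff_ops M"

definition conformally_invariant_system ::
  "mat8 set \<Rightarrow> mat8 set \<Rightarrow> (mat8 \<Rightarrow> (mat8 \<Rightarrow> complex) \<Rightarrow> mat8 \<Rightarrow> complex) \<Rightarrow>
   ((mat8 \<Rightarrow> complex) \<Rightarrow> mat8 \<Rightarrow> complex) list \<Rightarrow> bool"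
  where "conformally_invariant_system M \<gg> Act Ds \<longleftrightarrow>
    set Ds \<subseteq> diff_ops M \<and>
    (\<forall>x\<in>M. \<forall>c :: nat \<Rightarrow> complex.
       (\<forall>f\<in>smooth_funs M. (\<Sum>j<length Ds. c j * (Ds ! j) f x) = 0) \<longrightarrow>
       (\<forall>j<length Ds. c j = 0)) \<and>
    (\<forall>Y\<in>\<gg>. \<exists>C :: nat \<Rightarrow> nat \<Rightarrow> mat8 \<Rightarrow> complex.
       (\<forall>i<length Ds. \<forall>j<length Ds. C i j \<in> smooth_funs M) \<and>
       (\<forall>j<length Ds. \<forall>f\<in>smooth_funs M. \<forall>x\<in>M.
          Act Y ((Ds ! j) f) x - (Ds ! j) (Act Y f) x = (\<Sum>i<length Ds. C i j x * (Ds ! i) f x)))"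

text \<open>Elements of the dual of \<open>\<hh>\<close>, extended by \<open>0\<close> off \<open>\<hh>\<close> so that they can be compared,
  added and summed over.\<close>

type_synonym weight = "mat8 \<Rightarrow> complex"

definition cartan_subalgebra :: "mat8 set \<Rightarrow> bool"
  where "cartan_subalgebra \<hh> \<longleftrightarrow>
    cmat.subspace \<hh> \<and> \<hh> \<subseteq> so8 \<and> (\<forall>H\<in>\<hh>. \<forall>H'\<in>\<hh>. lbr H H' = 0) \<and>
    (\<forall>\<aa>. cmat.subspace \<aa> \<and> \<aa> \<subseteq> so8 \<and> (\<forall>H\<in>\<aa>. \<forall>H'\<in>\<aa>. lbr H H' = 0) \<and> \<hh> \<subseteq> \<aa> \<longrightarrow> \<aa> = \<hh>) \<and>
    (\<forall>H\<in>\<hh>. cmat.span {Z \<in> so8. \<exists>c. lbr H Z = c *\<^sub>C Z} = so8)"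

definition dual :: "mat8 set \<Rightarrow> weight set"
  where "dual \<hh> = {\<alpha>. (\<forall>x\<in>\<hh>. \<forall>y\<in>\<hh>. \<alpha> (x + y) = \<alpha> x + \<alpha> y) \<and>
    (\<forall>c. \<forall>x\<in>\<hh>. \<alpha> (c *\<^sub>C x) = c * \<alpha> x) \<and> (\<forall>x. x \<notin> \<hh> \<longrightarrow> \<alpha> x = 0)}"

definition root_space :: "mat8 set \<Rightarrow> weight \<Rightarrow> mat8 set"
  where "root_space \<hh> \<alpha> = {Z \<in> so8. \<forall>H\<in>\<hh>. lbr H Z = \<alpha> H *\<^sub>C Z}"

definition roots :: "mat8 set \<Rightarrow> weight set"
  where "roots \<hh> = {\<alpha> \<in> dual \<hh>. \<alpha> \<noteq> 0 \<and> root_space \<hh> \<alpha> \<noteq> {0}}"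

definition positive_system :: "mat8 set \<Rightarrow> weight set \<Rightarrow> bool"
  where "positive_system \<hh> P \<longleftrightarrow> P \<subseteq> roots \<hh> \<and>
    (\<forall>\<alpha>\<in>roots \<hh>. (\<alpha> \<in> P) \<noteq> (- \<alpha> \<in> P)) \<and>
    (\<forall>\<alpha>\<in>P. \<forall>\<beta>\<in>P. \<alpha> + \<beta> \<in> roots \<hh> \<longrightarrow> \<alpha> + \<beta> \<in> P)"

definition simple_roots :: "weight set \<Rightarrow> weight set"
  where "simple_roots P = {\<alpha> \<in> P. \<not> (\<exists>\<beta>\<in>P. \<exists>\<delta>\<in>P. \<alpha> = \<beta> + \<delta>)}"

definition highest_root :: "mat8 set \<Rightarrow> weight set \<Rightarrow> weight \<Rightarrow> bool"
  where "highest_root \<hh> P \<gamma> \<longleftrightarrow> \<gamma> \<in> roots \<hh> \<and>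
    (\<forall>\<alpha>\<in>roots \<hh>. \<exists>k :: weight \<Rightarrow> nat. \<forall>H.
       \<gamma> H - \<alpha> H = (\<Sum>\<sigma>\<in>simple_roots P. of_nat (k \<sigma>) * \<sigma> H))"

definition sl2_triple :: "mat8 \<Rightarrow> mat8 \<Rightarrow> mat8 \<Rightarrow> bool"
  where "sl2_triple F H E \<longleftrightarrow>
    lbr H E = 2 *\<^sub>C E \<and> lbr H F = (- 2) *\<^sub>C F \<and> lbr E F = H"

text \<open>\<open>kfactor\<close> is the multiple of the Killing form giving \<open>B\<close>; \<open>Xv\<close> and \<open>Hv\<close> are the
  families \<open>X\<^sub>\<alpha>\<close> and \<open>H\<^sub>\<alpha>\<close>.\<close>

record heis_data =
  csa :: "mat8 set"
  pos :: "weight set"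
  hroot :: weight
  kfactor :: real
  Xv :: "weight \<Rightarrow> mat8"
  Hv :: "weight \<Rightarrow> mat8"
  G0 :: "mat8 set"
  Q0 :: "mat8 set"
  L0 :: "mat8 set"

definition Bform :: "heis_data \<Rightarrow> mat8 \<Rightarrow> mat8 \<Rightarrow> complex"
  where "Bform D Y Z = of_real (kfactor D) * killing_form Y Z"

definition Bdual :: "heis_data \<Rightarrow> weight \<Rightarrow> mat8"
  where "Bdual D \<alpha> = (THE T. T \<in> csa D \<and> (\<forall>H\<in>csa D. Bform D T H = \<alpha> H))"

definition wip :: "heis_data \<Rightarrow> weight \<Rightarrow> weight \<Rightarrow> complex"
  where "wip D \<alpha> \<beta> = Bform D (Bdual D \<alpha>) (Bdual D \<beta>)"

definition levi_roots :: "heis_data \<Rightarrow> weight set"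
  where "levi_roots D = {\<alpha> \<in> roots (csa D). \<exists>k :: weight \<Rightarrow> int. \<forall>H.
    \<alpha> H = (\<Sum>\<sigma>\<in>{\<sigma> \<in> simple_roots (pos D). wip D \<sigma> (hroot D) = 0}. of_int (k \<sigma>) * \<sigma> H)}"

definition levi :: "heis_data \<Rightarrow> mat8 set"
  where "levi D = cmat.span (csa D \<union> (\<Union>\<alpha>\<in>levi_roots D. root_space (csa D) \<alpha>))"

definition nil :: "heis_data \<Rightarrow> mat8 set"
  where "nil D = cmat.span (\<Union>\<alpha>\<in>pos D - levi_roots D. root_space (csa D) \<alpha>)"

definition nilbar :: "heis_data \<Rightarrow> mat8 set"
  where "nilbar D = cmat.span (\<Union>\<alpha>\<in>pos D - levi_roots D. root_space (csa D) (- \<alpha>))"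

definition parab :: "heis_data \<Rightarrow> mat8 set"
  where "parab D = {Z + W | Z W. Z \<in> levi D \<and> W \<in> nil D}"

definition eigsp :: "heis_data \<Rightarrow> complex \<Rightarrow> mat8 set"
  where "eigsp D c = {Z \<in> so8. lbr (Hv D (hroot D)) Z = c *\<^sub>C Z}"

abbreviation Vplus :: "heis_data \<Rightarrow> mat8 set"
  where "Vplus D \<equiv> eigsp D 1"

abbreviation Vminus :: "heis_data \<Rightarrow> mat8 set"
  where "Vminus D \<equiv> eigsp D (- 1)"

definition roots_Vplus :: "heis_data \<Rightarrow> weight set"
  where "roots_Vplus D = {\<alpha> \<in> roots (csa D). root_space (csa D) \<alpha> \<subseteq> Vplus D}"

definition N0 :: "heis_data \<Rightarrow> mat8 set"
  where "N0 D = connected_lie_group (lie_alg (G0 D) \<inter> nil D)"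

definition nilbar0 :: "heis_data \<Rightarrow> mat8 set"
  where "nilbar0 D = lie_alg (G0 D) \<inter> nilbar D"

definition Nbar0 :: "heis_data \<Rightarrow> mat8 set"
  where "Nbar0 D = connected_lie_group (nilbar0 D)"

definition heisenberg_setting :: "heis_data \<Rightarrow> bool"
  where "heisenberg_setting D \<longleftrightarrow>
    cartan_subalgebra (csa D) \<and>
    positive_system (csa D) (pos D) \<and>
    highest_root (csa D) (pos D) (hroot D) \<and>
    kfactor D > 0 \<and>
    (\<forall>\<alpha>\<in>roots (csa D). Xv D \<alpha> \<in> root_space (csa D) \<alpha> \<and> Hv D \<alpha> \<in> csa D \<and>
       Bform D (Xv D \<alpha>) (Xv D (- \<alpha>)) = 1 \<and> wip D \<alpha> \<alpha> = 2) \<and>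
    (\<forall>\<alpha>\<in>pos D. sl2_triple (Xv D (- \<alpha>)) (Hv D \<alpha>) (Xv D \<alpha>)) \<and>
    (\<forall>\<alpha>\<in>roots (csa D). \<forall>\<beta>\<in>roots (csa D).
       lbr (Hv D \<alpha>) (Xv D \<beta>) = \<beta> (Hv D \<alpha>) *\<^sub>C Xv D \<beta> \<and> \<beta> (Hv D \<alpha>) = wip D \<beta> \<alpha>) \<and>
    G0 D \<subseteq> SO8 \<and> matrix_group (G0 D) \<and> closed (G0 D) \<and> connected (G0 D) \<and>
    complexifies_to (lie_alg (G0 D)) so8 \<and>
    Q0 D = {g \<in> G0 D. Ad g ` parab D = parab D} \<and>
    matrix_group (L0 D) \<and> closed (L0 D) \<and> L0 D \<inter> N0 D = {mat 1} \<and>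
    Q0 D = {l ** n | l n. l \<in> L0 D \<and> n \<in> N0 D} \<and>
    (\<forall>g\<in>Q0 D. Ad g ` N0 D = N0 D) \<and>
    complexifies_to (lie_alg (Q0 D)) (parab D) \<and>
    complexifies_to (lie_alg (L0 D)) (levi D) \<and>
    complexifies_to (lie_alg (N0 D)) (nil D) \<and>
    complexifies_to (nilbar0 D) (nilbar D)"

definition chi :: "heis_data \<Rightarrow> mat8 \<Rightarrow> complex"
  where "chi D l = (THE c. Ad l (Xv D (hroot D)) = c *\<^sub>C Xv D (hroot D))"

definition chiQ :: "heis_data \<Rightarrow> mat8 \<Rightarrow> complex"
  where "chiQ D g = chi D (THE l. l \<in> L0 D \<and> (\<exists>n\<in>N0 D. g = l ** n))"

definition dchi :: "heis_data \<Rightarrow> mat8 \<Rightarrow> complex"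
  where "dchi D = clin_ext (lie_alg (Q0 D))
    (\<lambda>Y. vector_derivative (\<lambda>t::real. chiQ D (mexp (t *\<^sub>R Y))) (at 0))"

text \<open>Sections of \<open>\<L>\<^sub>1\<close> are the elements of \<open>smooth_funs (Nbar0 D)\<close>; accordingly the
  operators below return functions vanishing off \<open>Nbar0 D\<close>.\<close>

definition Rop :: "heis_data \<Rightarrow> mat8 \<Rightarrow> (mat8 \<Rightarrow> complex) \<Rightarrow> mat8 \<Rightarrow> complex"
  where "Rop D Z f n = (if n \<in> Nbar0 D then
    clin_ext (nilbar0 D) (\<lambda>A. vector_derivative (\<lambda>t::real. f (n ** mexp (t *\<^sub>R A))) (at 0)) Z
    else 0)"

definition Pi_act :: "heis_data \<Rightarrow> mat8 \<Rightarrow> (mat8 \<Rightarrow> complex) \<Rightarrow> mat8 \<Rightarrow> complex"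
  where "Pi_act D Y f n = (if n \<in> Nbar0 D then
    dchi D (proj_along (parab D) (nilbar D) (Ad (matrix_inv n) Y)) * f n
    - Rop D (proj_along (nilbar D) (parab D) (Ad (matrix_inv n) Y)) f n
    else 0)"

definition Ncoef :: "heis_data \<Rightarrow> weight \<Rightarrow> complex"
  where "Ncoef D \<beta> =
    (THE c. lbr (Xv D \<beta>) (Xv D (hroot D - \<beta>)) = c *\<^sub>C Xv D (hroot D))"

definition Mcoef :: "heis_data \<Rightarrow> mat8 \<Rightarrow> weight \<Rightarrow> weight \<Rightarrow> complex"
  where "Mcoef D Z \<alpha> = (THE m. (\<forall>\<beta>. \<beta> \<notin> roots_Vplus D \<longrightarrow> m \<beta> = 0) \<and>
    lbr Z (Xv D \<alpha>) = (\<Sum>\<beta>\<in>roots_Vplus D. m \<beta> *\<^sub>C Xv D \<beta>))"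

definition levi_ss :: "heis_data \<Rightarrow> mat8 set"
  where "levi_ss D = cmat.span {lbr Z W | Z W. Z \<in> levi D \<and> W \<in> levi D}"

definition Omega2 :: "heis_data \<Rightarrow> mat8 \<Rightarrow> (mat8 \<Rightarrow> complex) \<Rightarrow> mat8 \<Rightarrow> complex"
  where "Omega2 D Z f n =
    (let Z' = proj_along (levi_ss D) (range (\<lambda>c. c *\<^sub>C Hv D (hroot D))) Z
     in - (1 / 2) * (\<Sum>\<alpha>\<in>roots_Vplus D. \<Sum>\<beta>\<in>roots_Vplus D.
          Ncoef D \<beta> * Mcoef D Z' \<alpha> (hroot D - \<beta>) *
          Rop D (Xv D (- \<alpha>)) (Rop D (Xv D (- \<beta>)) f) n))"

definition Omega3 :: "heis_data \<Rightarrow> mat8 \<Rightarrow> (mat8 \<Rightarrow> complex) \<Rightarrow> mat8 \<Rightarrow> complex"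
  where "Omega3 D Y f n =
    (\<Sum>\<epsilon>\<in>roots_Vplus D. Rop D (Xv D (- \<epsilon>)) (Omega2 D (lbr (Xv D \<epsilon>) Y) f) n)"

end

theory Submission
  imports Defs "HOL-Computational_Algebra.Fundamental_Theorem_Algebra"
begin

text \<open>
  Put \<open>\<complex>\<^sup>8 = E \<oplus> V\<^sub>0 \<oplus> E'\<close> with \<open>E\<close>, \<open>E'\<close> isotropic planes in duality and \<open>V\<^sub>0\<close> a
  nondegenerate space of dimension 4.  A Cartan subalgebra is diagonal in a basis of isotropic
  weight vectors \<open>u\<^sub>c\<close>, the roots are the sums \<open>\<epsilon>\<^sub>c + \<epsilon>\<^sub>d\<close> with root vectors \<open>u\<^sub>c \<and> u\<^sub>d\<close>, and the basis
  can be labelled so that the highest root is \<open>\<epsilon>\<^sub>1 + \<epsilon>\<^sub>2\<close>.  Then \<open>E\<close> has the basis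
  \<open>e\<^sub>1 = u\<^sub>1, e\<^sub>2 = u\<^sub>2\<close>, \<open>E'\<close> has the dual basis \<open>f\<^sub>1, f\<^sub>2\<close>, and \<open>V\<^sub>0\<close> gets an orthonormal basis
  \<open>v\<^sub>1, \<dots>, v\<^sub>4\<close>.  The Levi factor is \<open>gl(E) \<oplus> so(V\<^sub>0)\<close>, the space \<open>V\<^sup>-\<close> is spanned by the
  \<open>v\<^sub>a \<and> f\<^sub>i\<close>, and the centre of the opposite nilradical by \<open>f\<^sub>1 \<and> f\<^sub>2\<close>.  With
  \<open>R\<^sub>i\<^sub>a = R(v\<^sub>a \<and> f\<^sub>i)\<close> and \<open>T = R(f\<^sub>1 \<and> f\<^sub>2)\<close> the commutation relations are
  \<open>[R\<^sub>1\<^sub>a, R\<^sub>2\<^sub>b] = - \<delta>\<^sub>a\<^sub>b T\<close>, all other commutators being 0.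

  At a point \<open>n\<close> put \<open>A = n' Y n\<close>, \<open>n'\<close> the inverse of \<open>n\<close>, with matrix coefficients \<open>g\<^sub>i\<^sub>j = (f\<^sub>i, A e\<^sub>j)\<close>,
  \<open>m\<^sub>b\<^sub>c = (v\<^sub>b, A v\<^sub>c)\<close>, \<open>s\<^sub>i\<^sub>b = (v\<^sub>b, A e\<^sub>i)\<close>, \<open>x\<^sub>i\<^sub>b = (f\<^sub>i, A v\<^sub>b)\<close>, \<open>r = (e\<^sub>1, A e\<^sub>2)\<close>.  The differential
  of \<open>\<chi>\<close> is the trace on \<open>E\<close>, so that \<open>\<Pi>(Y) = (g\<^sub>1\<^sub>1 + g\<^sub>2\<^sub>2) - \<Sum> s\<^sub>i\<^sub>b R\<^sub>i\<^sub>b - r T\<close> (lemma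
  \<open>Pi_act_eq\<close>).  Since \<open>R\<close> differentiates \<open>n\<close> on the right, it turns these coefficients into one
  another, for example \<open>R\<^sub>i\<^sub>c g\<^sub>k\<^sub>j = \<delta>\<^sub>i\<^sub>j x\<^sub>k\<^sub>c\<close>.

  The idea is to look at the second order operators \<open>K\<^sub>a\<^sub>c = R\<^sub>1\<^sub>a R\<^sub>2\<^sub>c - R\<^sub>1\<^sub>c R\<^sub>2\<^sub>a\<close>, which are the
  values of \<open>\<Omega>\<^sub>2\<close> on \<open>so(V\<^sub>0)\<close> up to a factor.  For this line bundle their commutators with
  \<open>\<Pi>(Y)\<close> are combinations of the \<open>K\<^sub>b\<^sub>d\<close> again, without terms of lower order
  (\<open>bracket_moment\<close>).  The cubic operators \<open>C\<^sub>i\<^sub>c = \<Sum>\<^sub>a R\<^sub>i\<^sub>a K\<^sub>a\<^sub>c\<close> then satisfy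
  \<open>[\<Pi>(Y), C\<^sub>i\<^sub>c] = - (g\<^sub>1\<^sub>1 + g\<^sub>2\<^sub>2) C\<^sub>i\<^sub>c - \<Sum>\<^sub>j g\<^sub>i\<^sub>j C\<^sub>j\<^sub>c + \<Sum>\<^sub>b m\<^sub>b\<^sub>c C\<^sub>i\<^sub>b\<close>,
  because the possible extra term \<open>\<Sum>\<^sub>a x\<^sub>i\<^sub>a K\<^sub>a\<^sub>c\<close> arises with the total coefficient
  \<open>- 1 - 1 + (dim V\<^sub>0 - 1) - 1 = dim V\<^sub>0 - 4\<close>, which is 0 for \<open>D\<^sub>4\<close> (\<open>bracket_cubic\<close>).

  The part of \<open>\<Omega>\<^sub>3\<close> that comes from \<open>so(V\<^sub>0)\<close> is a multiple of \<open>C\<^sub>i\<^sub>c\<close> at once, and the part that comes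
  from \<open>sl(E)\<close> is another multiple of it by the commutation relations
  (\<open>cubic_quadratic_1\<close>, \<open>cubic_quadratic_2\<close>).  So \<open>\<Omega>\<^sub>3(v\<^sub>c \<and> f\<^sub>i)\<close> is a nonzero multiple of \<open>C\<^sub>i\<^sub>c\<close>
  (\<open>Omega3_frame\<close>), which gives the conformal covariance.  Independence at each point follows by applying
  the \<open>C\<^sub>i\<^sub>c\<close> to cubic monomials in the matrix entries of \<open>n\<close> (\<open>cubic_op_test\<close>).

  The rest reduces the abstract setting to this picture: the frame comes from
  \<open>cartan_frame_exists\<close>, sums over \<open>\<Delta>(V\<^sup>+)\<close> become sums over \<open>e\<^sub>i \<and> v\<^sub>a\<close> by \<open>contraction\<close>, and the
  structure constants \<open>N\<close> and \<open>M\<close> are eliminated by \<open>coefficient_product\<close>.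
\<close>

section \<open>Covariance of a cubic operator on the Heisenberg group\<close>

text \<open>The algebraic content of the calculus on the opposite nilpotent group, over any
  commutative ring of functions: \<open>R\<close> and \<open>T\<close> are the invariant vector
  fields, and \<open>x, s, g, m, r\<close> are the matrix coefficients of \<open>Ad(n)\<close>
  inverse applied to \<open>Y\<close>. The rules for \<open>R\<close> on the coefficients say how
  the adjoint action of \<open>v\<^sub>c \<and> f\<^sub>i\<close> permutes the graded pieces. The
  derivative of \<open>x\<^sub>2\<^sub>b\<close> along \<open>R\<^sub>1\<^sub>c\<close> involves the
  last coefficient \<open>(f\<^sub>1, A f\<^sub>2)\<close>, which enters only through the fact that
  the result is diagonal in \<open>b, c\<close>.\<close>

locale heisenberg_derivations =
  fixes S :: "'r::comm_ring_1 set"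
    and R :: "2 \<Rightarrow> 4 \<Rightarrow> 'r \<Rightarrow> 'r" and T :: "'r \<Rightarrow> 'r"
    and x s :: "2 \<Rightarrow> 4 \<Rightarrow> 'r" and g :: "2 \<Rightarrow> 2 \<Rightarrow> 'r" and m :: "4 \<Rightarrow> 4 \<Rightarrow> 'r" and r :: 'r
  assumes S_zero [simp]: "0 \<in> S"
    and S_add [simp]: "\<And>f h. f \<in> S \<Longrightarrow> h \<in> S \<Longrightarrow> f + h \<in> S"
    and S_minus [simp]: "\<And>f. f \<in> S \<Longrightarrow> - f \<in> S"
    and S_mult [simp]: "\<And>f h. f \<in> S \<Longrightarrow> h \<in> S \<Longrightarrow> f * h \<in> S"
    and R_closed [simp]: "\<And>i a f. f \<in> S \<Longrightarrow> R i a f \<in> S"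
    and T_closed [simp]: "\<And>f. f \<in> S \<Longrightarrow> T f \<in> S"
    and T_add: "\<And>f h. f \<in> S \<Longrightarrow> h \<in> S \<Longrightarrow> T (f + h) = T f + T h"
    and R_add: "\<And>i a f h. f \<in> S \<Longrightarrow> h \<in> S \<Longrightarrow> R i a (f + h) = R i a f + R i a h"
    and R_mult: "\<And>i a f h. f \<in> S \<Longrightarrow> h \<in> S \<Longrightarrow> R i a (f * h) = R i a f * h + f * R i a h"
    and R_same: "\<And>i a b f. f \<in> S \<Longrightarrow> R i a (R i b f) = R i b (R i a f)"
    and R_heis: "\<And>a b f. f \<in> S \<Longrightarrow>
      R 1 a (R 2 b f) = R 2 b (R 1 a f) - (if a = b then T f else 0)"
    and R_T: "\<And>i a f. f \<in> S \<Longrightarrow> R i a (T f) = T (R i a f)"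
    and coord_closed [simp]: "\<And>i a. x i a \<in> S" "\<And>i a. s i a \<in> S" "\<And>i j. g i j \<in> S"
      "\<And>a b. m a b \<in> S" "r \<in> S"
    and m_antisym: "\<And>a b. m b a = - m a b"
    and R_g: "\<And>i c k j. R i c (g k j) = (if i = j then x k c else 0)"
    and R_m: "\<And>i c b d. R i c (m b d) = (if c = d then x i b else 0) - (if c = b then x i d else 0)"
    and R_s: "\<And>i c j b. R i c (s j b) = (if i = j then m b c else 0) - (if b = c then g i j else 0)"
    and R_x: "\<exists>z. \<forall>c b. R 1 c (x 2 b) = (if b = c then z else 0)"
    and R1_r: "\<And>c. R 1 c r = s 2 c"
    and R2_r: "\<And>c. R 2 c r = - s 1 c"
begin

lemma S_diff [simp]: "f \<in> S \<Longrightarrow> h \<in> S \<Longrightarrow> f - h \<in> S"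
  using S_add[of f "- h"] by simp

lemma S_sum [simp]: "(\<And>b. b \<in> B \<Longrightarrow> f b \<in> S) \<Longrightarrow> sum f B \<in> S"
  by (induction B rule: infinite_finite_induct) auto

lemma R_zero [simp]: "R i a 0 = 0"
  using R_add[of 0 0 i a] by simp

lemma R_uminus: "f \<in> S \<Longrightarrow> R i a (- f) = - R i a f"
  using R_add[of f "- f" i a] by (simp add: eq_neg_iff_add_eq_0 add.commute)

lemma R_diff: "f \<in> S \<Longrightarrow> h \<in> S \<Longrightarrow> R i a (f - h) = R i a f - R i a h"
  using R_add[of f "- h" i a] by (simp add: R_uminus)

lemma R_sum: "(\<And>b. b \<in> B \<Longrightarrow> f b \<in> S) \<Longrightarrow> R i a (sum f B) = (\<Sum>b\<in>B. R i a (f b))"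
  by (induction B rule: infinite_finite_induct) (auto simp: R_add)

lemmas R_simps = R_add R_diff R_uminus R_sum R_mult

definition act :: "'r \<Rightarrow> 'r"
  where "act f = (g 1 1 + g 2 2) * f - (\<Sum>i\<in>UNIV. \<Sum>b\<in>UNIV. s i b * R i b f) - r * T f"

definition bracket :: "('r \<Rightarrow> 'r) \<Rightarrow> 'r \<Rightarrow> 'r"
  where "bracket P f = act (P f) - P (act f)"

lemma act_closed [simp]: "f \<in> S \<Longrightarrow> act f \<in> S"
  unfolding act_def by simp

lemma act_add: "f \<in> S \<Longrightarrow> h \<in> S \<Longrightarrow> act (f + h) = act f + act h"
  by (simp add: act_def R_add T_add algebra_simps sum.distrib)

lemma act_zero [simp]: "act 0 = 0"
  using act_add[of 0 0] by simp

lemma act_uminus: "f \<in> S \<Longrightarrow> act (- f) = - act f"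
  using act_add[of f "- f"] by (simp add: eq_neg_iff_add_eq_0 add.commute)

lemma act_diff: "f \<in> S \<Longrightarrow> h \<in> S \<Longrightarrow> act (f - h) = act f - act h"
  using act_add[of f "- h"] by (simp add: act_uminus)

lemma act_sum: "(\<And>b. b \<in> B \<Longrightarrow> f b \<in> S) \<Longrightarrow> act (sum f B) = (\<Sum>b\<in>B. act (f b))"
  by (induction B rule: infinite_finite_induct) (auto simp: act_add)

text \<open>Up to ordering, the angular momentum \<open>p\<^sub>a q\<^sub>c - p\<^sub>c
  q\<^sub>a\<close> of the Heisenberg algebra spanned by \<open>p\<^sub>a =
  R\<^sub>1\<^sub>a\<close>, \<open>q\<^sub>a = R\<^sub>2\<^sub>a\<close> and \<open>T\<close>.\<close>

definition moment :: "4 \<Rightarrow> 4 \<Rightarrow> 'r \<Rightarrow> 'r"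
  where "moment a c f = R 1 a (R 2 c f) - R 1 c (R 2 a f)"

lemma if_mult: "(if P then (a::'r) else 0) * b = (if P then a * b else 0)"
  "b * (if P then (a::'r) else 0) = (if P then b * a else 0)"
  by auto

text \<open>The derivatives of \<open>s\<close> produce the terms with \<open>g\<close> and
  \<open>m\<close>, and the multiplier \<open>g\<^sub>1\<^sub>1 + g\<^sub>2\<^sub>2\<close> produces
  the term of order 0. The terms with \<open>T\<close> cancel: commuting
  \<open>R\<^sub>i\<^sub>c\<close> past \<open>\<Sum> s\<^sub>j\<^sub>b R\<^sub>j\<^sub>b\<close>
  gives \<open>\<plusminus> s T\<close>, which is the derivative of \<open>r\<close>.\<close>

lemma bracket_R:
  assumes f: "f \<in> S"
  shows "bracket (R i c) f = - x i c * f - (\<Sum>j\<in>UNIV. g i j * R j c f) + (\<Sum>b\<in>UNIV. m b c * R i b f)"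
proof -
  have *: "R i c (act f) = R i c (g 1 1 + g 2 2) * f + (g 1 1 + g 2 2) * R i c f
     - (\<Sum>j\<in>UNIV. \<Sum>b\<in>UNIV. R i c (s j b) * R j b f + s j b * R i c (R j b f))
     - (R i c r * T f + r * T (R i c f))"
    using f by (simp add: act_def R_simps R_T)
  have comm: "R i c (R j b f) = R j b (R i c f) 
      - (if b = c then (if i = 1 \<and> j = 2 then T f else if i = 2 \<and> j = 1 then - T f else 0) else 0)" for j b
    using exhaust_2[of i] exhaust_2[of j] R_same[OF f, of i c b] R_heis[OF f, of c b] R_heis[OF f, of b c] 
    by auto
  have "bracket (R i c) f = (\<Sum>j\<in>UNIV. \<Sum>b\<in>UNIV. R i c (s j b) * R j b f) 
     + (\<Sum>j\<in>UNIV. \<Sum>b\<in>UNIV. s j b * (R i c (R j b f) - R j b (R i c f))) + R i c r * T f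
     - R i c (g 1 1 + g 2 2) * f"
    unfolding bracket_def * by (simp add: act_def algebra_simps sum.distrib sum_subtractf)
  moreover have "(\<Sum>j\<in>UNIV. \<Sum>b\<in>UNIV. s j b * (R i c (R j b f) - R j b (R i c f))) = - R i c r * T f"
    unfolding comm using exhaust_2[of i] by (auto simp: sum_2 if_mult R1_r R2_r sum_negf)
  moreover have "R i c (g 1 1 + g 2 2) = x i c"
    using exhaust_2[of i] by (auto simp: R_add R_g)
  moreover have "(\<Sum>j\<in>UNIV. \<Sum>b\<in>UNIV. R i c (s j b) * R j b f) = 
      (\<Sum>b\<in>UNIV. m b c * R i b f) - (\<Sum>j\<in>UNIV. g i j * R j c f)"
    using exhaust_2[of i] by (auto simp: R_s left_diff_distrib sum_subtractf if_mult sum_2)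
  ultimately show ?thesis by simp
qed

lemma bracket_comp:
  assumes "f \<in> S" "\<And>f. f \<in> S \<Longrightarrow> Q f \<in> S" 
  shows "bracket (\<lambda>f. R i a (Q f)) f = bracket (R i a) (Q f) + R i a (bracket Q f)"
  using assms by (simp add: bracket_def R_diff)

lemma moment_closed [simp]: "f \<in> S \<Longrightarrow> moment a c f \<in> S"
  by (simp add: moment_def)

lemma moment_self [simp]: "moment a a f = 0"
  by (simp add: moment_def)

lemma moment_antisym: "moment c a f = - moment a c f"
  by (simp add: moment_def)

text \<open>The first order terms and the terms with \<open>g\<^sub>1\<^sub>2\<close>,
  \<open>g\<^sub>2\<^sub>1\<close> are symmetric in \<open>a, c\<close>, up to the commutativity of
  the \<open>R\<^sub>1\<^sub>a\<close> among themselves and of the \<open>R\<^sub>2\<^sub>a\<close>.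
  That symmetry depends on the weight of the bundle: the multiplier contributes
  \<open>x\<^sub>2\<^sub>c R\<^sub>1\<^sub>a\<close>, and it is matched by \<open>x\<^sub>2\<^sub>a
  R\<^sub>1\<^sub>c\<close>, which comes from \<open>R\<^sub>1\<^sub>a g\<^sub>2\<^sub>1\<close>.\<close>

lemma bracket_RR:
  assumes f: "f \<in> S"
  shows "bracket (\<lambda>f. R 1 a (R 2 c f)) f =
     - (x 1 a * R 2 c f + x 1 c * R 2 a f) - (x 2 a * R 1 c f + x 2 c * R 1 a f)
     - g 1 2 * R 2 a (R 2 c f) - g 2 1 * R 1 a (R 1 c f) - (g 1 1 + g 2 2) * R 1 a (R 2 c f)
     + (\<Sum>b\<in>UNIV. m b a * R 1 b (R 2 c f) + m b c * R 1 a (R 2 b f))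
     + (if a = c then (\<Sum>b\<in>UNIV. x 1 b * R 2 b f) - R 1 a (x 2 a) * f else 0)"
proof -
  have z: "R 1 a (x 2 c) = (if a = c then R 1 a (x 2 a) else 0)"
  proof -
    obtain z where "\<And>c b. R 1 c (x 2 b) = (if b = c then z else 0)"
      using R_x by blast
    then show ?thesis by simp
  qed
  have c1: "bracket (R 1 a) (R 2 c f) = - x 1 a * R 2 c f - g 1 1 * R 1 a (R 2 c f) - g 1 2 * R 2 a (R 2 c f)
     + (\<Sum>b\<in>UNIV. m b a * R 1 b (R 2 c f))"
    using f by (simp add: bracket_R sum_2)
  have c2: "R 1 a (bracket (R 2 c) f) = - (R 1 a (x 2 c) * f + x 2 c * R 1 a f)
     - (x 2 a * R 1 c f + g 2 1 * R 1 a (R 1 c f)) - g 2 2 * R 1 a (R 2 c f) 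
     + (\<Sum>b\<in>UNIV. R 1 a (m b c) * R 2 b f + m b c * R 1 a (R 2 b f))"
    using f by (simp add: bracket_R sum_2 R_simps R_g)
  have c3: "(\<Sum>b\<in>UNIV. R 1 a (m b c) * R 2 b f) = 
     (if a = c then (\<Sum>b\<in>UNIV. x 1 b * R 2 b f) else 0) - x 1 c * R 2 a f"
    by (simp add: R_m left_diff_distrib sum_subtractf if_mult)
  have "bracket (\<lambda>f. R 1 a (R 2 c f)) f = bracket (R 1 a) (R 2 c f) + R 1 a (bracket (R 2 c) f)"
    using f by (intro bracket_comp) simp_all
  then show ?thesis
    unfolding c1 c2 z sum.distrib c3 by (cases "a = c") (simp_all add: algebra_simps)
qed

text \<open>Antisymmetrising \<open>bracket_RR\<close> removes all terms of order one and the
  off-diagonal \<open>g\<close>. The momenta therefore transform tensorially among themselves.\<close>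

lemma bracket_moment:
  assumes f: "f \<in> S"
  shows "bracket (moment a c) f = - (g 1 1 + g 2 2) * moment a c f
     + (\<Sum>b\<in>UNIV. m b a * moment b c f + m b c * moment a b f)"
proof (cases "a = c")
  case True
  have "(\<Sum>b\<in>UNIV. m b c * moment b c f + m b c * moment c b f) = 0"
    by (subst moment_antisym) simp
  then show ?thesis using True by (simp add: bracket_def)
next
  case False
  have "bracket (moment a c) f = bracket (\<lambda>f. R 1 a (R 2 c f)) f - bracket (\<lambda>f. R 1 c (R 2 a f)) f"
    using f by (simp add: bracket_def moment_def act_diff)
  also have "\<dots> = - (g 1 1 + g 2 2) * moment a c f
     + (\<Sum>b\<in>UNIV. m b a * moment b c f + m b c * moment a b f)"
    using f False by (simp add: bracket_RR R_same moment_def algebra_simps sum.distrib sum_subtractf)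
  finally show ?thesis .
qed

definition cubic :: "2 \<Rightarrow> 4 \<Rightarrow> 'r \<Rightarrow> 'r"
  where "cubic i c f = (\<Sum>a\<in>UNIV. R i a (moment a c f))"

text \<open>Four sources produce a multiple of \<open>\<Sum>\<^sub>a x\<^sub>i\<^sub>a moment a c
  f\<close>: the order 0 term in the bracket of the outer \<open>R\<^sub>i\<^sub>a\<close>
  (coefficient -1), the derivative of \<open>g\<^sub>1\<^sub>1 + g\<^sub>2\<^sub>2\<close>
  (coefficient -1), and the derivatives of \<open>m\<^sub>b\<^sub>a\<close> and
  \<open>m\<^sub>b\<^sub>c\<close> (coefficients 4 - 1 = 3 and -1, the 4 being the number of values
  of the index). They add up to 0.\<close>

theorem bracket_cubic:
  assumes f: "f \<in> S"
  shows "bracket (cubic i c) f = - (g 1 1 + g 2 2) * cubic i c f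
     - (\<Sum>j\<in>UNIV. g i j * cubic j c f) + (\<Sum>b\<in>UNIV. m b c * cubic i b f)"
proof -
  have b0: "bracket (cubic i c) f = (\<Sum>a\<in>UNIV. bracket (R i a) (moment a c f) + R i a (bracket (moment a c) f))"
    using f by (simp add: bracket_def cubic_def act_sum R_simps sum_subtractf)
  have b1: "R i a (bracket (moment a c) f) = - x i a * moment a c f - (g 1 1 + g 2 2) * R i a (moment a c f)
     + (\<Sum>b\<in>UNIV. R i a (m b a) * moment b c f + m b a * R i a (moment b c f) 
         + R i a (m b c) * moment a b f + m b c * R i a (moment a b f))" for a
    using f exhaust_2[of i] by (auto simp add: bracket_moment R_simps R_g algebra_simps)
  have b2: "bracket (R i a) (moment a c f) = - x i a * moment a c f - (\<Sum>j\<in>UNIV. g i j * R j a (moment a c f))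
     + (\<Sum>b\<in>UNIV. m b a * R i b (moment a c f))" for a
    using f by (simp add: bracket_R)
  have main: "bracket (cubic i c) f = 
     - (\<Sum>a\<in>UNIV. x i a * moment a c f) - (\<Sum>a\<in>UNIV. \<Sum>j\<in>UNIV. g i j * R j a (moment a c f)) 
     - (\<Sum>a\<in>UNIV. x i a * moment a c f) - (\<Sum>a\<in>UNIV. (g 1 1 + g 2 2) * R i a (moment a c f))
     + ((\<Sum>a\<in>UNIV. \<Sum>b\<in>UNIV. m b a * R i b (moment a c f)) + (\<Sum>a\<in>UNIV. \<Sum>b\<in>UNIV. m b a * R i a (moment b c f)))
     + (\<Sum>a\<in>UNIV. \<Sum>b\<in>UNIV. R i a (m b a) * moment b c f)
     + (\<Sum>a\<in>UNIV. \<Sum>b\<in>UNIV. R i a (m b c) * moment a b f) 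
     + (\<Sum>a\<in>UNIV. \<Sum>b\<in>UNIV. m b c * R i a (moment a b f))"
    unfolding b0 b1 b2 by (simp add: sum.distrib sum_subtractf sum_negf sum_distrib_left)
  have e1: "(\<Sum>a\<in>UNIV. \<Sum>b\<in>UNIV. m b a * R i b (moment a c f)) = 
      - (\<Sum>a\<in>UNIV. \<Sum>b\<in>UNIV. m b a * R i a (moment b c f))"
  proof -
    have "(\<Sum>a\<in>UNIV. \<Sum>b\<in>UNIV. m b a * R i b (moment a c f)) = (\<Sum>a\<in>UNIV. \<Sum>b\<in>UNIV. m a b * R i a (moment b c f))"
      by (rule sum.swap)
    also have "\<dots> = - (\<Sum>a\<in>UNIV. \<Sum>b\<in>UNIV. m b a * R i a (moment b c f))"
      by (subst m_antisym) (simp add: sum_negf)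
    finally show ?thesis .
  qed
  have e2: "(\<Sum>a\<in>UNIV. \<Sum>b\<in>UNIV. R i a (m b a) * moment b c f) = 3 * (\<Sum>a\<in>UNIV. x i a * moment a c f)"
  proof -
    have "(\<Sum>a\<in>UNIV. \<Sum>b\<in>UNIV. R i a (m b a) * moment b c f) = (\<Sum>b\<in>UNIV. \<Sum>a\<in>UNIV. R i a (m b a) * moment b c f)"
      by (rule sum.swap)
    also have "\<dots> = (\<Sum>b\<in>UNIV. 3 * (x i b * moment b c f))"
      by (simp add: R_m left_diff_distrib sum_subtractf if_mult algebra_simps)
    finally show ?thesis by (simp add: sum_distrib_left)
  qed
  have e3: "(\<Sum>a\<in>UNIV. \<Sum>b\<in>UNIV. R i a (m b c) * moment a b f) = - (\<Sum>a\<in>UNIV. x i a * moment a c f)"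
  proof -
    have "(\<Sum>a\<in>UNIV. \<Sum>b\<in>UNIV. R i a (m b c) * moment a b f) = (\<Sum>b\<in>UNIV. x i b * moment c b f)"
      by (subst sum.swap) (simp add: R_m left_diff_distrib sum_subtractf if_mult)
    also have "\<dots> = - (\<Sum>a\<in>UNIV. x i a * moment a c f)"
      by (subst moment_antisym) (simp add: sum_negf)
    finally show ?thesis .
  qed
  have e4: "(\<Sum>a\<in>UNIV. \<Sum>b\<in>UNIV. m b c * R i a (moment a b f)) = (\<Sum>b\<in>UNIV. m b c * cubic i b f)"
    by (subst sum.swap) (simp add: cubic_def sum_distrib_left)
  have e5: "(\<Sum>a\<in>UNIV. \<Sum>j\<in>UNIV. g i j * R j a (moment a c f)) = (\<Sum>j\<in>UNIV. g i j * cubic j c f)"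
    by (subst sum.swap) (simp add: cubic_def sum_distrib_left)
  have e6: "(\<Sum>a\<in>UNIV. (g 1 1 + g 2 2) * R i a (moment a c f)) = (g 1 1 + g 2 2) * cubic i c f"
    by (simp add: cubic_def sum_distrib_left)
  show ?thesis
    unfolding main e1 e2 e3 e4 e5 e6 by (simp add: algebra_simps)
qed

text \<open>Reordering turns each summand on the right into \<open>2 R\<^sub>1\<^sub>a (moment a c
  f)\<close> and a multiple of \<open>R\<^sub>1\<^sub>c T f\<close>; the multiples are 3 for
  \<open>a = c\<close> and -1 otherwise, and they add up to 0 because the index takes four values.\<close>

lemma cubic_quadratic_1:
  assumes f: "f \<in> S"
  shows "2 * cubic 1 c f = 2 * R 2 c (\<Sum>a\<in>UNIV. R 1 a (R 1 a f))
     - R 1 c (\<Sum>a\<in>UNIV. R 1 a (R 2 a f) + R 2 a (R 1 a f))"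
proof -
  have *: "R 2 b (R 1 a h) = R 1 a (R 2 b h) + (if a = b then T h else 0)" if "h \<in> S" for a b h
    using R_heis[OF that, of a b] by simp
  have e: "2 * R 2 c (R 1 a (R 1 a f)) - R 1 c (R 1 a (R 2 a f) + R 2 a (R 1 a f)) =
      2 * R 1 a (moment a c f) + ((if a = c then 4 * R 1 c (T f) else 0) - R 1 c (T f))" for a
  proof -
    have q1: "R 2 c (R 1 a (R 1 a f)) = R 1 a (R 1 a (R 2 c f)) + (if a = c then 2 * R 1 c (T f) else 0)"
      using f by (cases "a = c") (simp_all add: * R_add R_T)
    have q2: "R 1 c (R 1 a (R 2 a f) + R 2 a (R 1 a f)) = 2 * R 1 a (R 1 c (R 2 a f)) + R 1 c (T f)"
    proof -
      have "R 2 a (R 1 a f) = R 1 a (R 2 a f) + T f" using *[OF f, of a a] by simp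
      then show ?thesis
        using f R_same[of "R 2 a f" 1 c a] by (simp only: R_add S_add R_closed T_closed) simp
    qed
    have q3: "R 1 a (moment a c f) = R 1 a (R 1 a (R 2 c f)) - R 1 a (R 1 c (R 2 a f))"
      using f by (simp add: moment_def R_diff)
    show ?thesis
      unfolding q1 q2 q3 by (cases "a = c") simp_all
  qed
  have "(\<Sum>a\<in>UNIV. 2 * R 2 c (R 1 a (R 1 a f)) - R 1 c (R 1 a (R 2 a f) + R 2 a (R 1 a f))) =
      (\<Sum>a\<in>UNIV. 2 * R 1 a (moment a c f))"
    unfolding e sum.distrib sum_subtractf by simp
  then show ?thesis
    using f by (simp add: cubic_def R_sum sum_subtractf sum_distrib_left)
qed

lemma cubic_quadratic_2:
  assumes f: "f \<in> S"
  shows "2 * cubic 2 c f = R 2 c (\<Sum>a\<in>UNIV. R 1 a (R 2 a f) + R 2 a (R 1 a f))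
     - 2 * R 1 c (\<Sum>a\<in>UNIV. R 2 a (R 2 a f))"
proof -
  have *: "R 1 b (R 2 a h) = R 2 a (R 1 b h) - (if a = b then T h else 0)" if "h \<in> S" for a b h
    using R_heis[OF that, of b a] by auto
  have e: "R 2 c (R 1 a (R 2 a f) + R 2 a (R 1 a f)) - 2 * R 1 c (R 2 a (R 2 a f)) =
      2 * R 2 a (moment a c f) + ((if a = c then 4 * R 2 c (T f) else 0) - R 2 c (T f))" for a
  proof -
    have q1: "R 1 c (R 2 a (R 2 a f)) = R 2 a (R 1 c (R 2 a f)) - (if a = c then R 2 c (T f) else 0)"
      using f by (cases "a = c") (simp_all add: * R_diff R_T)
    have q2: "R 2 c (R 1 a (R 2 a f) + R 2 a (R 1 a f)) = 2 * R 2 a (R 2 c (R 1 a f)) - R 2 c (T f)"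
    proof -
      have "R 1 a (R 2 a f) = R 2 a (R 1 a f) - T f" using *[OF f, of a a] by simp
      then show ?thesis
        using f R_same[of "R 1 a f" 2 c a] 
        by (simp only: R_add R_diff S_add S_diff R_closed T_closed) simp
    qed
    have q3: "R 2 a (moment a c f) = R 2 a (R 2 c (R 1 a f)) - R 2 a (R 1 c (R 2 a f)) - (if a = c then R 2 c (T f) else 0)"
      using f by (cases "a = c") (simp_all add: moment_def * R_diff)
    show ?thesis
      unfolding q1 q2 q3 by (cases "a = c") simp_all
  qed
  have "(\<Sum>a\<in>UNIV. R 2 c (R 1 a (R 2 a f) + R 2 a (R 1 a f)) - 2 * R 1 c (R 2 a (R 2 a f))) =
      (\<Sum>a\<in>UNIV. 2 * R 2 a (moment a c f))"
    unfolding e sum.distrib sum_subtractf by simp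
  then show ?thesis
    using f by (simp add: cubic_def R_sum sum_subtractf sum_distrib_left)
qed

end

section \<open>Smooth functions and the symmetry of second derivatives\<close>

lemma Ck_on_subset: "Ck_on k U f \<Longrightarrow> V \<subseteq> U \<Longrightarrow> Ck_on k V f"
  by (induction k arbitrary: f) (auto intro: continuous_on_subset differentiable_on_subset)

lemma Ck_on_differentiable:
  assumes "open U" "Ck_on (Suc k) U f" "x \<in> U"
  shows "f differentiable (at x)"
proof -
  have "f differentiable (at x within U)"
    using assms(2,3) unfolding Ck_on.simps differentiable_on_def by blast
  then show ?thesis by (simp only: at_within_open[OF assms(3,1)])
qed

text \<open>Derivatives at points of an open set depend only on the values in the set.\<close>

lemma Ck_on_cong:
  assumes "open U" "Ck_on k U f" "\<And>x. x \<in> U \<Longrightarrow> f x = g x"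
  shows "Ck_on k U g"
  using assms(2,3)
proof (induction k arbitrary: f g)
  case 0
  then show ?case by (metis Ck_on.simps(1) continuous_on_cong)
next
  case (Suc k)
  have diff: "f differentiable (at x)" if "x \<in> U" for x
    by (rule Ck_on_differentiable[OF assms(1) Suc.prems(1) that])
  have g: "(g has_derivative frechet_derivative f (at x)) (at x)" if "x \<in> U" for x
    using diff[OF that] unfolding frechet_derivative_works
    by (rule has_derivative_transform_within_open[OF _ assms(1) that]) (rule Suc.prems(2))
  have "g differentiable_on U"
    using g by (auto simp: differentiable_on_def differentiable_def intro: has_derivative_at_withinI)
  moreover have "Ck_on k U (\<lambda>x. frechet_derivative g (at x) v)" for v
  proof (rule Suc.IH)
    show "Ck_on k U (\<lambda>x. frechet_derivative f (at x) v)" using Suc.prems(1) by simp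
    show "frechet_derivative f (at x) v = frechet_derivative g (at x) v" if "x \<in> U" for x
      using frechet_derivative_at[OF g[OF that]] by simp
  qed
  ultimately show ?case by simp
qed

lemma Ck_on_Suc_imp: "Ck_on (Suc k) U f \<Longrightarrow> Ck_on k U f"
  by (induction k arbitrary: f) (auto intro: differentiable_imp_continuous_on)

lemma Ck_on_const: "Ck_on k U (\<lambda>x. c)"
  by (induction k arbitrary: c) auto

lemma Ck_on_bounded_linear: "bounded_linear f \<Longrightarrow> Ck_on k U f"
proof (cases k)
  case (Suc j)
  assume f: "bounded_linear f"
  have "frechet_derivative f (at x) v = f v" for x v
    using frechet_derivative_at[OF bounded_linear_imp_has_derivative[OF f]] by metis
  then show ?thesis
    using f Suc by (simp add: Ck_on_const bounded_linear_imp_differentiable_on)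
qed (simp add: linear_continuous_on)

lemma Ck_on_add:
  assumes "open U"
  shows "Ck_on k U f \<Longrightarrow> Ck_on k U g \<Longrightarrow> Ck_on k U (\<lambda>x. f x + g x)"
proof (induction k arbitrary: f g)
  case 0
  then show ?case by (auto intro: continuous_intros)
next
  case (Suc k)
  have f: "(f has_derivative frechet_derivative f (at x)) (at x)" 
    and g: "(g has_derivative frechet_derivative g (at x)) (at x)" if "x \<in> U" for x
    using Ck_on_differentiable[OF assms Suc.prems(1) that] Ck_on_differentiable[OF assms Suc.prems(2) that]
    by (simp_all add: frechet_derivative_works)
  have "frechet_derivative (\<lambda>x. f x + g x) (at x) v = frechet_derivative f (at x) v + frechet_derivative g (at x) v"
    if "x \<in> U" for x v
    by (simp flip: frechet_derivative_at[OF has_derivative_add[OF f[OF that] g[OF that]]])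
  moreover have c: "Ck_on k U (\<lambda>x. frechet_derivative f (at x) v + frechet_derivative g (at x) v)" for v
    using Suc by auto
  moreover have "(\<lambda>x. f x + g x) differentiable_on U"
    using Suc.prems by (simp add: differentiable_on_add)
  ultimately show ?case
    using Ck_on_cong[OF assms c] by simp
qed

lemma Ck_on_mult:
  fixes f g :: "'a::real_normed_vector \<Rightarrow> 'b::real_normed_algebra"
  assumes "open U"
  shows "Ck_on k U f \<Longrightarrow> Ck_on k U g \<Longrightarrow> Ck_on k U (\<lambda>x. f x * g x)"
proof (induction k arbitrary: f g)
  case 0
  then show ?case by (auto intro: continuous_intros)
next
  case (Suc k)
  have f: "(f has_derivative frechet_derivative f (at x)) (at x)" 
    and g: "(g has_derivative frechet_derivative g (at x)) (at x)" if "x \<in> U" for x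
    using Ck_on_differentiable[OF assms Suc.prems(1) that] Ck_on_differentiable[OF assms Suc.prems(2) that]
    by (simp_all add: frechet_derivative_works)
  have "frechet_derivative (\<lambda>x. f x * g x) (at x) v = 
      f x * frechet_derivative g (at x) v + frechet_derivative f (at x) v * g x"
    if "x \<in> U" for x v
    by (simp flip: frechet_derivative_at[OF has_derivative_mult[OF f[OF that] g[OF that]]])
  moreover have c: "Ck_on k U (\<lambda>x. f x * frechet_derivative g (at x) v + frechet_derivative f (at x) v * g x)" for v
    using Suc.IH[OF Ck_on_Suc_imp[OF Suc.prems(1)], of "\<lambda>x. frechet_derivative g (at x) v"]
      Suc.IH[of "\<lambda>x. frechet_derivative f (at x) v", OF _ Ck_on_Suc_imp[OF Suc.prems(2)]] Suc.prems
    by (intro Ck_on_add assms) simp_all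
  moreover have "(\<lambda>x. f x * g x) differentiable_on U"
    using Suc.prems by (auto simp: differentiable_on_def intro!: differentiable_mult)
  ultimately show ?case
    using Ck_on_cong[OF assms c] by simp
qed

lemma Ck_on_sum:
  assumes "open U"
  shows "(\<And>b. b \<in> B \<Longrightarrow> Ck_on k U (f b)) \<Longrightarrow> Ck_on k U (\<lambda>x. \<Sum>b\<in>B. f b x)"
  by (induction B rule: infinite_finite_induct) (auto intro: Ck_on_const Ck_on_add[OF assms])

definition smooth_on :: "'a::real_normed_vector set \<Rightarrow> ('a \<Rightarrow> 'b::real_normed_vector) \<Rightarrow> bool"
  where "smooth_on U f \<longleftrightarrow> (\<forall>k. Ck_on k U f)"

lemma smooth_on_has_derivative:
  assumes "open U" "smooth_on U f" "x \<in> U"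
  shows "(f has_derivative frechet_derivative f (at x)) (at x)"
  using assms Ck_on_differentiable[of U 0 f x] frechet_derivative_works by (auto simp: smooth_on_def)

lemma smooth_on_frechet:
  assumes "smooth_on U f"
  shows "smooth_on U (\<lambda>x. frechet_derivative f (at x) v)"
  unfolding smooth_on_def
proof
  fix k
  have "Ck_on (Suc k) U f" using assms unfolding smooth_on_def by blast
  then show "Ck_on k U (\<lambda>x. frechet_derivative f (at x) v)" by simp
qed

lemma smooth_on_continuous: "smooth_on U f \<Longrightarrow> continuous_on U f"
  unfolding smooth_on_def using Ck_on.simps(1) by blast

lemma frechet_basis_expansion:
  fixes F :: "'a::euclidean_space \<Rightarrow> complex"
  assumes "(F has_derivative F') (at x)"
  shows "F' v = (\<Sum>b\<in>Basis. of_real (v \<bullet> b) * F' b)"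
proof -
  interpret bounded_linear F' using assms by (rule has_derivative_bounded_linear)
  have "F' v = F' (\<Sum>b\<in>Basis. (v \<bullet> b) *\<^sub>R b)" by (simp add: euclidean_representation)
  then show ?thesis by (simp add: sum scaleR scaleR_conv_of_real)
qed

text \<open>Smoothness of a derivative whose direction varies linearly with the point, as for
  invariant vector fields on a matrix group.\<close>

lemma smooth_on_directional:
  fixes F :: "'a::euclidean_space \<Rightarrow> complex"
  assumes "open U" "smooth_on U F" "bounded_linear L"
  shows "smooth_on U (\<lambda>x. frechet_derivative F (at x) (L x))"
  unfolding smooth_on_def
proof
  fix k
  have "bounded_linear (\<lambda>x. complex_of_real (L x \<bullet> b))" for b
    by (rule bounded_linear_compose[OF bounded_linear_of_real
          bounded_linear_compose[OF bounded_linear_inner_left assms(3)]])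
  then have "Ck_on k U (\<lambda>x. \<Sum>b\<in>Basis. of_real (L x \<bullet> b) * frechet_derivative F (at x) b)"
    using smooth_on_frechet[OF assms(2)]
    by (intro Ck_on_sum Ck_on_mult assms(1)) (simp_all add: smooth_on_def Ck_on_bounded_linear)
  then show "Ck_on k U (\<lambda>x. frechet_derivative F (at x) (L x))"
    by (rule Ck_on_cong[OF assms(1)]) 
      (rule frechet_basis_expansion[OF smooth_on_has_derivative[OF assms(1,2)], symmetric])
qed

text \<open>Two applications of the mean value theorem, one in the direction \<open>u\<close> and
  one in the direction \<open>v\<close>. Exchanging the roles of \<open>u\<close> and
  \<open>v\<close> leaves the second difference unchanged, which is how the symmetry of second
  derivatives arises.\<close>

lemma second_difference:
  fixes g :: "'a::real_normed_vector \<Rightarrow> real"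
  assumes s: "s > 0" and U: "cball x (s * (norm u + norm v)) \<subseteq> U"
    and dg: "\<And>y. y \<in> U \<Longrightarrow> (g has_derivative Dg y) (at y)"
    and du: "\<And>y. y \<in> U \<Longrightarrow> ((\<lambda>y. Dg y u) has_derivative Du y) (at y)"
  shows "\<exists>y \<in> cball x (s * (norm u + norm v)).
    g (x + s *\<^sub>R u + s *\<^sub>R v) - g (x + s *\<^sub>R u) - g (x + s *\<^sub>R v) + g x = s * s * Du y v"
proof -
  have inU: "x + a *\<^sub>R u + b *\<^sub>R v \<in> cball x (s * (norm u + norm v))" if "0 \<le> a" "a \<le> s" "0 \<le> b" "b \<le> s" for a b
  proof -
    have "norm (a *\<^sub>R u + b *\<^sub>R v) \<le> a * norm u + b * norm v"
      using that by (metis abs_of_nonneg norm_scaleR norm_triangle_ineq)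
    also have "\<dots> \<le> s * (norm u + norm v)"
      using that by (simp add: distrib_left add_mono mult_right_mono)
    finally have "norm (a *\<^sub>R u + b *\<^sub>R v) \<le> s * (norm u + norm v)" .
    moreover have "dist x (x + a *\<^sub>R u + b *\<^sub>R v) = norm (a *\<^sub>R u + b *\<^sub>R v)"
      by (metis add.assoc add_diff_cancel_left' dist_commute dist_norm)
    ultimately show ?thesis by simp
  qed
  have deriv_u: "((\<lambda>a. g (x + a *\<^sub>R u + b *\<^sub>R v)) has_real_derivative Dg (x + a *\<^sub>R u + b *\<^sub>R v) u) (at a)"
    if "0 \<le> a" "a \<le> s" "0 \<le> b" "b \<le> s" for a b
  proof -
    have "((\<lambda>a. x + a *\<^sub>R u + b *\<^sub>R v) has_derivative (\<lambda>h. h *\<^sub>R u)) (at a)"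
      by (auto intro!: derivative_eq_intros)
    then have "((\<lambda>a. g (x + a *\<^sub>R u + b *\<^sub>R v)) has_derivative (\<lambda>h. Dg (x + a *\<^sub>R u + b *\<^sub>R v) (h *\<^sub>R u))) (at a)"
      by (rule has_derivative_compose) (use dg inU[OF that] U in blast)
    moreover have "Dg (x + a *\<^sub>R u + b *\<^sub>R v) (h *\<^sub>R u) = Dg (x + a *\<^sub>R u + b *\<^sub>R v) u * h" for h
    proof -
      have "bounded_linear (Dg (x + a *\<^sub>R u + b *\<^sub>R v))"
        using dg inU[OF that] U has_derivative_bounded_linear by blast
      then show ?thesis
        using linear_cmul[OF bounded_linear.linear] by (metis mult.commute real_scaleR_def)
    qed
    ultimately show ?thesis by (simp add: has_field_derivative_def)
  qed
  have deriv_v: "((\<lambda>b. Dg (x + a *\<^sub>R u + b *\<^sub>R v) u) has_real_derivative Du (x + a *\<^sub>R u + b *\<^sub>R v) v) (at b)"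
    if "0 \<le> a" "a \<le> s" "0 \<le> b" "b \<le> s" for a b
  proof -
    have "((\<lambda>b. x + a *\<^sub>R u + b *\<^sub>R v) has_derivative (\<lambda>h. h *\<^sub>R v)) (at b)"
      by (auto intro!: derivative_eq_intros)
    then have "((\<lambda>b. Dg (x + a *\<^sub>R u + b *\<^sub>R v) u) has_derivative (\<lambda>h. Du (x + a *\<^sub>R u + b *\<^sub>R v) (h *\<^sub>R v))) (at b)"
      by (rule has_derivative_compose[where g = "\<lambda>y. Dg y u"]) (use du inU[OF that] U in blast)
    moreover have "Du (x + a *\<^sub>R u + b *\<^sub>R v) (h *\<^sub>R v) = Du (x + a *\<^sub>R u + b *\<^sub>R v) v * h" for h
    proof -
      have "bounded_linear (Du (x + a *\<^sub>R u + b *\<^sub>R v))"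
        using du inU[OF that] U has_derivative_bounded_linear by blast
      then show ?thesis
        using linear_cmul[OF bounded_linear.linear] by (metis mult.commute real_scaleR_def)
    qed
    ultimately show ?thesis by (simp add: has_field_derivative_def)
  qed
  define \<phi> where "\<phi> a = g (x + a *\<^sub>R u + s *\<^sub>R v) - g (x + a *\<^sub>R u + 0 *\<^sub>R v)" for a
  have "(\<phi> has_real_derivative Dg (x + a *\<^sub>R u + s *\<^sub>R v) u - Dg (x + a *\<^sub>R u + 0 *\<^sub>R v) u) (at a)" 
    if "0 \<le> a" "a \<le> s" for a
    unfolding \<phi>_def using deriv_u[OF that, of s] deriv_u[OF that, of 0] s by (intro DERIV_diff) simp_all
  from MVT2[OF s this] obtain \<xi> where \<xi>: "0 < \<xi>" "\<xi> < s"
    "\<phi> s - \<phi> 0 = s * (Dg (x + \<xi> *\<^sub>R u + s *\<^sub>R v) u - Dg (x + \<xi> *\<^sub>R u + 0 *\<^sub>R v) u)" by auto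
  obtain \<eta> where \<eta>: "0 < \<eta>" "\<eta> < s"
    "Dg (x + \<xi> *\<^sub>R u + s *\<^sub>R v) u - Dg (x + \<xi> *\<^sub>R u + 0 *\<^sub>R v) u = s * Du (x + \<xi> *\<^sub>R u + \<eta> *\<^sub>R v) v"
    using MVT2[OF s, of "\<lambda>b. Dg (x + \<xi> *\<^sub>R u + b *\<^sub>R v) u" "\<lambda>b. Du (x + \<xi> *\<^sub>R u + b *\<^sub>R v) v"] deriv_v \<xi>(1,2) by auto
  have "\<phi> s - \<phi> 0 = s * s * Du (x + \<xi> *\<^sub>R u + \<eta> *\<^sub>R v) v"
    using \<xi>(3) \<eta>(3) by simp
  then show ?thesis
    using inU[of \<xi> \<eta>] \<xi>(1,2) \<eta>(1,2) by (intro bexI[of _ "x + \<xi> *\<^sub>R u + \<eta> *\<^sub>R v"]) (auto simp: \<phi>_def)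
qed

lemma mixed_derivatives_eq:
  fixes g :: "'a::real_normed_vector \<Rightarrow> real"
  assumes "open U" "x \<in> U"
    and dg: "\<And>y. y \<in> U \<Longrightarrow> (g has_derivative Dg y) (at y)"
    and du: "\<And>y. y \<in> U \<Longrightarrow> ((\<lambda>y. Dg y u) has_derivative Du y) (at y)"
    and dv: "\<And>y. y \<in> U \<Longrightarrow> ((\<lambda>y. Dg y v) has_derivative Dv y) (at y)"
    and cu: "continuous_on U (\<lambda>y. Du y v)" and cv: "continuous_on U (\<lambda>y. Dv y u)"
  shows "Du x v = Dv x u"
proof (rule ccontr)
  assume "Du x v \<noteq> Dv x u"
  define e where "e = \<bar>Du x v - Dv x u\<bar> / 2"
  have e: "e > 0" using \<open>Du x v \<noteq> Dv x u\<close> by (simp add: e_def)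
  obtain d0 where d0: "d0 > 0" "cball x d0 \<subseteq> U"
    using assms(1,2) open_contains_cball by blast
  obtain d1 where d1: "d1 > 0" "\<And>y. y \<in> U \<Longrightarrow> dist y x < d1 \<Longrightarrow> dist (Du y v) (Du x v) < e"
    using cu e assms(2) unfolding continuous_on_iff by metis
  obtain d2 where d2: "d2 > 0" "\<And>y. y \<in> U \<Longrightarrow> dist y x < d2 \<Longrightarrow> dist (Dv y u) (Dv x u) < e"
    using cv e assms(2) unfolding continuous_on_iff by metis
  define d where "d = min d0 (min d1 d2) / 2"
  define s where "s = d / (norm u + norm v + 1)"
  have N: "norm u + norm v + 1 > 0" using norm_ge_zero[of u] norm_ge_zero[of v] by linarith
  have d: "d > 0" "d < d1" "d < d2" "d < d0" using d0(1) d1(1) d2(1) by (auto simp: d_def)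
  have s: "s > 0" using d N by (simp add: s_def)
  have "s * (norm u + norm v) \<le> d"
    using d N by (simp add: s_def field_simps)
  then have sub: "cball x (s * (norm u + norm v)) \<subseteq> U"
    using d0(2) d(4) by (meson order.trans less_imp_le subset_cball)
  have sub': "cball x (s * (norm v + norm u)) \<subseteq> U" using sub by (simp add: add.commute)
  obtain y where y: "y \<in> cball x (s * (norm u + norm v))"
    "g (x + s *\<^sub>R u + s *\<^sub>R v) - g (x + s *\<^sub>R u) - g (x + s *\<^sub>R v) + g x = s * s * Du y v"
    using second_difference[OF s sub dg du] by auto
  obtain z where z: "z \<in> cball x (s * (norm v + norm u))"
    "g (x + s *\<^sub>R v + s *\<^sub>R u) - g (x + s *\<^sub>R v) - g (x + s *\<^sub>R u) + g x = s * s * Dv z u"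
    using second_difference[OF s sub' dg dv] by auto
  have "g (x + s *\<^sub>R v + s *\<^sub>R u) = g (x + s *\<^sub>R u + s *\<^sub>R v)"
    by (rule arg_cong[of _ _ g]) (simp add: algebra_simps)
  then have "s * s * Du y v = s * s * Dv z u"
    using y(2) z(2) by linarith
  then have "Du y v = Dv z u" using s by simp
  moreover have "dist (Du y v) (Du x v) < e"
  proof (rule d1(2))
    show "y \<in> U" using y(1) sub by blast
    show "dist y x < d1" using y(1) \<open>s * (norm u + norm v) \<le> d\<close> d(2) by (simp add: dist_commute)
  qed
  moreover have "dist (Dv z u) (Dv x u) < e"
  proof (rule d2(2))
    show "z \<in> U" using z(1) sub' by blast
    show "dist z x < d2" using z(1) \<open>s * (norm u + norm v) \<le> d\<close> d(3) by (simp add: dist_commute add.commute)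
  qed
  ultimately show False unfolding e_def dist_real_def by (simp add: abs_if split: if_splits)
qed

text \<open>Applied separately to the real and the imaginary part, because the mean value theorem is
  about real functions.\<close>

lemma second_derivative_symmetric:
  fixes F :: "'a::real_normed_vector \<Rightarrow> complex"
  assumes U: "open U" and F: "smooth_on U F" and x: "x \<in> U"
  shows "frechet_derivative (\<lambda>y. frechet_derivative F (at y) u) (at x) v = 
         frechet_derivative (\<lambda>y. frechet_derivative F (at y) v) (at x) u"
proof -
  let ?D = "\<lambda>w y. frechet_derivative (\<lambda>y. frechet_derivative F (at y) w) (at y)"
  have dF: "(F has_derivative frechet_derivative F (at y)) (at y)" if "y \<in> U" for y
    using smooth_on_has_derivative[OF U F that] .
  have d2: "((\<lambda>y. frechet_derivative F (at y) w) has_derivative ?D w y) (at y)" if "y \<in> U" for y w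
    using smooth_on_has_derivative[OF U smooth_on_frechet[OF F] that] .
  have c: "continuous_on U (\<lambda>y. ?D w y w')" for w w'
    by (intro smooth_on_continuous smooth_on_frechet F)
  have "Re (?D u x v) = Re (?D v x u)"
    by (rule mixed_derivatives_eq[OF U x, of "\<lambda>y. Re (F y)" "\<lambda>y w. Re (frechet_derivative F (at y) w)"
          u "\<lambda>y w. Re (?D u y w)" v "\<lambda>y w. Re (?D v y w)"])
      (simp_all add: dF d2 c has_derivative_Re continuous_on_Re)
  moreover have "Im (?D u x v) = Im (?D v x u)"
    by (rule mixed_derivatives_eq[OF U x, of "\<lambda>y. Im (F y)" "\<lambda>y w. Im (frechet_derivative F (at y) w)"
          u "\<lambda>y w. Im (?D u y w)" v "\<lambda>y w. Im (?D v y w)"])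
      (simp_all add: dF d2 c has_derivative_Im continuous_on_Im)
  ultimately show ?thesis by (simp add: complex_eq_iff)
qed

section \<open>The orthogonal Lie algebra and its vector representation\<close>

text \<open>The complex bilinear form preserved by \<open>SO8\<close>; unlike the inner product of
  the type it is not sesquilinear, and it has isotropic vectors.\<close>

definition cdot :: "complex^8 \<Rightarrow> complex^8 \<Rightarrow> complex"
  where "cdot x y = (\<Sum>i\<in>UNIV. x $ i * y $ i)"

lemma cdot_commute: "cdot x y = cdot y x"
  by (simp add: cdot_def mult.commute)

lemma cdot_add_left [simp]: "cdot (x + y) z = cdot x z + cdot y z"
  by (simp add: cdot_def algebra_simps sum.distrib)

lemma cdot_scale_left [simp]: "cdot (c *s x) z = c * cdot x z"
  by (simp add: cdot_def sum_distrib_left algebra_simps)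

lemma cdot_zero_left [simp]: "cdot 0 z = 0"
  by (simp add: cdot_def)

lemma cdot_minus_left [simp]: "cdot (- x) z = - cdot x z"
  by (simp add: cdot_def sum_negf)

lemma cdot_diff_left [simp]: "cdot (x - y) z = cdot x z - cdot y z"
  by (simp add: cdot_def algebra_simps sum_subtractf)

lemma cdot_sum_left: "cdot (sum f B) z = (\<Sum>b\<in>B. cdot (f b) z)"
  by (induction B rule: infinite_finite_induct) auto

lemma cdot_right [simp]: "cdot x (y + z) = cdot x y + cdot x z" "cdot x (c *s y) = c * cdot x y"
    "cdot x 0 = 0" "cdot x (- y) = - cdot x y" "cdot x (y - z) = cdot x y - cdot x z"
  by (simp_all add: cdot_commute[of x])

lemma cdot_sum_right: "cdot z (sum f B) = (\<Sum>b\<in>B. cdot z (f b))"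
  by (simp add: cdot_commute[of z] cdot_sum_left)

lemma cdot_axis [simp]: "cdot (axis i 1) x = x $ i" "cdot x (axis i 1) = x $ i"
proof -
  show "cdot (axis i 1) x = x $ i" 
    by (simp add: cdot_def axis_def if_distrib[of "\<lambda>y. y * _"] cong: if_cong)
  then show "cdot x (axis i 1) = x $ i" by (simp add: cdot_commute)
qed

lemma cdot_eqI: "(\<And>z. cdot z x = cdot z y) \<Longrightarrow> x = y"
  by (metis cdot_axis(1) vec_eq_iff)

lemma cdot_nondegenerate: "x \<noteq> 0 \<Longrightarrow> \<exists>y. cdot x y \<noteq> 0"
  by (metis cdot_axis(2) vec_eq_iff zero_index)

lemma cdot_mv: "cdot (A *v x) y = cdot x (transpose A *v y)"
proof -
  have "cdot (A *v x) y = (\<Sum>i\<in>UNIV. \<Sum>j\<in>UNIV. A $ i $ j * x $ j * y $ i)"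
    by (simp add: cdot_def matrix_vector_mult_def sum_distrib_right)
  also have "\<dots> = (\<Sum>j\<in>UNIV. \<Sum>i\<in>UNIV. A $ i $ j * x $ j * y $ i)"
    by (rule sum.swap)
  also have "\<dots> = cdot x (transpose A *v y)"
    by (simp add: cdot_def matrix_vector_mult_def transpose_def sum_distrib_left algebra_simps)
  finally show ?thesis .
qed

lemma mv_minus_left [simp]: "(- A) *v x = - (A *v (x :: complex^8))" for A :: mat8
  by (simp add: matrix_vector_mult_def vec_eq_iff sum_negf)

lemma so8_cdot: "A \<in> so8 \<Longrightarrow> cdot (A *v x) y = - cdot x (A *v y)"
  by (simp add: cdot_mv so8_def)

lemma so8_cdot_self: "A \<in> so8 \<Longrightarrow> cdot x (A *v x) = 0"
  using so8_cdot[of A x x] cdot_commute[of x "A *v x"] by simp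

lemma so8I:
  assumes "\<And>x y. cdot (A *v x) y = - cdot x (A *v y)"
  shows "A \<in> so8"
proof -
  have "transpose A *v y = (- A) *v y" for y
    by (rule cdot_eqI) (metis assms cdot_mv cdot_right(4) mv_minus_left)
  then have "transpose A = - A" by (simp add: matrix_eq)
  then show ?thesis by (simp add: so8_def)
qed

lemma cscale_mv [simp]: "(c *\<^sub>C A) *v x = c *s (A *v x)"
  by (simp add: cscale_def matrix_vector_mult_def vec_eq_iff sum_distrib_left algebra_simps)

lemma mv_add [simp]: "(A + B) *v x = A *v x + B *v (x :: complex^8)" for A B :: mat8
  by (simp add: matrix_vector_mult_add_rdistrib)

lemma mv_diff [simp]: "(A - B) *v x = A *v x - B *v (x :: complex^8)" for A B :: mat8
  by (simp add: matrix_vector_mult_diff_rdistrib)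

lemma mv_scale: "A *v (c *s x) = c *s (A *v x)" for A :: mat8
  by (simp add: vec.scale)

lemma mv_right [simp]: "A *v (x + y) = A *v x + A *v y" "A *v (c *s x) = c *s (A *v x)"
   "A *v (- x) = - (A *v x)" "A *v (x - y) = A *v x - A *v y" for A :: mat8
  by (simp_all add: vec.add vec.scale vec.neg vec.diff)

lemma mv_sum: "A *v (sum f B) = (\<Sum>b\<in>B. A *v (f b))" for A :: mat8
  by (simp add: vec.sum)

lemma sum_mv: "(sum F B) *v x = (\<Sum>b\<in>B. F b *v (x :: complex^8))" for F :: "_ \<Rightarrow> mat8"
  by (induction B rule: infinite_finite_induct) auto

lemma mat8_eqI: "(\<And>x. A *v x = B *v x) \<Longrightarrow> A = B" for A B :: mat8
  by (simp add: matrix_eq)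

lemma lbr_mv: "lbr A B *v x = A *v (B *v x) - B *v (A *v x)"
  by (simp add: lbr_def matrix_vector_mul_assoc)

lemma cscale_minus_one: "- A = (- 1) *\<^sub>C A"
  by (simp add: cscale_def vec_eq_iff)

lemma subspace_so8: "cmat.subspace so8"
  unfolding cmat.subspace_def
  by (auto intro!: so8I simp: so8_cdot algebra_simps)

lemma so8_closed [simp, intro]: "A \<in> so8 \<Longrightarrow> B \<in> so8 \<Longrightarrow> A + B \<in> so8"
   "A \<in> so8 \<Longrightarrow> c *\<^sub>C A \<in> so8" "A \<in> so8 \<Longrightarrow> - A \<in> so8" 
   "A \<in> so8 \<Longrightarrow> B \<in> so8 \<Longrightarrow> A - B \<in> so8" "0 \<in> so8"
  using subspace_so8 cmat.subspace_add cmat.subspace_scale cmat.subspace_neg cmat.subspace_diff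
    cmat.subspace_0 by blast+

lemma so8_lbr [simp, intro]: "A \<in> so8 \<Longrightarrow> B \<in> so8 \<Longrightarrow> lbr A B \<in> so8"
  by (rule so8I) (simp add: lbr_mv so8_cdot)

lemma lbr_bilinear: "lbr (A + B) C = lbr A C + lbr B C" "lbr A (B + C) = lbr A B + lbr A C"
  "lbr (c *\<^sub>C A) B = c *\<^sub>C lbr A B" "lbr A (c *\<^sub>C B) = c *\<^sub>C lbr A B"
  "lbr (- A) B = - lbr A B" "lbr A (- B) = - lbr A B"
  "lbr (A - B) C = lbr A C - lbr B C" "lbr A (B - C) = lbr A B - lbr A C"
  "lbr 0 A = 0" "lbr A 0 = 0"
  by (auto intro!: mat8_eqI simp: lbr_mv algebra_simps)

lemma lbr_sum: "lbr (sum F B) C = (\<Sum>b\<in>B. lbr (F b) C)" "lbr C (sum F B) = (\<Sum>b\<in>B. lbr C (F b))"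
  by (induction B rule: infinite_finite_induct) (auto simp: lbr_bilinear)

lemma lbr_antisym: "lbr B A = - lbr A B"
  by (simp add: lbr_def)

lemma lbr_self [simp]: "lbr A A = 0"
  by (simp add: lbr_def)

text \<open>The identification of the exterior square of \<open>\<complex>\<^sup>8\<close> with the
  orthogonal Lie algebra.\<close>

definition wedge :: "complex^8 \<Rightarrow> complex^8 \<Rightarrow> mat8"
  where "wedge a b = (\<chi> i j. a $ i * b $ j - b $ i * a $ j)"

lemma wedge_mv [simp]: "wedge a b *v x = cdot b x *s a - cdot a x *s b"
  by (simp add: wedge_def matrix_vector_mult_def cdot_def vec_eq_iff sum_subtractf sum_distrib_left
      algebra_simps)

lemma wedge_so8 [simp, intro]: "wedge a b \<in> so8"
  by (rule so8I) (simp add: cdot_commute algebra_simps)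

lemma wedge_bilinear: "wedge (a + b) c = wedge a c + wedge b c" "wedge a (b + c) = wedge a b + wedge a c"
  "wedge (k *s a) b = k *\<^sub>C wedge a b" "wedge a (k *s b) = k *\<^sub>C wedge a b"
  "wedge (a - b) c = wedge a c - wedge b c" "wedge a (b - c) = wedge a b - wedge a c"
  "wedge (- a) b = - wedge a b" "wedge a (- b) = - wedge a b"
  "wedge 0 b = 0" "wedge a 0 = 0" "wedge a a = 0"
  by (simp_all add: wedge_def cscale_def vec_eq_iff algebra_simps)

lemma wedge_antisym: "wedge b a = - wedge a b"
  by (simp add: wedge_def vec_eq_iff)

lemma lbr_wedge: "A \<in> so8 \<Longrightarrow> lbr A (wedge a b) = wedge (A *v a) b + wedge a (A *v b)"
  by (rule mat8_eqI) (simp add: lbr_mv so8_cdot algebra_simps)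

text \<open>The characteristic polynomial must have a root. To see that it is not constant, note
  that the reversed polynomial \<open>q\<close>, with \<open>q(w) = det (1 - w A)\<close>, has the
  value 1 at 0, whereas a constant \<open>p\<close> would force \<open>q(w) = p(0)
  w\<^sup>8\<close>.\<close>

lemma complex_eigenvector:
  fixes A :: mat8
  shows "\<exists>x c. x \<noteq> 0 \<and> A *v x = c *s x"
proof -
  define p where "p = (\<Sum>\<sigma> | \<sigma> permutes (UNIV :: 8 set). of_int (sign \<sigma>) *
      (\<Prod>i\<in>UNIV. [: A $ i $ \<sigma> i, if i = \<sigma> i then - 1 else 0 :]))"
  have p: "poly p z = det (A - mat z)" for z
    by (auto simp: p_def det_def poly_sum poly_prod mat_def intro!: sum.cong prod.cong)
  define q where "q = (\<Sum>\<sigma> | \<sigma> permutes (UNIV :: 8 set). of_int (sign \<sigma>) *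
      (\<Prod>i\<in>UNIV. [: if i = \<sigma> i then 1 else 0, - A $ i $ \<sigma> i :]))"
  have q: "poly q w = det (mat 1 - w *\<^sub>C A)" for w
    by (auto simp: q_def det_def poly_sum poly_prod mat_def cscale_def intro!: sum.cong prod.cong)
  have "\<exists>z. poly p z = 0"
  proof (rule ccontr)
    assume no: "\<nexists>z. poly p z = 0"
    then have "constant (poly p)" using fundamental_theorem_of_algebra by blast
    then have c: "poly p z = poly p 0" for z unfolding constant_def by blast
    have "poly q w = poly p 0 * w ^ 8" if "w \<noteq> 0" for w
    proof -
      have e: "mat 1 - w *\<^sub>C A = (- w) *\<^sub>C (A - mat (1 / w))"
        using that by (simp add: cscale_def mat_def vec_eq_iff field_simps)
      have d: "det (k *\<^sub>C B) = k ^ 8 * det B" for k B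
      proof -
        have "k *\<^sub>C B = (\<chi> i. k *s (B $ i))" by (simp add: cscale_def vec_eq_iff)
        then have "det (k *\<^sub>C B) = prod (\<lambda>i. k) (UNIV :: 8 set) * det (\<chi> i. B $ i)"
          using det_rows_mul[of "\<lambda>i. k" "\<lambda>i. B $ i"] by simp
        then show ?thesis by simp
      qed
      have "poly q w = (- w) ^ 8 * poly p (1 / w)" by (simp only: q e d p)
      then show ?thesis by (subst (asm) c) simp
    qed
    then have "poly (q - monom (poly p 0) 8) w = 0" if "w \<in> UNIV - {0}" for w
      using that by (simp add: poly_monom)
    then have "UNIV - {0} \<subseteq> {w. poly (q - monom (poly p 0) 8) w = 0}" by blast
    moreover have "infinite (UNIV - {0 :: complex})" by (simp add: infinite_UNIV_char_0)
    ultimately have "q - monom (poly p 0) 8 = 0"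
      using poly_roots_finite finite_subset by blast
    then have "poly q 0 = 0" by (simp add: poly_monom)
    moreover have "poly q 0 = 1" by (simp add: q)
    ultimately show False by simp
  qed
  then obtain z where "det (A - mat z) = 0" by (auto simp: p)
  then have "\<not> inj ((*v) (A - mat z))"
    by (metis det_nz_iff_inj_gen matrix_of_matrix_vector_mul matrix_vector_mul_linear_gen)
  then obtain x y where "x \<noteq> y" "(A - mat z) *v x = (A - mat z) *v y" by (auto simp: inj_def)
  moreover have "mat z *v u = z *s u" for u :: "complex^8"
    by (simp add: mat_def matrix_vector_mult_def vec_eq_iff if_distrib[of "\<lambda>y. y * _"] cong: if_cong)
  ultimately have "x - y \<noteq> 0" "A *v (x - y) = z *s (x - y)"
    by (simp_all add: algebra_simps)
  then show ?thesis by blast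
qed

text \<open>The vector representation is irreducible: the matrices \<open>axis i 1 \<and> axis j
  1\<close> move a nonzero coordinate of \<open>y\<close> to any other place.\<close>

lemma so8_invariant_UNIV:
  assumes E: "vec.subspace E" and inv: "\<And>Z x. Z \<in> so8 \<Longrightarrow> x \<in> E \<Longrightarrow> Z *v x \<in> E"
    and y: "y \<in> E" "y \<noteq> 0"
  shows "E = UNIV"
proof -
  obtain k where k: "y $ k \<noteq> 0" using y(2) by (metis vec_eq_iff zero_index)
  have step: "x $ j *s axis i 1 - x $ i *s axis j 1 \<in> E" if "x \<in> E" for x i j
    using inv[OF wedge_so8[of "axis i 1" "axis j 1"] that] by simp
  have ax: "axis i 1 \<in> E" if "i \<noteq> k" for i
  proof -
    obtain l where l: "l \<noteq> i" "l \<noteq> k"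
    proof -
      have "card {i, k} < CARD(8)" by (simp add: card_insert_if)
      then have "{i, k} \<noteq> UNIV" by (metis less_irrefl)
      then show ?thesis using that by blast
    qed
    have w: "y $ k *s axis l 1 - y $ l *s axis k 1 \<in> E" using step[OF y(1)] .
    have "y $ k *s axis i 1 \<in> E"
      using step[OF w, of l i] l that by (simp add: axis_def)
    then have "(1 / y $ k) *s (y $ k *s axis i 1) \<in> E" using E vec.subspace_scale by blast
    then show ?thesis using k by simp
  qed
  have "axis i 1 \<in> E" for i
  proof (cases "i = k")
    case True
    obtain l where l: "l \<noteq> k"
    proof -
      have "card {k} < CARD(8)" by simp
      then have "{k} \<noteq> UNIV" by (metis less_irrefl)
      then show ?thesis using that by blast
    qed
    show ?thesis using step[OF ax[OF l], of l k] l True by (simp add: axis_def)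
  qed (rule ax)
  then have "(\<Sum>i\<in>UNIV. x $ i *s axis i 1) \<in> E" for x
    using E vec.subspace_sum vec.subspace_scale by (metis (no_types, lifting))
  then show ?thesis by (metis UNIV_eq_I basis_expansion)
qed

text \<open>An \<open>ad H\<close>-eigenvector in \<open>so8\<close> maps
  \<open>H\<close>-eigenvectors to \<open>H\<close>-eigenvectors. If such elements span
  \<open>so8\<close>, the span of the eigenvectors of \<open>H\<close> is therefore an invariant
  subspace of the irreducible vector representation, and it is not zero.\<close>

lemma ad_diagonalizable_imp_diagonalizable:
  assumes H: "H \<in> so8" and ad: "cmat.span {Z \<in> so8. \<exists>c. lbr H Z = c *\<^sub>C Z} = so8"
  shows "vec.span {x. \<exists>c. H *v x = c *s x} = UNIV"
proof -
  define E where "E = vec.span {x. \<exists>c. H *v x = c *s x}"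
  have sub: "vec.subspace E" by (simp add: E_def)
  have eig: "Z *v x \<in> E" if "Z \<in> so8" "H *v x = c *s x" for Z x c
  proof -
    have "Z \<in> cmat.span {Z \<in> so8. \<exists>c. lbr H Z = c *\<^sub>C Z}" using that ad by simp
    then show ?thesis
    proof (induction rule: cmat.span_induct_alt)
      case base
      then show ?case using sub vec.subspace_0 by simp
    next
      case (step d W Z)
      obtain e where e: "lbr H W = e *\<^sub>C W" using step by blast
      have "H *v (W *v x) = lbr H W *v x + W *v (H *v x)" by (simp add: lbr_mv)
      then have "H *v (W *v x) = (e + c) *s (W *v x)" using that(2) e by (simp add: algebra_simps)
      then have "W *v x \<in> E" unfolding E_def by (intro vec.span_base) blast
      then show ?case using step(2)
        by (auto intro!: vec.subspace_add[OF sub] vec.subspace_scale[OF sub])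
    qed
  qed
  have "Z *v x \<in> E" if Z: "Z \<in> so8" and x: "x \<in> E" for Z x
    using x[unfolded E_def]
  proof (induction rule: vec.span_induct_alt)
    case base
    then show ?case using sub vec.subspace_0 by simp
  next
    case (step d y z)
    then show ?case using eig[OF Z]
      by (auto intro!: vec.subspace_add[OF sub] vec.subspace_scale[OF sub])
  qed
  moreover obtain x c where "x \<noteq> 0" "H *v x = c *s x" using complex_eigenvector by blast
  moreover from this have "x \<in> E" unfolding E_def by (intro vec.span_base) blast
  ultimately have "E = UNIV" using so8_invariant_UNIV[OF sub] by blast
  then show ?thesis by (simp add: E_def)
qed

section \<open>Isotropic frames adapted to a Cartan subalgebra\<close>

text \<open>Applying \<open>F - \<mu>\<close> to the sum removes the component for
  \<open>\<mu>\<close> and rescales the others by nonzero factors, which allows induction on the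
  number of components.\<close>

lemma invariant_eigencomponents:
  fixes F :: mat8
  assumes W: "vec.subspace W" and inv: "\<And>x. x \<in> W \<Longrightarrow> F *v x \<in> W"
    and "finite S" and eig: "\<And>\<mu>. F *v y \<mu> = \<mu> *s y \<mu>" and "(\<Sum>\<mu>\<in>S. y \<mu>) \<in> W"
  shows "\<forall>\<mu>\<in>S. y \<mu> \<in> W"
  using assms(3-5)
proof (induction S arbitrary: y rule: finite_induct)
  case (insert \<nu> S)
  define z where "z \<mu> = (\<mu> - \<nu>) *s y \<mu>" for \<mu>
  have z: "F *v z \<mu> = \<mu> *s z \<mu>" for \<mu>
    by (simp add: z_def insert.prems(1) mult.commute)
  let ?s = "\<Sum>\<mu>\<in>insert \<nu> S. y \<mu>"
  have "F *v ?s - \<nu> *s ?s = (\<Sum>\<mu>\<in>insert \<nu> S. z \<mu>)"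
    by (simp add: mv_sum vec.scale_sum_right z_def insert.prems(1) vec.scale_left_diff_distrib sum_subtractf
        del: sum.insert)
  also have "\<dots> = (\<Sum>\<mu>\<in>S. z \<mu>)"
    using insert.hyps by (simp add: z_def)
  finally have "(\<Sum>\<mu>\<in>S. z \<mu>) \<in> W"
    using vec.subspace_diff[OF W inv[OF insert.prems(2)] vec.subspace_scale[OF W insert.prems(2)], of \<nu>] by simp
  then have zW: "\<forall>\<mu>\<in>S. z \<mu> \<in> W" using insert.IH[of z] z by blast
  have S: "y \<mu> \<in> W" if "\<mu> \<in> S" for \<mu>
  proof -
    have "\<mu> \<noteq> \<nu>" using that insert.hyps by blast
    then have "y \<mu> = (1 / (\<mu> - \<nu>)) *s z \<mu>" unfolding z_def vec.scale_scale by simp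
    then show ?thesis using zW that vec.subspace_scale[OF W] by metis
  qed
  have "y \<nu> = ?s - (\<Sum>\<mu>\<in>S. y \<mu>)" using insert.hyps by simp
  moreover have "(\<Sum>\<mu>\<in>S. y \<mu>) \<in> W" using S by (intro vec.subspace_sum[OF W]) blast
  ultimately have "y \<nu> \<in> W" using vec.subspace_diff[OF W insert.prems(2)] by metis
  then show ?case using S by blast
qed simp

lemma eigenspan_decomposition:
  fixes F :: mat8
  assumes "x \<in> vec.span {x. \<exists>c. F *v x = c *s x}"
  obtains S y where "finite S" "x = (\<Sum>\<mu>\<in>S. y \<mu>)" "\<And>\<mu>. F *v y \<mu> = \<mu> *s y \<mu>"
proof -
  have "\<exists>S y. finite S \<and> x = (\<Sum>\<mu>\<in>S. y \<mu>) \<and> (\<forall>\<mu>. F *v y \<mu> = \<mu> *s y \<mu>) \<and> (\<forall>\<mu>. \<mu> \<notin> S \<longrightarrow> y \<mu> = 0)"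
    using assms
  proof (induction rule: vec.span_induct_alt)
    case base
    show ?case by (rule exI[of _ "{}"], rule exI[of _ "\<lambda>_. 0"]) simp
  next
    case (step d e x)
    obtain \<nu> where \<nu>: "F *v e = \<nu> *s e" using step(1) by blast
    obtain S y where y: "finite S" "x = (\<Sum>\<mu>\<in>S. y \<mu>)" "\<forall>\<mu>. F *v y \<mu> = \<mu> *s y \<mu>" "\<forall>\<mu>. \<mu> \<notin> S \<longrightarrow> y \<mu> = 0"
      using step(2) by blast
    let ?y = "y(\<nu> := d *s e + y \<nu>)"
    have "(\<Sum>\<mu>\<in>insert \<nu> S. ?y \<mu>) = ?y \<nu> + (\<Sum>\<mu>\<in>S - {\<nu>}. ?y \<mu>)"
      using y(1) by (simp add: sum.insert_remove)
    also have "\<dots> = d *s e + (y \<nu> + (\<Sum>\<mu>\<in>S - {\<nu>}. y \<mu>))"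
      by simp
    also have "y \<nu> + (\<Sum>\<mu>\<in>S - {\<nu>}. y \<mu>) = (\<Sum>\<mu>\<in>S. y \<mu>)"
      using y(1,4) by (cases "\<nu> \<in> S") (simp_all add: sum.remove)
    finally have "d *s e + x = (\<Sum>\<mu>\<in>insert \<nu> S. ?y \<mu>)" using y(2) by simp
    moreover have "F *v ?y \<mu> = \<mu> *s ?y \<mu>" for \<mu>
      using y(3) \<nu> by (simp add: vec.scale_right_distrib mult.commute)
    ultimately show ?case
      using y(1,4) by (intro exI[of _ "insert \<nu> S"] exI[of _ ?y]) auto
  qed
  then show ?thesis using that by blast
qed

text \<open>If every member of the family is scalar on \<open>W\<close> there is nothing to do.
  Otherwise some \<open>F\<close> is not, its eigenspaces in \<open>W\<close> are proper and
  invariant, and induction on the dimension applies to each of them.\<close>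

lemma commuting_diagonalizable:
  fixes \<F> :: "mat8 set"
  assumes comm: "\<And>F G x. F \<in> \<F> \<Longrightarrow> G \<in> \<F> \<Longrightarrow> F *v (G *v x) = G *v (F *v x)"
    and diag: "\<And>F. F \<in> \<F> \<Longrightarrow> vec.span {x. \<exists>c. F *v x = c *s x} = UNIV"
    and "vec.subspace W" "\<And>F x. F \<in> \<F> \<Longrightarrow> x \<in> W \<Longrightarrow> F *v x \<in> W"
  shows "W \<subseteq> vec.span {x \<in> W. \<forall>F\<in>\<F>. \<exists>c. F *v x = c *s x}"
  using assms(3,4)
proof (induction "vec.dim W" arbitrary: W rule: less_induct)
  case less
  show ?case
  proof (cases "\<forall>F\<in>\<F>. \<exists>c. \<forall>x\<in>W. F *v x = c *s x")
    case True
    then have "W \<subseteq> {x \<in> W. \<forall>F\<in>\<F>. \<exists>c. F *v x = c *s x}" by blast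
    then show ?thesis using vec.span_superset by blast
  next
    case False
    then obtain F where F: "F \<in> \<F>" "\<And>c. \<not> (\<forall>x\<in>W. F *v x = c *s x)" by blast
    define E where "E \<mu> = {x \<in> W. F *v x = \<mu> *s x}" for \<mu>
    have subE: "vec.subspace (E \<mu>)" for \<mu>
      using less.prems(1) unfolding E_def vec.subspace_def
      by (auto simp: vec.scale_right_distrib mult.commute)
    have E: "E \<mu> \<subseteq> vec.span {x \<in> W. \<forall>F\<in>\<F>. \<exists>c. F *v x = c *s x}" for \<mu>
    proof -
      have "E \<mu> \<subseteq> W" by (auto simp: E_def)
      moreover have "E \<mu> \<noteq> W" using F(2)[of \<mu>] by (auto simp: E_def)
      ultimately have "vec.dim (E \<mu>) < vec.dim W"
        using vec.subspace_dim_equal[OF subE less.prems(1)] by (metis not_less)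
      moreover have "G *v x \<in> E \<mu>" if "G \<in> \<F>" "x \<in> E \<mu>" for G x
        using that less.prems(2) comm[OF F(1) that(1)] by (simp add: E_def)
      ultimately have "E \<mu> \<subseteq> vec.span {x \<in> E \<mu>. \<forall>F\<in>\<F>. \<exists>c. F *v x = c *s x}"
        using less.hyps subE by blast
      also have "\<dots> \<subseteq> vec.span {x \<in> W. \<forall>F\<in>\<F>. \<exists>c. F *v x = c *s x}"
        by (rule vec.span_mono) (auto simp: E_def)
      finally show ?thesis .
    qed
    have comp: "\<exists>S y. x = (\<Sum>\<mu>\<in>S. y \<mu>) \<and> (\<forall>\<mu>\<in>S. y \<mu> \<in> E \<mu>)" if "x \<in> W" for x
    proof -
      obtain S y where y: "finite S" "x = (\<Sum>\<mu>\<in>S. y \<mu>)" "\<And>\<mu>. F *v y \<mu> = \<mu> *s y \<mu>"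
        using eigenspan_decomposition[of x F] diag[OF F(1)] by (metis UNIV_I)
      have "\<forall>\<mu>\<in>S. y \<mu> \<in> W"
        by (rule invariant_eigencomponents[OF less.prems(1) less.prems(2)[OF F(1)] y(1,3)]) (use y(2) that in auto)
      then show ?thesis using y(2,3) by (auto simp: E_def)
    qed
    show ?thesis
    proof
      fix x assume "x \<in> W"
      then obtain S y where y: "x = (\<Sum>\<mu>\<in>S. y \<mu>)" "\<And>\<mu>. \<mu> \<in> S \<Longrightarrow> y \<mu> \<in> E \<mu>" using comp by blast
      show "x \<in> vec.span {x \<in> W. \<forall>F\<in>\<F>. \<exists>c. F *v x = c *s x}"
        unfolding y(1) using y(2) E by (intro vec.span_sum) blast
    qed
  qed
qed

text \<open>The weights of the vector representation come in pairs of opposite sign, so that the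
  basis vectors are numbered by \<open>\<plusminus> 1, \<dots>, \<plusminus> k\<close>.\<close>

definition Idx :: "nat \<Rightarrow> int set"
  where "Idx k = {c. c \<noteq> 0 \<and> \<bar>c\<bar> \<le> int k}"

lemma finite_Idx [simp]: "finite (Idx k)"
proof -
  have "Idx k \<subseteq> {- int k..int k}" by (auto simp: Idx_def)
  then show ?thesis using finite_subset by blast
qed

lemma Idx_uminus [simp]: "- c \<in> Idx k \<longleftrightarrow> c \<in> Idx k"
  by (simp add: Idx_def)

lemma Idx_0: "Idx 0 = {}"
  by (auto simp: Idx_def)

lemma Idx_Suc: "Idx (Suc k) = insert (int (Suc k)) (insert (- int (Suc k)) (Idx k))"
  by (auto simp: Idx_def)

lemma Idx_Suc_notin: "int (Suc k) \<notin> Idx k" "- int (Suc k) \<notin> Idx k" "1 + int k \<notin> Idx k" "- 1 - int k \<notin> Idx k"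
  by (auto simp: Idx_def)

lemma card_Idx: "card (Idx k) = 2 * k"
proof (induction k)
  case (Suc k)
  have "int (Suc k) \<noteq> - int (Suc k)" by simp
  then show ?case using Suc Idx_Suc_notin[of k] unfolding Idx_Suc by simp
qed (simp add: Idx_0)

locale cartan =
  fixes \<hh> :: "mat8 set"
  assumes cartan: "cartan_subalgebra \<hh>"
begin

lemma h_so8 [simp, intro]: "H \<in> \<hh> \<Longrightarrow> H \<in> so8"
  using cartan by (auto simp: cartan_subalgebra_def)

lemma h_subspace: "cmat.subspace \<hh>"
  using cartan by (auto simp: cartan_subalgebra_def)

lemma h_comm: "H \<in> \<hh> \<Longrightarrow> H' \<in> \<hh> \<Longrightarrow> lbr H H' = 0"
  using cartan by (auto simp: cartan_subalgebra_def)

text \<open>Adding \<open>Z\<close> to the Cartan subalgebra would give a larger commutative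
  subalgebra.\<close>

lemma h_maximal:
  assumes Z: "Z \<in> so8" and comm: "\<And>H. H \<in> \<hh> \<Longrightarrow> lbr H Z = 0"
  shows "Z \<in> \<hh>"
proof -
  define \<aa> where "\<aa> = {H + c *\<^sub>C Z | H c. H \<in> \<hh>}"
  have comm': "lbr Z H = 0" if "H \<in> \<hh>" for H
    using comm[OF that] lbr_antisym[of Z H] by simp
  have aI: "H + c *\<^sub>C Z \<in> \<aa>" if "H \<in> \<hh>" for H c
    using that by (auto simp: \<aa>_def)
  have "cmat.subspace \<aa>"
  proof (rule cmat.subspaceI)
    show "0 \<in> \<aa>" using aI[OF cmat.subspace_0[OF h_subspace], of 0] by simp
  next
    fix x y assume "x \<in> \<aa>" "y \<in> \<aa>"
    then obtain H c H' c' where *: "H \<in> \<hh>" "H' \<in> \<hh>" "x = H + c *\<^sub>C Z" "y = H' + c' *\<^sub>C Z"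
      unfolding \<aa>_def by blast
    then have "x + y = (H + H') + (c + c') *\<^sub>C Z" by (simp add: cmat.scale_left_distrib)
    then show "x + y \<in> \<aa>" using aI[OF cmat.subspace_add[OF h_subspace *(1,2)]] by simp
  next
    fix k x assume "x \<in> \<aa>"
    then obtain H c where *: "H \<in> \<hh>" "x = H + c *\<^sub>C Z" unfolding \<aa>_def by blast
    then have "k *\<^sub>C x = k *\<^sub>C H + (k * c) *\<^sub>C Z" by (simp add: cmat.scale_right_distrib)
    then show "k *\<^sub>C x \<in> \<aa>" using aI[OF cmat.subspace_scale[OF h_subspace *(1)]] by simp
  qed
  moreover have "\<aa> \<subseteq> so8" using Z by (auto simp: \<aa>_def)
  moreover have "\<forall>H\<in>\<aa>. \<forall>H'\<in>\<aa>. lbr H H' = 0"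
    by (auto simp: \<aa>_def lbr_bilinear comm comm' h_comm)
  moreover have "\<hh> \<subseteq> \<aa>"
  proof
    fix H assume "H \<in> \<hh>"
    from aI[OF this, of 0] show "H \<in> \<aa>" by simp
  qed
  ultimately have "\<aa> = \<hh>" using cartan unfolding cartan_subalgebra_def by blast
  moreover have "Z \<in> \<aa>"
    using aI[OF cmat.subspace_0[OF h_subspace], of 1] by simp
  ultimately show ?thesis by simp
qed

definition weight_vectors :: "(complex^8) set"
  where "weight_vectors = {x. \<forall>H\<in>\<hh>. \<exists>c. H *v x = c *s x}"

lemma span_weight_vectors: "vec.span weight_vectors = UNIV"
proof -
  have "UNIV \<subseteq> vec.span {x \<in> UNIV. \<forall>F\<in>\<hh>. \<exists>c. F *v x = c *s x}"
  proof (rule commuting_diagonalizable)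
    fix F G x assume "F \<in> \<hh>" "G \<in> \<hh>"
    then have "lbr F G *v x = 0" using h_comm by simp
    then show "F *v (G *v x) = G *v (F *v x)" by (simp add: lbr_mv)
  next
    fix F assume "F \<in> \<hh>"
    then show "vec.span {x. \<exists>c. F *v x = c *s x} = UNIV"
      using cartan by (intro ad_diagonalizable_imp_diagonalizable) (auto simp: cartan_subalgebra_def)
  qed auto
  then show ?thesis by (auto simp: weight_vectors_def)
qed

text \<open>A partial basis of weight vectors in which \<open>u c\<close> and \<open>u (- c)\<close>
  are dual to each other.\<close>

definition isotropic_frame :: "nat \<Rightarrow> (int \<Rightarrow> complex^8) \<Rightarrow> bool"
  where "isotropic_frame k u \<longleftrightarrow> (\<forall>c\<in>Idx k. \<forall>d\<in>Idx k. cdot (u c) (u d) = (if c = - d then 1 else 0)) \<and> u ` Idx k \<subseteq> weight_vectors"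

text \<open>The projection to the orthogonal complement of the span of the frame.\<close>

definition orth :: "nat \<Rightarrow> (int \<Rightarrow> complex^8) \<Rightarrow> complex^8 \<Rightarrow> complex^8"
  where "orth k u x = x - (\<Sum>c\<in>Idx k. cdot (u (- c)) x *s u c)"

lemma orth_linear: "orth k u (x + y) = orth k u x + orth k u y" "orth k u (a *s x) = a *s orth k u x"
   "orth k u 0 = 0"
  by (simp_all add: orth_def vec.scale_left_distrib sum.distrib vec.scale_right_diff_distrib
      vec.scale_sum_right)

lemma orth_perp:
  assumes "isotropic_frame k u" "d \<in> Idx k"
  shows "cdot (u d) (orth k u x) = 0"
proof -
  have "(\<Sum>c\<in>Idx k. cdot (u (- c)) x * cdot (u d) (u c)) = (\<Sum>c\<in>Idx k. if c = - d then cdot (u d) x else 0)"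
    using assms by (intro sum.cong) (auto simp: isotropic_frame_def)
  then show ?thesis using assms(2) by (simp add: orth_def cdot_sum_right)
qed

lemma cdot_orth:
  assumes "\<And>d. d \<in> Idx k \<Longrightarrow> cdot w (u d) = 0"
  shows "cdot w (orth k u x) = cdot w x"
  using assms by (simp add: orth_def cdot_sum_right)

lemma weights_opposite:
  assumes "H \<in> \<hh>" "H *v x = a *s x" "H *v y = b *s y" "cdot x y \<noteq> 0"
  shows "b = - a"
proof -
  have "a * cdot x y = - b * cdot x y"
    using so8_cdot[OF h_so8[OF assms(1)], of x y] assms(2,3) by simp
  then have "a = - b" using assms(4) mult_right_cancel by blast
  then show ?thesis by simp
qed

lemma orth_eigen:
  assumes u: "isotropic_frame k u" and H: "H \<in> \<hh>" and x: "H *v x = a *s x"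
  shows "H *v orth k u x = a *s orth k u x"
proof -
  have "cdot (u (- c)) x *s (H *v u c) = a *s (cdot (u (- c)) x *s u c)" if c: "c \<in> Idx k" for c
  proof (cases "cdot (u (- c)) x = 0")
    case False
    obtain e where e: "H *v u c = e *s u c" using u c H unfolding isotropic_frame_def weight_vectors_def by blast
    obtain e' where e': "H *v u (- c) = e' *s u (- c)"
      using u Idx_uminus[THEN iffD2, OF c] H unfolding isotropic_frame_def weight_vectors_def by blast
    have "cdot (u (- c)) (u c) = 1" using u c by (simp add: isotropic_frame_def)
    then have "e = - e'" using weights_opposite[OF H e' e] by simp
    moreover have "a = - e'" using weights_opposite[OF H e' x False] .
    ultimately show ?thesis using e by simp
  qed simp
  then show ?thesis
    by (simp add: orth_def mv_sum x vec.scale_right_diff_distrib vec.scale_sum_right)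
qed

lemma orth_weight_vectors: "isotropic_frame k u \<Longrightarrow> x \<in> weight_vectors \<Longrightarrow> orth k u x \<in> weight_vectors"
  using orth_eigen unfolding weight_vectors_def by blast

lemma orth_nonzero:
  assumes "isotropic_frame k u" "k < 4"
  shows "\<exists>x. orth k u x \<notin> vec.span {a}"
proof (rule ccontr)
  assume "\<not> ?thesis"
  then have o: "orth k u x \<in> vec.span {a}" for x by blast
  have "x \<in> vec.span (insert a (u ` Idx k))" for x
  proof -
    have "(\<Sum>c\<in>Idx k. cdot (u (- c)) x *s u c) \<in> vec.span (insert a (u ` Idx k))"
      by (intro vec.span_sum vec.span_scale vec.span_base) auto
    moreover have "orth k u x \<in> vec.span (insert a (u ` Idx k))"
      using o[of x] vec.span_mono[of "{a}" "insert a (u ` Idx k)"] by blast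
    ultimately have "orth k u x + (\<Sum>c\<in>Idx k. cdot (u (- c)) x *s u c) \<in> vec.span (insert a (u ` Idx k))"
      using vec.span_add by blast
    then show ?thesis by (simp add: orth_def)
  qed
  then have "vec.dim (UNIV :: (complex^8) set) \<le> card (insert a (u ` Idx k))"
    by (intro vec.dim_le_card) auto
  also have "\<dots> \<le> Suc (2 * k)"
    using card_image_le[of "Idx k" u] card_insert_le_m1[of "Suc (2 * k)" "u ` Idx k" a] by (simp add: card_Idx)
  finally show False using assms(2) by (simp add: vec.dim_UNIV card_cart_basis)
qed

text \<open>The orthogonal complement of the frame contains a weight vector \<open>w\<close> with a
  nonzero weight \<open>a\<close>; it is isotropic, and a weight vector pairing with it to 1 has the
  opposite weight and is isotropic as well, so both can be added. If there were no such
  \<open>w\<close>, the Cartan subalgebra would vanish on the complement. Then \<open>a \<and>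
  b\<close> commutes with the Cartan subalgebra for \<open>a, b\<close> in the complement, so it
  belongs to it by maximality, so it vanishes on the complement, and this forces the complement to
  have dimension at most 1; but its dimension is \<open>8 - 2 k\<close>, which is at least 2.\<close>

lemma isotropic_frame_extend:
  assumes u: "isotropic_frame k u" and k: "k < 4"
  shows "\<exists>u. isotropic_frame (Suc k) u"
proof -
  have "\<exists>x\<in>weight_vectors. \<exists>H\<in>\<hh>. H *v orth k u x \<noteq> 0"
  proof (rule ccontr)
    assume no: "\<not> ?thesis"
    have kill: "H *v orth k u x = 0" if H: "H \<in> \<hh>" for H x
    proof -
      have "x \<in> vec.span weight_vectors" by (simp add: span_weight_vectors)
      then show ?thesis
      proof (induction rule: vec.span_induct_alt)
        case base
        then show ?case by (simp add: orth_linear)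
      next
        case (step c y z)
        then show ?case using no H by (simp add: orth_linear)
      qed
    qed
    obtain x where x: "orth k u x \<noteq> 0"
      using orth_nonzero[OF u k, of 0] by (auto simp: vec.span_zero)
    define a where "a = orth k u x"
    obtain z where z: "cdot a z \<noteq> 0" using x cdot_nondegenerate[of a] by (auto simp: a_def)
    have az: "cdot a (orth k u z) = cdot a z"
      by (rule cdot_orth) (metis a_def cdot_commute orth_perp[OF u])
    have "orth k u y \<in> vec.span {a}" for y
    proof -
      define b where "b = orth k u y"
      have "wedge a b \<in> \<hh>"
        by (rule h_maximal) (simp_all add: lbr_wedge a_def b_def kill wedge_bilinear)
      from kill[OF this, of z] have "cdot b (orth k u z) *s a = cdot a z *s b" by (simp add: az)
      then have "(1 / cdot a z) *s (cdot a z *s b) = (1 / cdot a z) *s (cdot b (orth k u z) *s a)"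
        by simp
      moreover have "(1 / cdot a z) *s (cdot a z *s b) = b"
        using z unfolding vec.scale_scale by simp
      ultimately have "b = (1 / cdot a z) *s (cdot b (orth k u z) *s a)" by simp
      moreover have "(1 / cdot a z) *s (cdot b (orth k u z) *s a) \<in> vec.span {a}"
        by (intro vec.span_scale vec.span_base) simp
      ultimately show ?thesis unfolding b_def by simp
    qed
    then show False using orth_nonzero[OF u k, of a] by blast
  qed
  then obtain x H where x: "x \<in> weight_vectors" and H: "H \<in> \<hh>" and nz: "H *v orth k u x \<noteq> 0" by blast
  define w where "w = orth k u x"
  have w: "w \<in> weight_vectors" "w \<noteq> 0" using orth_weight_vectors[OF u x] nz by (auto simp: w_def)
  obtain a where a: "H *v w = a *s w" using w(1) H by (auto simp: weight_vectors_def)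
  then have "a \<noteq> 0" using nz w_def by auto
  have "\<exists>y\<in>weight_vectors. cdot w y \<noteq> 0"
  proof (rule ccontr)
    assume no: "\<not> ?thesis"
    have "cdot w z = 0" for z
    proof -
      have "z \<in> vec.span weight_vectors" by (simp add: span_weight_vectors)
      then show ?thesis by (induction rule: vec.span_induct_alt) (use no in auto)
    qed
    then show False using cdot_nondegenerate[OF w(2)] by blast
  qed
  then obtain y0 where y0: "y0 \<in> weight_vectors" "cdot w y0 \<noteq> 0" by blast
  have w_perp: "cdot w (u d) = 0" "cdot (u d) w = 0" if "d \<in> Idx k" for d
    using orth_perp[OF u that, of x] by (simp_all add: w_def cdot_commute)
  define y where "y = (1 / cdot w y0) *s orth k u y0"
  have y: "y \<in> weight_vectors" "cdot w y = 1" "cdot y w = 1"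
    using orth_weight_vectors[OF u y0(1)] y0(2) w_perp 
    by (auto simp: y_def weight_vectors_def mv_scale cdot_orth cdot_commute[of _ w] mult.commute)
  have y_perp: "cdot y (u d) = 0" "cdot (u d) y = 0" if "d \<in> Idx k" for d
    using orth_perp[OF u that, of y0] by (simp_all add: y_def cdot_commute)
  obtain b where b: "H *v y = b *s y" using y(1) H by (auto simp: weight_vectors_def)
  have "b = - a" using weights_opposite[OF H a b] y(2) by simp
  then have "b \<noteq> 0" using \<open>a \<noteq> 0\<close> by simp
  \<comment> \<open>Weight vectors with a nonzero weight are isotropic, since \<open>(w, H w) = 0\<close>.\<close>
  have ww: "cdot w w = 0" using so8_cdot_self[OF h_so8[OF H], of w] a \<open>a \<noteq> 0\<close> by simp
  have yy: "cdot y y = 0" using so8_cdot_self[OF h_so8[OF H], of y] b \<open>b \<noteq> 0\<close> by simp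
  define n where "n = int (Suc k)"
  have n: "n > 0" by (simp add: n_def)
  have Idx_n: "Idx (Suc k) = insert n (insert (- n) (Idx k))" by (simp add: Idx_Suc n_def)
  have neq: "c \<noteq> n" "n \<noteq> c" "c \<noteq> - n" "n \<noteq> - c" if "c \<in> Idx k" for c
    using that by (auto simp: Idx_def n_def)
  define u' where "u' c = (if c = n then w else if c = - n then y else u c)" for c
  have u'_old: "u' c = u c" if "c \<in> Idx k" for c
    using neq[OF that] by (simp add: u'_def)
  have u'_new: "u' n = w" "u' (- n) = y" using n by (simp_all add: u'_def)
  have "isotropic_frame (Suc k) u'"
    unfolding isotropic_frame_def
  proof (intro conjI ballI)
    fix c d assume "c \<in> Idx (Suc k)" and "d \<in> Idx (Suc k)"
    then have "c = n \<or> c = - n \<or> c \<in> Idx k" "d = n \<or> d = - n \<or> d \<in> Idx k" by (auto simp: Idx_n)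
    then show "cdot (u' c) (u' d) = (if c = - d then 1 else 0)"
      using u n by (elim disjE) (simp_all add: u'_old u'_new ww yy y(2,3) w_perp y_perp neq isotropic_frame_def)
  next
    show "u' ` Idx (Suc k) \<subseteq> weight_vectors"
      using u w(1) y(1) unfolding Idx_n isotropic_frame_def by (auto simp: u'_old u'_new)
  qed
  then show ?thesis by blast
qed

lemma isotropic_frame_exists: "k \<le> 4 \<Longrightarrow> \<exists>u. isotropic_frame k u"
proof (induction k)
  case 0
  show ?case by (rule exI[of _ "\<lambda>_. 0"]) (simp add: isotropic_frame_def Idx_0)
next
  case (Suc k)
  then show ?case using isotropic_frame_extend by auto
qed

text \<open>Eight vectors with nondegenerate Gram matrix are a basis of
  \<open>\<complex>\<^sup>8\<close>.\<close>

lemma isotropic_frame_4_basis: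
  assumes u: "isotropic_frame 4 u"
  shows "x = (\<Sum>c\<in>Idx 4. cdot (u (- c)) x *s u c)"
proof -
  have o: "orth 4 u (u d) = 0" if "d \<in> Idx 4" for d
  proof -
    have "cdot (u (- c)) (u d) *s u c = (if c = d then u d else 0)" if "c \<in> Idx 4" for c
      using u \<open>d \<in> Idx 4\<close> that by (simp add: isotropic_frame_def)
    then have "(\<Sum>c\<in>Idx 4. cdot (u (- c)) (u d) *s u c) = (\<Sum>c\<in>Idx 4. if c = d then u d else 0)"
      by (intro sum.cong) auto
    then show ?thesis using that by (simp add: orth_def)
  qed
  have inj: "inj_on u (Idx 4)"
  proof (rule inj_onI)
    fix c d assume cd: "c \<in> Idx 4" "d \<in> Idx 4" "u c = u d"
    have "cdot (u (- c)) (u c) = cdot (u (- c)) (u d)" using cd by simp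
    then show "c = d" using u cd(1,2) by (auto simp: isotropic_frame_def split: if_splits)
  qed
  have "vec.independent (u ` Idx 4)"
  proof (rule vec.independent_if_scalars_zero)
    fix f x assume "(\<Sum>x\<in>u ` Idx 4. f x *s x) = 0" and x: "x \<in> u ` Idx 4"
    then have z: "(\<Sum>c\<in>Idx 4. f (u c) *s u c) = 0" by (simp add: sum.reindex[OF inj])
    obtain d where d: "d \<in> Idx 4" "x = u d" using x by blast
    have "f (u c) * cdot (u (- d)) (u c) = (if c = d then f (u d) else 0)" if "c \<in> Idx 4" for c
      using u d(1) that by (simp add: isotropic_frame_def)
    then have "(\<Sum>c\<in>Idx 4. f (u c) * cdot (u (- d)) (u c)) = (\<Sum>c\<in>Idx 4. if c = d then f (u d) else 0)"
      by (intro sum.cong) auto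
    moreover have "(\<Sum>c\<in>Idx 4. f (u c) * cdot (u (- d)) (u c)) = cdot (u (- d)) (\<Sum>c\<in>Idx 4. f (u c) *s u c)"
      by (simp add: cdot_sum_right)
    ultimately show "f x = 0" using d z by simp
  qed simp
  then have "UNIV \<subseteq> vec.span (u ` Idx 4)"
    by (intro vec.card_ge_dim_independent) (simp_all add: card_image[OF inj] card_Idx vec.dim_UNIV card_cart_basis)
  then have "x \<in> vec.span (u ` Idx 4)" by blast
  then have "orth 4 u x = 0"
  proof (induction rule: vec.span_induct_alt)
    case base
    then show ?case by (simp add: orth_linear)
  next
    case (step c y z)
    then show ?case using o by (auto simp: orth_linear)
  qed
  then show ?thesis by (simp add: orth_def)
qed

end

locale cartan_frame = cartan +
  fixes u :: "int \<Rightarrow> complex^8"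
  assumes isotropic_frame_u: "isotropic_frame 4 u"
begin

abbreviation I :: "int set" where "I \<equiv> Idx 4"

lemma I_nonzero: "c \<in> I \<Longrightarrow> c \<noteq> 0" "c \<in> I \<Longrightarrow> c \<noteq> - c"
  by (auto simp: Idx_def)

lemma cdot_u: "c \<in> I \<Longrightarrow> d \<in> I \<Longrightarrow> cdot (u c) (u d) = (if c = - d then 1 else 0)"
  using isotropic_frame_u by (simp add: isotropic_frame_def)

lemma u_expand: "x = (\<Sum>c\<in>I. cdot (u (- c)) x *s u c)"
  by (rule isotropic_frame_4_basis[OF isotropic_frame_u])

text \<open>The weights of the vector representation, extended by 0 like all weights; they satisfy
  \<open>eps (- c) = - eps c\<close>.\<close>

definition eps :: "int \<Rightarrow> weight"
  where "eps c H = (if H \<in> \<hh> then cdot (u (- c)) (H *v u c) else 0)"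

lemma h_u: "H \<in> \<hh> \<Longrightarrow> c \<in> I \<Longrightarrow> H *v u c = eps c H *s u c"
proof -
  assume H: "H \<in> \<hh>" and c: "c \<in> I"
  obtain e where e: "H *v u c = e *s u c"
    using isotropic_frame_u H c unfolding isotropic_frame_def weight_vectors_def by blast
  then have "eps c H = e" using H c by (simp add: eps_def cdot_u)
  then show ?thesis using e by simp
qed

lemma eps_uminus: "c \<in> I \<Longrightarrow> eps (- c) = - eps c"
proof
  fix H assume c: "c \<in> I"
  show "eps (- c) H = (- eps c) H"
  proof (cases "H \<in> \<hh>")
    case True
    then show ?thesis
      using c so8_cdot[OF h_so8[OF True], of "u (- c)" "u c"] by (simp add: h_u cdot_u)
  qed (simp add: eps_def)
qed

lemma h_wedge: "c \<in> I \<Longrightarrow> wedge (u c) (u (- c)) \<in> \<hh>"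
  by (rule h_maximal) (simp_all add: lbr_wedge h_u eps_uminus wedge_bilinear)

lemma eps_h_wedge: "c \<in> I \<Longrightarrow> d \<in> I \<Longrightarrow>
  eps d (wedge (u c) (u (- c))) = (if d = c then 1 else 0) - (if d = - c then 1 else 0)"
  using I_nonzero[of d] by (auto simp: eps_def h_wedge cdot_u)

text \<open>The coefficient of \<open>u c \<and> u d\<close>.\<close>

definition coord :: "mat8 \<Rightarrow> int \<Rightarrow> int \<Rightarrow> complex"
  where "coord A c d = cdot (u (- c)) (A *v u (- d))"

lemma coord_linear: "coord (A + B) c d = coord A c d + coord B c d" "coord (k *\<^sub>C A) c d = k * coord A c d"
  "coord 0 c d = 0" "coord (- A) c d = - coord A c d"
  by (simp_all add: coord_def)

lemma coord_sum: "coord (sum F B) c d = (\<Sum>b\<in>B. coord (F b) c d)"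
  by (induction B rule: infinite_finite_induct) (auto simp: coord_linear)

lemma coord_antisym: "A \<in> so8 \<Longrightarrow> coord A d c = - coord A c d"
  unfolding coord_def by (subst cdot_commute) (rule so8_cdot)

lemma coord_wedge: "a \<in> I \<Longrightarrow> b \<in> I \<Longrightarrow> c \<in> I \<Longrightarrow> d \<in> I \<Longrightarrow>
  coord (wedge (u a) (u b)) c d = (if a = c \<and> b = d then 1 else 0) - (if a = d \<and> b = c then 1 else 0)"
proof -
  assume "a \<in> I" "b \<in> I" "c \<in> I" "d \<in> I"
  then have e: "cdot (u b) (u (- d)) = (if b = d then 1 else 0)" "cdot (u a) (u (- d)) = (if a = d then 1 else 0)"
    "cdot (u (- c)) (u a) = (if a = c then 1 else 0)" "cdot (u (- c)) (u b) = (if b = c then 1 else 0)"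
    by (simp_all add: cdot_u eq_commute)
  have m: "(if P then 1 else 0) * (if Q then 1 else 0) = (if Q \<and> P then 1 else (0 :: complex))" for P Q
    by simp
  show ?thesis unfolding coord_def wedge_mv cdot_right e m by (simp only: conj_commute)
qed

lemma coord_eqI:
  assumes "\<And>c d. c \<in> I \<Longrightarrow> d \<in> I \<Longrightarrow> coord A c d = coord B c d"
  shows "A = B"
proof -
  have v: "A *v u d = B *v u d" if "d \<in> I" for d
  proof -
    have "cdot (u (- c)) (A *v u d) = cdot (u (- c)) (B *v u d)" if "c \<in> I" for c
      using assms[of c "- d"] that \<open>d \<in> I\<close> by (simp add: coord_def)
    then show ?thesis
      using u_expand[of "A *v u d"] u_expand[of "B *v u d"] by (metis (mono_tags, lifting) sum.cong)
  qed
  show ?thesis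
  proof (rule mat8_eqI)
    fix x
    have "A *v (\<Sum>c\<in>I. cdot (u (- c)) x *s u c) = B *v (\<Sum>c\<in>I. cdot (u (- c)) x *s u c)"
      by (simp add: mv_sum v)
    then show "A *v x = B *v x" by (simp flip: u_expand)
  qed
qed

lemma so8_expand:
  assumes A: "A \<in> so8"
  shows "A = (\<Sum>c\<in>I. \<Sum>d\<in>I. (coord A c d / 2) *\<^sub>C wedge (u c) (u d))"
proof (rule coord_eqI)
  fix a b assume a: "a \<in> I" and b: "b \<in> I"
  have "coord (\<Sum>c\<in>I. \<Sum>d\<in>I. (coord A c d / 2) *\<^sub>C wedge (u c) (u d)) a b =
    (\<Sum>c\<in>I. \<Sum>d\<in>I. (if c = a then (if d = b then coord A c d / 2 else 0) else 0) 
       - (if c = b then (if d = a then coord A c d / 2 else 0) else 0))"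
    unfolding coord_sum coord_linear using a b by (intro sum.cong refl) (auto simp: coord_wedge)
  also have "\<dots> = (\<Sum>c\<in>I. (if c = a then coord A c b / 2 else 0) - (if c = b then coord A c a / 2 else 0))"
    unfolding sum_subtractf using a b by (intro arg_cong2[of _ _ _ _ minus] sum.cong refl) simp_all
  also have "\<dots> = coord A a b / 2 - coord A b a / 2" using a b by (simp add: sum_subtractf)
  also have "\<dots> = coord A a b" using coord_antisym[OF A, of b a] by simp
  finally show "coord A a b = coord (\<Sum>c\<in>I. \<Sum>d\<in>I. (coord A c d / 2) *\<^sub>C wedge (u c) (u d)) a b" ..
qed

definition rt :: "int \<Rightarrow> int \<Rightarrow> weight"
  where "rt c d = eps c + eps d"

text \<open>The pairs \<open>(c, d)\<close> for which \<open>eps c + eps d\<close> is a root: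
  \<open>c = d\<close> is excluded because \<open>u c \<and> u c = 0\<close>, and \<open>c = -
  d\<close> because the sum is 0.\<close>

definition RI :: "(int \<times> int) set"
  where "RI = {(c, d). c \<in> I \<and> d \<in> I \<and> c \<noteq> d \<and> c \<noteq> - d}"

lemma rt_commute: "rt c d = rt d c" by (simp add: rt_def add.commute)

lemma coord_lbr: "H \<in> \<hh> \<Longrightarrow> A \<in> so8 \<Longrightarrow> c \<in> I \<Longrightarrow> d \<in> I \<Longrightarrow> coord (lbr H A) c d = rt c d H * coord A c d"
proof -
  assume H: "H \<in> \<hh>" and A: "A \<in> so8" and c: "c \<in> I" and d: "d \<in> I"
  have "cdot (u (- c)) (H *v (A *v u (- d))) = - cdot (H *v u (- c)) (A *v u (- d))"
    using so8_cdot[OF h_so8[OF H]] by simp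
  then show ?thesis using H c d by (simp add: coord_def lbr_mv h_u eps_uminus rt_def algebra_simps)
qed

lemma eps_dual: "eps c \<in> dual \<hh>"
  using cmat.subspace_add[OF h_subspace] cmat.subspace_scale[OF h_subspace]
  by (simp add: dual_def eps_def)

lemma rt_dual: "rt c d \<in> dual \<hh>"
  using eps_dual[of c] eps_dual[of d] by (auto simp: dual_def rt_def algebra_simps)

lemma rt_eq_iff:
  assumes "(a, b) \<in> RI" "c \<in> I" "d \<in> I" "rt a b = rt c d"
  shows "(c = a \<and> d = b) \<or> (c = b \<and> d = a)"
proof -
  have "c = x \<or> d = x" if "x = a \<or> x = b" for x
  proof -
    have x: "x \<in> I" using assms(1) that by (auto simp: RI_def)
    have "rt a b (wedge (u x) (u (- x))) = 1"
      using assms(1) that x I_nonzero[OF x] by (auto simp: RI_def rt_def eps_h_wedge)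
    then have "rt c d (wedge (u x) (u (- x))) = 1" using assms(4) by simp
    then show ?thesis using assms(2,3) x by (auto simp: rt_def eps_h_wedge split: if_splits)
  qed
  then show ?thesis using assms(1) by (auto simp: RI_def)
qed

lemma wedge_nonzero: "c \<in> I \<Longrightarrow> d \<in> I \<Longrightarrow> c \<noteq> d \<Longrightarrow> wedge (u c) (u d) \<noteq> 0"
  using coord_wedge[of c d c d] by (auto simp: coord_linear)

lemma wedge_root_space: "c \<in> I \<Longrightarrow> d \<in> I \<Longrightarrow> k *\<^sub>C wedge (u c) (u d) \<in> root_space \<hh> (rt c d)"
  by (simp add: root_space_def lbr_bilinear lbr_wedge h_u wedge_bilinear rt_def
      cmat.scale_left_distrib cmat.scale_right_distrib mult.commute)

text \<open>In the coordinates \<open>coord\<close> the Cartan subalgebra acts on each \<open>u a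
  \<and> u b\<close> by \<open>rt a b\<close>, and different pairs in \<open>RI\<close> have
  different sums.\<close>

lemma root_space_rt:
  assumes cd: "(c, d) \<in> RI"
  shows "root_space \<hh> (rt c d) = range (\<lambda>k. k *\<^sub>C wedge (u c) (u d))"
proof (intro equalityI subsetI)
  fix Z assume Z: "Z \<in> root_space \<hh> (rt c d)"
  then have so: "Z \<in> so8" and e: "\<And>H. H \<in> \<hh> \<Longrightarrow> lbr H Z = rt c d H *\<^sub>C Z" by (auto simp: root_space_def)
  have zero: "coord Z a b = 0" if ab: "a \<in> I" "b \<in> I" "\<not> (a = c \<and> b = d)" "\<not> (a = d \<and> b = c)" for a b
  proof (rule ccontr)
    assume nz: "coord Z a b \<noteq> 0"
    have "rt c d H = rt a b H" for H
    proof (cases "H \<in> \<hh>")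
      case True
      then have "rt c d H * coord Z a b = rt a b H * coord Z a b"
        using coord_lbr[OF True so ab(1,2)] e[OF True] by (simp add: coord_linear)
      then show ?thesis using nz by simp
    qed (simp add: rt_def eps_def)
    then have "rt c d = rt a b" by blast
    then show False using rt_eq_iff[OF cd ab(1,2)] ab(3,4) by blast
  qed
  have "Z = coord Z c d *\<^sub>C wedge (u c) (u d)"
  proof (rule coord_eqI)
    fix a b assume "a \<in> I" "b \<in> I"
    then show "coord Z a b = coord (coord Z c d *\<^sub>C wedge (u c) (u d)) a b"
      using zero[of a b] coord_antisym[OF so, of d c] cd by (auto simp: coord_linear coord_wedge RI_def)
  qed
  then show "Z \<in> range (\<lambda>k. k *\<^sub>C wedge (u c) (u d))" by blast
next
  fix Z assume "Z \<in> range (\<lambda>k. k *\<^sub>C wedge (u c) (u d))"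
  then show "Z \<in> root_space \<hh> (rt c d)" using cd wedge_root_space by (auto simp: RI_def)
qed

lemma roots_eq: "roots \<hh> = (\<lambda>(c, d). rt c d) ` RI"
proof (intro equalityI subsetI)
  fix \<alpha> assume "\<alpha> \<in> roots \<hh>"
  then have \<alpha>: "\<alpha> \<in> dual \<hh>" "\<alpha> \<noteq> 0" "root_space \<hh> \<alpha> \<noteq> {0}" by (auto simp: roots_def)
  have "0 \<in> root_space \<hh> \<alpha>" by (simp add: root_space_def lbr_bilinear)
  then obtain Z where Z: "Z \<in> root_space \<hh> \<alpha>" "Z \<noteq> 0" using \<alpha>(3) by blast
  then have so: "Z \<in> so8" and e: "\<And>H. H \<in> \<hh> \<Longrightarrow> lbr H Z = \<alpha> H *\<^sub>C Z" by (auto simp: root_space_def)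
  obtain c d where cd: "c \<in> I" "d \<in> I" "coord Z c d \<noteq> 0"
    using coord_eqI[of Z 0] Z(2) by (auto simp: coord_linear)
  have "\<alpha> H = rt c d H" for H
  proof (cases "H \<in> \<hh>")
    case True
    then have "\<alpha> H * coord Z c d = rt c d H * coord Z c d"
      using coord_lbr[OF True so cd(1,2)] e[OF True] by (simp add: coord_linear)
    then show ?thesis using cd(3) by simp
  qed (use \<alpha>(1) in \<open>simp add: rt_def eps_def dual_def\<close>)
  then have eq: "\<alpha> = rt c d" by blast
  have "c \<noteq> - d" using eq \<alpha>(2) eps_uminus[OF cd(2)] by (auto simp: rt_def)
  moreover have "c \<noteq> d" using cd(3) coord_antisym[OF so, of c c] by auto
  ultimately show "\<alpha> \<in> (\<lambda>(c, d). rt c d) ` RI" using eq cd by (auto simp: RI_def)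
next
  fix \<alpha> assume "\<alpha> \<in> (\<lambda>(c, d). rt c d) ` RI"
  then obtain c d where cd: "(c, d) \<in> RI" "\<alpha> = rt c d" by auto
  then have c: "c \<in> I" and d: "d \<in> I" and ne: "c \<noteq> d" "c \<noteq> - d" by (auto simp: RI_def)
  have "rt c d (wedge (u c) (u (- c))) = 1"
    using c d ne I_nonzero[OF c] by (auto simp: rt_def eps_h_wedge)
  then have "rt c d \<noteq> 0" by auto
  moreover have "wedge (u c) (u d) \<in> root_space \<hh> (rt c d)" using wedge_root_space[OF c d, of 1] by simp
  ultimately show "\<alpha> \<in> roots \<hh>"
    using cd(2) rt_dual wedge_nonzero[OF c d ne(1)] by (auto simp: roots_def)
qed

lemma rt_uminus: "(c, d) \<in> RI \<Longrightarrow> - rt c d = rt (- c) (- d)"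
  by (simp add: rt_def RI_def eps_uminus)

lemma RI_uminus: "(c, d) \<in> RI \<Longrightarrow> (- c, - d) \<in> RI" "(c, d) \<in> RI \<Longrightarrow> (d, c) \<in> RI"
  by (auto simp: RI_def)

lemma finite_roots: "finite (roots \<hh>)"
proof -
  have "RI \<subseteq> I \<times> I" by (auto simp: RI_def)
  then have "finite RI" using finite_subset by fastforce
  then show ?thesis by (simp add: roots_eq)
qed

end

theorem cartan_frame_exists:
  assumes "cartan_subalgebra \<hh>"
  obtains u where "cartan_frame \<hh> u"
proof -
  interpret cartan \<hh> by unfold_locales (rule assms)
  obtain u where "isotropic_frame 4 u" using isotropic_frame_exists[of 4] by auto
  then have "cartan_frame \<hh> u" by unfold_locales
  then show ?thesis using that by blast
qed

section \<open>The root system and the Levi roots\<close>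

text \<open>The Weyl group of type D together with the outer sign change acts on frames by signed
  permutations of the index set, and it is transitive on the roots. This moves the highest root to
  \<open>eps 1 + eps 2\<close>.\<close>

lemma (in cartan_frame) relabel:
  assumes cd: "(c, d) \<in> RI"
  obtains u' where "cartan_frame \<hh> u'" "cartan_frame.rt \<hh> u' 1 2 = rt c d"
proof -
  have c: "c \<noteq> 0" "\<bar>c\<bar> \<le> 4" and d: "d \<noteq> 0" "\<bar>d\<bar> \<le> 4" and ne: "\<bar>c\<bar> \<noteq> \<bar>d\<bar>"
    using cd by (auto simp: RI_def Idx_def)
  have "card ({1,2,3,4} - {\<bar>c\<bar>, \<bar>d\<bar>}) = 2"
  proof -
    have "{\<bar>c\<bar>, \<bar>d\<bar>} \<subseteq> {1,2,3,4}" using c d by auto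
    then show ?thesis using ne by (subst card_Diff_subset) auto
  qed
  then obtain k l where kl: "{1,2,3,4} - {\<bar>c\<bar>, \<bar>d\<bar>} = {k, l}" "k \<noteq> l"
    unfolding card_2_iff by blast
  have "k \<in> {1,2,3,4} - {\<bar>c\<bar>, \<bar>d\<bar>}" "l \<in> {1,2,3,4} - {\<bar>c\<bar>, \<bar>d\<bar>}" unfolding kl(1) by blast+
  then have k: "k \<ge> 1" "k \<le> 4" "k \<noteq> \<bar>c\<bar>" "k \<noteq> \<bar>d\<bar>" and l: "l \<ge> 1" "l \<le> 4" "l \<noteq> \<bar>c\<bar>" "l \<noteq> \<bar>d\<bar>"
    by auto
  define \<pi> where "\<pi> j = (if \<bar>j\<bar> = 1 then sgn j * c else if \<bar>j\<bar> = 2 then sgn j * d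
      else if \<bar>j\<bar> = 3 then sgn j * k else sgn j * l)" for j :: int
  have \<pi>_neg: "\<pi> (- j) = - \<pi> j" for j by (simp add: \<pi>_def)
  have \<pi>_abs: "\<bar>\<pi> j\<bar> = (if \<bar>j\<bar> = 1 then \<bar>c\<bar> else if \<bar>j\<bar> = 2 then \<bar>d\<bar> else if \<bar>j\<bar> = 3 then k else l)" 
    if "j \<in> I" for j
  proof -
    have "\<bar>sgn j\<bar> = 1" "\<bar>k\<bar> = k" "\<bar>l\<bar> = l" using that k l by (simp_all add: Idx_def)
    then show ?thesis by (simp add: \<pi>_def abs_mult)
  qed
  have \<pi>_I: "\<pi> j \<in> I" if "j \<in> I" for j
  proof -
    have "\<bar>\<pi> j\<bar> \<ge> 1 \<and> \<bar>\<pi> j\<bar> \<le> 4" 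
    proof -
      have "\<bar>c\<bar> \<ge> 1" "\<bar>d\<bar> \<ge> 1" using c d by linarith+
      then show ?thesis unfolding \<pi>_abs[OF that] using c d k l by simp
    qed
    then show ?thesis by (auto simp: Idx_def)
  qed
  have I_abs: "\<bar>j\<bar> = 1 \<or> \<bar>j\<bar> = 2 \<or> \<bar>j\<bar> = 3 \<or> \<bar>j\<bar> = 4" if "j \<in> I" for j
    using that by (auto simp: Idx_def)
  have \<pi>_inj: "i = j" if i: "i \<in> I" and j: "j \<in> I" and e: "\<pi> i = \<pi> j" for i j
  proof -
    have "\<bar>i\<bar> = \<bar>j\<bar>"
      using \<pi>_abs[OF i] \<pi>_abs[OF j] I_abs[OF i] I_abs[OF j] ne kl(2) k l unfolding e
      by (elim disjE) simp_all
    then have "j = i \<or> j = - i" by linarith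
    moreover have "\<pi> i \<noteq> - \<pi> i" using \<pi>_I[OF i] I_nonzero(2) by blast
    ultimately show ?thesis using e \<pi>_neg by metis
  qed
  define u' where "u' j = u (\<pi> j)" for j
  have "isotropic_frame 4 u'"
    unfolding isotropic_frame_def
  proof (intro conjI ballI)
    fix i j assume ij: "i \<in> I" "j \<in> I"
    have "\<pi> i = - \<pi> j \<longleftrightarrow> i = - j" using \<pi>_inj[OF ij(1), of "- j"] ij(2) \<pi>_neg by auto
    then show "cdot (u' i) (u' j) = (if i = - j then 1 else 0)"
      using \<pi>_I ij by (simp add: u'_def cdot_u)
  next
    show "u' ` I \<subseteq> weight_vectors" using isotropic_frame_u \<pi>_I by (auto simp: isotropic_frame_def u'_def)
  qed
  then have fr: "cartan_frame \<hh> u'" by unfold_locales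
  interpret f': cartan_frame \<hh> u' by (rule fr)
  have 12: "\<pi> 1 = c" "\<pi> (- 1) = - c" "\<pi> 2 = d" "\<pi> (- 2) = - d" by (simp_all add: \<pi>_def)
  have "f'.eps 1 = eps c" "f'.eps 2 = eps d" by (simp_all add: fun_eq_iff f'.eps_def eps_def u'_def 12)
  then have "f'.rt 1 2 = rt c d" by (simp add: f'.rt_def rt_def)
  with fr show ?thesis by (rule that)
qed

text \<open>Nonnegative integral combinations of roots are handled as sums of lists, on which
  induction is convenient.\<close>

lemma nat_combination_sum_list:
  fixes S :: "weight set"
  assumes "finite S"
  shows "\<exists>xs. set xs \<subseteq> S \<and> (\<forall>H. sum_list xs H = (\<Sum>\<sigma>\<in>S. of_nat (k \<sigma>) * \<sigma> H))"
  using assms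
proof (induction S rule: finite_induct)
  case empty
  show ?case by (rule exI[of _ "[]"]) simp
next
  case (insert \<sigma> S)
  then obtain xs where xs: "set xs \<subseteq> S" "\<And>H. sum_list xs H = (\<Sum>\<sigma>\<in>S. of_nat (k \<sigma>) * \<sigma> H)" by blast
  have "sum_list (replicate n \<sigma>) H = of_nat n * \<sigma> H" for n H
    by (induction n) (simp_all add: algebra_simps)
  then show ?case
    using xs insert.hyps by (intro exI[of _ "replicate (k \<sigma>) \<sigma> @ xs"]) auto
qed

lemma sum_list_nat_combination:
  fixes S :: "weight set"
  assumes "finite S" "set xs \<subseteq> S"
  shows "sum_list xs H = (\<Sum>\<sigma>\<in>S. of_nat (count_list xs \<sigma>) * \<sigma> H)"
  using assms(2)
proof (induction xs)
  case (Cons \<tau> xs)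
  have "(\<Sum>\<sigma>\<in>S. of_nat (count_list (\<tau> # xs) \<sigma>) * \<sigma> H) = 
      (\<Sum>\<sigma>\<in>S. (if \<sigma> = \<tau> then \<sigma> H else 0) + of_nat (count_list xs \<sigma>) * \<sigma> H)"
    by (intro sum.cong) (auto simp: algebra_simps)
  then show ?case using Cons assms(1) by (simp add: sum.distrib)
qed simp

locale root_setting = cartan_frame "csa D" u for D :: heis_data and u +
  assumes setting: "heisenberg_setting D"
begin

abbreviation P where "P \<equiv> pos D"
abbreviation \<gamma> where "\<gamma> \<equiv> hroot D"
abbreviation \<Delta> where "\<Delta> \<equiv> roots (csa D)"

lemma X_root_space: "\<alpha> \<in> \<Delta> \<Longrightarrow> Xv D \<alpha> \<in> root_space (csa D) \<alpha>"
  using setting by (simp add: heisenberg_setting_def)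

text \<open>Otherwise the normalization \<open>B(X\<^sub>\<alpha>, X\<^sub>-\<^sub>\<alpha>) =
  1\<close> would fail.\<close>

lemma X_nonzero: assumes "\<alpha> \<in> \<Delta>" shows "Xv D \<alpha> \<noteq> 0"
proof
  assume "Xv D \<alpha> = 0"
  then have "Bform D (Xv D \<alpha>) (Xv D (- \<alpha>)) = 0"
    by (simp add: Bform_def killing_form_def lin_trace_def lbr_bilinear cmat.representation_zero)
  moreover have "Bform D (Xv D \<alpha>) (Xv D (- \<alpha>)) = 1"
    using setting assms by (simp add: heisenberg_setting_def)
  ultimately show False by simp
qed

lemma pos_system: "positive_system (csa D) P"
  using setting by (simp add: heisenberg_setting_def)

lemma pos_subset: "P \<subseteq> \<Delta>" and pos_cases: "\<alpha> \<in> \<Delta> \<Longrightarrow> (\<alpha> \<in> P) \<noteq> (- \<alpha> \<in> P)"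
  and pos_closed: "\<alpha> \<in> P \<Longrightarrow> \<beta> \<in> P \<Longrightarrow> \<alpha> + \<beta> \<in> \<Delta> \<Longrightarrow> \<alpha> + \<beta> \<in> P"
proof -
  show "P \<subseteq> \<Delta>" using pos_system by (simp add: positive_system_def)
  show "\<alpha> \<in> \<Delta> \<Longrightarrow> (\<alpha> \<in> P) \<noteq> (- \<alpha> \<in> P)" using pos_system by (simp add: positive_system_def)
  have "\<forall>\<alpha>\<in>P. \<forall>\<beta>\<in>P. \<alpha> + \<beta> \<in> \<Delta> \<longrightarrow> \<alpha> + \<beta> \<in> P" using pos_system unfolding positive_system_def by (elim conjE)
  then show "\<alpha> \<in> P \<Longrightarrow> \<beta> \<in> P \<Longrightarrow> \<alpha> + \<beta> \<in> \<Delta> \<Longrightarrow> \<alpha> + \<beta> \<in> P" by blast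
qed

lemma uminus_root: "\<alpha> \<in> \<Delta> \<Longrightarrow> - \<alpha> \<in> \<Delta>"
proof -
  assume "\<alpha> \<in> \<Delta>"
  then obtain c d where cd: "(c, d) \<in> RI" "\<alpha> = rt c d" by (auto simp: roots_eq)
  then have "- \<alpha> = rt (- c) (- d)" by (simp add: rt_uminus)
  then show ?thesis using RI_uminus(1)[OF cd(1)] by (auto simp: roots_eq)
qed

lemma wip_eq: "\<sigma> \<in> \<Delta> \<Longrightarrow> \<beta> \<in> \<Delta> \<Longrightarrow> wip D \<sigma> \<beta> = \<sigma> (Hv D \<beta>)"
  using setting by (simp add: heisenberg_setting_def)

lemma lbr_opposite_wedges:
  assumes "(c, d) \<in> RI"
  shows "lbr (wedge (u c) (u d)) (wedge (u (- c)) (u (- d))) =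
     - (wedge (u c) (u (- c)) + wedge (u d) (u (- d)))"
proof -
  have "c \<in> I" "d \<in> I" "c \<noteq> d" "c \<noteq> - d" using assms by (auto simp: RI_def)
  then have "wedge (u c) (u d) *v u (- c) = - u d" "wedge (u c) (u d) *v u (- d) = u c"
    by (auto simp: cdot_u)
  then show ?thesis
    using wedge_antisym[of "u (- c)" "u c"] by (simp add: lbr_wedge wedge_bilinear)
qed

text \<open>The value of \<open>eps a\<close> on the coroot of \<open>eps c + eps d\<close>.\<close>

definition coroot_pairing :: "int \<Rightarrow> int \<Rightarrow> int \<Rightarrow> int"
  where "coroot_pairing c d a = (if a = c \<or> a = d then 1 else if a = - c \<or> a = - d then - 1 else 0)"

lemma eps_coroot:
  assumes "(c, d) \<in> RI" "a \<in> I"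
  shows "eps a (wedge (u c) (u (- c)) + wedge (u d) (u (- d))) = of_int (coroot_pairing c d a)"
proof -
  have cd: "c \<in> I" "d \<in> I" "c \<noteq> d" "c \<noteq> - d" using assms by (auto simp: RI_def)
  have "eps a (wedge (u c) (u (- c)) + wedge (u d) (u (- d))) =
    eps a (wedge (u c) (u (- c))) + eps a (wedge (u d) (u (- d)))"
    using eps_dual[of a] h_wedge cd by (simp add: dual_def)
  then show ?thesis
    using cd assms(2) I_nonzero(2)[OF cd(1)] I_nonzero(2)[OF cd(2)] by (auto simp: eps_h_wedge coroot_pairing_def)
qed

lemma rt_coroot:
  assumes "(c, d) \<in> RI" "a \<in> I" "b \<in> I"
  shows "rt a b (wedge (u c) (u (- c)) + wedge (u d) (u (- d))) = of_int (coroot_pairing c d a + coroot_pairing c d b)"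
  using assms by (simp add: rt_def eps_coroot)

text \<open>The root spaces are lines, and the \<open>sl\<^sub>2\<close> relations determine the
  scalars up to one parameter \<open>k\<close> and determine \<open>H\<^sub>\<alpha>\<close>
  completely.\<close>

lemma pos_root_vectors:
  assumes cd: "(c, d) \<in> RI" and \<alpha>: "rt c d \<in> P"
  obtains k where "k \<noteq> 0" "Xv D (rt c d) = k *\<^sub>C wedge (u c) (u d)"
    "Xv D (- rt c d) = (- 1 / k) *\<^sub>C wedge (u (- c)) (u (- d))"
    "Hv D (rt c d) = wedge (u c) (u (- c)) + wedge (u d) (u (- d))"
proof -
  let ?\<alpha> = "rt c d" and ?H = "wedge (u c) (u (- c)) + wedge (u d) (u (- d))"
  have R: "?\<alpha> \<in> \<Delta>" using \<alpha> pos_subset by blast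
  obtain k where k: "Xv D ?\<alpha> = k *\<^sub>C wedge (u c) (u d)"
    using X_root_space[OF R] unfolding root_space_rt[OF cd] by blast
  have "k \<noteq> 0" using X_nonzero[OF R] k by auto
  obtain k' where k': "Xv D (- ?\<alpha>) = k' *\<^sub>C wedge (u (- c)) (u (- d))"
    using X_root_space[OF uminus_root[OF R]] unfolding rt_uminus[OF cd] root_space_rt[OF RI_uminus(1)[OF cd]] by blast
  have sl2: "sl2_triple (Xv D (- ?\<alpha>)) (Hv D ?\<alpha>) (Xv D ?\<alpha>)"
    using setting \<alpha> by (simp add: heisenberg_setting_def)
  have H: "Hv D ?\<alpha> = (- (k * k')) *\<^sub>C ?H"
  proof -
    have "Hv D ?\<alpha> = lbr (Xv D ?\<alpha>) (Xv D (- ?\<alpha>))" using sl2 by (simp add: sl2_triple_def)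
    then show ?thesis unfolding k k' lbr_bilinear lbr_opposite_wedges[OF cd]
      by (simp only: cmat.scale_scale cmat.scale_minus_right cmat.scale_minus_left mult.commute)
  qed
  have Hh: "?H \<in> csa D" using cd h_wedge cmat.subspace_add[OF h_subspace] by (auto simp: RI_def)
  have "lbr ?H (wedge (u c) (u d)) = rt c d ?H *\<^sub>C wedge (u c) (u d)"
    using Hh wedge_root_space[of c d 1] cd by (auto simp: root_space_def RI_def)
  moreover have "rt c d ?H = 2"
    using rt_coroot[OF cd, of c d] cd by (auto simp: RI_def coroot_pairing_def)
  ultimately have "lbr (Hv D ?\<alpha>) (Xv D ?\<alpha>) = (- (k * k') * 2 * k) *\<^sub>C wedge (u c) (u d)"
    unfolding H k by (simp add: lbr_bilinear mult.assoc mult.commute mult.left_commute)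
  moreover have "lbr (Hv D ?\<alpha>) (Xv D ?\<alpha>) = (2 * k) *\<^sub>C wedge (u c) (u d)"
    using sl2 k by (simp add: sl2_triple_def)
  moreover have "wedge (u c) (u d) \<noteq> 0" using cd wedge_nonzero by (auto simp: RI_def)
  ultimately have "- (k * k') * 2 * k = 2 * k" using cmat.scale_right_imp_eq by metis
  then have "(- (k * k')) * (2 * k) = 1 * (2 * k)" by (simp only: mult.assoc mult_1_left)
  then have kk: "- (k * k') = 1" using \<open>k \<noteq> 0\<close> by (simp only: mult_cancel_right) simp
  then have "k' * k = - 1" by (metis minus_minus mult.commute)
  then have "k' = - 1 / k" by (rule eq_divide_imp[OF \<open>k \<noteq> 0\<close>])
  then show ?thesis using that[OF \<open>k \<noteq> 0\<close> k] k' H kk by simp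
qed

text \<open>The familiar fact that two roots with negative inner product add up to a root or to 0.
  Here it is a short case distinction, because a negative pairing means that the two index pairs
  share an index with opposite signs.\<close>

lemma negative_pairing:
  assumes \<beta>: "\<beta> \<in> P" and \<alpha>: "\<alpha> \<in> \<Delta>" and neg: "Re (\<alpha> (Hv D \<beta>)) < 0"
  shows "\<alpha> + \<beta> = 0 \<or> \<alpha> + \<beta> \<in> \<Delta>"
proof -
  obtain c d where cd: "(c, d) \<in> RI" "\<beta> = rt c d" using \<beta> pos_subset by (auto simp: roots_eq)
  obtain a b where ab: "(a, b) \<in> RI" "\<alpha> = rt a b" using \<alpha> by (auto simp: roots_eq)
  have H: "Hv D \<beta> = wedge (u c) (u (- c)) + wedge (u d) (u (- d))"
    using pos_root_vectors[OF cd(1)] \<beta> cd(2) by metis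
  have "\<alpha> (Hv D \<beta>) = of_int (coroot_pairing c d a + coroot_pairing c d b)"
    using rt_coroot[OF cd(1), of a b] ab by (auto simp: H RI_def)
  then have n: "coroot_pairing c d a + coroot_pairing c d b < 0" using neg by simp
  have *: "rt x y + rt (- x) z = rt y z" if "x \<in> I" for x y z
    using eps_uminus[OF that] by (simp add: rt_def)
  have main: "rt b' z = 0 \<or> rt b' z \<in> \<Delta>" if "b' \<in> I" "z \<in> I" "b' \<noteq> z" for b' z
    using that eps_uminus[of z] by (cases "b' = - z") (auto simp: rt_def roots_eq RI_def)
  have I: "a \<in> I" "b \<in> I" "c \<in> I" "d \<in> I" using ab cd by (auto simp: RI_def)
  have "coroot_pairing c d a = - 1 \<and> coroot_pairing c d b \<noteq> 1 \<or> coroot_pairing c d b = - 1 \<and> coroot_pairing c d a \<noteq> 1"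
    using n by (auto simp: coroot_pairing_def split: if_splits)
  then consider "a = - c" "b \<noteq> d" | "a = - d" "b \<noteq> c" | "b = - c" "a \<noteq> d" | "b = - d" "a \<noteq> c"
    by (auto simp: coroot_pairing_def split: if_splits)
  then show ?thesis
  proof cases
    case 1
    then have "\<alpha> + \<beta> = rt b d" using *[OF I(3), of d b] ab(2) cd(2) by (simp add: add.commute rt_commute)
    then show ?thesis using main[of b d] I 1 by simp
  next
    case 2
    then have "\<alpha> + \<beta> = rt b c" using *[OF I(4), of c b] ab(2) cd(2) by (simp add: add.commute rt_commute)
    then show ?thesis using main[of b c] I 2 by simp
  next
    case 3
    then have "\<alpha> + \<beta> = rt a d" using *[OF I(3), of d a] ab(2) cd(2) by (simp add: add.commute rt_commute)
    then show ?thesis using main[of a d] I 3 by simp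
  next
    case 4
    then have "\<alpha> + \<beta> = rt a c" using *[OF I(4), of c a] ab(2) cd(2) by (simp add: add.commute rt_commute)
    then show ?thesis using main[of a c] I 4 by simp
  qed
qed

lemma pos_self_pairing: assumes "\<beta> \<in> P" shows "\<beta> (Hv D \<beta>) = 2"
proof -
  have "\<beta> \<in> \<Delta>" using assms pos_subset by blast
  moreover from this have "wip D \<beta> \<beta> = 2" using setting by (simp add: heisenberg_setting_def)
  ultimately show ?thesis using wip_eq[of \<beta> \<beta>] by simp
qed

text \<open>If a sum of positive roots were 0, some summand would pair negatively with the first
  one. Merging the two into one positive root makes the list shorter, so that induction on the
  length applies.\<close>

lemma pos_sum_nonzero:
  assumes "xs \<noteq> []" "set xs \<subseteq> P"
  shows "sum_list xs \<noteq> 0"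
  using assms
proof (induction "length xs" arbitrary: xs rule: less_induct)
  case less
  show ?case
  proof
    assume z: "sum_list xs = 0"
    obtain \<beta> ys where xs: "xs = \<beta> # ys" using less.prems(1) by (cases xs) auto
    have \<beta>: "\<beta> \<in> P" using less.prems(2) xs by simp
    have "\<exists>\<alpha>\<in>set ys. Re (\<alpha> (Hv D \<beta>)) < 0"
    proof (rule ccontr)
      assume "\<not> ?thesis"
      then have "0 \<le> (\<Sum>\<alpha>\<leftarrow>ys. Re (\<alpha> (Hv D \<beta>)))" by (intro sum_list_nonneg) auto
      moreover have "Re (sum_list zs H) = (\<Sum>\<alpha>\<leftarrow>zs. Re (\<alpha> H))" for zs :: "weight list" and H
        by (induction zs) auto
      ultimately have "Re (sum_list xs (Hv D \<beta>)) \<ge> 2" using xs pos_self_pairing[OF \<beta>] by simp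
      then show False using z by simp
    qed
    then obtain \<alpha> where \<alpha>: "\<alpha> \<in> set ys" "Re (\<alpha> (Hv D \<beta>)) < 0" by blast
    have \<alpha>P: "\<alpha> \<in> P" using \<alpha>(1) less.prems(2) xs by auto
    have "\<alpha> + \<beta> \<noteq> 0"
    proof
      assume "\<alpha> + \<beta> = 0"
      then have "\<alpha> = - \<beta>" by (simp add: eq_neg_iff_add_eq_0)
      then show False using pos_cases[of \<beta>] \<beta> \<alpha>P pos_subset by auto
    qed
    then have "\<alpha> + \<beta> \<in> \<Delta>" using negative_pairing[OF \<beta>, of \<alpha>] \<alpha>(2) \<alpha>P pos_subset by blast
    then have "\<alpha> + \<beta> \<in> P" using pos_closed \<alpha>P \<beta> by blast
    let ?zs = "(\<alpha> + \<beta>) # remove1 \<alpha> ys"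
    have "sum_list ?zs = sum_list xs"
      using sum_list_map_remove1[OF \<alpha>(1), of "\<lambda>x. x"] xs by (simp add: algebra_simps)
    moreover have "length ?zs < length xs" 
      using \<alpha>(1) xs length_pos_if_in_set[OF \<alpha>(1)] by (simp add: length_remove1)
    moreover have "set ?zs \<subseteq> P" using \<open>\<alpha> + \<beta> \<in> P\<close> less.prems(2) xs set_remove1_subset[of \<alpha> ys] by auto
    ultimately show False using less.hyps[of ?zs] z by simp
  qed
qed

lemma simple_subset: "simple_roots P \<subseteq> P"
  by (auto simp: simple_roots_def)

lemma finite_P: "finite P" using finite_subset[OF pos_subset finite_roots] .

lemma finite_simple: "finite (simple_roots P)" using finite_subset[OF simple_subset finite_P] .

lemma highest: "\<gamma> \<in> \<Delta>" "\<alpha> \<in> \<Delta> \<Longrightarrow> \<exists>xs. set xs \<subseteq> P \<and> \<gamma> - \<alpha> = sum_list xs"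
proof -
  have h: "highest_root (csa D) P \<gamma>" using setting by (simp add: heisenberg_setting_def)
  then show "\<gamma> \<in> \<Delta>" by (simp add: highest_root_def)
  assume "\<alpha> \<in> \<Delta>"
  then obtain k where k: "\<And>H. \<gamma> H - \<alpha> H = (\<Sum>\<sigma>\<in>simple_roots P. of_nat (k \<sigma>) * \<sigma> H)"
    using h unfolding highest_root_def by blast
  obtain xs where "set xs \<subseteq> simple_roots P" "\<And>H. sum_list xs H = (\<Sum>\<sigma>\<in>simple_roots P. of_nat (k \<sigma>) * \<sigma> H)"
    using nat_combination_sum_list[OF finite_simple] by blast
  then show "\<exists>xs. set xs \<subseteq> P \<and> \<gamma> - \<alpha> = sum_list xs"
    using k simple_subset by (intro exI[of _ xs]) (auto simp: fun_eq_iff)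
qed

text \<open>If \<open>- \<gamma>\<close> were positive, then \<open>\<gamma> - (- \<gamma>)\<close>
  would be a sum of positive roots; adding \<open>- \<gamma>\<close> twice, one would get 0 as a
  nonempty sum of positive roots.\<close>

lemma highest_pos: "\<gamma> \<in> P"
proof (rule ccontr)
  assume "\<gamma> \<notin> P"
  then have m: "- \<gamma> \<in> P" using pos_cases[OF highest(1)] by blast
  obtain xs where xs: "set xs \<subseteq> P" "\<gamma> - (- \<gamma>) = sum_list xs"
    using highest(2)[OF uminus_root[OF highest(1)]] by blast
  then have "sum_list (- \<gamma> # - \<gamma> # xs) = 0" by (simp flip: xs(2))
  then show False using pos_sum_nonzero[of "- \<gamma> # - \<gamma> # xs"] m xs(1) by simp
qed

text \<open>A positive root that pairs negatively with the highest root could be added to it.\<close>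

lemma pos_pairing_highest:
  assumes \<sigma>: "\<sigma> \<in> P"
  shows "Re (\<sigma> (Hv D \<gamma>)) \<ge> 0"
proof (rule ccontr)
  assume "\<not> ?thesis"
  then have "Re (\<sigma> (Hv D \<gamma>)) < 0" by simp
  moreover have "\<sigma> \<in> \<Delta>" using \<sigma> pos_subset by blast
  ultimately have "\<sigma> + \<gamma> = 0 \<or> \<sigma> + \<gamma> \<in> \<Delta>"
    using negative_pairing[OF highest_pos] by blast
  then show False
  proof
    assume "\<sigma> + \<gamma> = 0"
    then show False using pos_sum_nonzero[of "[\<sigma>, \<gamma>]"] \<sigma> highest_pos by simp
  next
    assume "\<sigma> + \<gamma> \<in> \<Delta>"
    then obtain xs where xs: "set xs \<subseteq> P" "\<gamma> - (\<sigma> + \<gamma>) = sum_list xs" using highest(2) by blast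
    then have "sum_list (\<sigma> # xs) = 0" by (simp flip: xs(2))
    then show False using pos_sum_nonzero[of "\<sigma> # xs"] \<sigma> xs(1) by simp
  qed
qed

text \<open>Splitting a root that is not simple strictly decreases the finite set of positive roots
  below it, so the recursion ends.\<close>

lemma simple_decomposition:
  assumes "\<alpha> \<in> P"
  shows "\<exists>xs. set xs \<subseteq> simple_roots P \<and> \<alpha> = sum_list xs"
proof -
  \<comment> \<open>The order in which a root precedes another if the difference is a nonempty sum of positive roots.\<close>
  define below where "below \<alpha> = {\<beta> \<in> P. \<exists>xs. xs \<noteq> [] \<and> set xs \<subseteq> P \<and> \<alpha> = \<beta> + sum_list xs}" for \<alpha>
  show ?thesis using assms
  proof (induction "card (below \<alpha>)" arbitrary: \<alpha> rule: less_induct)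
    case less
    show ?case
    proof (cases "\<alpha> \<in> simple_roots P")
      case True
      then show ?thesis by (intro exI[of _ "[\<alpha>]"]) simp
    next
      case False
      then obtain \<beta> \<delta> where bd: "\<beta> \<in> P" "\<delta> \<in> P" "\<alpha> = \<beta> + \<delta>"
        using less.prems by (auto simp: simple_roots_def)
      have step: "card (below \<beta>) < card (below \<alpha>)" if b: "\<beta> \<in> P" "\<delta> \<in> P" "\<alpha> = \<beta> + \<delta>" for \<beta> \<delta>
      proof (rule psubset_card_mono)
        show "finite (below \<alpha>)" using finite_P by (simp add: below_def)
        have "below \<beta> \<subseteq> below \<alpha>"
        proof
          fix \<rho> assume "\<rho> \<in> below \<beta>"
          then obtain xs where "\<rho> \<in> P" "set xs \<subseteq> P" "\<beta> = \<rho> + sum_list xs" by (auto simp: below_def)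
          then show "\<rho> \<in> below \<alpha>" using b
            by (auto simp: below_def algebra_simps intro!: exI[of _ "\<delta> # xs"])
        qed
        moreover have "\<beta> \<in> below \<alpha>" using b by (auto simp: below_def intro!: exI[of _ "[\<delta>]"])
        moreover have "\<beta> \<notin> below \<beta>"
        proof
          assume "\<beta> \<in> below \<beta>"
          then obtain xs where "xs \<noteq> []" "set xs \<subseteq> P" "\<beta> = \<beta> + sum_list xs" by (auto simp: below_def)
          then show False using pos_sum_nonzero by (metis add_cancel_left_right)
        qed
        ultimately show "below \<beta> \<subset> below \<alpha>" by blast
      qed
      obtain xs where xs: "set xs \<subseteq> simple_roots P" "\<beta> = sum_list xs"
        using less.hyps[OF step[OF bd] bd(1)] by blast
      obtain ys where ys: "set ys \<subseteq> simple_roots P" "\<delta> = sum_list ys"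
        using less.hyps[OF step[OF bd(2,1)] bd(2)] bd(3) by (auto simp: add.commute)
      show ?thesis using xs ys bd(3) by (intro exI[of _ "xs @ ys"]) auto
    qed
  qed
qed

text \<open>The simple roots pair with the highest root in nonnegative numbers. A positive root
  orthogonal to it is therefore a combination of those simple roots that are orthogonal to it.\<close>

lemma levi_roots_eq: "levi_roots D = {\<alpha> \<in> \<Delta>. \<alpha> (Hv D \<gamma>) = 0}"
proof -
  let ?S = "{\<sigma> \<in> simple_roots P. wip D \<sigma> \<gamma> = 0}"
  have S: "finite ?S" using finite_simple by simp
  have wS: "\<sigma> (Hv D \<gamma>) = 0" if "\<sigma> \<in> ?S" for \<sigma>
    using that wip_eq[OF _ highest(1), of \<sigma>] simple_subset pos_subset by auto
  have pos: "\<exists>k :: weight \<Rightarrow> nat. \<forall>H. \<alpha> H = (\<Sum>\<sigma>\<in>?S. of_nat (k \<sigma>) * \<sigma> H)"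
    if \<alpha>: "\<alpha> \<in> P" "\<alpha> (Hv D \<gamma>) = 0" for \<alpha>
  proof -
    obtain xs where xs: "set xs \<subseteq> simple_roots P" "\<alpha> = sum_list xs" using simple_decomposition[OF \<alpha>(1)] by blast
    have Re_sum: "Re (sum_list zs H) = (\<Sum>\<alpha>\<leftarrow>zs. Re (\<alpha> H))" for zs :: "weight list" and H
      by (induction zs) auto
    have nn: "Re (\<sigma> (Hv D \<gamma>)) \<ge> 0" if "\<sigma> \<in> set xs" for \<sigma>
      using that xs(1) simple_subset pos_pairing_highest by blast
    have "(\<Sum>\<sigma>\<leftarrow>xs. Re (\<sigma> (Hv D \<gamma>))) = Re (sum_list xs (Hv D \<gamma>))" by (rule Re_sum[symmetric])
    also have "\<dots> = 0" unfolding xs(2)[symmetric] \<alpha>(2) by simp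
    finally have sum0: "(\<Sum>\<sigma>\<leftarrow>xs. Re (\<sigma> (Hv D \<gamma>))) = 0" .
    then have z: "Re (\<sigma> (Hv D \<gamma>)) = 0" if "\<sigma> \<in> set xs" for \<sigma>
      using sum_list_nonneg_eq_0_iff[of "map (\<lambda>\<sigma>. Re (\<sigma> (Hv D \<gamma>))) xs"] nn sum0 that by auto
    have "set xs \<subseteq> ?S"
    proof
      fix \<sigma> assume s: "\<sigma> \<in> set xs"
      then have sd: "\<sigma> \<in> \<Delta>" using xs(1) simple_subset pos_subset by blast
      obtain a b where ab: "(a, b) \<in> RI" "\<sigma> = rt a b" using sd by (auto simp: roots_eq)
      obtain c d where cd: "(c, d) \<in> RI" "\<gamma> = rt c d" using highest(1) by (auto simp: roots_eq)
      have "Hv D \<gamma> = wedge (u c) (u (- c)) + wedge (u d) (u (- d))"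
        using pos_root_vectors[OF cd(1)] highest_pos cd(2) by metis
      then have "\<sigma> (Hv D \<gamma>) = of_int (coroot_pairing c d a + coroot_pairing c d b)"
        using rt_coroot[OF cd(1), of a b] ab by (auto simp: RI_def)
      then have "\<sigma> (Hv D \<gamma>) = 0" using z[OF s] by (simp add: complex_eq_iff)
      then show "\<sigma> \<in> ?S" using s xs(1) wip_eq[OF sd highest(1)] by auto
    qed
    then show ?thesis
      using sum_list_nat_combination[OF S] xs(2) by (intro exI[of _ "count_list xs"]) auto
  qed
  show ?thesis
  proof (intro equalityI subsetI)
    fix \<alpha> assume "\<alpha> \<in> levi_roots D"
    then obtain k :: "weight \<Rightarrow> int" where k: "\<alpha> \<in> \<Delta>" "\<And>H. \<alpha> H = (\<Sum>\<sigma>\<in>?S. of_int (k \<sigma>) * \<sigma> H)"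
      unfolding levi_roots_def by blast
    have "\<alpha> (Hv D \<gamma>) = 0" unfolding k(2) using wS by (intro sum.neutral) simp
    then show "\<alpha> \<in> {\<alpha> \<in> \<Delta>. \<alpha> (Hv D \<gamma>) = 0}" using k(1) by simp
  next
    fix \<alpha> assume a: "\<alpha> \<in> {\<alpha> \<in> \<Delta>. \<alpha> (Hv D \<gamma>) = 0}"
    show "\<alpha> \<in> levi_roots D"
    proof (cases "\<alpha> \<in> P")
      case True
      then obtain k :: "weight \<Rightarrow> nat" where "\<forall>H. \<alpha> H = (\<Sum>\<sigma>\<in>?S. of_nat (k \<sigma>) * \<sigma> H)" using pos a by blast
      then show ?thesis using a unfolding levi_roots_def 
        by (intro CollectI conjI exI[of _ "\<lambda>\<sigma>. int (k \<sigma>)"]) auto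
    next
      case False
      then have "- \<alpha> \<in> P" using pos_cases a by blast
      then obtain k :: "weight \<Rightarrow> nat" where k: "\<forall>H. (- \<alpha>) H = (\<Sum>\<sigma>\<in>?S. of_nat (k \<sigma>) * \<sigma> H)"
        using pos[of "- \<alpha>"] a by auto
      have "\<alpha> H = (\<Sum>\<sigma>\<in>?S. of_int (- int (k \<sigma>)) * \<sigma> H)" for H
      proof -
        have "\<alpha> H = - (- \<alpha>) H" by simp
        also have "\<dots> = - (\<Sum>\<sigma>\<in>?S. of_nat (k \<sigma>) * \<sigma> H)" using k by metis
        finally show ?thesis by (simp add: sum_negf)
      qed
      then show ?thesis using a unfolding levi_roots_def 
        by (intro CollectI conjI exI[of _ "\<lambda>\<sigma>. - int (k \<sigma>)"]) auto
    qed
  qed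
qed

end

section \<open>The Heisenberg grading in a frame\<close>

text \<open>No generality is lost, by \<open>relabel\<close>.\<close>

locale heis = root_setting +
  assumes gamma: "\<gamma> = rt 1 2"
begin

abbreviation Hg where "Hg \<equiv> Hv D \<gamma>"

lemma I_mem: "1 \<in> I" "2 \<in> I" "3 \<in> I" "4 \<in> I" "- 1 \<in> I" "- 2 \<in> I" "- 3 \<in> I" "- 4 \<in> I"
  by (simp_all add: Idx_def)

lemma RI_12: "(1, 2) \<in> RI"
  using I_mem by (simp add: RI_def)

text \<open>The planes \<open>E\<close> and its dual: the weight spaces of
  \<open>H\<^sub>\<gamma>\<close> for the eigenvalues 1 and -1 in the vector representation.\<close>

definition e :: "2 \<Rightarrow> complex^8" where "e i = (if i = 1 then u 1 else u 2)"
definition f :: "2 \<Rightarrow> complex^8" where "f i = (if i = 1 then u (- 1) else u (- 2))"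

text \<open>An orthonormal basis of the four dimensional space annihilated by
  \<open>H\<^sub>\<gamma>\<close>, made from the two isotropic pairs \<open>u 3, u (- 3)\<close> and
  \<open>u 4, u (- 4)\<close>. The factor 1/2 compensates for \<open>cdot (u c) (u (- c)) =
  1\<close>.\<close>

definition v :: "4 \<Rightarrow> complex^8"
  where "v a = (if a = 1 then u 3 + (1 / 2) *s u (- 3)
    else if a = 2 then \<i> *s u 3 - (\<i> / 2) *s u (- 3)
    else if a = 3 then u 4 + (1 / 2) *s u (- 4)
    else \<i> *s u 4 - (\<i> / 2) *s u (- 4))"

lemma cdot_ef [simp]: "cdot (e i) (f j) = (if i = j then 1 else 0)" "cdot (f j) (e i) = (if i = j then 1 else 0)"
  "cdot (e i) (e j) = 0" "cdot (f i) (f j) = 0"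
  using exhaust_2[of i] exhaust_2[of j] I_mem by (auto simp: e_def f_def cdot_u)

lemma cdot_ef_v [simp]: "cdot (e i) (v a) = 0" "cdot (v a) (e i) = 0" "cdot (f i) (v a) = 0" "cdot (v a) (f i) = 0"
proof -
  show "cdot (e i) (v a) = 0" "cdot (f i) (v a) = 0"
    by (simp_all only: e_def f_def v_def split: if_split) (simp_all add: cdot_u I_mem)
  then show "cdot (v a) (e i) = 0" "cdot (v a) (f i) = 0"
    by (simp_all add: cdot_commute[of "v a"])
qed

lemma cdot_u_V0: "cdot (u 3) (u 3) = 0" "cdot (u 3) (u (- 3)) = 1" "cdot (u (- 3)) (u 3) = 1" "cdot (u (- 3)) (u (- 3)) = 0"
  "cdot (u 4) (u 4) = 0" "cdot (u 4) (u (- 4)) = 1" "cdot (u (- 4)) (u 4) = 1" "cdot (u (- 4)) (u (- 4)) = 0"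
  "cdot (u 3) (u 4) = 0" "cdot (u 3) (u (- 4)) = 0" "cdot (u (- 3)) (u 4) = 0" "cdot (u (- 3)) (u (- 4)) = 0"
  "cdot (u 4) (u 3) = 0" "cdot (u (- 4)) (u 3) = 0" "cdot (u 4) (u (- 3)) = 0" "cdot (u (- 4)) (u (- 3)) = 0"
  by (simp_all add: cdot_u I_mem)

lemma v_numeral: "v 1 = u 3 + (1 / 2) *s u (- 3)" "v 2 = \<i> *s u 3 - (\<i> / 2) *s u (- 3)"
  "v 3 = u 4 + (1 / 2) *s u (- 4)" "v 4 = \<i> *s u 4 - (\<i> / 2) *s u (- 4)"
  by (simp_all add: v_def)

lemma cdot_v [simp]: "cdot (v a) (v b) = (if a = b then 1 else 0)"
proof -
  have "a \<in> {1, 2, 3, 4}" "b \<in> {1, 2, 3, 4}" using exhaust_4[of a] exhaust_4[of b] by simp_all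
  then show ?thesis
    by (elim insertE) (simp_all add: v_numeral cdot_u_V0)
qed

lemma u_V0: "u 3 = (1 / 2) *s (v 1 + (- \<i>) *s v 2)" "u (- 3) = v 1 + \<i> *s v 2"
  "u 4 = (1 / 2) *s (v 3 + (- \<i>) *s v 4)" "u (- 4) = v 3 + \<i> *s v 4"
  by (simp_all add: v_def vec_eq_iff field_simps)

lemma I_eq: "I = {1, 2, 3, 4, - 1, - 2, - 3, - 4}"
proof -
  have "c \<in> {1, 2, 3, 4, - 1, - 2, - 3, - 4}" if "c \<noteq> 0" "\<bar>c\<bar> \<le> 4" for c :: int
    using that by auto
  then show ?thesis by (auto simp: Idx_def)
qed

text \<open>Contraction of a bilinear map with the inverse of the form does not depend on the choice
  of the pair of dual bases: the left side uses the isotropic basis of \<open>V\<^sub>0\<close> and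
  the right side the orthonormal one.\<close>

lemma sum_dual_pairs:
  fixes B :: "complex^8 \<Rightarrow> complex^8 \<Rightarrow> complex"
  assumes add: "\<And>x y z. B (x + y) z = B x z + B y z" "\<And>x y z. B x (y + z) = B x y + B x z"
    and scale: "\<And>k x z. B (k *s x) z = k * B x z" "\<And>k x z. B x (k *s z) = k * B x z"
  shows "(\<Sum>c\<in>{3, - 3, 4, - 4}. B (u c) (u (- c))) = (\<Sum>a\<in>UNIV. B (v a) (v a))"
proof -
  have "(\<Sum>c\<in>{3, - 3, 4, - 4}. B (u c) (u (- c))) = B (u 3) (u (- 3)) + B (u (- 3)) (u 3) + B (u 4) (u (- 4)) + B (u (- 4)) (u 4)"
    by simp
  also have "\<dots> = (\<Sum>a\<in>UNIV. B (v a) (v a))"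
    unfolding sum_4 u_V0 add scale by (simp add: algebra_simps)
  finally show ?thesis .
qed

lemma frame_eqI:
  fixes A B :: mat8
  assumes "\<And>i. A *v e i = B *v e i" "\<And>i. A *v f i = B *v f i" "\<And>a. A *v v a = B *v v a"
  shows "A = B"
proof -
  have ef: "u 1 = e 1" "u 2 = e 2" "u (- 1) = f 1" "u (- 2) = f 2" by (simp_all add: e_def f_def)
  have "A *v u c = B *v u c" if "c \<in> I" for c
    using that unfolding I_eq by (elim insertE) (simp_all only: ef u_V0 mv_right assms empty_iff)
  then show ?thesis by (intro coord_eqI) (simp add: coord_def)
qed

lemma vec_frame_expand: "x = (\<Sum>i\<in>UNIV. cdot (f i) x *s e i) + (\<Sum>i\<in>UNIV. cdot (e i) x *s f i) + (\<Sum>a\<in>UNIV. cdot (v a) x *s v a)"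
proof -
  define M :: mat8 where "M = (\<chi> k l. (\<Sum>i\<in>UNIV. f i $ l * e i $ k) + (\<Sum>i\<in>UNIV. e i $ l * f i $ k) + (\<Sum>a\<in>UNIV. v a $ l * v a $ k))"
  have M: "M *v x = (\<Sum>i\<in>UNIV. cdot (f i) x *s e i) + (\<Sum>i\<in>UNIV. cdot (e i) x *s f i) + (\<Sum>a\<in>UNIV. cdot (v a) x *s v a)" for x
    by (simp add: M_def matrix_vector_mult_def cdot_def vec_eq_iff sum_2 sum_4 sum_distrib_right sum_distrib_left
       sum.distrib algebra_simps)
  have d: "(\<Sum>i\<in>UNIV. (if i = j then 1 else 0) *s g i) = g j" "(\<Sum>i\<in>UNIV. (if j = i then 1 else 0) *s g i) = g j"
    for j :: "'n::finite" and g :: "'n \<Rightarrow> complex^8"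
    by (simp_all add: if_distrib[of "\<lambda>k. k *s _"] cong: if_cong)
  have "M = mat 1"
    by (rule frame_eqI) (simp_all add: M d)
  then show ?thesis using M[of x] by simp
qed

lemma cdot_frame_eqI:
  assumes "\<And>i. cdot (e i) x = cdot (e i) y" "\<And>i. cdot (f i) x = cdot (f i) y" "\<And>a. cdot (v a) x = cdot (v a) y"
  shows "x = y"
  using vec_frame_expand[of x] vec_frame_expand[of y] assms by simp

lemma sum_if_const: "(\<Sum>a\<in>B. if Q then g a else 0) = (if Q then \<Sum>a\<in>B. g a else (0 :: complex))"
  by simp

lemma delta_mult: "(x :: complex) * (if Q then 1 else 0) = (if Q then x else 0)"
  "(if Q then 1 else 0) * x = (if Q then x else (0 :: complex))"
  by simp_all

lemma Hg_eq: "Hg = wedge (e 1) (f 1) + wedge (e 2) (f 2)"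
proof -
  have "rt 1 2 \<in> P" using highest_pos gamma by simp
  then obtain k where "Hv D (rt 1 2) = wedge (u 1) (u (- 1)) + wedge (u 2) (u (- 2))"
    by (rule pos_root_vectors[OF RI_12])
  then show ?thesis by (simp add: gamma e_def f_def)
qed

lemma Hg_frame [simp]: "Hg *v e i = e i" "Hg *v f i = - f i" "Hg *v v a = 0"
  using exhaust_2[of i] by (auto simp: Hg_eq)

lemma Hg_so8: "Hg \<in> so8"
  by (simp add: Hg_eq)

lemma Hg_csa: "Hg \<in> csa D"
  using setting highest(1) by (simp add: heisenberg_setting_def)

lemma eigsp_cdot:
  assumes Z: "Z \<in> eigsp D k" and x: "Hg *v x = a *s x" and y: "Hg *v y = b *s y" and ne: "k \<noteq> - a - b"
  shows "cdot x (Z *v y) = 0"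
proof -
  have "lbr Hg Z *v y = k *s (Z *v y)" using Z by (simp add: eigsp_def)
  then have "Hg *v (Z *v y) = k *s (Z *v y) + b *s (Z *v y)" by (simp add: lbr_mv y algebra_simps)
  then have "cdot x (Hg *v (Z *v y)) = (k + b) * cdot x (Z *v y)" by (simp add: algebra_simps)
  moreover have "cdot x (Hg *v (Z *v y)) = - a * cdot x (Z *v y)"
    using so8_cdot[OF Hg_so8, of x "Z *v y"] by (simp add: x)
  ultimately have "- a * cdot x (Z *v y) = (k + b) * cdot x (Z *v y)" by simp
  then have "cdot x (Z *v y) = 0 \<or> - a = k + b" by (simp only: mult_cancel_right)
  moreover have "- a \<noteq> k + b" using ne by (metis add_diff_cancel)
  ultimately show ?thesis by blast
qed

lemma eigsp_subspace: "cmat.subspace (eigsp D k)"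
  by (rule cmat.subspaceI) (auto simp: eigsp_def lbr_bilinear cmat.scale_right_distrib mult.commute)

lemma wedge_eigsp:
  assumes "Hg *v x = a *s x" "Hg *v y = b *s y" "k = a + b"
  shows "wedge x y \<in> eigsp D k"
  using assms by (simp add: eigsp_def lbr_wedge Hg_so8 wedge_bilinear cmat.scale_left_distrib)

lemma Hg_frame': "Hg *v e i = 1 *s e i" "Hg *v f i = (- 1) *s f i" "Hg *v v a = 0 *s v a"
  by (simp_all add: vec_eq_iff)

lemma wedge_grades: "wedge (f i) (f j) \<in> eigsp D (- 2)" "wedge (v a) (f i) \<in> eigsp D (- 1)"
  "wedge (e i) (f j) \<in> eigsp D 0" "wedge (v a) (v b) \<in> eigsp D 0" 
  "wedge (v a) (e i) \<in> eigsp D 1" "wedge (e i) (v a) \<in> eigsp D 1" "wedge (e i) (e j) \<in> eigsp D 2"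
  by (rule wedge_eigsp[OF Hg_frame'(2) Hg_frame'(2)] wedge_eigsp[OF Hg_frame'(3) Hg_frame'(2)]
      wedge_eigsp[OF Hg_frame'(1) Hg_frame'(2)] wedge_eigsp[OF Hg_frame'(3) Hg_frame'(3)]
      wedge_eigsp[OF Hg_frame'(3) Hg_frame'(1)] wedge_eigsp[OF Hg_frame'(1) Hg_frame'(3)]
      wedge_eigsp[OF Hg_frame'(1) Hg_frame'(1)], simp)+

lemma eigsp_so8: "Z \<in> eigsp D k \<Longrightarrow> Z \<in> so8" by (simp add: eigsp_def)

lemma so8_swap: "A \<in> so8 \<Longrightarrow> cdot x (A *v y) = - cdot y (A *v x)"
  using so8_cdot[of A y x] cdot_commute[of x "A *v y"] by simp

lemma so8_frame_eqI:
  assumes A: "A \<in> so8" and B: "B \<in> so8"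
    and ve: "\<And>a i. cdot (v a) (A *v e i) = cdot (v a) (B *v e i)"
    and vf: "\<And>a i. cdot (v a) (A *v f i) = cdot (v a) (B *v f i)"
    and fe: "\<And>i j. cdot (f i) (A *v e j) = cdot (f i) (B *v e j)"
    and vv: "\<And>a b. cdot (v a) (A *v v b) = cdot (v a) (B *v v b)"
    and ee: "cdot (e 1) (A *v e 2) = cdot (e 1) (B *v e 2)"
    and ff: "cdot (f 1) (A *v f 2) = cdot (f 1) (B *v f 2)"
  shows "A = B"
proof -
  have sw: "cdot x (A *v y) = cdot x (B *v y)" if "cdot y (A *v x) = cdot y (B *v x)" for x y
    using that so8_swap[OF A, of x y] so8_swap[OF B, of x y] by simp
  have two: "cdot (g i) (A *v g j) = cdot (g i) (B *v g j)" 
    if "cdot (g 1) (A *v g 2) = cdot (g 1) (B *v g 2)" for g :: "2 \<Rightarrow> complex^8" and i j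
    using that sw[OF that] exhaust_2[of i] exhaust_2[of j] so8_cdot_self[OF A] so8_cdot_self[OF B] by (elim disjE) simp_all
  show ?thesis
    by (intro frame_eqI cdot_frame_eqI) (use ve vf fe vv two[OF ee] two[OF ff] sw in blast)+
qed

text \<open>The components of a matrix in \<open>so8\<close> in the eigenspaces of \<open>ad
  H\<^sub>\<gamma>\<close> for -2, -1, 0, 1, 2, in terms of the frame. The factor 1/2 in degree 0 is
  there because each pair \<open>a, b\<close> is counted twice.\<close>

definition part_m2 :: "mat8 \<Rightarrow> mat8"
  where "part_m2 A = cdot (e 1) (A *v e 2) *\<^sub>C wedge (f 1) (f 2)"
definition part_m1 :: "mat8 \<Rightarrow> mat8"
  where "part_m1 A = (\<Sum>i\<in>UNIV. \<Sum>a\<in>UNIV. cdot (v a) (A *v e i) *\<^sub>C wedge (v a) (f i))"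
definition part_0 :: "mat8 \<Rightarrow> mat8"
  where "part_0 A = (\<Sum>i\<in>UNIV. \<Sum>j\<in>UNIV. cdot (f i) (A *v e j) *\<^sub>C wedge (e i) (f j))
       + (\<Sum>a\<in>UNIV. \<Sum>b\<in>UNIV. (cdot (v a) (A *v v b) / 2) *\<^sub>C wedge (v a) (v b))"
definition part_1 :: "mat8 \<Rightarrow> mat8"
  where "part_1 A = (\<Sum>i\<in>UNIV. \<Sum>a\<in>UNIV. cdot (v a) (A *v f i) *\<^sub>C wedge (v a) (e i))"
definition part_2 :: "mat8 \<Rightarrow> mat8"
  where "part_2 A = cdot (f 1) (A *v f 2) *\<^sub>C wedge (e 1) (e 2)"

lemma parts_eigsp: "part_m2 A \<in> eigsp D (- 2)" "part_m1 A \<in> eigsp D (- 1)" "part_0 A \<in> eigsp D 0"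
  "part_1 A \<in> eigsp D 1" "part_2 A \<in> eigsp D 2"
  unfolding part_m2_def part_m1_def part_0_def part_1_def part_2_def
  by (intro cmat.subspace_sum[OF eigsp_subspace] cmat.subspace_scale[OF eigsp_subspace]
      cmat.subspace_add[OF eigsp_subspace] wedge_grades)+

text \<open>Both sides have the same matrix coefficients in the frame, by the antisymmetry of
  \<open>A\<close>.\<close>

lemma grade_decomposition:
  assumes A: "A \<in> so8"
  shows "A = part_m2 A + part_m1 A + part_0 A + part_1 A + part_2 A"
    (is "A = ?B")
proof (rule so8_frame_eqI[OF A])
  show "?B \<in> so8" using parts_eigsp[THEN eigsp_so8] by auto
  have vv: "cdot (v b) (A *v v a) = - cdot (v a) (A *v v b)" for a b using so8_swap[OF A] .
  show "cdot (v a) (A *v e i) = cdot (v a) (?B *v e i)" for a i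
    by (simp add: part_m2_def part_m1_def part_0_def part_1_def part_2_def sum_mv cdot_sum_right delta_mult sum_if_const)
  show "cdot (v a) (A *v f i) = cdot (v a) (?B *v f i)" for a i
    by (simp add: part_m2_def part_m1_def part_0_def part_1_def part_2_def sum_mv cdot_sum_right delta_mult sum_if_const)
  show "cdot (f i) (A *v e j) = cdot (f i) (?B *v e j)" for i j
    by (simp add: part_m2_def part_m1_def part_0_def part_1_def part_2_def sum_mv cdot_sum_right delta_mult sum_if_const)
  show "cdot (v a) (A *v v b) = cdot (v a) (?B *v v b)" for a b
    by (simp add: part_m2_def part_m1_def part_0_def part_1_def part_2_def sum_mv cdot_sum_right delta_mult sum_if_const
       right_diff_distrib sum_subtractf vv[of b a])
  show "cdot (e 1) (A *v e 2) = cdot (e 1) (?B *v e 2)"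
    by (simp add: part_m2_def part_m1_def part_0_def part_1_def part_2_def sum_mv cdot_sum_right delta_mult sum_if_const)
  show "cdot (f 1) (A *v f 2) = cdot (f 1) (?B *v f 2)"
    by (simp add: part_m2_def part_m1_def part_0_def part_1_def part_2_def sum_mv cdot_sum_right delta_mult sum_if_const)
qed

lemma root_coords: 
  assumes "\<alpha> \<in> \<Delta>"
  obtains c d where "(c, d) \<in> RI" "\<alpha> = rt c d" "\<alpha> Hg = of_int (coroot_pairing 1 2 c + coroot_pairing 1 2 d)"
proof -
  obtain c d where cd: "(c, d) \<in> RI" "\<alpha> = rt c d" using assms by (auto simp: roots_eq)
  have "Hg = wedge (u 1) (u (- 1)) + wedge (u 2) (u (- 2))" by (simp add: Hg_eq e_def f_def)
  then have "\<alpha> Hg = of_int (coroot_pairing 1 2 c + coroot_pairing 1 2 d)"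
    using rt_coroot[OF RI_12, of c d] cd by (auto simp: RI_def)
  then show ?thesis using that cd by blast
qed

lemma root_space_eigsp: "root_space (csa D) \<alpha> \<subseteq> eigsp D (\<alpha> Hg)"
  using Hg_csa by (auto simp: root_space_def eigsp_def)

lemma eigsp_induct:
  assumes Z: "Z \<in> eigsp D k" and W: "cmat.subspace W"
    and r: "\<And>\<alpha>. \<alpha> \<in> \<Delta> \<Longrightarrow> \<alpha> Hg = k \<Longrightarrow> root_space (csa D) \<alpha> \<subseteq> W"
    and h: "k = 0 \<Longrightarrow> csa D \<subseteq> W"
  shows "Z \<in> W"
proof -
  have so: "Z \<in> so8" using Z by (rule eigsp_so8)
  have "(coord Z c d / 2) *\<^sub>C wedge (u c) (u d) \<in> W" if cd: "c \<in> I" "d \<in> I" for c d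
  proof (cases "coord Z c d = 0 \<or> c = d")
    case True
    then show ?thesis using cmat.subspace_0[OF W] by (auto simp: wedge_bilinear)
  next
    case False
    have "rt c d Hg * coord Z c d = k * coord Z c d"
      using coord_lbr[OF Hg_csa so cd] Z by (auto simp: eigsp_def coord_linear)
    then have k: "rt c d Hg = k" using False by simp
    show ?thesis
    proof (cases "c = - d")
      case True
      have "k = 0" using k True eps_uminus[OF cd(2)] by (simp add: rt_def)
      moreover have "wedge (u c) (u d) \<in> csa D" using h_wedge[OF cd(1)] True by simp
      ultimately show ?thesis using h cmat.subspace_scale[OF W] by blast
    next
      case False
      then have "(c, d) \<in> RI" using cd \<open>\<not> (coord Z c d = 0 \<or> c = d)\<close> by (simp add: RI_def)
      then have "rt c d \<in> \<Delta>" by (auto simp: roots_eq)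
      then show ?thesis using r k wedge_root_space[OF cd] by blast
    qed
  qed
  then have "(\<Sum>c\<in>I. \<Sum>d\<in>I. (coord Z c d / 2) *\<^sub>C wedge (u c) (u d)) \<in> W"
    by (intro cmat.subspace_sum[OF W])
  then show ?thesis by (simp flip: so8_expand[OF so])
qed

lemma csa_eigsp: "csa D \<subseteq> eigsp D 0"
  using h_comm[OF Hg_csa] by (auto simp: eigsp_def)

lemma nil_root_pairing:
  assumes "\<alpha> \<in> P - levi_roots D"
  shows "\<alpha> Hg = 1 \<or> \<alpha> Hg = 2"
proof -
  have a: "\<alpha> \<in> \<Delta>" "\<alpha> \<in> P" "\<alpha> Hg \<noteq> 0" using assms pos_subset by (auto simp: levi_roots_eq)
  obtain c d where "\<alpha> Hg = of_int (coroot_pairing 1 2 c + coroot_pairing 1 2 d)" using root_coords[OF a(1)] by metis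
  then obtain n where n: "n = coroot_pairing 1 2 c + coroot_pairing 1 2 d" "\<alpha> Hg = of_int n" by blast
  have "n \<ge> 0" using pos_pairing_highest[OF a(2)] n(2) by simp
  moreover have "n \<le> 2" unfolding n(1) by (simp add: coroot_pairing_def)
  moreover have "n \<noteq> 0" using n(2) a(3) by auto
  ultimately have "n = 1 \<or> n = 2" by linarith
  then show ?thesis using n(2) by auto
qed

lemma nil_rootI:
  assumes "\<alpha> \<in> \<Delta>" "\<alpha> Hg = 1 \<or> \<alpha> Hg = 2"
  shows "\<alpha> \<in> P - levi_roots D"
proof -
  have "- \<alpha> \<notin> P" using pos_pairing_highest[of "- \<alpha>"] assms(2) by auto
  then have "\<alpha> \<in> P" using pos_cases[OF assms(1)] by blast
  then show ?thesis using assms(2) by (auto simp: levi_roots_eq)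
qed

text \<open>The standard Levi factor is the centralizer of \<open>H\<^sub>\<gamma>\<close>, because
  the Levi roots are the roots vanishing on it.\<close>

lemma levi_eq: "levi D = eigsp D 0"
proof
  show "levi D \<subseteq> eigsp D 0"
    unfolding levi_def
  proof (rule cmat.span_minimal[OF _ eigsp_subspace], intro Un_least csa_eigsp UN_least)
    fix \<alpha> assume "\<alpha> \<in> levi_roots D"
    then show "root_space (csa D) \<alpha> \<subseteq> eigsp D 0" using root_space_eigsp[of \<alpha>] by (simp add: levi_roots_eq)
  qed
  show "eigsp D 0 \<subseteq> levi D"
  proof
    fix Z assume "Z \<in> eigsp D 0"
    then show "Z \<in> levi D"
    proof (rule eigsp_induct)
      show "cmat.subspace (levi D)" by (simp add: levi_def)
    next
      fix \<alpha> assume "\<alpha> \<in> \<Delta>" "\<alpha> Hg = 0"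
      then have "\<alpha> \<in> levi_roots D" by (simp add: levi_roots_eq)
      then have "root_space (csa D) \<alpha> \<subseteq> csa D \<union> (\<Union>\<alpha>\<in>levi_roots D. root_space (csa D) \<alpha>)" by blast
      then show "root_space (csa D) \<alpha> \<subseteq> levi D" unfolding levi_def by (rule order_trans[OF _ cmat.span_superset])
    next
      show "csa D \<subseteq> levi D" unfolding levi_def by (rule order_trans[OF Un_upper1 cmat.span_superset])
    qed
  qed
qed

lemma eigsp_nil:
  assumes "k = 1 \<or> k = 2"
  shows "eigsp D k \<subseteq> nil D" "eigsp D (- k) \<subseteq> nilbar D"
proof -
  show "eigsp D k \<subseteq> nil D"
  proof
    fix Z assume "Z \<in> eigsp D k"
    then show "Z \<in> nil D"
    proof (rule eigsp_induct)
      fix \<alpha> assume "\<alpha> \<in> \<Delta>" "\<alpha> Hg = k"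
      then have "\<alpha> \<in> P - levi_roots D" using nil_rootI assms by simp
      then have "root_space (csa D) \<alpha> \<subseteq> (\<Union>\<alpha>\<in>P - levi_roots D. root_space (csa D) \<alpha>)" by (rule UN_upper)
      then show "root_space (csa D) \<alpha> \<subseteq> nil D" unfolding nil_def by (rule order_trans[OF _ cmat.span_superset])
    next
      show "cmat.subspace (nil D)" by (simp add: nil_def)
    qed (use assms in simp)
  qed
  show "eigsp D (- k) \<subseteq> nilbar D"
  proof
    fix Z assume "Z \<in> eigsp D (- k)"
    then show "Z \<in> nilbar D"
    proof (rule eigsp_induct)
      fix \<alpha> assume a: "\<alpha> \<in> \<Delta>" "\<alpha> Hg = - k"
      then have "- \<alpha> \<in> P - levi_roots D" using nil_rootI[of "- \<alpha>"] uminus_root assms by simp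
      then have "root_space (csa D) (- (- \<alpha>)) \<subseteq> (\<Union>\<alpha>\<in>P - levi_roots D. root_space (csa D) (- \<alpha>))" by (rule UN_upper)
      then have "root_space (csa D) \<alpha> \<subseteq> (\<Union>\<alpha>\<in>P - levi_roots D. root_space (csa D) (- \<alpha>))" by simp
      then show "root_space (csa D) \<alpha> \<subseteq> nilbar D" unfolding nilbar_def by (rule order_trans[OF _ cmat.span_superset])
    next
      show "cmat.subspace (nilbar D)" by (simp add: nilbar_def)
    qed (use assms in auto)
  qed
qed

lemma nil_subspace: "cmat.subspace (nil D)" by (simp add: nil_def)

lemma nilbar_subspace: "cmat.subspace (nilbar D)" by (simp add: nilbar_def)

lemma parts_nil: "part_1 A + part_2 A \<in> nil D" "part_m2 A + part_m1 A \<in> nilbar D"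
proof -
  have "part_1 A \<in> nil D" "part_2 A \<in> nil D" "part_m2 A \<in> nilbar D" "part_m1 A \<in> nilbar D"
    using eigsp_nil(1)[of 1] eigsp_nil(1)[of 2] eigsp_nil(2)[of 1] eigsp_nil(2)[of 2] parts_eigsp[of A] by auto
  then show "part_1 A + part_2 A \<in> nil D" "part_m2 A + part_m1 A \<in> nilbar D"
    using cmat.subspace_add[OF nil_subspace] cmat.subspace_add[OF nilbar_subspace] by simp_all
qed

lemma eigsp_cdot_frame:
  assumes "Z \<in> eigsp D k"
  shows "k \<noteq> - 1 \<Longrightarrow> cdot (v a) (Z *v e i) = 0" "k \<noteq> 1 \<Longrightarrow> cdot (v a) (Z *v f i) = 0"
    "k \<noteq> 0 \<Longrightarrow> cdot (f i) (Z *v e j) = 0" "k \<noteq> 0 \<Longrightarrow> cdot (v a) (Z *v v b) = 0"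
    "k \<noteq> - 2 \<Longrightarrow> cdot (e i) (Z *v e j) = 0" "k \<noteq> 2 \<Longrightarrow> cdot (f i) (Z *v f j) = 0"
    "k \<noteq> 0 \<Longrightarrow> cdot (e j) (Z *v f i) = 0" "k \<noteq> 1 \<Longrightarrow> cdot (f i) (Z *v v a) = 0"
    "k \<noteq> - 1 \<Longrightarrow> cdot (e i) (Z *v v a) = 0"
  by (rule eigsp_cdot[OF assms Hg_frame'(3) Hg_frame'(1)] eigsp_cdot[OF assms Hg_frame'(3) Hg_frame'(2)]
      eigsp_cdot[OF assms Hg_frame'(2) Hg_frame'(1)] eigsp_cdot[OF assms Hg_frame'(3) Hg_frame'(3)]
      eigsp_cdot[OF assms Hg_frame'(1) Hg_frame'(1)] eigsp_cdot[OF assms Hg_frame'(2) Hg_frame'(2)]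
      eigsp_cdot[OF assms Hg_frame'(1) Hg_frame'(2)] eigsp_cdot[OF assms Hg_frame'(2) Hg_frame'(3)]
      eigsp_cdot[OF assms Hg_frame'(1) Hg_frame'(3)], simp)+

text \<open>The parabolic subalgebra is the stabilizer of the plane \<open>E\<close>.\<close>

lemma parab_iff: "A \<in> parab D \<longleftrightarrow> A \<in> so8 \<and> (\<forall>a i. cdot (v a) (A *v e i) = 0) \<and> (\<forall>i j. cdot (e i) (A *v e j) = 0)"
proof -
  define PB where "PB = {A. A \<in> so8 \<and> (\<forall>a i. cdot (v a) (A *v e i) = 0) \<and> (\<forall>i j. cdot (e i) (A *v e j) = 0)}"
  have sub: "cmat.subspace PB" unfolding PB_def by (rule cmat.subspaceI) auto
  have "levi D \<subseteq> PB" unfolding levi_eq by (auto simp: PB_def eigsp_cdot_frame dest: eigsp_so8)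
  moreover have "nil D \<subseteq> PB"
    unfolding nil_def
  proof (rule cmat.span_minimal[OF _ sub], rule UN_least)
    fix \<alpha> assume "\<alpha> \<in> P - levi_roots D"
    then have a: "\<alpha> Hg = 1 \<or> \<alpha> Hg = 2" by (rule nil_root_pairing)
    show "root_space (csa D) \<alpha> \<subseteq> PB"
    proof
      fix Z assume "Z \<in> root_space (csa D) \<alpha>"
      then have Z: "Z \<in> eigsp D (\<alpha> Hg)" using root_space_eigsp by blast
      show "Z \<in> PB" using a eigsp_cdot_frame(1,5)[OF Z] eigsp_so8[OF Z] by (auto simp: PB_def)
    qed
  qed
  ultimately have "parab D \<subseteq> PB" unfolding parab_def by (auto intro!: cmat.subspace_add[OF sub])
  moreover have "A \<in> parab D" if "A \<in> PB" for A
  proof -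
    have "part_m2 A = 0" "part_m1 A = 0" using that by (simp_all add: PB_def part_m2_def part_m1_def)
    then have "A = part_0 A + (part_1 A + part_2 A)"
      using grade_decomposition[of A] that by (simp add: PB_def add.assoc)
    moreover have "part_1 A + part_2 A \<in> nil D"
      by (rule parts_nil)
    moreover have "part_0 A \<in> levi D" using parts_eigsp by (simp add: levi_eq)
    ultimately show ?thesis unfolding parab_def by blast
  qed
  ultimately have "parab D = PB" by blast
  then show ?thesis by (simp add: PB_def)
qed

lemma nilbar_iff: "A \<in> nilbar D \<longleftrightarrow> A \<in> so8 \<and> (\<forall>i. A *v f i = 0) \<and> (\<forall>a b. cdot (v a) (A *v v b) = 0)"
proof -
  define NB where "NB = {A. A \<in> so8 \<and> (\<forall>i. A *v f i = 0) \<and> (\<forall>a b. cdot (v a) (A *v v b) = 0)}"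
  have sub: "cmat.subspace NB" unfolding NB_def by (rule cmat.subspaceI) auto
  have "nilbar D \<subseteq> NB"
    unfolding nilbar_def
  proof (rule cmat.span_minimal[OF _ sub], rule UN_least)
    fix \<alpha> assume "\<alpha> \<in> P - levi_roots D"
    then have a: "\<alpha> Hg = 1 \<or> \<alpha> Hg = 2" by (rule nil_root_pairing)
    show "root_space (csa D) (- \<alpha>) \<subseteq> NB"
    proof
      fix Z assume "Z \<in> root_space (csa D) (- \<alpha>)"
      then have Z: "Z \<in> eigsp D (- \<alpha> Hg)" using root_space_eigsp[of "- \<alpha>"] by auto
      have "Z *v f i = 0" for i
        by (rule cdot_frame_eqI) (use a eigsp_cdot_frame(2,6,7)[OF Z] in auto)
      then show "Z \<in> NB" using a eigsp_cdot_frame(4)[OF Z] eigsp_so8[OF Z] by (auto simp: NB_def)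
    qed
  qed
  moreover have "A \<in> nilbar D" if "A \<in> NB" for A
  proof -
    have so: "A \<in> so8" using that by (simp add: NB_def)
    have "cdot (f i) (A *v e j) = 0" for i j using so8_swap[OF so, of "f i" "e j"] that by (simp add: NB_def)
    then have "part_0 A = 0" "part_1 A = 0" "part_2 A = 0"
      using that by (simp_all add: NB_def part_0_def part_1_def part_2_def)
    then have "A = part_m2 A + part_m1 A"
      using grade_decomposition[OF so] by simp
    moreover have "part_m2 A + part_m1 A \<in> nilbar D"
      by (rule parts_nil)
    ultimately show ?thesis by simp
  qed
  ultimately have "nilbar D = NB" by blast
  then show ?thesis by (simp add: NB_def)
qed

lemma nilbar_frame:
  assumes "Z \<in> nilbar D"
  shows "Z *v f i = 0" "Z *v v a = (\<Sum>i\<in>UNIV. cdot (e i) (Z *v v a) *s f i)"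
    "Z *v e i = (\<Sum>j\<in>UNIV. cdot (e j) (Z *v e i) *s f j) + (\<Sum>a\<in>UNIV. cdot (v a) (Z *v e i) *s v a)"
proof -
  have Z: "Z \<in> so8" "\<And>i. Z *v f i = 0" "\<And>a b. cdot (v a) (Z *v v b) = 0" using assms by (auto simp: nilbar_iff)
  show "Z *v f i = 0" by (rule Z(2))
  have "cdot (f i) (Z *v x) = 0" for i x using so8_swap[OF Z(1), of "f i" x] Z(2) by simp
  then show "Z *v v a = (\<Sum>i\<in>UNIV. cdot (e i) (Z *v v a) *s f i)"
    "Z *v e i = (\<Sum>j\<in>UNIV. cdot (e j) (Z *v e i) *s f j) + (\<Sum>a\<in>UNIV. cdot (v a) (Z *v e i) *s v a)"
    using vec_frame_expand[of "Z *v v a"] vec_frame_expand[of "Z *v e i"] Z(3) by simp_all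
qed

lemma nilbar_so8: "Z \<in> nilbar D \<Longrightarrow> Z \<in> so8" by (simp add: nilbar_iff)

lemma nilbar_double_v: "A \<in> nilbar D \<Longrightarrow> B \<in> nilbar D \<Longrightarrow> A *v (B *v v a) = 0"
  by (subst nilbar_frame(2)[of B]) (simp_all add: mv_sum nilbar_frame(1))

text \<open>The opposite nilradical lowers the filtration \<open>\<complex>\<^sup>8 \<supseteq>
  V\<^sub>0 \<oplus> E' \<supseteq> E' \<supseteq> 0\<close>. So exponentials of its elements are
  polynomials of degree 2.\<close>

lemma nilbar_triple:
  assumes "A \<in> nilbar D" "B \<in> nilbar D" "C \<in> nilbar D"
  shows "A ** B ** C = 0"
proof (rule frame_eqI)
  fix i a
  show "A ** B ** C *v f i = 0 *v f i" using nilbar_frame(1)[OF assms(3)] by (simp flip: matrix_vector_mul_assoc)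
  show "A ** B ** C *v v a = 0 *v v a"
    using nilbar_double_v[OF assms(2,3)] by (simp flip: matrix_vector_mul_assoc)
  have "A *v (B *v (C *v e i)) = 0"
    by (subst nilbar_frame(3)[OF assms(3)]) (simp add: mv_sum nilbar_frame(1) nilbar_double_v assms)
  then show "A ** B ** C *v e i = 0 *v e i" by (simp flip: matrix_vector_mul_assoc)
qed

lemma nilbar_lbr:
  assumes "A \<in> nilbar D" "B \<in> nilbar D"
  shows "lbr A B \<in> nilbar D"
  using assms by (simp add: nilbar_iff[of "lbr A B"] nilbar_so8 lbr_mv nilbar_frame(1) nilbar_double_v)

lemma wedges_nilbar: "wedge (v a) (f i) \<in> nilbar D" "wedge (f 1) (f 2) \<in> nilbar D"
  by (simp_all add: nilbar_iff)

definition nilpart :: "mat8 \<Rightarrow> mat8"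
  where "nilpart A = part_m1 A + part_m2 A"

lemma nilpart_nilbar: "nilpart A \<in> nilbar D"
  unfolding nilpart_def part_m1_def part_m2_def
  by (intro cmat.subspace_add[OF nilbar_subspace] cmat.subspace_sum[OF nilbar_subspace]
      cmat.subspace_scale[OF nilbar_subspace] wedges_nilbar)

lemma nilbar_eq_nilpart:
  assumes "A \<in> nilbar D" shows "A = nilpart A"
proof -
  have A: "A \<in> so8" "\<And>i. A *v f i = 0" "\<And>a b. cdot (v a) (A *v v b) = 0" using assms by (auto simp: nilbar_iff)
  have "cdot (f i) (A *v e j) = 0" for i j using so8_swap[OF A(1), of "f i" "e j"] A(2) by simp
  then have "part_0 A = 0" "part_1 A = 0" "part_2 A = 0"
    using A by (simp_all add: part_0_def part_1_def part_2_def)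
  then show ?thesis using grade_decomposition[OF A(1)] by (simp add: nilpart_def add.commute)
qed

lemma parab_nilpart:
  assumes "A \<in> so8" shows "A - nilpart A \<in> parab D"
proof -
  have e: "A - nilpart A = part_0 A + (part_1 A + part_2 A)"
    by (subst (1) grade_decomposition[OF assms]) (simp add: nilpart_def algebra_simps)
  have "part_1 A + part_2 A \<in> nil D"
    by (rule parts_nil)
  moreover have "part_0 A \<in> levi D" using parts_eigsp by (simp add: levi_eq)
  ultimately show ?thesis unfolding parab_def e by blast
qed

lemma nilpart_parab: "A \<in> parab D \<Longrightarrow> nilpart A = 0"
  by (simp add: parab_iff nilpart_def part_m1_def part_m2_def)

lemma nilpart_add: "nilpart (A + B) = nilpart A + nilpart B"
  by (simp add: nilpart_def part_m1_def part_m2_def cmat.scale_left_distrib sum.distrib algebra_simps)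

lemma decomposition_unique:
  assumes "A = n + q" "n \<in> nilbar D" "q \<in> parab D"
  shows "n = nilpart A"
  using assms nilbar_eq_nilpart[OF assms(2)] nilpart_parab[OF assms(3)] by (simp add: nilpart_add)

lemma proj_nilbar: "A \<in> so8 \<Longrightarrow> proj_along (nilbar D) (parab D) A = nilpart A"
  unfolding proj_along_def
  by (rule the_equality)
    (use nilpart_nilbar parab_nilpart decomposition_unique in \<open>auto intro!: bexI[of _ "A - nilpart A"]\<close>)

lemma proj_parab: "A \<in> so8 \<Longrightarrow> proj_along (parab D) (nilbar D) A = A - nilpart A"
  unfolding proj_along_def
proof (rule the_equality)
  assume "A \<in> so8"
  then show "A - nilpart A \<in> parab D \<and> (\<exists>w\<in>nilbar D. A = A - nilpart A + w)"
    using nilpart_nilbar parab_nilpart by (auto intro!: bexI[of _ "nilpart A"])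
next
  fix q assume "q \<in> parab D \<and> (\<exists>w\<in>nilbar D. A = q + w)"
  then obtain w where w: "q \<in> parab D" "w \<in> nilbar D" "A = w + q" by (auto simp: add.commute)
  have "q = A - w" unfolding w(3) by simp
  then show "q = A - nilpart A" unfolding decomposition_unique[OF w(3,2,1), symmetric] .
qed

lemma eigsp_m1_iff: "Z \<in> eigsp D (- 1) \<longleftrightarrow> Z = part_m1 Z"
proof
  assume Z: "Z \<in> eigsp D (- 1)"
  then have "Z = nilpart Z" using eigsp_nil(2)[of 1] nilbar_eq_nilpart by auto
  moreover have "part_m2 Z = 0" using eigsp_cdot_frame(5)[OF Z] by (simp add: part_m2_def)
  ultimately show "Z = part_m1 Z" by (simp add: nilpart_def)
next
  show "Z = part_m1 Z \<Longrightarrow> Z \<in> eigsp D (- 1)" using parts_eigsp(2)[of Z] by simp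
qed

definition \<kappa> :: complex where "\<kappa> = (SOME k. k \<noteq> 0 \<and> Xv D \<gamma> = k *\<^sub>C wedge (e 1) (e 2))"

lemma kappa: "\<kappa> \<noteq> 0" "Xv D \<gamma> = \<kappa> *\<^sub>C wedge (e 1) (e 2)"
proof -
  have "rt 1 2 \<in> P" using highest_pos gamma by simp
  then obtain k where "k \<noteq> 0" "Xv D (rt 1 2) = k *\<^sub>C wedge (u 1) (u 2)"
    by (rule pos_root_vectors[OF RI_12])
  then have "\<exists>k. k \<noteq> 0 \<and> Xv D \<gamma> = k *\<^sub>C wedge (e 1) (e 2)" by (auto simp: gamma e_def)
  from someI_ex[OF this] show "\<kappa> \<noteq> 0" "Xv D \<gamma> = \<kappa> *\<^sub>C wedge (e 1) (e 2)" by (auto simp: \<kappa>_def)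
qed

definition ctr :: "mat8 \<Rightarrow> complex" where "ctr Z = cdot (f 1) (Z *v e 1) + cdot (f 2) (Z *v e 2)"

lemma parab_e: "Z \<in> parab D \<Longrightarrow> Z *v e i = (\<Sum>j\<in>UNIV. cdot (f j) (Z *v e i) *s e j)"
  using vec_frame_expand[of "Z *v e i"] by (simp add: parab_iff)

lemma parab_X: "Z \<in> parab D \<Longrightarrow> lbr Z (Xv D \<gamma>) = ctr Z *\<^sub>C Xv D \<gamma>"
proof -
  assume Z: "Z \<in> parab D"
  have "lbr Z (wedge (e 1) (e 2)) = wedge (Z *v e 1) (e 2) + wedge (e 1) (Z *v e 2)"
    using Z by (simp add: lbr_wedge parab_iff)
  also have "\<dots> = ctr Z *\<^sub>C wedge (e 1) (e 2)"
    by (subst parab_e[OF Z, of 1], subst parab_e[OF Z, of 2])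
      (simp add: sum_2 wedge_bilinear ctr_def cmat.scale_left_distrib)
  finally show ?thesis by (simp add: kappa(2) lbr_bilinear mult.commute)
qed

end

section \<open>Sums over the roots of the degree one part\<close>

context heis
begin

definition E :: "int set" where "E = {1, 2}"
definition C :: "int set" where "C = {3, - 3, 4, - 4}"

lemma EC_I: "i \<in> E \<Longrightarrow> i \<in> I" "c \<in> C \<Longrightarrow> c \<in> I" "i \<in> E \<Longrightarrow> c \<in> C \<Longrightarrow> (i, c) \<in> RI"
  using I_mem by (auto simp: E_def C_def RI_def)

lemma coroot_pairing_12: "i \<in> E \<Longrightarrow> coroot_pairing 1 2 i = 1" "c \<in> C \<Longrightarrow> coroot_pairing 1 2 c = 0" "i \<in> E \<Longrightarrow> coroot_pairing 1 2 (- i) = - 1"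
  by (auto simp: E_def C_def coroot_pairing_def)

lemma rt_Hg: "(c, d) \<in> RI \<Longrightarrow> rt c d Hg = of_int (coroot_pairing 1 2 c + coroot_pairing 1 2 d)"
  using rt_coroot[OF RI_12, of c d] by (auto simp: RI_def Hg_eq e_def f_def)

lemma rt_EC_P:
  assumes "i \<in> E" "c \<in> C" shows "rt i c \<in> P" "rt i c \<in> \<Delta>" "rt i c Hg = 1"
proof -
  have R: "(i, c) \<in> RI" using EC_I assms by blast
  then show D: "rt i c \<in> \<Delta>" by (auto simp: roots_eq)
  show H: "rt i c Hg = 1" using rt_Hg[OF R] coroot_pairing_12 assms by simp
  show "rt i c \<in> P" using nil_rootI[OF D] H by simp
qed

lemma roots_Vplus_eq: "roots_Vplus D = (\<lambda>(i, c). rt i c) ` (E \<times> C)"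
proof (intro equalityI subsetI)
  fix \<alpha> assume "\<alpha> \<in> roots_Vplus D"
  then have a: "\<alpha> \<in> \<Delta>" "root_space (csa D) \<alpha> \<subseteq> eigsp D 1" by (auto simp: roots_Vplus_def)
  have "Xv D \<alpha> \<in> eigsp D 1" "Xv D \<alpha> \<in> eigsp D (\<alpha> Hg)"
    using X_root_space[OF a(1)] a(2) root_space_eigsp by auto
  then have "\<alpha> Hg *\<^sub>C Xv D \<alpha> = 1 *\<^sub>C Xv D \<alpha>" by (simp add: eigsp_def)
  then have H: "\<alpha> Hg = 1" using X_nonzero[OF a(1)] cmat.scale_right_imp_eq by blast
  obtain c d where cd: "(c, d) \<in> RI" "\<alpha> = rt c d" using a(1) by (auto simp: roots_eq)
  have "of_int (coroot_pairing 1 2 c + coroot_pairing 1 2 d) = (1 :: complex)" using rt_Hg[OF cd(1)] cd(2) H by simp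
  then have s: "coroot_pairing 1 2 c + coroot_pairing 1 2 d = 1" by (metis of_int_eq_1_iff)
  have "c \<in> I" "d \<in> I" using cd(1) by (auto simp: RI_def)
  then have "(c \<in> E \<and> d \<in> C) \<or> (d \<in> E \<and> c \<in> C)"
    using s unfolding I_eq E_def C_def by (elim insertE) (simp_all add: coroot_pairing_def)
  then show "\<alpha> \<in> (\<lambda>(i, c). rt i c) ` (E \<times> C)"
  proof
    assume "c \<in> E \<and> d \<in> C"
    then show ?thesis using cd(2) by (intro image_eqI[of _ _ "(c, d)"]) auto
  next
    assume "d \<in> E \<and> c \<in> C"
    then show ?thesis using cd(2) rt_commute[of c d] by (intro image_eqI[of _ _ "(d, c)"]) auto
  qed
next
  fix \<alpha> assume "\<alpha> \<in> (\<lambda>(i, c). rt i c) ` (E \<times> C)"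
  then obtain i c where ic: "i \<in> E" "c \<in> C" "\<alpha> = rt i c" by auto
  show "\<alpha> \<in> roots_Vplus D"
    using rt_EC_P[OF ic(1,2)] root_space_eigsp[of \<alpha>] ic(3) by (auto simp: roots_Vplus_def)
qed

lemma rt_EC_inj: "inj_on (\<lambda>(i, c). rt i c) (E \<times> C)"
proof (rule inj_onI)
  fix p q assume p: "p \<in> E \<times> C" and q: "q \<in> E \<times> C" and e: "(\<lambda>(i, c). rt i c) p = (\<lambda>(i, c). rt i c) q"
  obtain i c where ic: "p = (i, c)" "i \<in> E" "c \<in> C" using p by blast
  obtain j d where jd: "q = (j, d)" "j \<in> E" "d \<in> C" using q by blast
  have "(j = i \<and> d = c) \<or> (j = c \<and> d = i)"
    using rt_eq_iff[OF EC_I(3)[OF ic(2,3)] EC_I(1)[OF jd(2)] EC_I(2)[OF jd(3)]] e ic jd by simp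
  moreover have "\<not> (j = c)" using jd ic by (auto simp: E_def C_def)
  ultimately show "p = q" using ic jd by simp
qed

lemma sum_roots_Vplus: "(\<Sum>\<alpha>\<in>roots_Vplus D. g \<alpha>) = (\<Sum>i\<in>E. \<Sum>c\<in>C. g (rt i c))"
  for g :: "weight \<Rightarrow> 'b::comm_monoid_add"
  unfolding roots_Vplus_eq sum.reindex[OF rt_EC_inj] by (simp add: sum.cartesian_product case_prod_unfold o_def)

definition root_vector_scale :: "int \<Rightarrow> int \<Rightarrow> complex"
  where "root_vector_scale i c = (SOME k. k \<noteq> 0 \<and> Xv D (rt i c) = k *\<^sub>C wedge (u i) (u c) \<and>
     Xv D (- rt i c) = (1 / k) *\<^sub>C wedge (u (- c)) (u (- i)))"

lemma root_vector_scale: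
  assumes "i \<in> E" "c \<in> C"
  shows "root_vector_scale i c \<noteq> 0" "Xv D (rt i c) = root_vector_scale i c *\<^sub>C wedge (u i) (u c)"
    "Xv D (- rt i c) = (1 / root_vector_scale i c) *\<^sub>C wedge (u (- c)) (u (- i))"
proof -
  obtain k where k: "k \<noteq> 0" "Xv D (rt i c) = k *\<^sub>C wedge (u i) (u c)"
    "Xv D (- rt i c) = (- 1 / k) *\<^sub>C wedge (u (- i)) (u (- c))"
    by (rule pos_root_vectors[OF EC_I(3)[OF assms] rt_EC_P(1)[OF assms]]) (rule that)
  have "(- 1 / k) *\<^sub>C wedge (u (- i)) (u (- c)) = (1 / k) *\<^sub>C wedge (u (- c)) (u (- i))"
    by (subst wedge_antisym[of "u (- c)"]) (simp add: cscale_def vec_eq_iff)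
  then have "\<exists>k. k \<noteq> 0 \<and> Xv D (rt i c) = k *\<^sub>C wedge (u i) (u c) \<and>
     Xv D (- rt i c) = (1 / k) *\<^sub>C wedge (u (- c)) (u (- i))" using k by auto
  from someI_ex[OF this] show "root_vector_scale i c \<noteq> 0" "Xv D (rt i c) = root_vector_scale i c *\<^sub>C wedge (u i) (u c)"
    "Xv D (- rt i c) = (1 / root_vector_scale i c) *\<^sub>C wedge (u (- c)) (u (- i))" by (simp_all add: root_vector_scale_def)
qed

lemma wedge_u_nilbar: "i \<in> E \<Longrightarrow> c \<in> C \<Longrightarrow> wedge (u (- c)) (u (- i)) \<in> nilbar D"
proof -
  assume i: "i \<in> E" and c: "c \<in> C"
  have "rt (- c) (- i) = - rt i c" using rt_uminus[OF EC_I(3)[OF i c]] rt_commute[of "- c" "- i"] by simp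
  then have "rt (- c) (- i) Hg = - 1" using rt_EC_P(3)[OF i c] by simp
  moreover have "wedge (u (- c)) (u (- i)) \<in> root_space (csa D) (rt (- c) (- i))"
    using wedge_root_space[of "- c" "- i" 1] EC_I i c by simp
  ultimately have "wedge (u (- c)) (u (- i)) \<in> eigsp D (- 1)" using root_space_eigsp[of "rt (- c) (- i)"] by auto
  then show ?thesis using eigsp_nil(2)[of 1] by auto
qed

text \<open>The scalars of \<open>X\<^sub>\<alpha>\<close> and
  \<open>X\<^sub>-\<^sub>\<alpha>\<close> are inverse to each other, so a bilinear sum over roots
  does not see the normalization of the root vectors. It can then be rewritten in the orthonormal
  basis of \<open>V\<^sub>0\<close>.\<close>

lemma contraction:
  fixes G :: "mat8 \<Rightarrow> mat8 \<Rightarrow> complex"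
  assumes add1: "\<And>X X' Y. X \<in> eigsp D 1 \<Longrightarrow> X' \<in> eigsp D 1 \<Longrightarrow> Y \<in> nilbar D \<Longrightarrow> G (X + X') Y = G X Y + G X' Y"
    and scale1: "\<And>k X Y. X \<in> eigsp D 1 \<Longrightarrow> Y \<in> nilbar D \<Longrightarrow> G (k *\<^sub>C X) Y = k * G X Y"
    and add2: "\<And>X Y Y'. X \<in> eigsp D 1 \<Longrightarrow> Y \<in> nilbar D \<Longrightarrow> Y' \<in> nilbar D \<Longrightarrow> G X (Y + Y') = G X Y + G X Y'"
    and scale2: "\<And>k X Y. X \<in> eigsp D 1 \<Longrightarrow> Y \<in> nilbar D \<Longrightarrow> G X (k *\<^sub>C Y) = k * G X Y"
  shows "(\<Sum>\<alpha>\<in>roots_Vplus D. G (Xv D \<alpha>) (Xv D (- \<alpha>))) = (\<Sum>i\<in>UNIV. \<Sum>a\<in>UNIV. G (wedge (e i) (v a)) (wedge (v a) (f i)))"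
proof -
  have uE: "wedge (u i) (u c) \<in> eigsp D 1" if "i \<in> E" "c \<in> C" for i c
    using wedge_root_space[of i c 1] EC_I that root_space_eigsp[of "rt i c"] rt_EC_P(3)[OF that] by auto
  have 1: "G (Xv D (rt i c)) (Xv D (- rt i c)) = G (wedge (u i) (u c)) (wedge (u (- c)) (u (- i)))"
    if "i \<in> E" "c \<in> C" for i c
    using root_vector_scale[OF that] wedge_u_nilbar[OF that] cmat.subspace_scale[OF nilbar_subspace wedge_u_nilbar[OF that]]
    by (simp add: scale1 scale2 uE that)
  \<comment> \<open>Composing with the projection to \<open>V\<^sub>0\<close> makes the bilinear map total, so that \<open>sum_dual_pairs\<close> applies.\<close>
  define pr where "pr x = (\<Sum>a\<in>UNIV. cdot (v a) x *s v a)" for x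
  have prw: "wedge (pr x) (f i) \<in> nilbar D" for x i
    unfolding nilbar_iff by (simp add: pr_def cdot_sum_left cdot_sum_right)
  have prE: "wedge (e i) (pr x) \<in> eigsp D 1" for x i
    by (rule wedge_eigsp[OF Hg_frame'(1), of _ 0]) (simp_all add: pr_def mv_sum)
  have pr_lin: "pr (x + y) = pr x + pr y" "pr (k *s x) = k *s pr x" for x y k
    by (simp_all add: pr_def vec.scale_left_distrib sum.distrib vec.scale_sum_right)
  have pr_v: "pr (v a) = v a" for a
    by (simp add: pr_def if_distrib[of "\<lambda>k. k *s _"] cong: if_cong)
  have pr_u: "pr (u c) = u c" if "c \<in> C" for c
    using that unfolding C_def by (elim insertE) (simp_all only: u_V0 pr_lin pr_v empty_iff)
  have 2: "(\<Sum>c\<in>C. G (wedge (e i) (u c)) (wedge (u (- c)) (f i))) = (\<Sum>a\<in>UNIV. G (wedge (e i) (v a)) (wedge (v a) (f i)))" for i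
  proof -
    have "(\<Sum>c\<in>{3, - 3, 4, - 4}. G (wedge (e i) (pr (u c))) (wedge (pr (u (- c))) (f i))) = 
        (\<Sum>a\<in>UNIV. G (wedge (e i) (pr (v a))) (wedge (pr (v a)) (f i)))"
      by (rule sum_dual_pairs[where B = "\<lambda>x y. G (wedge (e i) (pr x)) (wedge (pr y) (f i))"])
        (simp_all add: pr_lin wedge_bilinear add1 scale1 add2 scale2 prw prE)
    moreover have "pr (u (- c)) = u (- c)" if "c \<in> C" for c
      using that by (intro pr_u) (auto simp: C_def)
    ultimately show ?thesis using pr_u by (simp add: C_def[symmetric] pr_v)
  qed
  have "(\<Sum>\<alpha>\<in>roots_Vplus D. G (Xv D \<alpha>) (Xv D (- \<alpha>))) = (\<Sum>i\<in>E. \<Sum>c\<in>C. G (wedge (u i) (u c)) (wedge (u (- c)) (u (- i))))"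
    unfolding sum_roots_Vplus by (intro sum.cong refl 1)
  also have "\<dots> = (\<Sum>c\<in>C. G (wedge (e 1) (u c)) (wedge (u (- c)) (f 1))) + (\<Sum>c\<in>C. G (wedge (e 2) (u c)) (wedge (u (- c)) (f 2)))"
    by (simp add: E_def e_def f_def)
  also have "\<dots> = (\<Sum>i\<in>UNIV. \<Sum>a\<in>UNIV. G (wedge (e i) (v a)) (wedge (v a) (f i)))"
    unfolding 2 sum_2 ..
  finally show ?thesis .
qed

text \<open>The coefficient of \<open>X\<^sub>\<gamma>\<close> in an element of the centre of the
  nilradical.\<close>

definition \<phi> :: "mat8 \<Rightarrow> complex" where "\<phi> W = cdot (f 1) (W *v f 2) / \<kappa>"

lemma phi_linear: "\<phi> (A + B) = \<phi> A + \<phi> B" "\<phi> (k *\<^sub>C A) = k * \<phi> A" "\<phi> 0 = 0" "\<phi> (- A) = - \<phi> A"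
  by (simp_all add: \<phi>_def add_divide_distrib)

lemma phi_sum: "\<phi> (sum F B) = (\<Sum>b\<in>B. \<phi> (F b))"
  by (induction B rule: infinite_finite_induct) (auto simp: phi_linear)

lemma phi_X: "\<phi> (k *\<^sub>C Xv D \<gamma>) = k"
  using kappa by (simp add: \<phi>_def)

lemma phi_X1: "\<phi> (Xv D \<gamma>) = 1"
  using phi_X[of 1] by simp

lemma lbr_EC:
  assumes "i \<in> E" "c \<in> C" "j \<in> E" "d \<in> C"
  shows "lbr (wedge (u i) (u c)) (wedge (u j) (u d)) = (if d = - c then wedge (u j) (u i) else 0)"
proof -
  have I: "i \<in> I" "c \<in> I" "j \<in> I" "d \<in> I" using assms EC_I by simp_all
  have ne: "c \<noteq> - j" "i \<noteq> - j" "i \<noteq> - d" using assms unfolding E_def C_def by auto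
  have "wedge (u i) (u c) *v u j = 0" "wedge (u i) (u c) *v u d = (if d = - c then u i else 0)"
    using ne I by (simp_all add: cdot_u)
  then show ?thesis using I by (simp add: lbr_wedge wedge_bilinear)
qed

lemma wedge_EE: 
  assumes "i \<in> E" "j \<in> E"
  shows "wedge (u j) (u i) = (\<phi> (wedge (u j) (u i))) *\<^sub>C Xv D \<gamma>"
proof -
  have "\<exists>k. wedge (u j) (u i) = k *\<^sub>C wedge (e 1) (e 2)"
  proof -
    consider "j = i" | "j = 1" "i = 2" | "j = 2" "i = 1" using assms unfolding E_def by auto
    then show ?thesis
    proof cases
      case 1
      then show ?thesis by (intro exI[of _ 0]) (simp add: wedge_bilinear)
    next
      case 2
      then show ?thesis by (intro exI[of _ 1]) (simp add: e_def)
    next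
      case 3
      then show ?thesis using wedge_antisym[of "u 2" "u 1"] by (intro exI[of _ "- 1"]) (simp add: e_def)
    qed
  qed
  then obtain k where k: "wedge (u j) (u i) = k *\<^sub>C wedge (e 1) (e 2)" ..
  then have "wedge (u j) (u i) = (k / \<kappa>) *\<^sub>C Xv D \<gamma>" using kappa by simp
  then show ?thesis by (simp add: phi_linear phi_X1)
qed

lemma lbr_X_EC:
  assumes "i \<in> E" "c \<in> C" "j \<in> E" "d \<in> C"
  shows "lbr (Xv D (rt i c)) (Xv D (rt j d)) = \<phi> (lbr (Xv D (rt i c)) (Xv D (rt j d))) *\<^sub>C Xv D \<gamma>"
    and "rt j d \<noteq> \<gamma> - rt i c \<Longrightarrow> lbr (Xv D (rt i c)) (Xv D (rt j d)) = 0"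
proof -
  have l: "lbr (Xv D (rt i c)) (Xv D (rt j d)) = (root_vector_scale i c * root_vector_scale j d) *\<^sub>C (if d = - c then wedge (u j) (u i) else 0)"
    using root_vector_scale(2)[OF assms(1,2)] root_vector_scale(2)[OF assms(3,4)] lbr_EC[OF assms] by (simp add: lbr_bilinear mult.commute)
  show "lbr (Xv D (rt i c)) (Xv D (rt j d)) = \<phi> (lbr (Xv D (rt i c)) (Xv D (rt j d))) *\<^sub>C Xv D \<gamma>"
  proof (cases "d = - c")
    case True
    have "(root_vector_scale i c * root_vector_scale j d) *\<^sub>C wedge (u j) (u i) = (root_vector_scale i c * root_vector_scale j d) *\<^sub>C (\<phi> (wedge (u j) (u i)) *\<^sub>C Xv D \<gamma>)"
      using wedge_EE[OF assms(1,3)] by simp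
    then show ?thesis unfolding l using True by (simp add: phi_linear phi_X1)
  qed (simp add: l phi_linear)
  show "lbr (Xv D (rt i c)) (Xv D (rt j d)) = 0" if ne: "rt j d \<noteq> \<gamma> - rt i c"
  proof (cases "d = - c \<and> i \<noteq> j")
    case True
    then have "rt j d + rt i c = rt 1 2"
      using assms eps_uminus[OF EC_I(2)[OF assms(2)]] by (auto simp: rt_def E_def algebra_simps)
    then have "rt j d = \<gamma> - rt i c" by (simp add: gamma eq_diff_eq)
    then show ?thesis using ne by blast
  next
    case False
    then show ?thesis unfolding l by (auto simp: wedge_bilinear)
  qed
qed

lemma eigsp_1_span:
  assumes "Z \<in> eigsp D 1"
  shows "Z = (\<Sum>i\<in>E. \<Sum>c\<in>C. (coord Z i c / root_vector_scale i c) *\<^sub>C Xv D (rt i c))"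
proof (rule coord_eqI)
  have so: "Z \<in> so8" using assms by (rule eigsp_so8)
  have zero: "coord Z a b = 0" if ab: "a \<in> I" "b \<in> I" "\<not> (a \<in> E \<and> b \<in> C)" "\<not> (b \<in> E \<and> a \<in> C)" for a b
  proof (cases "a = b")
    case True
    then show ?thesis using coord_antisym[OF so, of a a] by simp
  next
    case False
    have "rt a b Hg * coord Z a b = coord Z a b"
      using coord_lbr[OF Hg_csa so ab(1,2)] assms by (simp add: eigsp_def coord_linear)
    moreover have "rt a b Hg \<noteq> 1"
    proof (cases "a = - b")
      case True
      then show ?thesis using eps_uminus[OF ab(2)] by (simp add: rt_def)
    next
      case F: False
      have "coroot_pairing 1 2 a + coroot_pairing 1 2 b \<noteq> 1"
        using ab False F unfolding I_eq E_def C_def by (elim insertE) (simp_all add: coroot_pairing_def)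
      moreover have "rt a b Hg = of_int (coroot_pairing 1 2 a + coroot_pairing 1 2 b)" using rt_Hg ab False F by (simp add: RI_def)
      ultimately show ?thesis by (metis of_int_eq_1_iff)
    qed
    ultimately show ?thesis by simp
  qed
  fix a b assume ab: "a \<in> I" "b \<in> I"
  have disj: "i \<noteq> c" if "i \<in> E" "c \<in> C" for i c using that unfolding E_def C_def by auto
  have finE: "finite E" and finC: "finite C" by (simp_all add: E_def C_def)
  have "coord (\<Sum>i\<in>E. \<Sum>c\<in>C. (coord Z i c / root_vector_scale i c) *\<^sub>C Xv D (rt i c)) a b =
     (\<Sum>i\<in>E. \<Sum>c\<in>C. coord Z i c * coord (wedge (u i) (u c)) a b)"
    unfolding coord_sum coord_linear by (intro sum.cong refl) (simp add: root_vector_scale coord_linear)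
  also have "\<dots> = (\<Sum>i\<in>E. \<Sum>c\<in>C. coord Z i c * ((if i = a \<and> c = b then 1 else 0) - (if i = b \<and> c = a then 1 else 0)))"
    using ab EC_I by (intro sum.cong refl) (simp add: coord_wedge)
  also have "\<dots> = coord Z a b"
  proof -
    have s: "(\<Sum>i\<in>E. \<Sum>c\<in>C. coord Z i c * (if i = x \<and> c = y then 1 else 0)) = (if x \<in> E \<and> y \<in> C then coord Z x y else 0)" for x y
    proof -
      have "(\<Sum>c\<in>C. coord Z i c * (if i = x \<and> c = y then 1 else 0)) = (if i = x then (if y \<in> C then coord Z x y else 0) else 0)" for i
        using finC by (cases "i = x") (simp_all add: delta_mult)
      then show ?thesis using finE by simp
    qed
    show ?thesis
      unfolding right_diff_distrib sum_subtractf s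
      using zero[OF ab] coord_antisym[OF so, of a b] disj by auto
  qed
  finally show "coord Z a b = coord (\<Sum>i\<in>E. \<Sum>c\<in>C. (coord Z i c / root_vector_scale i c) *\<^sub>C Xv D (rt i c)) a b" ..
qed

lemma EC_disjoint: "i \<in> E \<Longrightarrow> c \<in> C \<Longrightarrow> i \<noteq> c"
  unfolding E_def C_def by auto

lemma coord_EC: "i \<in> E \<Longrightarrow> c \<in> C \<Longrightarrow> j \<in> E \<Longrightarrow> d \<in> C \<Longrightarrow>
    coord (wedge (u i) (u c)) j d = (if i = j then (if c = d then 1 else 0) else 0)"
  using EC_disjoint[of i d] by (simp add: coord_wedge EC_I)

lemma X_EC_independent:
  assumes "(\<Sum>i\<in>E. \<Sum>c\<in>C. k (rt i c) *\<^sub>C Xv D (rt i c)) = 0" "j \<in> E" "d \<in> C"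
  shows "k (rt j d) = 0"
proof -
  have "0 = coord (\<Sum>i\<in>E. \<Sum>c\<in>C. k (rt i c) *\<^sub>C Xv D (rt i c)) j d" unfolding assms(1) by (simp add: coord_linear)
  also have "\<dots> = (\<Sum>i\<in>E. \<Sum>c\<in>C. k (rt i c) * root_vector_scale i c * coord (wedge (u i) (u c)) j d)"
    unfolding coord_sum coord_linear by (intro sum.cong refl) (simp add: root_vector_scale coord_linear)
  also have "\<dots> = (\<Sum>i\<in>E. \<Sum>c\<in>C. if i = j then (if c = d then k (rt j d) * root_vector_scale j d else 0) else 0)"
    using assms(2,3) by (intro sum.cong refl) (simp add: coord_EC)
  also have "\<dots> = k (rt j d) * root_vector_scale j d" 
  proof -
    have fin: "finite E" "finite C" by (simp_all add: E_def C_def)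
    have "(\<Sum>c\<in>C. if i = j then (if c = d then k (rt j d) * root_vector_scale j d else 0) else 0) = (if i = j then k (rt j d) * root_vector_scale j d else 0)" for i
      using assms(3) fin by (cases "i = j") simp_all
    then show ?thesis using assms(2) fin by simp
  qed
  finally show ?thesis using root_vector_scale(1)[OF assms(2,3)] by simp
qed

lemma eigsp_lbr: 
  assumes "Z \<in> eigsp D 0" "X \<in> eigsp D k" shows "lbr Z X \<in> eigsp D k"
proof -
  have "lbr Hg (lbr Z X) = lbr (lbr Hg Z) X + lbr Z (lbr Hg X)"
    by (rule mat8_eqI) (simp add: lbr_mv)
  then show ?thesis using assms by (simp add: eigsp_def lbr_bilinear)
qed

text \<open>For given \<open>\<beta>\<close>, the only root vector of degree 1 with a nonzero
  bracket with \<open>X\<^sub>\<beta>\<close> is that of \<open>\<gamma> - \<beta>\<close>. So the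
  product of the two structure constants is the coefficient of \<open>X\<^sub>\<gamma>\<close> in a
  double bracket, an expression that is bilinear and free of choices.\<close>

lemma coefficient_product:
  assumes Z: "Z \<in> eigsp D 0" and \<alpha>: "\<alpha> \<in> roots_Vplus D" and \<beta>: "\<beta> \<in> roots_Vplus D"
  shows "Ncoef D \<beta> * Mcoef D Z \<alpha> (\<gamma> - \<beta>) = \<phi> (lbr (Xv D \<beta>) (lbr Z (Xv D \<alpha>)))"
proof -
  let ?R = "roots_Vplus D"
  obtain i c where ic: "i \<in> E" "c \<in> C" "\<beta> = rt i c" using \<beta> by (auto simp: roots_Vplus_eq)
  obtain i' c' where ic': "i' \<in> E" "c' \<in> C" "\<alpha> = rt i' c'" using \<alpha> by (auto simp: roots_Vplus_eq)
  have fin: "finite ?R" by (simp add: roots_Vplus_eq E_def C_def)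
  have "Xv D \<alpha> \<in> eigsp D 1" using X_root_space[of \<alpha>] root_space_eigsp[of \<alpha>] rt_EC_P[OF ic'(1,2)] ic'(3) by auto
  then have ZX: "lbr Z (Xv D \<alpha>) \<in> eigsp D 1" by (rule eigsp_lbr[OF Z])
  define W where "W = lbr Z (Xv D \<alpha>)"
  define m where "m \<delta> = (if \<delta> \<in> ?R then (SOME k. \<exists>j d. j \<in> E \<and> d \<in> C \<and> \<delta> = rt j d \<and> k = coord W j d / root_vector_scale j d) else 0)" for \<delta>
  have m: "m (rt j d) = coord W j d / root_vector_scale j d" if "j \<in> E" "d \<in> C" for j d
  proof -
    have R: "rt j d \<in> ?R" using that by (auto simp: roots_Vplus_eq)
    have "\<exists>k. \<exists>j' d'. j' \<in> E \<and> d' \<in> C \<and> rt j d = rt j' d' \<and> k = coord W j' d' / root_vector_scale j' d'" using that by blast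
    from someI_ex[OF this] obtain j' d' where jd: "j' \<in> E" "d' \<in> C" "rt j d = rt j' d'" "m (rt j d) = coord W j' d' / root_vector_scale j' d'"
      using R by (auto simp: m_def)
    have "(j, d) = (j', d')" using inj_onD[OF rt_EC_inj, of "(j, d)" "(j', d')"] jd that by simp
    then show ?thesis using jd by simp
  qed
  have W: "W = (\<Sum>\<delta>\<in>?R. m \<delta> *\<^sub>C Xv D \<delta>)"
    unfolding sum_roots_Vplus using eigsp_1_span[OF ZX[folded W_def]] m by (simp cong: sum.cong)
  have uniq: "m' = m" if "\<forall>\<delta>. \<delta> \<notin> ?R \<longrightarrow> m' \<delta> = 0" "W = (\<Sum>\<delta>\<in>?R. m' \<delta> *\<^sub>C Xv D \<delta>)" for m'
  proof
    fix \<delta>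
    show "m' \<delta> = m \<delta>"
    proof (cases "\<delta> \<in> ?R")
      case True
      then obtain j d where jd: "j \<in> E" "d \<in> C" "\<delta> = rt j d" by (auto simp: roots_Vplus_eq)
      have "(\<Sum>\<delta>\<in>?R. (m' \<delta> - m \<delta>) *\<^sub>C Xv D \<delta>) = 0"
        using W that(2) by (simp add: cmat.scale_left_diff_distrib sum_subtractf)
      then have "m' (rt j d) - m (rt j d) = 0"
        using X_EC_independent[of "\<lambda>\<delta>. m' \<delta> - m \<delta>", OF _ jd(1,2)] unfolding sum_roots_Vplus by simp
      then show ?thesis using jd(3) by simp
    qed (use that(1) in \<open>simp add: m_def\<close>)
  qed
  have M: "Mcoef D Z \<alpha> = m"
    unfolding Mcoef_def W_def[symmetric]
  proof (rule the_equality)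
    have "\<forall>\<delta>. \<delta> \<notin> ?R \<longrightarrow> m \<delta> = 0" by (simp add: m_def)
    then show "(\<forall>\<delta>. \<delta> \<notin> ?R \<longrightarrow> m \<delta> = 0) \<and> W = (\<Sum>\<delta>\<in>?R. m \<delta> *\<^sub>C Xv D \<delta>)" using W by (rule conjI)
  next
    fix m' assume "(\<forall>\<delta>. \<delta> \<notin> ?R \<longrightarrow> m' \<delta> = 0) \<and> W = (\<Sum>\<delta>\<in>?R. m' \<delta> *\<^sub>C Xv D \<delta>)"
    then show "m' = m" by (elim conjE) (rule uniq)
  qed
  show ?thesis
  proof -
    define \<beta>' where "\<beta>' = \<gamma> - \<beta>"
    define i2 where "i2 = 3 - i"
    have i12: "i = 1 \<and> i2 = 2 \<or> i = 2 \<and> i2 = 1" using ic(1) unfolding E_def i2_def by auto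
    then have i2: "i2 \<in> E" unfolding E_def by auto
    have b': "\<beta>' = rt i2 (- c)"
      using i12 by (elim disjE conjE) (simp_all add: \<beta>'_def gamma rt_def ic(3) eps_uminus[OF EC_I(2)[OF ic(2)]])
    have mc: "- c \<in> C" using ic(2) unfolding C_def by auto
    have b'R: "\<beta>' \<in> ?R" unfolding b' roots_Vplus_eq using i2 mc by (intro image_eqI[of _ _ "(i2, - c)"]) auto
    have N: "lbr (Xv D \<beta>) (Xv D \<beta>') = \<phi> (lbr (Xv D \<beta>) (Xv D \<beta>')) *\<^sub>C Xv D \<gamma>"
      using lbr_X_EC(1)[OF ic(1,2) i2 mc] by (simp add: ic(3) b')
    have Nc: "Ncoef D \<beta> = \<phi> (lbr (Xv D \<beta>) (Xv D \<beta>'))"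
      unfolding Ncoef_def \<beta>'_def[symmetric]
    proof (rule the_equality)
      fix k assume "lbr (Xv D \<beta>) (Xv D \<beta>') = k *\<^sub>C Xv D \<gamma>"
      then show "k = \<phi> (lbr (Xv D \<beta>) (Xv D \<beta>'))" by (simp add: phi_X)
    qed (rule N)
    have z: "lbr (Xv D \<beta>) (Xv D \<delta>) = 0" if "\<delta> \<in> ?R" "\<delta> \<noteq> \<beta>'" for \<delta>
    proof -
      obtain j d where "j \<in> E" "d \<in> C" "\<delta> = rt j d" using \<open>\<delta> \<in> ?R\<close> by (auto simp: roots_Vplus_eq)
      then show ?thesis using lbr_X_EC(2)[OF ic(1,2), of j d] that(2) by (simp add: ic(3) \<beta>'_def)
    qed
    have "\<phi> (lbr (Xv D \<beta>) W) = (\<Sum>\<delta>\<in>?R. m \<delta> * \<phi> (lbr (Xv D \<beta>) (Xv D \<delta>)))"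
      by (subst W) (simp add: lbr_sum phi_sum lbr_bilinear phi_linear)
    also have "\<dots> = (\<Sum>\<delta>\<in>?R. if \<delta> = \<beta>' then m \<beta>' * \<phi> (lbr (Xv D \<beta>) (Xv D \<beta>')) else 0)"
      by (intro sum.cong refl) (use z in \<open>auto simp: phi_linear\<close>)
    also have "\<dots> = m \<beta>' * \<phi> (lbr (Xv D \<beta>) (Xv D \<beta>'))" using fin b'R by simp
    finally show ?thesis unfolding M Nc W_def \<beta>'_def by (simp add: mult.commute)
  qed
qed

lemma levi_wedges: "wedge (e i) (f j) \<in> levi D" "wedge (v a) (v b) \<in> levi D"
  by (simp_all add: levi_eq wedge_grades)

lemma ctr_lbr: "Z \<in> levi D \<Longrightarrow> W \<in> levi D \<Longrightarrow> ctr (lbr Z W) = 0"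
proof -
  assume Z: "Z \<in> levi D" and W: "W \<in> levi D"
  then have so: "Z \<in> so8" "W \<in> so8" by (auto simp: levi_eq eigsp_so8)
  have ex: "Z *v e i = (\<Sum>j\<in>UNIV. cdot (f j) (Z *v e i) *s e j)" if "Z \<in> levi D" for Z i
    using vec_frame_expand[of "Z *v e i"] eigsp_cdot_frame[OF that[unfolded levi_eq]] by simp
  have tr: "cdot (f i) (Z *v (W *v e i)) = (\<Sum>j\<in>UNIV. cdot (f j) (W *v e i) * cdot (f i) (Z *v e j))"
    if "Z \<in> levi D" "W \<in> levi D" for Z W i
    by (subst ex[OF that(2)]) (simp add: mv_sum cdot_sum_right)
  show ?thesis
    by (simp add: ctr_def lbr_mv tr[OF Z W] tr[OF W Z] sum_2 algebra_simps)
qed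

lemma ctr_linear: "ctr (A + B) = ctr A + ctr B" "ctr (k *\<^sub>C A) = k * ctr A" "ctr 0 = 0"
  by (simp_all add: ctr_def algebra_simps)

lemma levi_ss_ctr: "Z \<in> levi_ss D \<Longrightarrow> ctr Z = 0 \<and> Z \<in> eigsp D 0"
  unfolding levi_ss_def
proof (induction rule: cmat.span_induct_alt)
  case base
  then show ?case using cmat.subspace_0[OF eigsp_subspace] by (simp add: ctr_linear)
next
  case (step c x y)
  then obtain Z W where ZW: "x = lbr Z W" "Z \<in> levi D" "W \<in> levi D" by blast
  then have "x \<in> eigsp D 0" using eigsp_lbr by (simp add: levi_eq)
  then show ?case using step ZW ctr_lbr cmat.subspace_add[OF eigsp_subspace] cmat.subspace_scale[OF eigsp_subspace]
    by (simp add: ctr_linear)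
qed

lemma levi_ss_lbr: "Z \<in> levi D \<Longrightarrow> W \<in> levi D \<Longrightarrow> lbr Z W \<in> levi_ss D"
  unfolding levi_ss_def by (rule cmat.span_base) blast

lemma levi_ss_mem: "i \<noteq> j \<Longrightarrow> wedge (e i) (f j) \<in> levi_ss D" "wedge (e 1) (f 1) - wedge (e 2) (f 2) \<in> levi_ss D"
   "wedge (v a) (v b) \<in> levi_ss D"
proof -
  show "wedge (e i) (f j) \<in> levi_ss D" if "i \<noteq> j"
    using levi_ss_lbr[OF levi_wedges(1)[of i i] levi_wedges(1)[of i j]] that by (simp add: lbr_wedge wedge_bilinear)
  have "lbr (wedge (e 1) (f 2)) (wedge (e 2) (f 1)) = wedge (e 1) (f 1) - wedge (e 2) (f 2)"
    by (simp add: lbr_wedge wedge_bilinear)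
  then show "wedge (e 1) (f 1) - wedge (e 2) (f 2) \<in> levi_ss D"
    using levi_ss_lbr[OF levi_wedges(1)[of 1 2] levi_wedges(1)[of 2 1]] by simp
  show "wedge (v a) (v b) \<in> levi_ss D"
  proof (cases "a = b")
    case True
    then show ?thesis by (simp add: wedge_bilinear levi_ss_def cmat.span_zero)
  next
    case False
    have "card {a, b} < CARD(4)" by (simp add: card_insert_if)
    then have "{a, b} \<noteq> UNIV" by (metis less_irrefl)
    then obtain c where c: "c \<noteq> a" "c \<noteq> b" by blast
    then have "lbr (wedge (v a) (v c)) (wedge (v c) (v b)) = wedge (v a) (v b)"
      using False by (simp add: lbr_wedge wedge_bilinear)
    then show ?thesis using levi_ss_lbr[OF levi_wedges(2)[of a c] levi_wedges(2)[of c b]] by simp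
  qed
qed

text \<open>The trace on \<open>E\<close> vanishes on the derived algebra but not on
  \<open>H\<^sub>\<gamma>\<close>, so the sum is direct.\<close>

lemma proj_levi_ss:
  assumes "Z' \<in> levi_ss D"
  shows "proj_along (levi_ss D) (range (\<lambda>c. c *\<^sub>C Hg)) (Z' + k *\<^sub>C Hg) = Z'"
  unfolding proj_along_def
proof (rule the_equality)
  show "Z' \<in> levi_ss D \<and> (\<exists>w\<in>range (\<lambda>c. c *\<^sub>C Hg). Z' + k *\<^sub>C Hg = Z' + w)" using assms by blast
next
  fix z assume "z \<in> levi_ss D \<and> (\<exists>w\<in>range (\<lambda>c. c *\<^sub>C Hg). Z' + k *\<^sub>C Hg = z + w)"
  then obtain l where l: "z \<in> levi_ss D" "Z' + k *\<^sub>C Hg = z + l *\<^sub>C Hg" by blast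
  have "ctr (Z' + k *\<^sub>C Hg) = ctr (z + l *\<^sub>C Hg)" using l(2) by simp
  then have "k * ctr Hg = l * ctr Hg" using levi_ss_ctr[OF assms] levi_ss_ctr[OF l(1)] by (simp add: ctr_linear)
  moreover have "ctr Hg = 2" by (simp add: ctr_def)
  ultimately show "z = Z'" using l(2) by simp
qed

end

section \<open>Invariant vector fields on the opposite nilpotent group\<close>

lemma mat_distrib: "(A + B) ** C = A ** C + B ** C" "C ** (A + B) = C ** A + C ** B"
  "(A - B) ** C = A ** C - B ** C" "C ** (A - B) = C ** A - C ** B"
  "(- A) ** C = - (A ** C)" "C ** (- A) = - (C ** A)"
  "(r *\<^sub>R A) ** C = r *\<^sub>R (A ** C)" "C ** (r *\<^sub>R A) = r *\<^sub>R (C ** A)"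
  for A B C :: mat8 and r :: real
  by (simp_all add: matrix_matrix_mult_def vec_eq_iff algebra_simps sum.distrib sum_subtractf sum_negf scaleR_sum_right)

lemma bounded_linear_mat_mul: "bounded_linear (\<lambda>x :: mat8. x ** A)" "bounded_linear (\<lambda>x :: mat8. A ** x)" for A :: mat8
proof -
  have "linear (\<lambda>x :: mat8. x ** A)" by (rule linearI) (simp_all add: mat_distrib)
  moreover have "linear (\<lambda>x :: mat8. A ** x)" by (rule linearI) (simp_all add: mat_distrib)
  ultimately show "bounded_linear (\<lambda>x :: mat8. x ** A)" "bounded_linear (\<lambda>x :: mat8. A ** x)"
    by (simp_all add: linear_conv_bounded_linear)
qed

lemma mat_mul_cscale: "A ** (c *\<^sub>C B) = c *\<^sub>C (A ** B)" "(c *\<^sub>C A) ** B = c *\<^sub>C (A ** B)"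
  by (simp_all add: matrix_matrix_mult_def cscale_def vec_eq_iff sum_distrib_left mult.assoc mult.left_commute)

lemma linear_fun_bounded: "bounded_linear (\<lambda>x. cdot w (x *v \<xi>))"
proof -
  have "linear (\<lambda>x. cdot w (x *v \<xi>))"
    by (rule linearI) (simp_all add: cdot_def matrix_vector_mult_def scaleR_conv_of_real[where 'a = complex] sum_distrib_left sum.distrib algebra_simps)
  then show ?thesis by (simp add: linear_conv_bounded_linear)
qed

text \<open>The series terminates.\<close>

lemma mexp_nilpotent:
  assumes "A ** A ** A = 0"
  shows "mexp A = mat 1 + A + (1 / 2) *\<^sub>R (A ** A)"
proof -
  have p: "((**) A ^^ n) (mat 1) = 0" if "n \<ge> 3" for n
    using that
  proof (induction n rule: dec_induct)
    case base
    show ?case using assms by (simp add: numeral_3_eq_3 matrix_mul_assoc)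
  next
    case (step n)
    then show ?case by simp
  qed
  have "(\<lambda>n. (1 / fact n) *\<^sub>R (((**) A ^^ n) (mat 1))) sums (\<Sum>n\<in>{..<3}. (1 / fact n) *\<^sub>R (((**) A ^^ n) (mat 1)))"
    by (rule sums_finite) (simp_all add: p)
  then have "mexp A = (\<Sum>n\<in>{..<3}. (1 / fact n) *\<^sub>R (((**) A ^^ n) (mat 1)))"
    unfolding mexp_def by (rule sums_unique[symmetric])
  then show ?thesis by (simp add: numeral_3_eq_3 fact_numeral numeral_2_eq_2)
qed

definition expn :: "mat8 \<Rightarrow> mat8" where "expn A = mat 1 + A + (1 / 2) *\<^sub>R (A ** A)"

lemma smooth_funsI:
  assumes "\<And>x. x \<in> M \<Longrightarrow> \<exists>U F. open U \<and> x \<in> U \<and> smooth_on U F \<and> (\<forall>y\<in>M \<inter> U. F y = f y)"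
    and "\<And>x. x \<notin> M \<Longrightarrow> f x = 0"
  shows "f \<in> smooth_funs M"
  using assms by (auto simp: smooth_funs_def smooth_on_def)

lemma smooth_funsE:
  assumes "f \<in> smooth_funs M" "x \<in> M"
  obtains U F where "open U" "x \<in> U" "smooth_on U F" "\<forall>y\<in>M \<inter> U. F y = f y"
proof -
  have "\<exists>U F. open U \<and> x \<in> U \<and> (\<forall>k. Ck_on k U F) \<and> (\<forall>y\<in>M \<inter> U. F y = f y)"
    using assms unfolding smooth_funs_def by simp
  then show ?thesis using that unfolding smooth_on_def by blast
qed

lemma smooth_funs_off: "f \<in> smooth_funs M \<Longrightarrow> x \<notin> M \<Longrightarrow> f x = 0"
  by (simp add: smooth_funs_def)

lemma smooth_on_subset: "smooth_on U f \<Longrightarrow> V \<subseteq> U \<Longrightarrow> smooth_on V f"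
  unfolding smooth_on_def using Ck_on_subset by blast

lemma smooth_on_add: "open U \<Longrightarrow> smooth_on U f \<Longrightarrow> smooth_on U g \<Longrightarrow> smooth_on U (\<lambda>x. f x + g x)"
  unfolding smooth_on_def using Ck_on_add by blast

lemma smooth_on_mult: "open U \<Longrightarrow> smooth_on U f \<Longrightarrow> smooth_on U g \<Longrightarrow> smooth_on U (\<lambda>x. f x * g x)"
  for f g :: "_ \<Rightarrow> complex"
  unfolding smooth_on_def using Ck_on_mult by blast

lemma smooth_on_const: "smooth_on U (\<lambda>x. c)"
  unfolding smooth_on_def using Ck_on_const by blast

lemma smooth_on_linear: "bounded_linear f \<Longrightarrow> smooth_on U f"
  unfolding smooth_on_def using Ck_on_bounded_linear by blast

lemma smooth_funs_add: "f \<in> smooth_funs M \<Longrightarrow> g \<in> smooth_funs M \<Longrightarrow> (\<lambda>x. f x + g x) \<in> smooth_funs M"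
proof (rule smooth_funsI)
  fix x assume f: "f \<in> smooth_funs M" and g: "g \<in> smooth_funs M" and x: "x \<in> M"
  obtain U F where U: "open U" "x \<in> U" "smooth_on U F" "\<forall>y\<in>M \<inter> U. F y = f y"
    by (rule smooth_funsE[OF f x]) (rule that)
  obtain V G where V: "open V" "x \<in> V" "smooth_on V G" "\<forall>y\<in>M \<inter> V. G y = g y"
    by (rule smooth_funsE[OF g x]) (rule that)
  have "smooth_on (U \<inter> V) (\<lambda>x. F x + G x)"
    by (rule smooth_on_add[OF open_Int[OF U(1) V(1)] smooth_on_subset[OF U(3) Int_lower1]
            smooth_on_subset[OF V(3) Int_lower2]])
  then show "\<exists>U F. open U \<and> x \<in> U \<and> smooth_on U F \<and> (\<forall>y\<in>M \<inter> U. F y = f y + g y)"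
    using U V by (intro exI[of _ "U \<inter> V"] exI[of _ "\<lambda>x. F x + G x"]) auto
qed (simp add: smooth_funs_off)

lemma smooth_funs_mult: "f \<in> smooth_funs M \<Longrightarrow> g \<in> smooth_funs M \<Longrightarrow> (\<lambda>x. f x * g x) \<in> smooth_funs M"
proof (rule smooth_funsI)
  fix x assume f: "f \<in> smooth_funs M" and g: "g \<in> smooth_funs M" and x: "x \<in> M"
  obtain U F where U: "open U" "x \<in> U" "smooth_on U F" "\<forall>y\<in>M \<inter> U. F y = f y"
    by (rule smooth_funsE[OF f x]) (rule that)
  obtain V G where V: "open V" "x \<in> V" "smooth_on V G" "\<forall>y\<in>M \<inter> V. G y = g y"
    by (rule smooth_funsE[OF g x]) (rule that)
  have "smooth_on (U \<inter> V) (\<lambda>x. F x * G x)"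
    by (rule smooth_on_mult[OF open_Int[OF U(1) V(1)] smooth_on_subset[OF U(3) Int_lower1]
            smooth_on_subset[OF V(3) Int_lower2]])
  then show "\<exists>U F. open U \<and> x \<in> U \<and> smooth_on U F \<and> (\<forall>y\<in>M \<inter> U. F y = f y * g y)"
    using U V by (intro exI[of _ "U \<inter> V"] exI[of _ "\<lambda>x. F x * G x"]) auto
qed (simp add: smooth_funs_off)

text \<open>Restriction to \<open>M\<close>, extended by 0 as required for elements of
  \<open>smooth_funs M\<close>.\<close>

definition res :: "mat8 set \<Rightarrow> (mat8 \<Rightarrow> complex) \<Rightarrow> mat8 \<Rightarrow> complex"
  where "res M F x = (if x \<in> M then F x else 0)"

lemma res_smooth: "smooth_on UNIV F \<Longrightarrow> res M F \<in> smooth_funs M"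
  by (rule smooth_funsI) (auto simp: res_def intro!: exI[of _ UNIV] exI[of _ F])

lemma smooth_funs_cmult: "f \<in> smooth_funs M \<Longrightarrow> (\<lambda>x. c * f x) \<in> smooth_funs M"
proof -
  assume f: "f \<in> smooth_funs M"
  have "(\<lambda>x. c * f x) = (\<lambda>x. res M (\<lambda>_. c) x * f x)"
    using smooth_funs_off[OF f] by (auto simp: res_def fun_eq_iff)
  then show ?thesis using smooth_funs_mult[OF res_smooth[OF smooth_on_const] f] by simp
qed

lemma smooth_funs_zero: "(\<lambda>x. 0) \<in> smooth_funs M"
  using res_smooth[OF smooth_on_const[of UNIV 0], of M] by (simp add: res_def[abs_def])

text \<open>The part of the setting that the calculus with \<open>R\<close> rests on: a real form of
  the opposite nilradical, in which all products of three elements vanish.\<close>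

locale nil_group =
  fixes D :: heis_data
  assumes cx: "complexifies_to (nilbar0 D) (nilbar D)"
    and triple: "\<And>A B C. A \<in> nilbar D \<Longrightarrow> B \<in> nilbar D \<Longrightarrow> C \<in> nilbar D \<Longrightarrow> A ** B ** C = 0"
    and nb_sub: "cmat.subspace (nilbar D)"
    and nb_lbr: "\<And>A B. A \<in> nilbar D \<Longrightarrow> B \<in> nilbar D \<Longrightarrow> lbr A B \<in> nilbar D"
    and G0_group: "matrix_group (G0 D)"
begin

abbreviation M where "M \<equiv> Nbar0 D"
abbreviation V0 where "V0 \<equiv> nilbar0 D"
abbreviation V where "V \<equiv> nilbar D"
abbreviation S where "S \<equiv> smooth_funs (Nbar0 D)"

lemma V0_sub: "subspace V0" and bij: "bij_betw (\<lambda>(A, B). A + \<i> *\<^sub>C B) (V0 \<times> V0) V"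
  using cx by (auto simp: complexifies_to_def)

lemma V0_V: "A \<in> V0 \<Longrightarrow> A \<in> V" by (simp add: nilbar0_def)

lemma mexp_V: "A \<in> V \<Longrightarrow> mexp A = expn A"
  unfolding expn_def by (rule mexp_nilpotent) (rule triple)

lemma M_eq: "M = \<Inter>{G. matrix_group G \<and> mexp ` V0 \<subseteq> G}"
  by (simp add: Nbar0_def connected_lie_group_def)

lemma M_least: "matrix_group G \<Longrightarrow> mexp ` V0 \<subseteq> G \<Longrightarrow> M \<subseteq> G"
  unfolding M_eq by (rule Inter_lower) simp

lemma mexp_M: "A \<in> V0 \<Longrightarrow> mexp A \<in> M"
  unfolding M_eq by (auto simp: image_subset_iff)

lemma M_G0: "M \<subseteq> G0 D"
proof (rule M_least[OF G0_group])
  show "mexp ` V0 \<subseteq> G0 D"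
  proof
    fix x assume "x \<in> mexp ` V0"
    then obtain A where A: "A \<in> V0" "x = mexp A" by blast
    then have "\<forall>t. mexp (t *\<^sub>R A) \<in> G0 D" by (simp add: nilbar0_def lie_alg_def)
    from this[rule_format, of 1] show "x \<in> G0 D" using A by simp
  qed
qed

lemma M_group: "matrix_group M"
  unfolding matrix_group_def
proof (intro conjI ballI)
  show "mat 1 \<in> M" by (simp add: M_eq matrix_group_def)
next
  fix a assume a: "a \<in> M"
  then show "matrix_inv a \<in> M" by (simp add: M_eq matrix_group_def)
  have "a \<in> G0 D" using a M_G0 by blast
  then show "invertible a" using G0_group by (simp add: matrix_group_def)
next
  fix a b assume "a \<in> M" "b \<in> M"
  then show "a ** b \<in> M" by (simp add: M_eq matrix_group_def)
qed

lemma M_mult: "a \<in> M \<Longrightarrow> b \<in> M \<Longrightarrow> a ** b \<in> M"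
  using M_group by (simp add: matrix_group_def)

lemma V_decomp:
  assumes "Z \<in> V"
  obtains A B where "A \<in> V0" "B \<in> V0" "Z = A + \<i> *\<^sub>C B"
proof -
  have "Z \<in> (\<lambda>(A, B). A + \<i> *\<^sub>C B) ` (V0 \<times> V0)" using assms bij by (simp add: bij_betw_def)
  then show ?thesis using that by auto
qed

lemma clin_ext_V0:
  assumes "A \<in> V0" "B \<in> V0"
  shows "clin_ext V0 \<phi> (A + \<i> *\<^sub>C B) = \<phi> A + \<i> * \<phi> B"
proof -
  have "inv_into (V0 \<times> V0) (\<lambda>(A, B). A + \<i> *\<^sub>C B) ((\<lambda>(A, B). A + \<i> *\<^sub>C B) (A, B)) = (A, B)"
    using assms bij by (intro inv_into_f_f) (auto simp: bij_betw_def)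
  then show ?thesis by (simp add: clin_ext_def)
qed

text \<open>The real Lie algebra is defined through one parameter groups, so closure under brackets
  needs an argument. Because triple products vanish, \<open>exp(tA) exp(B) exp(-tA) exp(-B) = exp(t
  [A, B])\<close> exactly.\<close>

lemma V0_lbr:
  assumes A: "A \<in> V0" and B: "B \<in> V0"
  shows "lbr A B \<in> V0"
proof -
  have AV: "A \<in> V" and BV: "B \<in> V" using A B V0_V by auto
  have "mexp (t *\<^sub>R lbr A B) \<in> G0 D" for t :: real
  proof -
    define X where "X = t *\<^sub>R A"
    have X0: "X \<in> V0" using A V0_sub by (simp add: X_def subspace_scale)
    then have X: "X \<in> V" by (rule V0_V)
    have C: "lbr X B \<in> V" using nb_lbr X BV by blast
    have neg: "- X \<in> V0" "- B \<in> V0" using X0 B V0_sub by (simp_all add: subspace_neg)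
    have e: "lbr X B = t *\<^sub>R lbr A B"
      by (simp add: lbr_def X_def mat_distrib scaleR_right_diff_distrib)
    have t: "X ** (X ** X) = 0" "X ** (X ** B) = 0" "X ** (B ** X) = 0" "B ** (X ** X) = 0"
      "X ** (B ** B) = 0" "B ** (X ** B) = 0" "B ** (B ** X) = 0" "B ** (B ** B) = 0"
      using triple X BV by (simp_all add: matrix_mul_assoc)
    define hX where "hX = (1 / 2) *\<^sub>R (X ** X)"
    define hB where "hB = (1 / 2) *\<^sub>R (B ** B)"
    have sq: "X ** X = hX + hX" "B ** B = hB + hB"
      unfolding hX_def hB_def by (simp_all flip: scaleR_add_left)
    have zr: "X ** hX = 0" "X ** hB = 0" "B ** hX = 0" "B ** hB = 0"
      by (simp_all add: hX_def hB_def mat_distrib t)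
    have zl: "hX ** X = 0" "hX ** B = 0" "hB ** X = 0" "hB ** B = 0"
      using t by (simp_all add: hX_def hB_def mat_distrib flip: matrix_mul_assoc)
    have zl': "hX ** (X ** W) = 0" "hX ** (B ** W) = 0" "hB ** (X ** W) = 0" "hB ** (B ** W) = 0" for W
      by (simp_all add: matrix_mul_assoc zl)
    have zz: "hX ** hX = 0" "hX ** hB = 0" "hB ** hX = 0" "hB ** hB = 0"
      by (simp_all add: hX_def[of] hB_def mat_distrib flip: matrix_mul_assoc)
        (simp_all add: t)
    have z4: "X ** (B ** (X ** B)) = 0" "X ** (B ** (B ** X)) = 0" "B ** (X ** (X ** B)) = 0" "B ** (X ** (B ** X)) = 0"
      by (simp_all add: t)
    \<comment> \<open>With \<open>hX\<close> and \<open>hB\<close> the half squares, all products of three or more factors vanish.\<close>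
    have P: "expn X ** expn B = mat 1 + X + B + X ** B + hX + hB"
      by (simp add: expn_def mat_distrib t flip: matrix_mul_assoc hX_def hB_def)
        (simp add: zr zl zz algebra_simps)
    have Q: "expn (- X) ** expn (- B) = mat 1 - X - B + X ** B + hX + hB"
      by (simp add: expn_def mat_distrib t flip: matrix_mul_assoc hX_def hB_def)
        (simp add: zr zl zz algebra_simps)
    have "expn X ** expn B ** (expn (- X) ** expn (- B)) = mat 1 + lbr X B"
      unfolding P Q by (simp add: mat_distrib t zr zl zl' zz z4 lbr_def flip: matrix_mul_assoc)
        (simp add: sq algebra_simps)
    also have "mat 1 + lbr X B = expn (lbr X B)"
      by (simp add: expn_def lbr_def mat_distrib z4 flip: matrix_mul_assoc)
    finally have "mexp (t *\<^sub>R lbr A B) = mexp X ** mexp B ** (mexp (- X) ** mexp (- B))"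
      using X BV C neg V0_V by (simp add: mexp_V e)
    moreover have "mexp X \<in> G0 D" "mexp B \<in> G0 D" "mexp (- X) \<in> G0 D" "mexp (- B) \<in> G0 D"
      using X0 B neg mexp_M M_G0 by auto
    ultimately show ?thesis using G0_group by (simp add: matrix_group_def)
  qed
  then show ?thesis using nb_lbr[OF AV BV] by (simp add: nilbar0_def lie_alg_def)
qed

lemma mexp_line:
  assumes "A \<in> V0"
  shows "mexp (t *\<^sub>R A) = mat 1 + t *\<^sub>R A + (t * t / 2) *\<^sub>R (A ** A)"
proof -
  have tA: "t *\<^sub>R A \<in> V" using assms V0_sub V0_V by (simp add: subspace_scale)
  show ?thesis by (simp add: mexp_V[OF tA] expn_def mat_distrib)
qed

lemma curve_derivative:
  fixes n :: mat8
  assumes "A \<in> V0"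
  shows "((\<lambda>t::real. n ** mexp (t *\<^sub>R A)) has_vector_derivative n ** A) (at 0)"
proof -
  have "((\<lambda>t. mat 1 + t *\<^sub>R A + (t * t / 2) *\<^sub>R (A ** A)) has_vector_derivative A) (at 0)"
    unfolding has_vector_derivative_def by (auto intro!: derivative_eq_intros)
  then have "((\<lambda>t. mexp (t *\<^sub>R A)) has_vector_derivative A) (at 0)" by (simp add: mexp_line[OF assms])
  then show ?thesis by (rule bounded_linear.has_vector_derivative[OF bounded_linear_mat_mul(2)[of n]])
qed

lemma curve_in_M: "n \<in> M \<Longrightarrow> A \<in> V0 \<Longrightarrow> n ** mexp (t *\<^sub>R A) \<in> M"
  using M_mult mexp_M V0_sub by (simp add: subspace_scale)

text \<open>The curve \<open>n exp(tA)\<close> stays in \<open>M\<close> and has the velocity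
  \<open>n A\<close>, so that the derivative along it can be computed with any local extension
  \<open>F\<close>, and is independent of the extension.\<close>

lemma Rop_real:
  assumes U: "open U" "n \<in> U" "smooth_on U F" "\<forall>y\<in>M \<inter> U. F y = f y"
    and n: "n \<in> M" and A: "A \<in> V0"
  shows "vector_derivative (\<lambda>t::real. f (n ** mexp (t *\<^sub>R A))) (at 0) = frechet_derivative F (at n) (n ** A)"
proof (rule vector_derivative_at)
  let ?c = "\<lambda>t::real. n ** mexp (t *\<^sub>R A)"
  have c0: "?c 0 = n" by (simp add: mexp_line[OF A, of 0, simplified])
  have "(F has_derivative frechet_derivative F (at n)) (at (?c 0))"
    using smooth_on_has_derivative[OF U(1,3,2)] c0 by simp
  then have "(F has_derivative frechet_derivative F (at n)) (at (?c 0) within range ?c)"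
    by (rule has_derivative_at_withinI)
  from vector_derivative_diff_chain_within[OF curve_derivative[OF A] this]
  have d: "((\<lambda>t. F (?c t)) has_vector_derivative frechet_derivative F (at n) (n ** A)) (at 0)"
    by (simp add: o_def)
  have "continuous_on UNIV ?c"
    unfolding mexp_line[OF A] mat_distrib by (intro continuous_intros) auto
  then have o: "open (?c -` U)" using U(1) by (simp add: open_vimage)
  have 0: "0 \<in> ?c -` U" using c0 U(2) by simp
  show "((\<lambda>t. f (?c t)) has_vector_derivative frechet_derivative F (at n) (n ** A)) (at 0)"
    by (rule has_vector_derivative_transform_within_open[OF d o 0]) (use U(4) curve_in_M[OF n A] in auto)
qed

lemma Rop_local:
  assumes U: "open U" "n \<in> U" "smooth_on U F" "\<forall>y\<in>M \<inter> U. F y = f y"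
    and n: "n \<in> M" and AB: "A \<in> V0" "B \<in> V0"
  shows "Rop D (A + \<i> *\<^sub>C B) f n = frechet_derivative F (at n) (n ** A) + \<i> * frechet_derivative F (at n) (n ** B)"
  unfolding Rop_def clin_ext_V0[OF AB] using Rop_real[OF U n AB(1)] Rop_real[OF U n AB(2)] n by simp

lemma Rop_off: "n \<notin> M \<Longrightarrow> Rop D Z f n = 0"
  by (simp add: Rop_def)

lemma Rop_smooth:
  assumes Z: "Z \<in> V" and f: "f \<in> S"
  shows "Rop D Z f \<in> S"
proof (rule smooth_funsI)
  fix x assume x: "x \<in> M"
  obtain A B where AB: "A \<in> V0" "B \<in> V0" "Z = A + \<i> *\<^sub>C B" using V_decomp[OF Z] .
  obtain U F where U: "open U" "x \<in> U" "smooth_on U F" "\<forall>y\<in>M \<inter> U. F y = f y"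
    by (rule smooth_funsE[OF f x]) (rule that)
  have "smooth_on U (\<lambda>y. frechet_derivative F (at y) (y ** A) + \<i> * frechet_derivative F (at y) (y ** B))"
    by (intro smooth_on_add smooth_on_mult smooth_on_directional smooth_on_const U bounded_linear_mat_mul)
  moreover have "Rop D Z f y = frechet_derivative F (at y) (y ** A) + \<i> * frechet_derivative F (at y) (y ** B)"
    if "y \<in> M" "y \<in> U" for y
    unfolding AB(3) by (rule Rop_local[OF U(1) that(2) U(3,4) that(1) AB(1,2)])
  ultimately show "\<exists>U F. open U \<and> x \<in> U \<and> smooth_on U F \<and> (\<forall>y\<in>M \<inter> U. F y = Rop D Z f y)"
    using U(1,2) by (intro exI[of _ U] exI) auto
qed (rule Rop_off)

lemma frechet_linear:
  assumes "open U" "n \<in> U" "smooth_on U F"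
  shows "frechet_derivative F (at n) (x + y) = frechet_derivative F (at n) x + frechet_derivative F (at n) y"
    "frechet_derivative F (at n) (r *\<^sub>R x) = of_real r * (frechet_derivative F (at n) x :: complex)"
proof -
  have "linear (frechet_derivative F (at n))"
    using smooth_on_has_derivative[OF assms(1,3,2)] has_derivative_linear by blast
  then show "frechet_derivative F (at n) (x + y) = frechet_derivative F (at n) x + frechet_derivative F (at n) y"
    "frechet_derivative F (at n) (r *\<^sub>R x) = of_real r * frechet_derivative F (at n) x"
    by (simp_all add: linear_add linear_cmul scaleR_conv_of_real)
qed

lemma Rop_add:
  assumes Z: "Z \<in> V" and f: "f \<in> S" and g: "g \<in> S"
  shows "Rop D Z (\<lambda>x. f x + g x) = (\<lambda>x. Rop D Z f x + Rop D Z g x)"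
proof
  fix x
  show "Rop D Z (\<lambda>x. f x + g x) x = Rop D Z f x + Rop D Z g x"
  proof (cases "x \<in> M")
    case x: True
    obtain A B where AB: "A \<in> V0" "B \<in> V0" "Z = A + \<i> *\<^sub>C B" using V_decomp[OF Z] .
    obtain U F where U: "open U" "x \<in> U" "smooth_on U F" "\<forall>y\<in>M \<inter> U. F y = f y"
      by (rule smooth_funsE[OF f x]) (rule that)
    obtain W G where W: "open W" "x \<in> W" "smooth_on W G" "\<forall>y\<in>M \<inter> W. G y = g y"
      by (rule smooth_funsE[OF g x]) (rule that)
    have s: "smooth_on (U \<inter> W) (\<lambda>x. F x + G x)"
    by (rule smooth_on_add[OF open_Int[OF U(1) W(1)] smooth_on_subset[OF U(3) Int_lower1]
            smooth_on_subset[OF W(3) Int_lower2]])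
    have "frechet_derivative (\<lambda>x. F x + G x) (at x) = (\<lambda>h. frechet_derivative F (at x) h + frechet_derivative G (at x) h)"
      using has_derivative_add[OF smooth_on_has_derivative[OF U(1,3,2)] smooth_on_has_derivative[OF W(1,3,2)]]
      by (rule frechet_derivative_at[symmetric])
    then show ?thesis
      unfolding AB(3) Rop_local[OF U x AB(1,2)] Rop_local[OF W x AB(1,2)]
      using Rop_local[of "U \<inter> W" x _ "\<lambda>x. f x + g x", OF _ _ s _ x AB(1,2)] U W by (simp add: open_Int algebra_simps)
  qed (simp add: Rop_off)
qed

lemma Rop_mult:
  assumes Z: "Z \<in> V" and f: "f \<in> S" and g: "g \<in> S"
  shows "Rop D Z (\<lambda>x. f x * g x) = (\<lambda>x. Rop D Z f x * g x + f x * Rop D Z g x)"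
proof
  fix x
  show "Rop D Z (\<lambda>x. f x * g x) x = Rop D Z f x * g x + f x * Rop D Z g x"
  proof (cases "x \<in> M")
    case x: True
    obtain A B where AB: "A \<in> V0" "B \<in> V0" "Z = A + \<i> *\<^sub>C B" using V_decomp[OF Z] .
    obtain U F where U: "open U" "x \<in> U" "smooth_on U F" "\<forall>y\<in>M \<inter> U. F y = f y"
      by (rule smooth_funsE[OF f x]) (rule that)
    obtain W G where W: "open W" "x \<in> W" "smooth_on W G" "\<forall>y\<in>M \<inter> W. G y = g y"
      by (rule smooth_funsE[OF g x]) (rule that)
    have s: "smooth_on (U \<inter> W) (\<lambda>x. F x * G x)"
    by (rule smooth_on_mult[OF open_Int[OF U(1) W(1)] smooth_on_subset[OF U(3) Int_lower1]
            smooth_on_subset[OF W(3) Int_lower2]])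
    have "frechet_derivative (\<lambda>x. F x * G x) (at x) = (\<lambda>h. F x * frechet_derivative G (at x) h + frechet_derivative F (at x) h * G x)"
      using has_derivative_mult[OF smooth_on_has_derivative[OF U(1,3,2)] smooth_on_has_derivative[OF W(1,3,2)]]
      by (rule frechet_derivative_at[symmetric])
    moreover have "F x = f x" "G x = g x" using U W x by auto
    ultimately show ?thesis
      unfolding AB(3) Rop_local[OF U x AB(1,2)] Rop_local[OF W x AB(1,2)]
      using Rop_local[of "U \<inter> W" x _ "\<lambda>x. f x * g x", OF _ _ s _ x AB(1,2)] U W by (simp add: open_Int algebra_simps)
  qed (simp add: Rop_off)
qed

text \<open>The matrix coefficients \<open>(w, n \<xi>)\<close> as functions of \<open>n\<close>;
  they are the test functions for independence.\<close>

definition lin :: "complex^8 \<Rightarrow> complex^8 \<Rightarrow> mat8 \<Rightarrow> complex"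
  where "lin w \<xi> = res M (\<lambda>x. cdot w (x *v \<xi>))"

lemma lin_S: "lin w \<xi> \<in> S"
  unfolding lin_def by (rule res_smooth[OF smooth_on_linear[OF linear_fun_bounded]])

lemma Rop_lin:
  assumes Z: "Z \<in> V"
  shows "Rop D Z (lin w \<xi>) = lin w (Z *v \<xi>)"
proof
  fix n
  show "Rop D Z (lin w \<xi>) n = lin w (Z *v \<xi>) n"
  proof (cases "n \<in> M")
    case n: True
    obtain A B where AB: "A \<in> V0" "B \<in> V0" "Z = A + \<i> *\<^sub>C B" using V_decomp[OF Z] .
    have "frechet_derivative (\<lambda>x. cdot w (x *v \<xi>)) (at n) = (\<lambda>x. cdot w (x *v \<xi>))"
      by (rule frechet_derivative_at[symmetric]) (rule bounded_linear_imp_has_derivative[OF linear_fun_bounded])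
    then show ?thesis
      unfolding AB(3)
      using Rop_local[OF open_UNIV UNIV_I smooth_on_linear[OF linear_fun_bounded] _ n AB(1,2), of w \<xi> "lin w \<xi>"] n
      by (simp add: lin_def res_def flip: matrix_vector_mul_assoc)
  qed (simp add: Rop_off lin_def res_def)
qed

lemma res_const_S: "res M (\<lambda>_. c) \<in> S"
  by (rule res_smooth[OF smooth_on_const])

lemma Rop_const: 
  assumes Z: "Z \<in> V"
  shows "Rop D Z (res M (\<lambda>_. c)) = (\<lambda>x. 0)"
proof
  fix n
  show "Rop D Z (res M (\<lambda>_. c)) n = 0"
  proof (cases "n \<in> M")
    case n: True
    obtain A B where AB: "A \<in> V0" "B \<in> V0" "Z = A + \<i> *\<^sub>C B" using V_decomp[OF Z] .
    show ?thesis
      unfolding AB(3)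
      using Rop_local[OF open_UNIV UNIV_I smooth_on_const _ n AB(1,2), of c "res M (\<lambda>_. c)"]
      by (simp add: res_def)
  qed (simp add: Rop_off)
qed

lemma Rop_cmult:
  assumes Z: "Z \<in> V" and f: "f \<in> S"
  shows "Rop D Z (\<lambda>x. c * f x) = (\<lambda>x. c * Rop D Z f x)"
proof -
  have "(\<lambda>x. c * f x) = (\<lambda>x. res M (\<lambda>_. c) x * f x)"
    using smooth_funs_off[OF f] by (auto simp: res_def fun_eq_iff)
  then have "Rop D Z (\<lambda>x. c * f x) = (\<lambda>x. res M (\<lambda>_. c) x * Rop D Z f x)"
    using Rop_mult[OF Z res_const_S f] Rop_const[OF Z] by simp
  also have "\<dots> = (\<lambda>x. c * Rop D Z f x)"
    using Rop_off by (auto simp: res_def fun_eq_iff)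
  finally show ?thesis .
qed

lemma Rop_Z_add:
  assumes Z: "Z \<in> V" "W \<in> V" and f: "f \<in> S"
  shows "Rop D (Z + W) f = (\<lambda>x. Rop D Z f x + Rop D W f x)"
proof
  fix x
  show "Rop D (Z + W) f x = Rop D Z f x + Rop D W f x"
  proof (cases "x \<in> M")
    case x: True
    obtain A B where AB: "A \<in> V0" "B \<in> V0" "Z = A + \<i> *\<^sub>C B" using V_decomp[OF Z(1)] .
    obtain A' B' where AB': "A' \<in> V0" "B' \<in> V0" "W = A' + \<i> *\<^sub>C B'" using V_decomp[OF Z(2)] .
    obtain U F where U: "open U" "x \<in> U" "smooth_on U F" "\<forall>y\<in>M \<inter> U. F y = f y"
      by (rule smooth_funsE[OF f x]) (rule that)
    have e: "Z + W = (A + A') + \<i> *\<^sub>C (B + B')" by (simp add: AB AB' cmat.scale_right_distrib)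
    have "A + A' \<in> V0" "B + B' \<in> V0" using AB AB' V0_sub subspace_add by auto
    from Rop_local[OF U x this] show ?thesis
      unfolding e unfolding AB(3) AB'(3) Rop_local[OF U x AB(1,2)] Rop_local[OF U x AB'(1,2)]
      by (simp add: mat_distrib frechet_linear[OF U(1,2,3)] algebra_simps)
  qed (simp add: Rop_off)
qed

lemma Rop_Z_scale:
  assumes Z: "Z \<in> V" and f: "f \<in> S"
  shows "Rop D (c *\<^sub>C Z) f = (\<lambda>x. c * Rop D Z f x)"
proof
  fix x
  show "Rop D (c *\<^sub>C Z) f x = c * Rop D Z f x"
  proof (cases "x \<in> M")
    case x: True
    obtain A B where AB: "A \<in> V0" "B \<in> V0" "Z = A + \<i> *\<^sub>C B" using V_decomp[OF Z] .
    obtain U F where U: "open U" "x \<in> U" "smooth_on U F" "\<forall>y\<in>M \<inter> U. F y = f y"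
      by (rule smooth_funsE[OF f x]) (rule that)
    define A' where "A' = Re c *\<^sub>R A + (- Im c) *\<^sub>R B"
    define B' where "B' = Im c *\<^sub>R A + Re c *\<^sub>R B"
    have e: "c *\<^sub>C Z = A' + \<i> *\<^sub>C B'"
      by (simp add: AB(3) A'_def B'_def cscale_def vec_eq_iff complex_eq_iff algebra_simps)
    have "A' \<in> V0" "B' \<in> V0"
      unfolding A'_def B'_def by (intro subspace_add[OF V0_sub] subspace_scale[OF V0_sub] AB(1) AB(2))+
    from Rop_local[OF U x this] show ?thesis
      unfolding e unfolding AB(3) Rop_local[OF U x AB(1,2)] unfolding A'_def B'_def
      by (simp only: mat_distrib frechet_linear[OF U(1,2,3)]) (simp add: complex_eq_iff algebra_simps)
  qed (simp add: Rop_off)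
qed

text \<open>The product rule for a directional derivative whose direction depends linearly on the
  point.\<close>

lemma derivative_directional:
  fixes F :: "mat8 \<Rightarrow> complex"
  assumes U: "open U" "n \<in> U" "smooth_on U F" and L: "bounded_linear L"
  shows "frechet_derivative (\<lambda>y. frechet_derivative F (at y) (L y)) (at n) h =
    frechet_derivative F (at n) (L h) + frechet_derivative (\<lambda>y. frechet_derivative F (at y) (L n)) (at n) (h :: mat8)"
    (is "?lhs = _ + ?D2 (L n)")
proof -
  interpret L: bounded_linear L by (rule L)
  let ?d = "\<lambda>w. frechet_derivative F (at n) w"
  have dF: "((\<lambda>y. frechet_derivative F (at y) w) has_derivative (\<lambda>h. frechet_derivative (\<lambda>y. frechet_derivative F (at y) w) (at n) h)) (at n)" for w
    by (rule smooth_on_has_derivative[OF U(1) smooth_on_frechet[OF U(3)] U(2)])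
  have lb: "bounded_linear (\<lambda>y. complex_of_real (L y \<bullet> b))" for b
    by (rule bounded_linear_compose[OF bounded_linear_of_real
          bounded_linear_compose[OF bounded_linear_inner_left L]])
  have "((\<lambda>y. \<Sum>b\<in>Basis. of_real (L y \<bullet> b) * frechet_derivative F (at y) b) has_derivative
      (\<lambda>h. \<Sum>b\<in>Basis. of_real (L n \<bullet> b) * frechet_derivative (\<lambda>y. frechet_derivative F (at y) b) (at n) h + of_real (L h \<bullet> b) * ?d b)) (at n)"
    by (intro has_derivative_sum has_derivative_mult dF bounded_linear_imp_has_derivative lb)
  then have dd: "((\<lambda>y. frechet_derivative F (at y) (L y)) has_derivative
      (\<lambda>h. \<Sum>b\<in>Basis. of_real (L n \<bullet> b) * frechet_derivative (\<lambda>y. frechet_derivative F (at y) b) (at n) h + of_real (L h \<bullet> b) * ?d b)) (at n)"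
    by (rule has_derivative_transform_within_open[OF _ U(1,2)])
      (rule frechet_basis_expansion[OF smooth_on_has_derivative[OF U(1,3)], symmetric])
  have "?lhs = (\<Sum>b\<in>Basis. of_real (L n \<bullet> b) * ?D2 b + of_real (L h \<bullet> b) * ?d b)"
    by (rule fun_cong[OF frechet_derivative_at[OF dd], symmetric])
  then have 1: "?lhs = (\<Sum>b\<in>Basis. of_real (L n \<bullet> b) * ?D2 b) + (\<Sum>b\<in>Basis. of_real (L h \<bullet> b) * ?d b)"
    by (simp only: sum.distrib)
  have 2: "(\<Sum>b\<in>Basis. of_real (L h \<bullet> b) * ?d b) = ?d (L h)"
    by (rule frechet_basis_expansion[OF smooth_on_has_derivative[OF U(1,3,2)], symmetric])
  have sym: "?D2 w = frechet_derivative (\<lambda>y. frechet_derivative F (at y) h) (at n) w" for w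
    by (rule second_derivative_symmetric[OF U(1,3,2)])
  have 3: "(\<Sum>b\<in>Basis. of_real (L n \<bullet> b) * ?D2 b) = ?D2 (L n)"
    unfolding sym by (rule frechet_basis_expansion[OF dF, symmetric])
  show ?thesis unfolding 1 2 3 by simp
qed

lemma Rop_real_eq:
  assumes U: "open U" "n \<in> U" "smooth_on U F" "\<forall>y\<in>M \<inter> U. F y = f y"
    and n: "n \<in> M" and A: "A \<in> V0"
  shows "Rop D A f n = frechet_derivative F (at n) (n ** A)"
proof -
  have "0 \<in> V0" using V0_sub by (simp add: subspace_0)
  moreover have "frechet_derivative F (at n) 0 = 0" using frechet_linear(2)[OF U(1,2,3), of 0 0] by simp
  ultimately show ?thesis using Rop_local[OF U n A, of 0] by simp
qed

text \<open>The second derivatives cancel by symmetry, and the derivatives of the direction \<open>n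
  A\<close> contribute \<open>n (A B - B A)\<close>.\<close>

lemma Rop_commute_real:
  assumes A: "A \<in> V0" and B: "B \<in> V0" and f: "f \<in> S"
  shows "Rop D A (Rop D B f) n - Rop D B (Rop D A f) n = Rop D (lbr A B) f n"
proof (cases "n \<in> M")
  case n: True
  obtain U F where U: "open U" "n \<in> U" "smooth_on U F" "\<forall>y\<in>M \<inter> U. F y = f y"
    by (rule smooth_funsE[OF f n]) (rule that)
  have main: "Rop D X (Rop D Y f) n = frechet_derivative F (at n) (n ** X ** Y) 
      + frechet_derivative (\<lambda>y. frechet_derivative F (at y) (n ** Y)) (at n) (n ** X)" if X: "X \<in> V0" and Y: "Y \<in> V0" for X Y
  proof -
    have G: "smooth_on U (\<lambda>y. frechet_derivative F (at y) (y ** Y))"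
      by (intro smooth_on_directional U bounded_linear_mat_mul)
    have "\<forall>y\<in>M \<inter> U. frechet_derivative F (at y) (y ** Y) = Rop D Y f y"
      using Rop_real_eq[OF U(1) _ U(3,4) _ Y] by simp
    from Rop_real_eq[OF U(1,2) G this n X] show ?thesis
      using derivative_directional[OF U(1,2,3) bounded_linear_mat_mul(1)[of Y], of "n ** X"] by simp
  qed
  have AB: "lbr A B \<in> V0" by (rule V0_lbr[OF A B])
  have "n ** A ** B = n ** lbr A B + n ** B ** A"
    by (simp add: lbr_def mat_distrib matrix_mul_assoc)
  then show ?thesis
    unfolding main[OF A B] main[OF B A] Rop_real_eq[OF U n AB]
    using second_derivative_symmetric[OF U(1,3,2), of "n ** A" "n ** B"] frechet_linear(1)[OF U(1,2,3)] by simp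
qed (simp add: Rop_off)

lemma Rop_split:
  assumes "A \<in> V0" "B \<in> V0" "f \<in> S"
  shows "Rop D (A + \<i> *\<^sub>C B) f = (\<lambda>x. Rop D A f x + \<i> * Rop D B f x)"
proof -
  have "A \<in> V" "\<i> *\<^sub>C B \<in> V" "B \<in> V" using assms V0_V nb_sub cmat.subspace_scale by auto
  then show ?thesis using Rop_Z_add[of A "\<i> *\<^sub>C B" f] Rop_Z_scale[of B f \<i>] assms(3) by simp
qed

lemma Rop_commute:
  assumes Z: "Z \<in> V" and W: "W \<in> V" and f: "f \<in> S"
  shows "Rop D Z (Rop D W f) n - Rop D W (Rop D Z f) n = Rop D (lbr Z W) f n"
proof -
  obtain A B where AB: "A \<in> V0" "B \<in> V0" "Z = A + \<i> *\<^sub>C B" using V_decomp[OF Z] .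
  obtain A' B' where AB': "A' \<in> V0" "B' \<in> V0" "W = A' + \<i> *\<^sub>C B'" using V_decomp[OF W] .
  have V: "A \<in> V" "B \<in> V" "A' \<in> V" "B' \<in> V" using AB AB' V0_V by auto
  have R: "Rop D X g \<in> S" if "X \<in> V" "g \<in> S" for X g using Rop_smooth that by blast
  have e: "Rop D X (Rop D (Y + \<i> *\<^sub>C Y') f) n = Rop D X (Rop D Y f) n + \<i> * Rop D X (Rop D Y' f) n"
    if "X \<in> V" "Y \<in> V0" "Y' \<in> V0" for X Y Y'
  proof -
    have "Rop D Y f \<in> S" "Rop D Y' f \<in> S" using that f V0_V Rop_smooth by auto
    then show ?thesis
      unfolding Rop_split[OF that(2,3) f]
      using Rop_add[OF that(1), of "Rop D Y f" "\<lambda>x. \<i> * Rop D Y' f x"] Rop_cmult[OF that(1), of "Rop D Y' f" \<i>]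
      by (simp add: smooth_funs_cmult)
  qed
  have l: "lbr Z W = (lbr A A' - lbr B B') + \<i> *\<^sub>C (lbr A B' + lbr B A')"
    unfolding AB(3) AB'(3) by (simp add: lbr_bilinear cmat.scale_right_distrib cscale_minus_one[symmetric] algebra_simps)
  have C: "lbr A A' \<in> V0" "lbr B B' \<in> V0" "lbr A B' \<in> V0" "lbr B A' \<in> V0" using V0_lbr AB AB' by auto
  then have C': "lbr A A' - lbr B B' \<in> V0" "lbr A B' + lbr B A' \<in> V0" using V0_sub subspace_diff subspace_add by auto
  have CV: "lbr A A' \<in> V" "lbr B B' \<in> V" "lbr A B' \<in> V" "lbr B A' \<in> V" using C V0_V by auto
  have neg: "Rop D (lbr A A' - lbr B B') f n = Rop D (lbr A A') f n - Rop D (lbr B B') f n"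
    using Rop_Z_add[OF CV(1) cmat.subspace_scale[OF nb_sub CV(2), of "- 1"] f] Rop_Z_scale[OF CV(2) f, of "- 1"]
    by (simp flip: cscale_minus_one)
  have Wg: "Rop D (A + \<i> *\<^sub>C B) (Rop D W f) n = Rop D A (Rop D W f) n + \<i> * Rop D B (Rop D W f) n"
    using Rop_split[OF AB(1,2) R[OF W f]] by simp
  have Zg: "Rop D (A' + \<i> *\<^sub>C B') (Rop D Z f) n = Rop D A' (Rop D Z f) n + \<i> * Rop D B' (Rop D Z f) n"
    using Rop_split[OF AB'(1,2) R[OF Z f]] by simp
  have "Rop D Z (Rop D W f) n - Rop D W (Rop D Z f) n =
    (Rop D A (Rop D A' f) n - Rop D A' (Rop D A f) n) - (Rop D B (Rop D B' f) n - Rop D B' (Rop D B f) n)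
    + \<i> * ((Rop D A (Rop D B' f) n - Rop D B' (Rop D A f) n) + (Rop D B (Rop D A' f) n - Rop D A' (Rop D B f) n))"
    using Wg Zg e[OF V(1) AB'(1,2)] e[OF V(2) AB'(1,2)] e[OF V(3) AB(1,2)] e[OF V(4) AB(1,2)]
    by (simp add: AB(3)[symmetric] AB'(3)[symmetric]) (simp add: algebra_simps)
  also have "\<dots> = Rop D (lbr Z W) f n"
    unfolding l Rop_split[OF C' f] neg Rop_commute_real[OF AB(1) AB'(1) f] Rop_commute_real[OF AB(2) AB'(2) f]
      Rop_commute_real[OF AB(1) AB'(2) f] Rop_commute_real[OF AB(2) AB'(1) f]
    using Rop_Z_add[OF CV(3,4) f] by simp
  finally show ?thesis .
qed

lemma Rop_vector_field: "Z \<in> V \<Longrightarrow> Rop D Z \<in> vector_fields M"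
  unfolding vector_fields_def using Rop_smooth Rop_add Rop_cmult Rop_mult by simp

end

section \<open>The character of the parabolic subgroup\<close>

lemma matrix_inv_props:
  assumes "invertible (A :: mat8)"
  shows "A ** matrix_inv A = mat 1" "matrix_inv A ** A = mat 1"
proof -
  have "\<exists>B. A ** B = mat 1 \<and> B ** A = mat 1" using assms by (simp add: invertible_def)
  from someI_ex[OF this] show "A ** matrix_inv A = mat 1" "matrix_inv A ** A = mat 1"
    by (simp_all add: matrix_inv_def)
qed

lemma matrix_inv_unique:
  fixes A B :: mat8
  assumes "A ** B = mat 1" "B ** A = mat 1"
  shows "matrix_inv A = B"
proof -
  have "invertible A" using assms by (auto simp: invertible_def)
  have "matrix_inv A = matrix_inv A ** (A ** B)" using assms by simp
  also have "\<dots> = (matrix_inv A ** A) ** B" by (simp only: matrix_mul_assoc)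
  also have "\<dots> = B" using matrix_inv_props(2)[OF \<open>invertible A\<close>] by simp
  finally show ?thesis .
qed

lemma SO8_transpose:
  assumes "n \<in> SO8"
  shows "transpose n ** n = mat 1" "n ** transpose n = mat 1" "matrix_inv n = transpose n" 
    "matrix_inv (transpose n) = n" "cdot (n *v x) (n *v y) = cdot x y"
proof -
  show 1: "transpose n ** n = mat 1" using assms by (simp add: SO8_def)
  then show 2: "n ** transpose n = mat 1" using matrix_left_right_inverse by blast
  show "matrix_inv n = transpose n" "matrix_inv (transpose n) = n"
    using 1 2 by (auto intro: matrix_inv_unique)
  show "cdot (n *v x) (n *v y) = cdot x y" by (simp add: cdot_mv matrix_vector_mul_assoc 1)
qed

lemma SO8_wedge: "g \<in> SO8 \<Longrightarrow> g ** wedge a b = wedge (g *v a) (g *v b) ** g"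
  by (rule mat8_eqI) (simp add: SO8_transpose(5) flip: matrix_vector_mul_assoc)

text \<open>The matrix coefficients of a one parameter group as power series in \<open>t\<close>;
  these are differentiated and compared termwise.\<close>

lemma mexp_series:
  fixes Y :: mat8
  defines "c \<equiv> \<lambda>w \<xi> n. (1 / fact n) * cdot w (((*v) Y ^^ n) \<xi>)"
  shows "summable (\<lambda>n. c w \<xi> n * z ^ n)"
    and "cdot w (mexp (t *\<^sub>R Y) *v \<xi>) = (\<Sum>n. c w \<xi> n * of_real t ^ n)"
    and "summable (\<lambda>n. (1 / fact n) *\<^sub>R (((**) Y ^^ n) (mat 1)))"
proof -
  obtain K where K: "K \<ge> 0" "\<And>x. norm (Y ** x) \<le> norm (x :: mat8) * K"
    using bounded_linear.nonneg_bounded[OF bounded_linear_mat_mul(2)[of Y]] by blast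
  let ?p = "\<lambda>n. ((**) Y ^^ n) (mat 1 :: mat8)"
  have p: "norm (?p n) \<le> norm (mat 1 :: mat8) * K ^ n" for n
  proof (induction n)
    case (Suc n)
    have "norm (?p (Suc n)) \<le> norm (?p n) * K" using K(2) by simp
    also have "\<dots> \<le> norm (mat 1 :: mat8) * K ^ n * K" using Suc K(1) by (rule mult_right_mono)
    finally show ?case by (simp add: mult_ac)
  qed simp
  have pv: "?p n *v \<xi> = ((*v) Y ^^ n) \<xi>" for n \<xi>
    by (induction n) (simp_all flip: matrix_vector_mul_assoc)
  have pt: "((**) (t *\<^sub>R Y) ^^ n) (mat 1) = t ^ n *\<^sub>R ?p n" for t n
    by (induction n) (simp_all add: mat_distrib)
  have sumK: "summable (\<lambda>n. B * (x ^ n / fact n))" for B x :: real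
    using summable_exp_generic[of x] by (intro summable_mult) (simp add: divide_inverse mult.commute)
  have a: "summable (\<lambda>n. (1 / fact n) *\<^sub>R (t ^ n *\<^sub>R ?p n))" for t
  proof (rule summable_comparison_test'[OF sumK[of "norm (mat 1 :: mat8)" "\<bar>t\<bar> * K"], of 0])
    fix n
    have "norm ((1 / fact n) *\<^sub>R (t ^ n *\<^sub>R ?p n)) = \<bar>t\<bar> ^ n / fact n * norm (?p n)" by (simp add: power_abs)
    also have "\<dots> \<le> \<bar>t\<bar> ^ n / fact n * (norm (mat 1 :: mat8) * K ^ n)" using p by (intro mult_left_mono) auto
    finally show "norm ((1 / fact n) *\<^sub>R (t ^ n *\<^sub>R ?p n)) \<le> norm (mat 1 :: mat8) * ((\<bar>t\<bar> * K) ^ n / fact n)"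
      by (simp add: power_mult_distrib mult_ac)
  qed
  from a[of 1] show "summable (\<lambda>n. (1 / fact n) *\<^sub>R ?p n)" by simp
  let ?L = "\<lambda>x :: mat8. cdot w (x *v \<xi>)"
  have L: "bounded_linear ?L" by (rule linear_fun_bounded)
  obtain B where B: "B \<ge> 0" "\<And>x. norm (?L x) \<le> norm x * B" using bounded_linear.nonneg_bounded[OF L] by blast
  show "summable (\<lambda>n. c w \<xi> n * z ^ n)"
  proof (rule summable_comparison_test'[OF sumK[of "norm (mat 1 :: mat8) * B" "norm z * K"], of 0])
    fix n
    have "norm (?L (?p n)) \<le> norm (mat 1 :: mat8) * K ^ n * B"
      using B(2)[of "?p n"] mult_right_mono[OF p[of n] B(1)] by linarith
    then have "norm z ^ n / fact n * norm (?L (?p n)) \<le> norm z ^ n / fact n * (norm (mat 1 :: mat8) * K ^ n * B)"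
      by (intro mult_left_mono) auto
    then show "norm (c w \<xi> n * z ^ n) \<le> norm (mat 1 :: mat8) * B * ((norm z * K) ^ n / fact n)"
      by (simp add: c_def pv norm_mult norm_divide norm_power power_mult_distrib mult_ac)
  qed
  have "mexp (t *\<^sub>R Y) = (\<Sum>n. (1 / fact n) *\<^sub>R (t ^ n *\<^sub>R ?p n))" unfolding mexp_def pt ..
  then have "?L (mexp (t *\<^sub>R Y)) = (\<Sum>n. ?L ((1 / fact n) *\<^sub>R (t ^ n *\<^sub>R ?p n)))"
    using bounded_linear.suminf[OF L a] by simp
  also have "\<dots> = (\<Sum>n. c w \<xi> n * of_real t ^ n)"
  proof (rule suminf_cong)
    fix n
    have "?L ((1 / fact n) *\<^sub>R (t ^ n *\<^sub>R ?p n)) = of_real (1 / fact n) * (of_real (t ^ n) * ?L (?p n))"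
      using linear_cmul[OF bounded_linear.linear[OF L], of "t ^ n / fact n" "?p n"]
      by (simp add: scaleR_conv_of_real[where 'a = complex])
    then show "?L ((1 / fact n) *\<^sub>R (t ^ n *\<^sub>R ?p n)) = c w \<xi> n * of_real t ^ n" by (simp add: c_def pv)
  qed
  finally show "cdot w (mexp (t *\<^sub>R Y) *v \<xi>) = (\<Sum>n. c w \<xi> n * of_real t ^ n)" .
qed

lemma mexp_derivative:
  "((\<lambda>t::real. cdot w (mexp (t *\<^sub>R Y) *v \<xi>)) has_vector_derivative cdot w (Y *v \<xi>)) (at 0)"
proof -
  let ?c = "\<lambda>n. (1 / fact n) * cdot w (((*v) Y ^^ n) \<xi>)"
  have "((\<lambda>z. \<Sum>n. ?c n * z ^ n) has_field_derivative (\<Sum>n. diffs ?c n * 0 ^ n)) (at 0)"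
    by (rule termdiffs_strong_converges_everywhere) (rule mexp_series(1))
  then have "((\<lambda>z. \<Sum>n. ?c n * z ^ n) has_field_derivative cdot w (Y *v \<xi>)) (at (of_real 0))"
    by (simp add: diffs_def)
  from has_vector_derivative_real_field[OF this] show ?thesis by (simp add: mexp_series(2))
qed

lemma mexp_zero: "cdot w (mexp (0 *\<^sub>R Y) *v \<xi>) = cdot w \<xi>"
  unfolding mexp_series(2) of_real_0 powser_zero by simp

lemma mexp_vanish:
  assumes "\<And>n. cdot w (((*v) Y ^^ n) \<xi>) = 0"
  shows "cdot w (mexp (t *\<^sub>R Y) *v \<xi>) = 0"
  unfolding mexp_series(2) by (simp add: assms)

text \<open>Termwise in the exponential series.\<close>

lemma mexp_commute:
  assumes "Y ** X = X ** Y"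
  shows "mexp Y ** X = X ** mexp (Y :: mat8)"
proof -
  let ?a = "\<lambda>n. (1 / fact n) *\<^sub>R (((**) Y ^^ n) (mat 1 :: mat8))"
  have c: "((**) Y ^^ n) (mat 1) ** X = X ** ((**) Y ^^ n) (mat 1)" for n
  proof (induction n)
    case (Suc n)
    have "((**) Y ^^ Suc n) (mat 1) ** X = Y ** (((**) Y ^^ n) (mat 1) ** X)" by (simp flip: matrix_mul_assoc)
    also have "\<dots> = (X ** Y) ** ((**) Y ^^ n) (mat 1)" unfolding Suc assms[symmetric] by (simp flip: matrix_mul_assoc)
    finally show ?case by (simp flip: matrix_mul_assoc)
  qed simp
  have "mexp Y ** X = (\<Sum>n. ?a n ** X)" 
    unfolding mexp_def by (rule bounded_linear.suminf[OF bounded_linear_mat_mul(1)[of X] mexp_series(3)])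
  also have "\<dots> = (\<Sum>n. X ** ?a n)" by (simp add: mat_distrib c)
  also have "\<dots> = X ** mexp Y"
    unfolding mexp_def by (rule bounded_linear.suminf[OF bounded_linear_mat_mul(2)[of X] mexp_series(3), symmetric])
  finally show ?thesis .
qed

sublocale heis \<subseteq> nil_group D
proof unfold_locales
  show "complexifies_to (nilbar0 D) (nilbar D)" "matrix_group (G0 D)"
    using setting by (simp_all add: heisenberg_setting_def)
qed (use nilbar_triple nilbar_subspace nilbar_lbr in blast)+

context heis
begin

lemma G0_SO8: "G0 D \<subseteq> SO8" and Q0_eq: "Q0 D = {l ** n | l n. l \<in> L0 D \<and> n \<in> N0 D}"
  and L0_group: "matrix_group (L0 D)" and L0_N0: "L0 D \<inter> N0 D = {mat 1}"
  and Q0_G0: "Q0 D \<subseteq> G0 D" and Q0_cx: "complexifies_to (lie_alg (Q0 D)) (parab D)"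
proof -
  have q: "Q0 D = {g \<in> G0 D. Ad g ` parab D = parab D}" using setting by (simp add: heisenberg_setting_def)
  show "G0 D \<subseteq> SO8" "Q0 D = {l ** n | l n. l \<in> L0 D \<and> n \<in> N0 D}" "matrix_group (L0 D)" "L0 D \<inter> N0 D = {mat 1}"
    "complexifies_to (lie_alg (Q0 D)) (parab D)"
    using setting unfolding heisenberg_setting_def by blast+
  show "Q0 D \<subseteq> G0 D" unfolding q by blast
qed

lemma nil_parab: "nil D \<subseteq> parab D"
proof
  fix A assume "A \<in> nil D"
  moreover have "0 \<in> levi D" by (simp add: levi_def cmat.span_zero)
  ultimately show "A \<in> parab D" unfolding parab_def by force
qed

lemma nil_ctr: "A \<in> nil D \<Longrightarrow> ctr A = 0"
  unfolding nil_def
proof (induction rule: cmat.span_induct_alt)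
  case base
  then show ?case by (simp add: ctr_linear)
next
  case (step c x y)
  then obtain \<alpha> where a: "\<alpha> \<in> P - levi_roots D" "x \<in> root_space (csa D) \<alpha>" by blast
  have x: "x \<in> eigsp D (\<alpha> Hg)" using root_space_eigsp a(2) by blast
  have "\<alpha> Hg \<noteq> 0" using nil_root_pairing[OF a(1)] by auto
  then have "ctr x = 0" using eigsp_cdot_frame(3)[OF x] by (simp add: ctr_def)
  then show ?case using step by (simp add: ctr_linear)
qed

text \<open>The commutator of \<open>nil\<close> with the highest root vector is 0. Elements of
  \<open>G0\<close> commuting with that vector form a group, so the group generated by the
  exponentials commutes with it as well.\<close>

lemma N0_group: "matrix_group (N0 D)" and N0_X: "n \<in> N0 D \<Longrightarrow> n ** Xv D \<gamma> = Xv D \<gamma> ** n"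
proof -
  define K where "K = {a \<in> G0 D. a ** Xv D \<gamma> = Xv D \<gamma> ** a}"
  have K: "matrix_group K"
    unfolding matrix_group_def
  proof (intro conjI ballI)
    show "mat 1 \<in> K" using G0_group by (simp add: K_def matrix_group_def)
  next
    fix a assume a: "a \<in> K"
    then show i: "invertible a" using G0_group by (simp add: K_def matrix_group_def)
    have "matrix_inv a ** Xv D \<gamma> = matrix_inv a ** Xv D \<gamma> ** (a ** matrix_inv a)"
      using matrix_inv_props[OF i] by simp
    also have "\<dots> = matrix_inv a ** (Xv D \<gamma> ** a) ** matrix_inv a" by (simp only: matrix_mul_assoc)
    also have "\<dots> = matrix_inv a ** (a ** Xv D \<gamma>) ** matrix_inv a" using a by (simp add: K_def)
    also have "\<dots> = (matrix_inv a ** a) ** Xv D \<gamma> ** matrix_inv a" by (simp only: matrix_mul_assoc)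
    finally show "matrix_inv a \<in> K" using a G0_group matrix_inv_props[OF i] by (simp add: K_def matrix_group_def)
  next
    fix a b assume a: "a \<in> K" and b: "b \<in> K"
    have "a ** b ** Xv D \<gamma> = a ** (b ** Xv D \<gamma>)" by (simp only: matrix_mul_assoc)
    also have "\<dots> = (a ** Xv D \<gamma>) ** b" using b by (simp add: K_def matrix_mul_assoc)
    also have "\<dots> = Xv D \<gamma> ** (a ** b)" using a by (simp add: K_def matrix_mul_assoc)
    finally show "a ** b \<in> K" using a b G0_group by (simp add: K_def matrix_group_def)
  qed
  have "mexp ` (lie_alg (G0 D) \<inter> nil D) \<subseteq> K"
  proof
    fix g assume "g \<in> mexp ` (lie_alg (G0 D) \<inter> nil D)"
    then obtain A where A: "A \<in> lie_alg (G0 D)" "A \<in> nil D" "g = mexp A" by blast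
    have "mexp (1 *\<^sub>R A) \<in> G0 D" using A(1) unfolding lie_alg_def by blast
    moreover have "lbr A (Xv D \<gamma>) = 0" using parab_X[of A] nil_parab A(2) nil_ctr[OF A(2)] by auto
    then have "A ** Xv D \<gamma> = Xv D \<gamma> ** A" by (simp add: lbr_def)
    ultimately show "g \<in> K" using mexp_commute A(3) by (simp add: K_def)
  qed
  then have sub: "N0 D \<subseteq> K" using K unfolding N0_def connected_lie_group_def by (intro Inter_lower) simp
  then show "n \<in> N0 D \<Longrightarrow> n ** Xv D \<gamma> = Xv D \<gamma> ** n" by (auto simp: K_def)
  show "matrix_group (N0 D)"
    unfolding matrix_group_def
  proof (intro conjI ballI)
    show "mat 1 \<in> N0 D" by (simp add: N0_def connected_lie_group_def matrix_group_def)
  next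
    fix a assume a: "a \<in> N0 D"
    then show "matrix_inv a \<in> N0 D" by (simp add: N0_def connected_lie_group_def matrix_group_def)
    show "invertible a" using a sub K by (auto simp: matrix_group_def)
  next
    fix a b assume "a \<in> N0 D" "b \<in> N0 D"
    then show "a ** b \<in> N0 D" by (simp add: N0_def connected_lie_group_def matrix_group_def)
  qed
qed

lemma X_gamma_nonzero: "Xv D \<gamma> \<noteq> 0"
  using X_nonzero highest(1) by blast

text \<open>Because \<open>N0\<close> fixes \<open>X\<^sub>\<gamma>\<close>, the character can be
  read off from the adjoint action of \<open>g\<close> itself on \<open>X\<^sub>\<gamma>\<close>,
  without splitting \<open>g\<close>.\<close>

lemma chiQ_eq:
  assumes g: "g \<in> Q0 D" and X: "g ** Xv D \<gamma> = d *\<^sub>C (Xv D \<gamma> ** g)"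
  shows "chiQ D g = d"
proof -
  obtain l n where ln: "l \<in> L0 D" "n \<in> N0 D" "g = l ** n" using g Q0_eq by blast
  have inv: "invertible l" "invertible n" "matrix_inv l \<in> L0 D" "matrix_inv n \<in> N0 D"
    using L0_group N0_group ln by (auto simp: matrix_group_def)
  have "(THE l. l \<in> L0 D \<and> (\<exists>n\<in>N0 D. g = l ** n)) = l"
  proof (rule the_equality)
    show "l \<in> L0 D \<and> (\<exists>n\<in>N0 D. g = l ** n)" using ln by blast
    fix l' assume "l' \<in> L0 D \<and> (\<exists>n\<in>N0 D. g = l' ** n)"
    then obtain n' where l': "l' \<in> L0 D" "n' \<in> N0 D" "g = l' ** n'" by blast
    have "matrix_inv l ** l' ** n' ** matrix_inv n = matrix_inv l ** (l' ** n') ** matrix_inv n"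
      by (simp only: matrix_mul_assoc)
    also have "l' ** n' = l ** n" using l'(3) ln(3) by simp
    also have "matrix_inv l ** (l ** n) ** matrix_inv n = (matrix_inv l ** l) ** (n ** matrix_inv n)" by (simp only: matrix_mul_assoc)
    finally have e: "matrix_inv l ** l' ** (n' ** matrix_inv n) = mat 1"
      using matrix_inv_props[OF inv(1)] matrix_inv_props[OF inv(2)] by (simp add: matrix_mul_assoc)
    let ?a = "matrix_inv l ** l'" and ?b = "n' ** matrix_inv n"
    have aL: "?a \<in> L0 D" and bN: "?b \<in> N0 D" using L0_group N0_group inv l' by (auto simp: matrix_group_def)
    have ib: "invertible ?b" using bN N0_group by (simp add: matrix_group_def)
    have "?a = ?a ** (?b ** matrix_inv ?b)" using matrix_inv_props[OF ib] by simp
    also have "\<dots> = matrix_inv ?b" using e by (simp add: matrix_mul_assoc)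
    finally have "?a \<in> N0 D" using N0_group bN by (simp add: matrix_group_def)
    then have "?a = mat 1" using aL L0_N0 by blast
    then have "l ** ?a = l" by simp
    then show "l' = l" using matrix_inv_props[OF inv(1)] by (simp add: matrix_mul_assoc)
  qed
  then have c: "chiQ D g = chi D l" by (simp add: chiQ_def)
  have "(l ** Xv D \<gamma>) ** n = d *\<^sub>C (Xv D \<gamma> ** l) ** n"
  proof -
    have "(l ** Xv D \<gamma>) ** n = l ** (n ** Xv D \<gamma>)" using N0_X[OF ln(2)] by (simp add: matrix_mul_assoc)
    also have "\<dots> = g ** Xv D \<gamma>" by (simp add: ln(3) matrix_mul_assoc)
    finally show ?thesis using X by (simp add: ln(3) matrix_mul_assoc mat_mul_cscale)
  qed
  then have "(l ** Xv D \<gamma>) ** n ** matrix_inv n = (d *\<^sub>C (Xv D \<gamma> ** l)) ** n ** matrix_inv n" by (simp add: mat_mul_cscale)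
  then have lX: "l ** Xv D \<gamma> = d *\<^sub>C (Xv D \<gamma> ** l)"
    using matrix_inv_props(1)[OF inv(2)] by (simp flip: matrix_mul_assoc)
  have "Ad l (Xv D \<gamma>) = d *\<^sub>C Xv D \<gamma>"
    unfolding Ad_def lX using matrix_inv_props(1)[OF inv(1)] by (simp add: mat_mul_cscale flip: matrix_mul_assoc)
  then have "chi D l = d"
    unfolding chi_def using X_gamma_nonzero by (intro the_equality) (auto dest: cmat.scale_right_imp_eq)
  then show ?thesis using c by simp
qed

text \<open>The group \<open>Q0\<close> preserves the plane \<open>E\<close>, and
  \<open>X\<^sub>\<gamma>\<close> is a multiple of \<open>e 1 \<and> e 2\<close>, so
  \<open>\<chi>\<close> is the determinant on \<open>E\<close>. Its derivative is the trace.\<close>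

lemma chiQ_derivative:
  assumes Y: "Y \<in> lie_alg (Q0 D)" "Y \<in> parab D"
  shows "vector_derivative (\<lambda>t::real. chiQ D (mexp (t *\<^sub>R Y))) (at 0) = ctr Y"
proof -
  define h where "h i j t = cdot (f i) (mexp (t *\<^sub>R Y) *v e j)" for i j and t :: real
  have pres: "(\<forall>a. cdot (v a) (((*v) Y ^^ n) (e j)) = 0) \<and> (\<forall>i. cdot (e i) (((*v) Y ^^ n) (e j)) = 0)" for n j
  proof (induction n)
    case (Suc n)
    let ?x = "((*v) Y ^^ n) (e j)"
    have x: "?x = (\<Sum>i\<in>UNIV. cdot (f i) ?x *s e i)" using vec_frame_expand[of ?x] Suc by simp
    have "Y *v ?x = (\<Sum>i\<in>UNIV. cdot (f i) ?x *s (Y *v e i))" by (subst x) (simp add: mv_sum)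
    then show ?case using Y(2) by (simp add: cdot_sum_right parab_iff)
  qed simp
  have ge: "mexp (t *\<^sub>R Y) *v e j = (\<Sum>i\<in>UNIV. h i j t *s e i)" for t j
    using vec_frame_expand[of "mexp (t *\<^sub>R Y) *v e j"] mexp_vanish[of _ Y "e j" t] pres by (simp add: h_def)
  have chi: "chiQ D (mexp (t *\<^sub>R Y)) = h 1 1 t * h 2 2 t - h 2 1 t * h 1 2 t" for t
  proof (rule chiQ_eq)
    show g: "mexp (t *\<^sub>R Y) \<in> Q0 D" using Y(1) by (simp add: lie_alg_def)
    then have so: "mexp (t *\<^sub>R Y) \<in> SO8" using Q0_G0 G0_SO8 by blast
    have "wedge (mexp (t *\<^sub>R Y) *v e 1) (mexp (t *\<^sub>R Y) *v e 2) = (h 1 1 t * h 2 2 t - h 2 1 t * h 1 2 t) *\<^sub>C wedge (e 1) (e 2)"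
      unfolding ge sum_2 using wedge_antisym[of "e 2" "e 1"]
      by (simp add: wedge_bilinear cmat.scale_left_diff_distrib mult.commute)
    then show "mexp (t *\<^sub>R Y) ** Xv D \<gamma> = (h 1 1 t * h 2 2 t - h 2 1 t * h 1 2 t) *\<^sub>C (Xv D \<gamma> ** mexp (t *\<^sub>R Y))"
      unfolding kappa(2) mat_mul_cscale SO8_wedge[OF so] by (simp add: mat_mul_cscale mult.commute)
  qed
  have dh: "(h i j has_vector_derivative cdot (f i) (Y *v e j)) (at 0)" for i j
    unfolding h_def[abs_def] by (rule mexp_derivative)
  have h0: "h i j 0 = (if i = j then 1 else 0)" for i j unfolding h_def mexp_zero by simp
  have "((\<lambda>t. h 1 1 t * h 2 2 t - h 2 1 t * h 1 2 t) has_vector_derivative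
     (h 1 1 0 * cdot (f 2) (Y *v e 2) + cdot (f 1) (Y *v e 1) * h 2 2 0) -
     (h 2 1 0 * cdot (f 1) (Y *v e 2) + cdot (f 2) (Y *v e 1) * h 1 2 0)) (at 0)"
    by (intro has_vector_derivative_diff has_vector_derivative_mult dh)
  then have "((\<lambda>t. h 1 1 t * h 2 2 t - h 2 1 t * h 1 2 t) has_vector_derivative ctr Y) (at 0)"
    by (simp add: h0 ctr_def add.commute)
  then show ?thesis unfolding chi by (rule vector_derivative_at)
qed

text \<open>The trace on \<open>E\<close> is complex linear, so it is the complex linear extension
  of its restriction to the real form.\<close>

lemma dchi_parab:
  assumes "Z \<in> parab D" shows "dchi D Z = ctr Z"
proof -
  let ?Q = "lie_alg (Q0 D)"
  have bij: "bij_betw (\<lambda>(A, B). A + \<i> *\<^sub>C B) (?Q \<times> ?Q) (parab D)" and sub: "subspace ?Q"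
    using Q0_cx by (auto simp: complexifies_to_def)
  have "Z \<in> (\<lambda>(A, B). A + \<i> *\<^sub>C B) ` (?Q \<times> ?Q)" using bij_betw_imp_surj_on[OF bij] assms by simp
  then obtain p where p: "p \<in> ?Q \<times> ?Q" "Z = (\<lambda>(A, B). A + \<i> *\<^sub>C B) p" by (rule imageE)
  obtain A B where "p = (A, B)" by (rule prod.exhaust)
  then have AB: "A \<in> ?Q" "B \<in> ?Q" "Z = A + \<i> *\<^sub>C B" using p by simp_all
  have 0: "0 \<in> ?Q" using sub by (simp add: subspace_0)
  have par: "X \<in> parab D" if "X \<in> ?Q" for X
  proof -
    have "(X, 0) \<in> ?Q \<times> ?Q" using that 0 by simp
    from bij_betwE[OF bij, rule_format, OF this] show ?thesis by simp
  qed
  have "inv_into (?Q \<times> ?Q) (\<lambda>(A, B). A + \<i> *\<^sub>C B) ((\<lambda>(A, B). A + \<i> *\<^sub>C B) (A, B)) = (A, B)"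
    by (rule inv_into_f_f[OF bij_betw_imp_inj_on[OF bij]]) (simp add: AB)
  then have "dchi D Z = ctr A + \<i> * ctr B"
    using chiQ_derivative[OF AB(1) par[OF AB(1)]] chiQ_derivative[OF AB(2) par[OF AB(2)]]
    by (simp add: dchi_def clin_ext_def AB(3))
  then show ?thesis by (simp add: AB(3) ctr_linear)
qed

end

section \<open>The action and the cubic system in a frame\<close>

context heis
begin

abbreviation Ro :: "2 \<Rightarrow> 4 \<Rightarrow> (mat8 \<Rightarrow> complex) \<Rightarrow> mat8 \<Rightarrow> complex"
  where "Ro i a \<equiv> Rop D (wedge (v a) (f i))"
abbreviation To where "To \<equiv> Rop D (wedge (f 1) (f 2))"

lemma M_SO8: "n \<in> M \<Longrightarrow> n \<in> SO8"
  using M_G0 G0_SO8 by blast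

lemma S_fun: 
  "(0 :: mat8 \<Rightarrow> complex) \<in> S" "h \<in> S \<Longrightarrow> h' \<in> S \<Longrightarrow> h + h' \<in> S"
  "h \<in> S \<Longrightarrow> h' \<in> S \<Longrightarrow> h * h' \<in> S" "h \<in> S \<Longrightarrow> - h \<in> S"
proof -
  show "(0 :: mat8 \<Rightarrow> complex) \<in> S" using smooth_funs_zero[of M] by (simp add: zero_fun_def)
  show "h \<in> S \<Longrightarrow> h' \<in> S \<Longrightarrow> h + h' \<in> S" using smooth_funs_add by (simp add: plus_fun_def)
  show "h \<in> S \<Longrightarrow> h' \<in> S \<Longrightarrow> h * h' \<in> S" using smooth_funs_mult by (simp add: times_fun_def)
  show "h \<in> S \<Longrightarrow> - h \<in> S" using smooth_funs_cmult[of h M "- 1"] by (simp add: fun_Compl_def)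
qed

lemma S_sum_fun: "(\<And>b. b \<in> B \<Longrightarrow> F b \<in> S) \<Longrightarrow> (\<lambda>x. \<Sum>b\<in>B. F b x) \<in> S"
  by (induction B rule: infinite_finite_induct) (simp_all add: smooth_funs_zero smooth_funs_add)

lemma Rop_sum: "Z \<in> V \<Longrightarrow> (\<And>b. b \<in> B \<Longrightarrow> F b \<in> S) \<Longrightarrow> Rop D Z (\<lambda>x. \<Sum>b\<in>B. F b x) = (\<lambda>x. \<Sum>b\<in>B. Rop D Z (F b) x)"
proof (induction B rule: infinite_finite_induct)
  case (insert b B)
  then show ?case using Rop_add[of Z "F b" "\<lambda>x. \<Sum>b\<in>B. F b x"] S_sum_fun[of B F] by simp
qed (use Rop_cmult[of Z "\<lambda>x. 0" 0] smooth_funs_zero in auto)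

lemma Rop_Z_sum: "h \<in> S \<Longrightarrow> (\<And>b. b \<in> B \<Longrightarrow> Z b \<in> V) \<Longrightarrow> Rop D (\<Sum>b\<in>B. Z b) h x = (\<Sum>b\<in>B. Rop D (Z b) h x)"
proof (induction B rule: infinite_finite_induct)
  case (insert b B)
  then have "(\<Sum>b\<in>B. Z b) \<in> V" by (intro cmat.subspace_sum[OF nilbar_subspace]) simp
  then show ?case using insert Rop_Z_add[of "Z b" "\<Sum>b\<in>B. Z b" h] by simp
qed (use Rop_Z_scale[of 0 h 0] cmat.subspace_0[OF nilbar_subspace] in auto)

text \<open>The matrix coefficients of \<open>n\<^sup>T Y n\<close>, where \<open>n\<^sup>T\<close>
  is the inverse of \<open>n\<close>, as smooth functions of \<open>n\<close>.\<close>

definition Phi :: "mat8 \<Rightarrow> complex^8 \<Rightarrow> complex^8 \<Rightarrow> mat8 \<Rightarrow> complex"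
  where "Phi Y \<xi> \<eta> = res M (\<lambda>x. cdot (x *v \<xi>) (Y *v (x *v \<eta>)))"

lemma Phi_lin: "Phi Y \<xi> \<eta> = (\<lambda>x. \<Sum>k\<in>UNIV. lin (axis k 1) \<xi> x * lin (transpose Y *v axis k 1) \<eta> x)"
proof
  fix x
  have "cdot (transpose Y *v axis k 1) y = (Y *v y) $ k" for k y
    using cdot_mv[of Y y "axis k 1"] by (simp add: cdot_commute[of y])
  then show "Phi Y \<xi> \<eta> x = (\<Sum>k\<in>UNIV. lin (axis k 1) \<xi> x * lin (transpose Y *v axis k 1) \<eta> x)"
    by (simp add: Phi_def lin_def res_def cdot_def[of "x *v \<xi>"])
qed

lemma Phi_S: "Phi Y \<xi> \<eta> \<in> S"
  unfolding Phi_lin by (intro S_sum_fun smooth_funs_mult lin_S)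

lemma Rop_Phi:
  assumes Z: "Z \<in> V" shows "Rop D Z (Phi Y \<xi> \<eta>) = Phi Y (Z *v \<xi>) \<eta> + Phi Y \<xi> (Z *v \<eta>)"
  unfolding Phi_lin
  by (simp add: Rop_sum[OF Z] smooth_funs_mult lin_S Rop_mult[OF Z] Rop_lin[OF Z] sum.distrib plus_fun_def)

lemma Phi_bilinear: "Phi Y (- \<xi>) \<eta> = - Phi Y \<xi> \<eta>" "Phi Y \<xi> (- \<eta>) = - Phi Y \<xi> \<eta>"
  "Phi Y 0 \<eta> = 0" "Phi Y \<xi> 0 = 0"
  by (auto simp: Phi_def res_def fun_eq_iff)

lemma Phi_antisym:
  assumes Y: "Y \<in> so8" shows "Phi Y \<eta> \<xi> = - Phi Y \<xi> \<eta>"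
proof
  fix x
  show "Phi Y \<eta> \<xi> x = (- Phi Y \<xi> \<eta>) x"
    using so8_swap[OF Y, of "x *v \<eta>" "x *v \<xi>"] by (simp add: Phi_def res_def)
qed

lemma wedge_act: "wedge (v c) (f i) *v e j = (if i = j then v c else 0)" "wedge (v c) (f i) *v f j = 0"
   "wedge (v c) (f i) *v v b = (if b = c then - f i else 0)"
  by (auto simp: vec_eq_iff)

lemma lbr_vf: "lbr (wedge (v a) (f i)) (wedge (v b) (f j)) = (if a = b then wedge (f j) (f i) else 0)"
  by (simp add: lbr_wedge wedge_act wedge_bilinear wedge_antisym[of "f j"])

lemma lbr_vf_ff: "lbr (wedge (v a) (f i)) (wedge (f 1) (f 2)) = 0"
  by (simp add: lbr_wedge wedge_act wedge_bilinear)

lemma Rop_zero: "h \<in> S \<Longrightarrow> Rop D 0 h = 0"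
  using Rop_Z_scale[of 0 h 0] cmat.subspace_0[OF nilbar_subspace] by (simp add: zero_fun_def)

text \<open>All rules about the coefficients follow from \<open>Rop_Phi\<close> and the action of
  \<open>v\<^sub>c \<and> f\<^sub>i\<close> on the frame.\<close>

lemma algebra:
  assumes Y: "Y \<in> so8"
  shows "heisenberg_derivations S Ro To (\<lambda>i b. Phi Y (f i) (v b)) (\<lambda>i b. Phi Y (v b) (e i))
     (\<lambda>i j. Phi Y (f i) (e j)) (\<lambda>b c. Phi Y (v b) (v c)) (Phi Y (e 1) (e 2))"
proof
  note nb = wedges_nilbar
  have comm: "Rop D Z (Rop D W h) = Rop D W (Rop D Z h) + Rop D (lbr Z W) h" if "Z \<in> V" "W \<in> V" "h \<in> S" for Z W h
    using Rop_commute[OF that] by (simp add: fun_eq_iff algebra_simps)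
  show "Ro i a (Ro i b h) = Ro i b (Ro i a h)" if "h \<in> S" for i a b h
    using comm[OF nb(1)[of a i] nb(1)[of b i] that] Rop_zero[OF that] by (simp add: lbr_vf wedge_bilinear)
  show "Ro 1 a (Ro 2 b h) = Ro 2 b (Ro 1 a h) - (if a = b then To h else 0)" if "h \<in> S" for a b h
  proof -
    have "Rop D (- wedge (f 1) (f 2)) h = - To h"
      using Rop_Z_scale[OF nb(2) that, of "- 1"] by (simp add: fun_Compl_def flip: cscale_minus_one)
    then show ?thesis
      using comm[OF nb(1)[of a 1] nb(1)[of b 2] that] Rop_zero[OF that] wedge_antisym[of "f 2" "f 1"] by (simp add: lbr_vf)
  qed
  show "Ro i a (To h) = To (Ro i a h)" if "h \<in> S" for i a h
    using comm[OF nb(1)[of a i] nb(2) that] Rop_zero[OF that] by (simp add: lbr_vf_ff)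
  show "Ro i a (h + h') = Ro i a h + Ro i a h'" if "h \<in> S" "h' \<in> S" for i a h h'
    using Rop_add[OF nb(1) that] by (simp add: plus_fun_def)
  show "To (h + h') = To h + To h'" if "h \<in> S" "h' \<in> S" for h h'
    using Rop_add[OF nb(2) that] by (simp add: plus_fun_def)
  show "Ro i a (h * h') = Ro i a h * h' + h * Ro i a h'" if "h \<in> S" "h' \<in> S" for i a h h'
    using Rop_mult[OF nb(1) that] by (simp add: plus_fun_def times_fun_def)
  show "Phi Y (v b) (v a) = - Phi Y (v a) (v b)" for a b by (rule Phi_antisym[OF Y])
  show "Ro i c (Phi Y (f k) (e j)) = (if i = j then Phi Y (f k) (v c) else 0)" for i c k j
    by (simp add: Rop_Phi[OF nb(1)] wedge_act Phi_bilinear)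
  show "Ro i c (Phi Y (v b) (v d)) = (if c = d then Phi Y (f i) (v b) else 0) - (if c = b then Phi Y (f i) (v d) else 0)" for i c b d
    using Phi_antisym[OF Y, of "v b" "f i"] by (simp add: Rop_Phi[OF nb(1)] wedge_act Phi_bilinear)
  show "Ro i c (Phi Y (v b) (e j)) = (if i = j then Phi Y (v b) (v c) else 0) - (if b = c then Phi Y (f i) (e j) else 0)" for i c j b
    by (simp add: Rop_Phi[OF nb(1)] wedge_act Phi_bilinear)
  show "\<exists>z. \<forall>c b. Ro 1 c (Phi Y (f 2) (v b)) = (if b = c then z else 0)"
    using Phi_antisym[OF Y, of "f 1" "f 2"] by (intro exI[of _ "Phi Y (f 1) (f 2)"]) (simp add: Rop_Phi[OF nb(1)] wedge_act Phi_bilinear)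
  show "Ro 1 c (Phi Y (e 1) (e 2)) = Phi Y (v c) (e 2)" for c
    by (simp add: Rop_Phi[OF nb(1)] wedge_act Phi_bilinear)
  show "Ro 2 c (Phi Y (e 1) (e 2)) = - Phi Y (v c) (e 1)" for c
    using Phi_antisym[OF Y, of "v c" "e 1"] by (simp add: Rop_Phi[OF nb(1)] wedge_act Phi_bilinear)
qed (assumption | rule S_fun wedges_nilbar Phi_S Rop_smooth)+

text \<open>In the frame, the component of \<open>n\<^sup>T Y n\<close> in the opposite nilradical
  is \<open>\<Sum> s\<^sub>i\<^sub>a v\<^sub>a \<and> f\<^sub>i + r f\<^sub>1 \<and>
  f\<^sub>2\<close>, and \<open>d\<chi>\<close> of the remaining component is the trace
  \<open>g\<^sub>1\<^sub>1 + g\<^sub>2\<^sub>2\<close>.\<close>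

lemma Pi_act_eq:
  assumes Y: "Y \<in> so8" and h: "h \<in> S"
  shows "Pi_act D Y h = heisenberg_derivations.act Ro To (\<lambda>i b. Phi Y (v b) (e i)) (\<lambda>i j. Phi Y (f i) (e j)) (Phi Y (e 1) (e 2)) h"
proof -
  interpret A: heisenberg_derivations S Ro To "\<lambda>i b. Phi Y (f i) (v b)" "\<lambda>i b. Phi Y (v b) (e i)"
     "\<lambda>i j. Phi Y (f i) (e j)" "\<lambda>b c. Phi Y (v b) (v c)" "Phi Y (e 1) (e 2)" by (rule algebra[OF Y])
  show ?thesis
  proof
    fix n
    show "Pi_act D Y h n = A.act h n"
    proof (cases "n \<in> M")
      case n: True
      note so = SO8_transpose[OF M_SO8[OF n]]
      define A where "A = transpose n ** Y ** n"
      have Ad: "Ad (matrix_inv n) Y = A" by (simp add: Ad_def so A_def)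
      have Ph: "cdot \<xi> (A *v \<eta>) = Phi Y \<xi> \<eta> n" for \<xi> \<eta>
        using n cdot_mv[of n \<xi> "Y *v (n *v \<eta>)"] by (simp add: A_def Phi_def res_def flip: matrix_vector_mul_assoc)
      have A8: "A \<in> so8"
      proof (rule so8I)
        fix x y
        have "cdot y (A *v x) = - cdot x (A *v y)" unfolding Ph Phi_antisym[OF Y, of y x] by simp
        then show "cdot (A *v x) y = - cdot x (A *v y)" unfolding cdot_commute[of "A *v x" y] .
      qed
      have np: "ctr (A - nilpart A) = ctr A"
      proof -
        have "ctr (nilpart A) = 0" using nilpart_nilbar[of A] by (simp add: ctr_def nilpart_def part_m1_def part_m2_def sum_mv cdot_sum_right delta_mult)
        moreover have "ctr A = ctr (A - nilpart A) + ctr (nilpart A)" by (simp flip: ctr_linear)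
        ultimately show ?thesis by simp
      qed
      have R: "Rop D (nilpart A) h n = (\<Sum>i\<in>UNIV. \<Sum>a\<in>UNIV. cdot (v a) (A *v e i) * Ro i a h n) + cdot (e 1) (A *v e 2) * To h n"
      proof -
        have s: "cdot (v a) (A *v e i) *\<^sub>C wedge (v a) (f i) \<in> V" "(\<Sum>a\<in>UNIV. cdot (v a) (A *v e i) *\<^sub>C wedge (v a) (f i)) \<in> V"
          "part_m1 A \<in> V" "part_m2 A \<in> V" for a i
          unfolding part_m1_def part_m2_def
          by (intro cmat.subspace_sum[OF nilbar_subspace] cmat.subspace_scale[OF nilbar_subspace] wedges_nilbar)+
        have "Rop D (nilpart A) h n = Rop D (part_m1 A) h n + Rop D (part_m2 A) h n"
          unfolding nilpart_def using Rop_Z_add[OF s(3,4) h] by simp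
        moreover have "Rop D (part_m1 A) h n = (\<Sum>i\<in>UNIV. \<Sum>a\<in>UNIV. cdot (v a) (A *v e i) * Ro i a h n)"
          unfolding part_m1_def using s by (simp add: Rop_Z_sum[OF h] Rop_Z_scale[OF wedges_nilbar(1) h])
        moreover have "Rop D (part_m2 A) h n = cdot (e 1) (A *v e 2) * To h n"
          unfolding part_m2_def by (simp add: Rop_Z_scale[OF wedges_nilbar(2) h])
        ultimately show ?thesis by simp
      qed
      have "Pi_act D Y h n = ctr A * h n - Rop D (nilpart A) h n"
        using n by (simp add: Pi_act_def Ad proj_parab[OF A8] proj_nilbar[OF A8] dchi_parab[OF parab_nilpart[OF A8]] np)
      then show ?thesis by (simp add: A.act_def R ctr_def Ph sum_2 sum_4 algebra_simps)
    next
      case n: False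
      have "A.act h n = 0"
        unfolding A.act_def using n by (simp add: Phi_def res_def Rop_off sum_2 sum_4)
      then show ?thesis using n by (simp add: Pi_act_def)
    qed
  qed
qed

text \<open>The operator \<open>\<Omega>\<^sub>2\<close> on the derived algebra of the Levi factor,
  with the sums over roots replaced by sums over the frame.\<close>

definition Omega2_op :: "mat8 \<Rightarrow> (mat8 \<Rightarrow> complex) \<Rightarrow> mat8 \<Rightarrow> complex"
  where "Omega2_op Z h n = - (1 / 2) * (\<Sum>i\<in>UNIV. \<Sum>a\<in>UNIV. \<Sum>j\<in>UNIV. \<Sum>b\<in>UNIV.
     \<phi> (lbr (wedge (e j) (v b)) (lbr Z (wedge (e i) (v a)))) * Ro i a (Ro j b h) n)"

lemma X_minus_nilbar: "\<beta> \<in> roots_Vplus D \<Longrightarrow> Xv D (- \<beta>) \<in> V"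
proof -
  assume "\<beta> \<in> roots_Vplus D"
  then obtain i c where "i \<in> E" "c \<in> C" "\<beta> = rt i c" unfolding roots_Vplus_eq by auto
  then show ?thesis using root_vector_scale(3) cmat.subspace_scale[OF nilbar_subspace wedge_u_nilbar] by simp
qed

text \<open>The product of structure constants becomes a bilinear expression by
  \<open>coefficient_product\<close>, after which \<open>contraction\<close> is applied once for
  each of the two summations.\<close>

lemma Omega2_eq:
  assumes Z: "Z' \<in> levi_ss D" and h: "h \<in> S"
  shows "Omega2 D (Z' + k *\<^sub>C Hg) h = Omega2_op Z' h"
proof
  fix n
  have Z0: "Z' \<in> eigsp D 0" using levi_ss_ctr[OF Z] by simp
  let ?R = "roots_Vplus D"
  have RR: "Rop D X h \<in> S" if "X \<in> V" for X using Rop_smooth[OF that h] .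
  have "Omega2 D (Z' + k *\<^sub>C Hg) h n = - (1 / 2) * (\<Sum>\<alpha>\<in>?R. \<Sum>\<beta>\<in>?R.
      \<phi> (lbr (Xv D \<beta>) (lbr Z' (Xv D \<alpha>))) * Rop D (Xv D (- \<alpha>)) (Rop D (Xv D (- \<beta>)) h) n)"
    unfolding Omega2_def proj_levi_ss[OF Z] Let_def using coefficient_product[OF Z0] by simp
  also have "(\<Sum>\<alpha>\<in>?R. \<Sum>\<beta>\<in>?R. \<phi> (lbr (Xv D \<beta>) (lbr Z' (Xv D \<alpha>))) * Rop D (Xv D (- \<alpha>)) (Rop D (Xv D (- \<beta>)) h) n) =
     (\<Sum>i\<in>UNIV. \<Sum>a\<in>UNIV. \<Sum>\<beta>\<in>?R. \<phi> (lbr (Xv D \<beta>) (lbr Z' (wedge (e i) (v a)))) * Ro i a (Rop D (Xv D (- \<beta>)) h) n)"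
    by (rule contraction[where G = "\<lambda>X Y. \<Sum>\<beta>\<in>?R. \<phi> (lbr (Xv D \<beta>) (lbr Z' X)) * Rop D Y (Rop D (Xv D (- \<beta>)) h) n"])
      (simp_all add: lbr_bilinear phi_linear Rop_Z_add Rop_Z_scale RR X_minus_nilbar sum.distrib sum_distrib_left algebra_simps cong: sum.cong)
  also have "\<dots> = (\<Sum>i\<in>UNIV. \<Sum>a\<in>UNIV. \<Sum>j\<in>UNIV. \<Sum>b\<in>UNIV.
     \<phi> (lbr (wedge (e j) (v b)) (lbr Z' (wedge (e i) (v a)))) * Ro i a (Ro j b h) n)"
  proof (intro sum.cong refl)
    fix i a
    have lin1: "Ro i a (Rop D (Y + Y') h) n = Ro i a (Rop D Y h) n + Ro i a (Rop D Y' h) n" if "Y \<in> V" "Y' \<in> V" for Y Y'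
      using Rop_add[OF wedges_nilbar(1) RR[OF that(1)] RR[OF that(2)]] by (simp add: Rop_Z_add[OF that h])
    have lin2: "Ro i a (Rop D (c *\<^sub>C Y) h) n = c * Ro i a (Rop D Y h) n" if "Y \<in> V" for c Y
      using Rop_cmult[OF wedges_nilbar(1) RR[OF that]] by (simp add: Rop_Z_scale[OF that h])
    show "(\<Sum>\<beta>\<in>?R. \<phi> (lbr (Xv D \<beta>) (lbr Z' (wedge (e i) (v a)))) * Ro i a (Rop D (Xv D (- \<beta>)) h) n) =
      (\<Sum>j\<in>UNIV. \<Sum>b\<in>UNIV. \<phi> (lbr (wedge (e j) (v b)) (lbr Z' (wedge (e i) (v a)))) * Ro i a (Ro j b h) n)"
      by (rule contraction[where G = "\<lambda>X Y. \<phi> (lbr X (lbr Z' (wedge (e i) (v a)))) * Ro i a (Rop D Y h) n"])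
        (simp_all add: lbr_bilinear phi_linear lin1 lin2 algebra_simps)
  qed
  finally show "Omega2 D (Z' + k *\<^sub>C Hg) h n = Omega2_op Z' h n" by (simp add: Omega2_op_def)
qed

lemma diff_rearrange:
  fixes Z p q a b n h d :: mat8
  assumes "Z = p + q + a + b + n" "p + q - h = d"
  shows "Z - h = d + a + b + n"
  unfolding assms(1) assms(2)[symmetric] by (simp add: algebra_simps)

lemma levi_split: "Z \<in> levi D \<Longrightarrow> Z - (ctr Z / 2) *\<^sub>C Hg \<in> levi_ss D"
proof -
  assume "Z \<in> levi D"
  then have Z: "Z \<in> eigsp D 0" by (simp add: levi_eq)
  have sub: "cmat.subspace (levi_ss D)" by (simp add: levi_ss_def)
  let ?g = "\<lambda>i j. cdot (f i) (Z *v e j)"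
  let ?N = "\<Sum>a\<in>UNIV. \<Sum>b\<in>UNIV. (cdot (v a) (Z *v v b) / 2) *\<^sub>C wedge (v a) (v b)"
  have "part_m2 Z = 0" "part_m1 Z = 0" "part_1 Z = 0" "part_2 Z = 0"
    using eigsp_cdot_frame[OF Z] by (simp_all add: part_m2_def part_m1_def part_1_def part_2_def)
  then have "Z = part_0 Z" using grade_decomposition[OF eigsp_so8[OF Z]] by simp
  then have "Z = ?g 1 1 *\<^sub>C wedge (e 1) (f 1) + ?g 2 2 *\<^sub>C wedge (e 2) (f 2) + ?g 1 2 *\<^sub>C wedge (e 1) (f 2) + ?g 2 1 *\<^sub>C wedge (e 2) (f 1) + ?N"
    by (simp add: part_0_def[of Z] sum_2 algebra_simps)
  moreover have "?g 1 1 *\<^sub>C wedge (e 1) (f 1) + ?g 2 2 *\<^sub>C wedge (e 2) (f 2) - (ctr Z / 2) *\<^sub>C Hg =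
     ((?g 1 1 - ?g 2 2) / 2) *\<^sub>C (wedge (e 1) (f 1) - wedge (e 2) (f 2))"
    by (simp add: Hg_eq ctr_def cscale_def vec_eq_iff field_simps)
  ultimately have "Z - (ctr Z / 2) *\<^sub>C Hg = ((?g 1 1 - ?g 2 2) / 2) *\<^sub>C (wedge (e 1) (f 1) - wedge (e 2) (f 2))
     + ?g 1 2 *\<^sub>C wedge (e 1) (f 2) + ?g 2 1 *\<^sub>C wedge (e 2) (f 1) + ?N"
    by (rule diff_rearrange)
  also have "\<dots> \<in> levi_ss D"
    by (intro cmat.subspace_add[OF sub] cmat.subspace_scale[OF sub] cmat.subspace_sum[OF sub] levi_ss_mem) simp_all
  finally show ?thesis .
qed

text \<open>The projection of the Levi factor to its derived algebra along
  \<open>H\<^sub>\<gamma>\<close>; the factor 1/2 is the inverse of the trace of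
  \<open>H\<^sub>\<gamma>\<close> on \<open>E\<close>.\<close>

definition levi_ss_part :: "mat8 \<Rightarrow> mat8" where "levi_ss_part Z = Z - (ctr Z / 2) *\<^sub>C Hg"

lemma levi_ss_part_linear: "levi_ss_part (A + B) = levi_ss_part A + levi_ss_part B" "levi_ss_part (k *\<^sub>C A) = k *\<^sub>C levi_ss_part A" "levi_ss_part 0 = 0"
  by (simp_all add: levi_ss_part_def ctr_linear add_divide_distrib cmat.scale_left_distrib cmat.scale_right_diff_distrib)

lemma Omega2_levi: "Z \<in> levi D \<Longrightarrow> h \<in> S \<Longrightarrow> Omega2 D Z h = Omega2_op (levi_ss_part Z) h"
  using Omega2_eq[OF levi_split, of Z h "ctr Z / 2"] by (simp add: levi_ss_part_def)

lemma Omega2_op_linear: "Omega2_op (A + B) h = (\<lambda>n. Omega2_op A h n + Omega2_op B h n)" "Omega2_op (k *\<^sub>C A) h = (\<lambda>n. k * Omega2_op A h n)" 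
  by (simp_all add: Omega2_op_def fun_eq_iff lbr_bilinear phi_linear sum.distrib sum_distrib_left algebra_simps)

lemma Omega2_op_S: "h \<in> S \<Longrightarrow> Omega2_op Z h \<in> S"
  unfolding Omega2_op_def[abs_def]
  by (intro smooth_funs_cmult S_sum_fun) (intro Rop_smooth wedges_nilbar)

text \<open>A third application of \<open>contraction\<close>.\<close>

lemma Omega3_eq:
  assumes Y: "Y \<in> eigsp D (- 1)" and h: "h \<in> S"
  shows "Omega3 D Y h = (\<lambda>n. \<Sum>i\<in>UNIV. \<Sum>a\<in>UNIV. Ro i a (Omega2_op (levi_ss_part (lbr (wedge (e i) (v a)) Y)) h) n)"
proof
  fix n
  have lv: "lbr X Y \<in> levi D" if "X \<in> eigsp D 1" for X
  proof -
    have "lbr Hg (lbr X Y) = lbr (lbr Hg X) Y + lbr X (lbr Hg Y)"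
      by (rule mat8_eqI) (simp add: lbr_mv)
    then show ?thesis using Y that by (simp add: levi_eq eigsp_def lbr_bilinear)
  qed
  have X1: "Xv D \<beta> \<in> eigsp D 1" if "\<beta> \<in> roots_Vplus D" for \<beta>
    using that X_root_space by (auto simp: roots_Vplus_def)
  have "Omega3 D Y h n = (\<Sum>\<epsilon>\<in>roots_Vplus D. Rop D (Xv D (- \<epsilon>)) (Omega2_op (levi_ss_part (lbr (Xv D \<epsilon>) Y)) h) n)"
    unfolding Omega3_def using Omega2_levi[OF lv[OF X1] h] by simp
  also have "\<dots> = (\<Sum>i\<in>UNIV. \<Sum>a\<in>UNIV. Ro i a (Omega2_op (levi_ss_part (lbr (wedge (e i) (v a)) Y)) h) n)"
    by (rule contraction[where G = "\<lambda>X Z. Rop D Z (Omega2_op (levi_ss_part (lbr X Y)) h) n"])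
      (simp_all add: lbr_bilinear levi_ss_part_linear Omega2_op_linear Rop_add Rop_cmult Rop_Z_add Rop_Z_scale Omega2_op_S h)
  finally show "Omega3 D Y h n = (\<Sum>i\<in>UNIV. \<Sum>a\<in>UNIV. Ro i a (Omega2_op (levi_ss_part (lbr (wedge (e i) (v a)) Y)) h) n)" .
qed

end

context heis
begin

lemma so8_zero: "(0 :: mat8) \<in> so8"
  by simp

definition moment_op :: "4 \<Rightarrow> 4 \<Rightarrow> (mat8 \<Rightarrow> complex) \<Rightarrow> mat8 \<Rightarrow> complex"
  where "moment_op a c h = Ro 1 a (Ro 2 c h) - Ro 1 c (Ro 2 a h)"

definition cubic_op :: "2 \<Rightarrow> 4 \<Rightarrow> (mat8 \<Rightarrow> complex) \<Rightarrow> mat8 \<Rightarrow> complex"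
  where "cubic_op i c h = (\<Sum>a\<in>UNIV. Ro i a (moment_op a c h))"

definition quadratic_op :: "2 \<Rightarrow> 2 \<Rightarrow> (mat8 \<Rightarrow> complex) \<Rightarrow> mat8 \<Rightarrow> complex"
  where "quadratic_op i j h = (\<Sum>a\<in>UNIV. Ro i a (Ro j a h))"

lemma sum_fun: "(\<Sum>b\<in>B. F b) x = (\<Sum>b\<in>B. F b x)" for F :: "_ \<Rightarrow> mat8 \<Rightarrow> complex"
  by (induction B rule: infinite_finite_induct) simp_all

lemma Omega2_op_act:
  assumes "Z \<in> eigsp D 0"
  shows "Omega2_op Z h n = - (1 / 2) / \<kappa> * (\<Sum>i\<in>UNIV. \<Sum>a\<in>UNIV. \<Sum>j\<in>UNIV. \<Sum>b\<in>UNIV.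
     (cdot (f 1) (wedge (Z *v e i) (e j) *v f 2) * cdot (v a) (v b)
        + cdot (f 1) (wedge (e i) (e j) *v f 2) * cdot (v b) (Z *v v a)) * Ro i a (Ro j b h) n)"
proof -
  have l: "lbr (wedge (e j) (v b)) (lbr Z (wedge (e i) (v a))) = 
     cdot (v a) (v b) *\<^sub>C wedge (Z *v e i) (e j) + cdot (v b) (Z *v v a) *\<^sub>C wedge (e i) (e j)" for i a j b
  proof -
    have c: "cdot (e j) (Z *v e i) = 0" "cdot (v b) (Z *v e i) = 0" "cdot (e j) (Z *v v a) = 0"
      using eigsp_cdot_frame[OF assms] by simp_all
    show ?thesis
      by (simp add: lbr_wedge eigsp_so8[OF assms] lbr_bilinear wedge_bilinear c)
  qed
  have p: "\<phi> (lbr (wedge (e j) (v b)) (lbr Z (wedge (e i) (v a)))) = 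
     (cdot (f 1) (wedge (Z *v e i) (e j) *v f 2) * cdot (v a) (v b)
        + cdot (f 1) (wedge (e i) (e j) *v f 2) * cdot (v b) (Z *v v a)) / \<kappa>" for i a j b
    unfolding l by (simp add: \<phi>_def mult.commute)
  show ?thesis
    unfolding Omega2_op_def p times_divide_eq_left sum_divide_distrib[symmetric] by simp
qed

text \<open>On \<open>so(V\<^sub>0)\<close> the operator \<open>\<Omega>\<^sub>2\<close> is the
  angular momentum, up to the factor \<open>1/\<kappa>\<close>.\<close>

lemma Omega2_op_vv: 
  assumes h: "h \<in> S"
  shows "Omega2_op (wedge (v c) (v d)) h n = moment_op c d h n / \<kappa>"
proof -
  have "Omega2_op (wedge (v c) (v d)) h n = - (1 / 2) / \<kappa> * (\<Sum>i\<in>UNIV. \<Sum>a\<in>UNIV. \<Sum>j\<in>UNIV. \<Sum>b\<in>UNIV.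
     (cdot (f 1) (wedge (e i) (e j) *v f 2) * ((if a = d then if b = c then 1 else 0 else 0) - (if a = c then if b = d then 1 else 0 else 0))) * Ro i a (Ro j b h) n)"
    unfolding Omega2_op_act[OF wedge_grades(4)] by (intro arg_cong2[where f = "(*)"] refl sum.cong) auto
  also have "\<dots> = - (1 / 2) / \<kappa> * (\<Sum>i\<in>UNIV. \<Sum>j\<in>UNIV. 
     cdot (f 1) (wedge (e i) (e j) *v f 2) * (Ro i d (Ro j c h) n - Ro i c (Ro j d h) n))"
  proof (intro arg_cong2[where f = "(*)"] refl sum.cong)
    fix i
    let ?w = "\<lambda>j. cdot (f 1) (wedge (e i) (e j) *v f 2)"
    have "(\<Sum>a\<in>UNIV. \<Sum>j\<in>UNIV. \<Sum>b\<in>UNIV. (?w j * ((if a = d then if b = c then 1 else 0 else 0) - (if a = c then if b = d then 1 else 0 else 0))) * Ro i a (Ro j b h) n)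
      = (\<Sum>j\<in>UNIV. \<Sum>a\<in>UNIV. \<Sum>b\<in>UNIV. (if a = d then if b = c then ?w j * Ro i a (Ro j b h) n else 0 else 0) - (if a = c then if b = d then ?w j * Ro i a (Ro j b h) n else 0 else 0))"
      by (subst sum.swap) (intro sum.cong refl, auto)
    also have "\<dots> = (\<Sum>j\<in>UNIV. ?w j * (Ro i d (Ro j c h) n - Ro i c (Ro j d h) n))"
      by (simp add: sum_subtractf sum_if_const right_diff_distrib)
    finally show "(\<Sum>a\<in>UNIV. \<Sum>j\<in>UNIV. \<Sum>b\<in>UNIV. (?w j * ((if a = d then if b = c then 1 else 0 else 0) - (if a = c then if b = d then 1 else 0 else 0))) * Ro i a (Ro j b h) n)
      = (\<Sum>j\<in>UNIV. ?w j * (Ro i d (Ro j c h) n - Ro i c (Ro j d h) n))" .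
  qed
  also have "\<dots> = - (1 / 2) / \<kappa> * ((Ro 1 d (Ro 2 c h) n - Ro 1 c (Ro 2 d h) n) - (Ro 2 d (Ro 1 c h) n - Ro 2 c (Ro 1 d h) n))"
    by (simp add: sum_2)
  also have "\<dots> = moment_op c d h n / \<kappa>"
  proof -
    interpret A: heisenberg_derivations S Ro To "\<lambda>i b. Phi 0 (f i) (v b)" "\<lambda>i b. Phi 0 (v b) (e i)"
     "\<lambda>i j. Phi 0 (f i) (e j)" "\<lambda>b c. Phi 0 (v b) (v c)" "Phi 0 (e 1) (e 2)" by (rule algebra[OF so8_zero])
    have s: "Ro 2 d (Ro 1 c h) n = Ro 1 c (Ro 2 d h) n + (if c = d then To h n else 0)"
       "Ro 2 c (Ro 1 d h) n = Ro 1 d (Ro 2 c h) n + (if c = d then To h n else 0)"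
      using A.R_heis[OF h, of c d] A.R_heis[OF h, of d c] by auto
    show ?thesis unfolding s using kappa(1) by (simp add: moment_op_def field_simps)
  qed
  finally show ?thesis .
qed

lemma Omega2_op_ef:
  assumes Z: "Z \<in> eigsp D 0" and z: "\<And>a. Z *v v a = 0"
  shows "Omega2_op Z h n = - (1 / 2) / \<kappa> * (\<Sum>i\<in>UNIV. \<Sum>j\<in>UNIV. cdot (f 1) (wedge (Z *v e i) (e j) *v f 2) * quadratic_op i j h n)"
proof -
  have "Omega2_op Z h n = - (1 / 2) / \<kappa> * (\<Sum>i\<in>UNIV. \<Sum>a\<in>UNIV. \<Sum>j\<in>UNIV. \<Sum>b\<in>UNIV.
     if a = b then cdot (f 1) (wedge (Z *v e i) (e j) *v f 2) * Ro i a (Ro j b h) n else 0)"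
    unfolding Omega2_op_act[OF Z] by (intro arg_cong2[where f = "(*)"] refl sum.cong) (simp add: z)
  also have "\<dots> = - (1 / 2) / \<kappa> * (\<Sum>i\<in>UNIV. \<Sum>a\<in>UNIV. \<Sum>j\<in>UNIV. cdot (f 1) (wedge (Z *v e i) (e j) *v f 2) * Ro i a (Ro j a h) n)"
    by simp
  also have "(\<Sum>i\<in>UNIV. \<Sum>a\<in>UNIV. \<Sum>j\<in>UNIV. cdot (f 1) (wedge (Z *v e i) (e j) *v f 2) * Ro i a (Ro j a h) n) = 
      (\<Sum>i\<in>UNIV. \<Sum>j\<in>UNIV. cdot (f 1) (wedge (Z *v e i) (e j) *v f 2) * quadratic_op i j h n)"
    by (intro sum.cong[OF refl], subst sum.swap) (simp add: quadratic_op_def sum_fun sum_distrib_left)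
  finally show ?thesis .
qed

text \<open>On \<open>sl(E)\<close> the operator \<open>\<Omega>\<^sub>2\<close> consists of the
  contractions of \<open>R\<close> with itself over \<open>V\<^sub>0\<close>.\<close>

lemma Omega2_op_sl2: "Omega2_op (wedge (e 1) (f 2)) h n = - quadratic_op 2 2 h n / (2 * \<kappa>)"
  "Omega2_op (wedge (e 2) (f 1)) h n = quadratic_op 1 1 h n / (2 * \<kappa>)"
  "Omega2_op (wedge (e 1) (f 1) - wedge (e 2) (f 2)) h n = - (quadratic_op 1 2 h n + quadratic_op 2 1 h n) / (2 * \<kappa>)"
proof -
  have d: "wedge (e 1) (f 1) - wedge (e 2) (f 2) \<in> eigsp D 0"
    by (intro cmat.subspace_diff[OF eigsp_subspace] wedge_grades)
  show "Omega2_op (wedge (e 1) (f 2)) h n = - quadratic_op 2 2 h n / (2 * \<kappa>)"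
    "Omega2_op (wedge (e 2) (f 1)) h n = quadratic_op 1 1 h n / (2 * \<kappa>)"
    by (subst Omega2_op_ef[OF wedge_grades(3)]; simp add: sum_2 wedge_bilinear)+
  show "Omega2_op (wedge (e 1) (f 1) - wedge (e 2) (f 2)) h n = - (quadratic_op 1 2 h n + quadratic_op 2 1 h n) / (2 * \<kappa>)"
    by (subst Omega2_op_ef[OF d]; use kappa(1) in \<open>simp add: sum_2 wedge_bilinear field_simps\<close>)
qed

lemma levi_ss_part_frame: "levi_ss_part (wedge (v a) (v c)) = wedge (v a) (v c)"
  "i \<noteq> j \<Longrightarrow> levi_ss_part (wedge (e i) (f j)) = wedge (e i) (f j)"
  "levi_ss_part (wedge (e 1) (f 1)) = (1 / 2) *\<^sub>C (wedge (e 1) (f 1) - wedge (e 2) (f 2))"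
  "levi_ss_part (wedge (e 2) (f 2)) = (- (1 / 2)) *\<^sub>C (wedge (e 1) (f 1) - wedge (e 2) (f 2))"
proof -
  show "levi_ss_part (wedge (v a) (v c)) = wedge (v a) (v c)" by (simp add: levi_ss_part_def ctr_def)
  show "levi_ss_part (wedge (e i) (f j)) = wedge (e i) (f j)" if "i \<noteq> j" using that by (auto simp add: levi_ss_part_def ctr_def)
  show "levi_ss_part (wedge (e 1) (f 1)) = (1 / 2) *\<^sub>C (wedge (e 1) (f 1) - wedge (e 2) (f 2))"
    "levi_ss_part (wedge (e 2) (f 2)) = (- (1 / 2)) *\<^sub>C (wedge (e 1) (f 1) - wedge (e 2) (f 2))"
    by (simp_all add: levi_ss_part_def ctr_def Hg_eq cscale_def vec_eq_iff field_simps)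
qed

lemma lbr_ev_vf: "lbr (wedge (e j) (v a)) (wedge (v c) (f i)) = 
   (if a = c then wedge (e j) (f i) else 0) + (if i = j then wedge (v a) (v c) else 0)"
  unfolding wedge_antisym[of "v a" "v c"] by (simp add: lbr_wedge wedge_bilinear)

lemma moment_op_S: "h \<in> S \<Longrightarrow> moment_op a c h \<in> S"
  using S_fun(2)[of "Ro 1 a (Ro 2 c h)" "- Ro 1 c (Ro 2 a h)"] S_fun(4) Rop_smooth wedges_nilbar by (simp add: moment_op_def)

lemma quadratic_op_S: "h \<in> S \<Longrightarrow> quadratic_op i j h \<in> S"
proof -
  assume h: "h \<in> S"
  have "quadratic_op i j h = (\<lambda>x. \<Sum>a\<in>UNIV. Ro i a (Ro j a h) x)" by (rule ext) (simp add: quadratic_op_def sum_fun)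
  then show ?thesis using S_sum_fun[of UNIV "\<lambda>a. Ro i a (Ro j a h)"] Rop_smooth wedges_nilbar h by simp
qed

lemma Ro_cmult: "h \<in> S \<Longrightarrow> Ro i a (\<lambda>x. k * h x) n = k * Ro i a h n"
  using Rop_cmult[OF wedges_nilbar(1)] by simp

text \<open>The bracket \<open>[e\<^sub>j \<and> v\<^sub>a, v\<^sub>c \<and> f\<^sub>i] =
  \<delta>\<^sub>a\<^sub>c e\<^sub>j \<and> f\<^sub>i + \<delta>\<^sub>i\<^sub>j v\<^sub>a \<and>
  v\<^sub>c\<close> has a part in \<open>so(V\<^sub>0)\<close>, which contributes
  \<open>1/\<kappa>\<close> times the cubic operator, and a part in \<open>gl(E)\<close>, which
  contributes \<open>1/(2\<kappa>)\<close> times it by \<open>cubic_quadratic_1\<close> and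
  \<open>cubic_quadratic_2\<close>.\<close>

theorem Omega3_frame:
  assumes h: "h \<in> S"
  shows "Omega3 D (wedge (v c) (f i)) h n = 3 / (2 * \<kappa>) * cubic_op i c h n"
proof -
  interpret A: heisenberg_derivations S Ro To "\<lambda>i b. Phi 0 (f i) (v b)" "\<lambda>i b. Phi 0 (v b) (e i)"
     "\<lambda>i j. Phi 0 (f i) (e j)" "\<lambda>b c. Phi 0 (v b) (v c)" "Phi 0 (e 1) (e 2)" by (rule algebra[OF so8_zero])
  have s: "Omega2_op (levi_ss_part (lbr (wedge (e j) (v a)) (wedge (v c) (f i)))) h = 
     (\<lambda>n. (if a = c then Omega2_op (levi_ss_part (wedge (e j) (f i))) h n else 0) + (if i = j then moment_op a c h n / \<kappa> else 0))" for j a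
  proof -
    have z: "Omega2_op 0 h n = 0" for n using Omega2_op_linear(2)[of 0 0 h] by simp
    show ?thesis
      unfolding lbr_ev_vf levi_ss_part_linear Omega2_op_linear by (rule ext) (simp add: z levi_ss_part_linear(3) levi_ss_part_frame(1) Omega2_op_vv[OF h])
  qed
  have S1: "(\<lambda>n. if a = c then Omega2_op (levi_ss_part (wedge (e j) (f i))) h n else 0) \<in> S" for j a
    using Omega2_op_S[OF h] smooth_funs_zero by (cases "a = c") simp_all
  have S2: "(\<lambda>n. if i = j then moment_op a c h n / \<kappa> else 0) \<in> S" for j a
    using smooth_funs_cmult[OF moment_op_S[OF h], of "1 / \<kappa>"] smooth_funs_zero by (cases "i = j") simp_all
  have r0: "Ro j a (\<lambda>n. 0) n = 0" for j a using Ro_cmult[where h = "\<lambda>n. 0" and i = j and a = a and k = 0 and n = n] smooth_funs_zero by simp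
  have r: "Ro j a (Omega2_op (levi_ss_part (lbr (wedge (e j) (v a)) (wedge (v c) (f i)))) h) n = 
     (if a = c then Ro j c (Omega2_op (levi_ss_part (wedge (e j) (f i))) h) n else 0) + (if i = j then Ro i a (moment_op a c h) n / \<kappa> else 0)" for j a
  proof -
    have "Ro j a (\<lambda>n. if i = j then moment_op a c h n / \<kappa> else 0) n = (if i = j then Ro i a (moment_op a c h) n / \<kappa> else 0)"
      using Ro_cmult[where h = "moment_op a c h" and i = j and a = a and k = "1 / \<kappa>" and n = n, OF moment_op_S[OF h]] r0 by (cases "i = j") simp_all
    moreover have "Ro j a (\<lambda>n. if a = c then Omega2_op (levi_ss_part (wedge (e j) (f i))) h n else 0) n = 
       (if a = c then Ro j c (Omega2_op (levi_ss_part (wedge (e j) (f i))) h) n else 0)"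
      using r0 by (cases "a = c") simp_all
    ultimately show ?thesis unfolding s using Rop_add[OF wedges_nilbar(1) S1 S2] by simp
  qed
  have "Omega3 D (wedge (v c) (f i)) h n = (\<Sum>j\<in>UNIV. Ro j c (Omega2_op (levi_ss_part (wedge (e j) (f i))) h) n) + cubic_op i c h n / \<kappa>"
    unfolding Omega3_eq[OF wedge_grades(2) h] r sum.distrib 
    by (simp add: sum_if_const cubic_op_def sum_fun sum_divide_distrib)
  also have "(\<Sum>j\<in>UNIV. Ro j c (Omega2_op (levi_ss_part (wedge (e j) (f i))) h) n) = cubic_op i c h n / (2 * \<kappa>)"
  proof -
    have "i = 1 \<or> i = 2" using exhaust_2 by blast
    then show ?thesis
    proof
      assume i: "i = 1"
      have q1: "Omega2_op (levi_ss_part (wedge (e 1) (f 1))) h = (\<lambda>n. - (1 / (4 * \<kappa>)) * (quadratic_op 1 2 h + quadratic_op 2 1 h) n)"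
        unfolding levi_ss_part_frame(3) Omega2_op_linear Omega2_op_sl2 using kappa(1) by (intro ext) (simp add: field_simps)
      have q2: "Omega2_op (levi_ss_part (wedge (e 2) (f 1))) h = (\<lambda>n. (1 / (2 * \<kappa>)) * quadratic_op 1 1 h n)"
        by (rule ext) (simp add: levi_ss_part_frame(2) Omega2_op_sl2)
      have "2 * cubic_op 1 c h n = 2 * Ro 2 c (quadratic_op 1 1 h) n - Ro 1 c (quadratic_op 1 2 h + quadratic_op 2 1 h) n"
        using fun_cong[OF A.cubic_quadratic_1[OF h, of c], of n] 
        unfolding A.cubic_def A.moment_def cubic_op_def moment_op_def quadratic_op_def sum.distrib by simp
      then have C: "cubic_op 1 c h n = Ro 2 c (quadratic_op 1 1 h) n - Ro 1 c (quadratic_op 1 2 h + quadratic_op 2 1 h) n / 2"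
        by (simp add: field_simps)
      show ?thesis
        unfolding i sum_2 q1 q2 Ro_cmult[OF quadratic_op_S[OF h]] Ro_cmult[OF S_fun(2)[OF quadratic_op_S[OF h] quadratic_op_S[OF h]]] C
        using kappa(1) by (simp add: field_simps)
    next
      assume i: "i = 2"
      have q1: "Omega2_op (levi_ss_part (wedge (e 2) (f 2))) h = (\<lambda>n. (1 / (4 * \<kappa>)) * (quadratic_op 1 2 h + quadratic_op 2 1 h) n)"
        unfolding levi_ss_part_frame(4) Omega2_op_linear Omega2_op_sl2 using kappa(1) by (intro ext) (simp add: field_simps)
      have q2: "Omega2_op (levi_ss_part (wedge (e 1) (f 2))) h = (\<lambda>n. (- 1 / (2 * \<kappa>)) * quadratic_op 2 2 h n)"
        by (rule ext) (simp add: levi_ss_part_frame(2) Omega2_op_sl2)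
      have "2 * cubic_op 2 c h n = Ro 2 c (quadratic_op 1 2 h + quadratic_op 2 1 h) n - 2 * Ro 1 c (quadratic_op 2 2 h) n"
        using fun_cong[OF A.cubic_quadratic_2[OF h, of c], of n] 
        unfolding A.cubic_def A.moment_def cubic_op_def moment_op_def quadratic_op_def sum.distrib by simp
      then have C: "cubic_op 2 c h n = Ro 2 c (quadratic_op 1 2 h + quadratic_op 2 1 h) n / 2 - Ro 1 c (quadratic_op 2 2 h) n"
        by (simp add: field_simps)
      show ?thesis
        unfolding i sum_2 q1 q2 Ro_cmult[OF quadratic_op_S[OF h]] Ro_cmult[OF S_fun(2)[OF quadratic_op_S[OF h] quadratic_op_S[OF h]]] C
        using kappa(1) by (simp add: field_simps)
    qed
  qed
  finally show ?thesis using kappa by (simp add: field_simps)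
qed

lemma Omega3_linear:
  assumes h: "h \<in> S"
  shows "Y \<in> eigsp D (- 1) \<Longrightarrow> Y' \<in> eigsp D (- 1) \<Longrightarrow> Omega3 D (Y + Y') h n = Omega3 D Y h n + Omega3 D Y' h n"
    "Y \<in> eigsp D (- 1) \<Longrightarrow> Omega3 D (k *\<^sub>C Y) h n = k * Omega3 D Y h n"
proof -
  show "Omega3 D (Y + Y') h n = Omega3 D Y h n + Omega3 D Y' h n" if "Y \<in> eigsp D (- 1)" "Y' \<in> eigsp D (- 1)"
    unfolding Omega3_eq[OF that(1) h] Omega3_eq[OF that(2) h] Omega3_eq[OF cmat.subspace_add[OF eigsp_subspace that] h]
    by (simp add: lbr_bilinear levi_ss_part_linear Omega2_op_linear Rop_add[OF wedges_nilbar(1) Omega2_op_S[OF h] Omega2_op_S[OF h]] sum.distrib)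
  show "Omega3 D (k *\<^sub>C Y) h n = k * Omega3 D Y h n" if "Y \<in> eigsp D (- 1)"
    unfolding Omega3_eq[OF that h] Omega3_eq[OF cmat.subspace_scale[OF eigsp_subspace that] h]
    by (simp add: lbr_bilinear levi_ss_part_linear Omega2_op_linear Rop_cmult[OF wedges_nilbar(1) Omega2_op_S[OF h]] sum_distrib_left)
qed

lemma Omega3_sum:
  assumes h: "h \<in> S" and "finite B" "\<And>b. b \<in> B \<Longrightarrow> Z b \<in> eigsp D (- 1)"
  shows "Omega3 D (\<Sum>b\<in>B. k b *\<^sub>C Z b) h n = (\<Sum>b\<in>B. k b * Omega3 D (Z b) h n)"
  using assms(2,3)
proof (induction B rule: finite_induct)
  case empty
  show ?case using Omega3_linear(2)[OF h cmat.subspace_0[OF eigsp_subspace], of 0 n] by simp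
next
  case (insert b B)
  have "(\<Sum>b\<in>B. k b *\<^sub>C Z b) \<in> eigsp D (- 1)" "k b *\<^sub>C Z b \<in> eigsp D (- 1)"
    using insert by (auto intro!: cmat.subspace_sum[OF eigsp_subspace] cmat.subspace_scale[OF eigsp_subspace])
  then show ?case using insert by (simp add: Omega3_linear(1)[OF h] Omega3_linear(2)[OF h])
qed

text \<open>The coordinates of an element of \<open>V\<^sup>-\<close> in the basis \<open>v\<^sub>c
  \<and> f\<^sub>i\<close>.\<close>

definition coef :: "mat8 \<Rightarrow> 2 \<Rightarrow> 4 \<Rightarrow> complex" where "coef W i c = cdot (v c) (W *v e i)"

lemma Omega3_cubic:
  assumes W: "W \<in> eigsp D (- 1)" and h: "h \<in> S"
  shows "Omega3 D W h n = (\<Sum>i\<in>UNIV. \<Sum>c\<in>UNIV. 3 / (2 * \<kappa>) * coef W i c * cubic_op i c h n)"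
proof -
  have "W = (\<Sum>i\<in>UNIV. 1 *\<^sub>C (\<Sum>c\<in>UNIV. coef W i c *\<^sub>C wedge (v c) (f i)))"
    using W unfolding eigsp_m1_iff by (simp add: part_m1_def coef_def)
  then have "Omega3 D W h n = Omega3 D (\<Sum>i\<in>UNIV. 1 *\<^sub>C (\<Sum>c\<in>UNIV. coef W i c *\<^sub>C wedge (v c) (f i))) h n" by simp
  also have "\<dots> = (\<Sum>i\<in>UNIV. 1 * Omega3 D (\<Sum>c\<in>UNIV. coef W i c *\<^sub>C wedge (v c) (f i)) h n)"
    by (rule Omega3_sum[OF h]) (auto intro!: cmat.subspace_sum[OF eigsp_subspace] cmat.subspace_scale[OF eigsp_subspace] wedge_grades)
  also have "\<dots> = (\<Sum>i\<in>UNIV. \<Sum>c\<in>UNIV. coef W i c * Omega3 D (wedge (v c) (f i)) h n)"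
    by (simp add: Omega3_sum[OF h] wedge_grades)
  finally show ?thesis by (simp add: Omega3_frame[OF h] mult_ac)
qed

lemma cubic_op_S: "h \<in> S \<Longrightarrow> cubic_op i c h \<in> S"
proof -
  assume h: "h \<in> S"
  have "cubic_op i c h = (\<lambda>x. \<Sum>a\<in>UNIV. Ro i a (moment_op a c h) x)" by (rule ext) (simp add: cubic_op_def sum_fun)
  then show ?thesis using S_sum_fun[of UNIV "\<lambda>a. Ro i a (moment_op a c h)"] Rop_smooth wedges_nilbar moment_op_S[OF h] by simp
qed

lemma diff_ops_sum: "(\<And>b. b \<in> B \<Longrightarrow> F b \<in> diff_ops M) \<Longrightarrow> finite B \<Longrightarrow> (\<lambda>h x. \<Sum>b\<in>B. F b h x) \<in> diff_ops M"
proof (induction B rule: infinite_finite_induct)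
  case empty
  show ?case using diff_ops.mult[OF smooth_funs_zero[of M]] by simp
next
  case (insert b B)
  then show ?case using diff_ops.add[of "F b" M "\<lambda>h x. \<Sum>b\<in>B. F b h x"] by simp
qed simp

text \<open>Constants are not smooth functions in the sense of \<open>smooth_funs M\<close>, which
  vanish off \<open>M\<close>; therefore the values of the operator must vanish there too.\<close>

lemma diff_ops_cmult: "F \<in> diff_ops M \<Longrightarrow> (\<And>h n. h \<in> S \<Longrightarrow> n \<notin> M \<Longrightarrow> F h n = 0) \<Longrightarrow> (\<lambda>h x. k * F h x) \<in> diff_ops M"
proof -
  assume F: "F \<in> diff_ops M" and off: "\<And>h n. h \<in> S \<Longrightarrow> n \<notin> M \<Longrightarrow> F h n = 0"
  have "(\<lambda>h x. res M (\<lambda>_. k) x * F h x) \<in> diff_ops M"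
    using diff_ops.comp[OF diff_ops.mult[OF res_const_S[of k]] F] by simp
  then show ?thesis by (rule diff_ops.cong) (use off in \<open>auto simp: res_def fun_eq_iff\<close>)
qed

lemma cubic_op_diff_ops: "cubic_op i c \<in> diff_ops M"
proof -
  have R: "Ro i a \<in> diff_ops M" for i a by (intro diff_ops.field Rop_vector_field wedges_nilbar)
  have KK: "moment_op a c \<in> diff_ops M" for a
  proof -
    have "(\<lambda>h x. - 1 * Ro 1 c (Ro 2 a h) x) \<in> diff_ops M"
      by (rule diff_ops_cmult[OF diff_ops.comp[OF R R]]) (simp add: Rop_off)
    from diff_ops.add[OF diff_ops.comp[OF R[where i = 1 and a = a] R[where i = 2 and a = c]] this] show ?thesis
      by (rule diff_ops.cong) (simp add: moment_op_def fun_eq_iff)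
  qed
  have "(\<lambda>h x. \<Sum>a\<in>UNIV. Ro i a (moment_op a c h) x) \<in> diff_ops M"
    by (rule diff_ops_sum) (simp_all add: diff_ops.comp[OF R KK])
  then show ?thesis by (rule diff_ops.cong) (simp add: cubic_op_def sum_fun fun_eq_iff)
qed

lemma Omega3_diff_ops:
  assumes W: "W \<in> eigsp D (- 1)" shows "Omega3 D W \<in> diff_ops M"
proof -
  have "(\<lambda>h x. \<Sum>i\<in>UNIV. \<Sum>c\<in>UNIV. 3 / (2 * \<kappa>) * coef W i c * cubic_op i c h x) \<in> diff_ops M"
    by (intro diff_ops_sum diff_ops_cmult cubic_op_diff_ops) (simp_all add: smooth_funs_off[OF cubic_op_S])
  then show ?thesis by (rule diff_ops.cong) (simp add: Omega3_cubic[OF W] fun_eq_iff)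
qed

lemma lin_lin: "lin w (k *s \<xi>) = (\<lambda>x. k * lin w \<xi> x)" "lin w (- \<xi>) = (\<lambda>x. - lin w \<xi> x)" "lin w 0 = (\<lambda>x. 0)"
  by (auto simp: lin_def res_def fun_eq_iff)

text \<open>At the given point the linear functions in \<open>h\<close> vanish, so only the products
  of three first derivatives survive: \<open>h\<close> behaves like the monomial
  \<open>z\<^sub>p\<^sub>b\<^sup>2 z\<^sub>q\<^sub>d\<close> in coordinates dual to the
  \<open>R\<^sub>i\<^sub>a\<close>. Using the vectors \<open>n v\<^sub>b\<close> as coefficients
  centres these coordinates at \<open>n\<close>.\<close>

lemma cubic_op_test:
  assumes n: "n \<in> M" and bd: "b \<noteq> d" and pq: "p \<noteq> q"
  defines "h \<equiv> lin (n *v v b) (e p) * lin (n *v v b) (e p) * lin (n *v v d) (e q)"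
  shows "h \<in> S" "cubic_op i c h n = (if i = p \<and> c = d then if p = 1 then 2 else - 2 else 0)"
proof -
  note so = M_SO8[OF n]
  interpret A: heisenberg_derivations S Ro To "\<lambda>i b. Phi 0 (f i) (v b)" "\<lambda>i b. Phi 0 (v b) (e i)"
     "\<lambda>i j. Phi 0 (f i) (e j)" "\<lambda>b c. Phi 0 (v b) (v c)" "Phi 0 (e 1) (e 2)" by (rule algebra[OF so8_zero])
  have L: "lin w \<xi> \<in> S" for w \<xi> by (rule lin_S)
  then show "h \<in> S" by (simp add: h_def)
  have z: "Ro i a (\<lambda>x. 0) = 0" for i a using A.R_zero[where i = i and a = a] by (simp add: zero_fun_def)
  have z': "(\<lambda>x. 0 :: complex) = (0 :: mat8 \<Rightarrow> complex)" by (simp add: zero_fun_def)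
  have rl: "Ro i a (lin w (e j)) = (if i = j then lin w (v a) else 0)"
    "Ro i a (lin w (v b)) = (if a = b then - lin w (f i) else 0)"
    "Ro i a (lin w (f j)) = 0" for i a j w b
    using Rop_lin[OF wedges_nilbar(1)[of a i], of w] by (auto simp: wedge_act lin_lin z' fun_Compl_def simp del: wedge_mv)
  have val: "lin (n *v v a) (v c) n = (if a = c then 1 else 0)" "lin (n *v v a) (e j) n = 0" "lin (n *v v a) (f j) n = 0" for a c j
    using n by (simp_all add: lin_def res_def SO8_transpose(5)[OF so])
  let ?A = "lin (n *v v b) (e p)" and ?B = "lin (n *v v d) (e q)"
  define X where "X i a = (if i = p \<and> a = b then 1 else (0 :: complex))" for i a
  define Y where "Y i a = (if i = q \<and> a = d then 1 else (0 :: complex))" for i a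
  have v0: "?A n = 0" "?B n = 0" by (simp_all add: val)
  have v1: "Ro i a ?A n = X i a" "Ro i a ?B n = Y i a" for i a
    by (simp_all add: rl X_def Y_def val)
  have "Ro i a (Ro j c (Ro k g (F * G * H))) n =
      Ro i a F n * Ro j c G n * Ro k g H n + Ro i a F n * Ro k g G n * Ro j c H n + Ro j c F n * Ro i a G n * Ro k g H n
    + Ro j c F n * Ro k g G n * Ro i a H n + Ro k g F n * Ro i a G n * Ro j c H n + Ro k g F n * Ro j c G n * Ro i a H n"
    if "F \<in> S" "G \<in> S" "H \<in> S" "F n = 0" "G n = 0" "H n = 0" for F G H and i j k :: 2 and a c g :: 4
    using that by (simp add: A.R_mult A.R_add algebra_simps)
  from this[OF L L L v0(1) v0(1) v0(2)]
  have triple: "Ro i a (Ro j c (Ro k g h)) n = 2 * (X i a * X j c * Y k g + X i a * X k g * Y j c + X j c * X k g * Y i a)" for i j k a c g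
    unfolding h_def v1 by (simp add: algebra_simps)
  have "cubic_op i c h n = (\<Sum>a\<in>UNIV. Ro i a (Ro 1 a (Ro 2 c h)) n - Ro i a (Ro 1 c (Ro 2 a h)) n)"
    using \<open>h \<in> S\<close> by (simp add: cubic_op_def moment_op_def sum_fun A.R_diff)
  also have "\<dots> = (\<Sum>a\<in>UNIV. if a = b then (if i = p \<and> c = d then if p = 1 then 2 else - 2 else 0) else 0)"
  proof (rule sum.cong[OF refl])
    fix a
    have "(i = 1 \<or> i = 2) \<and> (p = 1 \<and> q = 2 \<or> p = 2 \<and> q = 1)"
      using pq exhaust_2[of i] exhaust_2[of p] exhaust_2[of q] by auto
    then show "Ro i a (Ro 1 a (Ro 2 c h)) n - Ro i a (Ro 1 c (Ro 2 a h)) n = 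
      (if a = b then (if i = p \<and> c = d then if p = 1 then 2 else - 2 else 0) else 0)"
      unfolding triple X_def Y_def using bd by (elim conjE disjE) simp_all
  qed
  finally show "cubic_op i c h n = (if i = p \<and> c = d then if p = 1 then 2 else - 2 else 0)" by simp
qed

lemma Omega3_injective:
  assumes W: "W \<in> eigsp D (- 1)" and n: "n \<in> M" and z: "\<And>h. h \<in> S \<Longrightarrow> Omega3 D W h n = 0"
  shows "W = 0"
proof -
  have c: "coef W p d = 0" for p d
  proof -
    obtain b :: 4 where b: "b \<noteq> d" by (metis zero_neq_one)
    obtain q :: 2 where q: "p \<noteq> q" by (metis zero_neq_one)
    define h where "h = lin (n *v v b) (e p) * lin (n *v v b) (e p) * lin (n *v v d) (e q)"
    have h: "h \<in> S" and t: "\<And>i c. cubic_op i c h n = (if i = p \<and> c = d then if p = 1 then 2 else - 2 else 0)"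
      unfolding h_def using cubic_op_test[OF n b q] by blast+
    have "0 = (\<Sum>i\<in>UNIV. \<Sum>c\<in>UNIV. 3 / (2 * \<kappa>) * coef W i c * cubic_op i c h n)"
      using z[OF h] Omega3_cubic[OF W h] by simp
    also have "\<dots> = (\<Sum>i\<in>UNIV. \<Sum>c\<in>UNIV. if i = p then if c = d then 3 / (2 * \<kappa>) * coef W p d * (if p = 1 then 2 else - 2) else 0 else 0)"
      unfolding t by (intro sum.cong refl) simp
    also have "\<dots> = 3 / (2 * \<kappa>) * coef W p d * (if p = 1 then 2 else - 2)" by (simp add: sum_if_const)
    finally show ?thesis using kappa by (auto split: if_splits)
  qed
  then have "part_m1 W = 0" by (simp add: part_m1_def flip: coef_def)
  then show ?thesis using W unfolding eigsp_m1_iff by simp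
qed

text \<open>The functions in \<open>bracket_cubic\<close>, extended linearly from \<open>v\<^sub>c
  \<and> f\<^sub>i\<close> to \<open>W\<close>.\<close>

definition mult_coef :: "mat8 \<Rightarrow> mat8 \<Rightarrow> 2 \<Rightarrow> 4 \<Rightarrow> mat8 \<Rightarrow> complex"
  where "mult_coef Y W l d n = - (Phi Y (f 1) (e 1) n + Phi Y (f 2) (e 2) n) * coef W l d
     - (\<Sum>i\<in>UNIV. coef W i d * Phi Y (f i) (e l) n) + (\<Sum>c\<in>UNIV. coef W l c * Phi Y (v d) (v c) n)"

lemma mult_coef_S: "mult_coef Y W l d \<in> S"
proof -
  have 1: "(\<lambda>n. \<Sum>i\<in>UNIV. coef W i d * Phi Y (f i) (e l) n) \<in> S" "(\<lambda>n. \<Sum>c\<in>UNIV. coef W l c * Phi Y (v d) (v c) n) \<in> S"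
    by (intro S_sum_fun smooth_funs_cmult Phi_S)+
  have "(\<lambda>n. - coef W l d * (Phi Y (f 1) (e 1) n + Phi Y (f 2) (e 2) n) + - 1 * (\<Sum>i\<in>UNIV. coef W i d * Phi Y (f i) (e l) n)
     + (\<Sum>c\<in>UNIV. coef W l c * Phi Y (v d) (v c) n)) \<in> S"
    by (intro smooth_funs_add smooth_funs_cmult 1 Phi_S)
  then show ?thesis by (simp add: mult_coef_def[abs_def] algebra_simps)
qed

lemma Omega3_bracket:
  assumes Y: "Y \<in> so8" and W: "W \<in> eigsp D (- 1)" and h: "h \<in> S"
  shows "Pi_act D Y (Omega3 D W h) n - Omega3 D W (Pi_act D Y h) n = 
     (\<Sum>l\<in>UNIV. \<Sum>d\<in>UNIV. mult_coef Y W l d n * Omega3 D (wedge (v d) (f l)) h n)"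
proof -
  interpret A: heisenberg_derivations S Ro To "\<lambda>i b. Phi Y (f i) (v b)" "\<lambda>i b. Phi Y (v b) (e i)"
     "\<lambda>i j. Phi Y (f i) (e j)" "\<lambda>b c. Phi Y (v b) (v c)" "Phi Y (e 1) (e 2)" by (rule algebra[OF Y])
  have cub: "A.cubic = cubic_op"
    by (intro ext) (simp add: A.cubic_def A.moment_def cubic_op_def moment_op_def)
  have off: "F n = 0" if "F \<in> S" "n \<notin> M" for F n using smooth_funs_off that by blast
  define q where "q = 3 / (2 * \<kappa>)"
  have O: "Omega3 D W h' n = (\<Sum>i\<in>UNIV. \<Sum>c\<in>UNIV. q * coef W i c * cubic_op i c h' n)" if "h' \<in> S" for h' n
    using Omega3_cubic[OF W that] by (simp add: q_def)
  have OS: "Omega3 D W h \<in> S"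
  proof -
    have "Omega3 D W h = (\<lambda>n. \<Sum>i\<in>UNIV. \<Sum>c\<in>UNIV. q * coef W i c * cubic_op i c h n)" using O[OF h] by (intro ext) simp
    moreover have "\<dots> \<in> S" by (intro S_sum_fun smooth_funs_cmult cubic_op_S h)
    ultimately show ?thesis by simp
  qed
  have scal: "A.act (\<lambda>n. k * F n) n = k * A.act F n" if "F \<in> S" for k F n
  proof -
    have "To (\<lambda>n. k * F n) = (\<lambda>n. k * To F n)" "Ro i a (\<lambda>n. k * F n) = (\<lambda>n. k * Ro i a F n)" for i a
      using Rop_cmult[OF wedges_nilbar(2) that] Rop_cmult[OF wedges_nilbar(1) that] by simp_all
    then show ?thesis by (simp add: A.act_def sum_fun sum_distrib_left algebra_simps)
  qed
  have cS: "(\<lambda>n. q * coef W i c * cubic_op i c h n) \<in> S" for i c by (intro smooth_funs_cmult cubic_op_S h)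
  have "Omega3 D W h = (\<Sum>i\<in>UNIV. \<Sum>c\<in>UNIV. (\<lambda>n. q * coef W i c * cubic_op i c h n))"
    by (rule ext) (simp add: O[OF h] sum_fun)
  then have "A.act (Omega3 D W h) n = (\<Sum>i\<in>UNIV. \<Sum>c\<in>UNIV. A.act (\<lambda>n. q * coef W i c * cubic_op i c h n) n)"
    using cS by (simp add: A.act_sum sum_fun)
  also have "\<dots> = (\<Sum>i\<in>UNIV. \<Sum>c\<in>UNIV. q * coef W i c * A.act (cubic_op i c h) n)"
    by (simp add: scal cubic_op_S[OF h])
  finally have "A.act (Omega3 D W h) n - Omega3 D W (A.act h) n = 
      (\<Sum>i\<in>UNIV. \<Sum>c\<in>UNIV. q * coef W i c * A.bracket (cubic_op i c) h n)"
    using h by (simp add: O A.bracket_def right_diff_distrib sum_subtractf)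
  also have "\<dots> = (\<Sum>l\<in>UNIV. \<Sum>d\<in>UNIV. mult_coef Y W l d n * (q * cubic_op l d h n))"
  proof -
    let ?t = "Phi Y (f 1) (e 1) n + Phi Y (f 2) (e 2) n"
    let ?G = "\<lambda>i j. Phi Y (f i) (e j) n" and ?m = "\<lambda>b c. Phi Y (v b) (v c) n" and ?k = "coef W" and ?C = "\<lambda>i c. cubic_op i c h n"
    have "(\<Sum>i\<in>UNIV. \<Sum>c\<in>UNIV. q * ?k i c * A.bracket (cubic_op i c) h n) =
       (\<Sum>i\<in>UNIV. \<Sum>c\<in>UNIV. - ?t * ?k i c * (q * ?C i c)) - (\<Sum>i\<in>UNIV. \<Sum>c\<in>UNIV. \<Sum>j\<in>UNIV. ?k i c * ?G i j * (q * ?C j c))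
        + (\<Sum>i\<in>UNIV. \<Sum>c\<in>UNIV. \<Sum>b\<in>UNIV. ?k i c * ?m b c * (q * ?C i b))"
      unfolding A.bracket_cubic[OF h, unfolded cub]
      by (simp add: sum_fun sum_distrib_left sum.distrib sum_subtractf sum_negf algebra_simps)
    also have "(\<Sum>i\<in>UNIV. \<Sum>c\<in>UNIV. \<Sum>j\<in>UNIV. ?k i c * ?G i j * (q * ?C j c)) = 
       (\<Sum>j\<in>UNIV. \<Sum>c\<in>UNIV. \<Sum>i\<in>UNIV. ?k i c * ?G i j * (q * ?C j c))"
      by (simp add: sum_2 sum.distrib algebra_simps)
    also have "(\<Sum>i\<in>UNIV. \<Sum>c\<in>UNIV. \<Sum>b\<in>UNIV. ?k i c * ?m b c * (q * ?C i b)) = 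
       (\<Sum>i\<in>UNIV. \<Sum>b\<in>UNIV. \<Sum>c\<in>UNIV. ?k i c * ?m b c * (q * ?C i b))"
      by (intro sum.cong refl sum.swap)
    finally show ?thesis
      by (simp add: mult_coef_def left_diff_distrib distrib_right sum_distrib_right sum.distrib sum_subtractf)
  qed
  also have "\<dots> = (\<Sum>l\<in>UNIV. \<Sum>d\<in>UNIV. mult_coef Y W l d n * Omega3 D (wedge (v d) (f l)) h n)"
    by (simp add: Omega3_frame[OF h] q_def)
  finally show ?thesis by (simp add: Pi_act_eq[OF Y] h OS)
qed

text \<open>The matrix \<open>C(Y)\<close> is the one for the basis \<open>v\<^sub>d \<and>
  f\<^sub>l\<close>, transported to the basis \<open>Ys\<close>. Independence at \<open>n\<close>
  reduces to \<open>Omega3_injective\<close> because \<open>\<Omega>\<^sub>3\<close> is linear on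
  \<open>V\<^sup>-\<close>.\<close>

theorem conformal:
  assumes dist: "distinct Ys" and indep: "\<not> cmat.dependent (set Ys)" and span: "cmat.span (set Ys) = Vminus D"
  shows "conformally_invariant_system M so8 (Pi_act D) (map (Omega3 D) Ys)"
  unfolding conformally_invariant_system_def length_map
proof (intro conjI ballI allI impI)
  have Ys: "Ys ! j \<in> eigsp D (- 1)" if "j < length Ys" for j
    using that span cmat.span_base[of "Ys ! j" "set Ys"] by simp
  have reindex: "(\<Sum>j<length Ys. F (Ys ! j)) = (\<Sum>y\<in>set Ys. F y)" for F :: "mat8 \<Rightarrow> 'z::comm_monoid_add"
    using sum.reindex_bij_betw[OF bij_betw_nth[OF dist refl refl], of F] by simp
  show "set (map (Omega3 D) Ys) \<subseteq> diff_ops M"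
    using Omega3_diff_ops span cmat.span_superset[of "set Ys"] by auto
  show "c j = 0" if n: "n \<in> M" and z: "\<forall>h\<in>S. (\<Sum>j<length Ys. c j * (map (Omega3 D) Ys ! j) h n) = 0" and j: "j < length Ys"
    for n c j
  proof -
    define c' where "c' y = c (the_inv_into {..<length Ys} ((!) Ys) y)" for y
    have inj: "inj_on ((!) Ys) {..<length Ys}" using dist by (simp add: inj_on_nth)
    have c': "c' (Ys ! j) = c j" if "j < length Ys" for j
      using that the_inv_into_f_f[OF inj, of j] by (simp add: c'_def)
    define W where "W = (\<Sum>j\<in>{..<length Ys}. c j *\<^sub>C Ys ! j)"
    have W: "W \<in> eigsp D (- 1)"
      unfolding W_def by (intro cmat.subspace_sum[OF eigsp_subspace] cmat.subspace_scale[OF eigsp_subspace]) (simp add: Ys)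
    have "Omega3 D W h n = 0" if h: "h \<in> S" for h
    proof -
      have "Omega3 D W h n = (\<Sum>j<length Ys. c j * Omega3 D (Ys ! j) h n)"
        unfolding W_def by (rule Omega3_sum[OF h]) (simp_all add: Ys)
      also have "\<dots> = (\<Sum>j<length Ys. c j * (map (Omega3 D) Ys ! j) h n)" by (rule sum.cong) simp_all
      finally show ?thesis using z h by simp
    qed
    from Omega3_injective[OF W n this] have "W = 0" .
    moreover have "W = (\<Sum>y\<in>set Ys. c' y *\<^sub>C y)"
      unfolding W_def reindex[symmetric, of "\<lambda>y. c' y *\<^sub>C y"] by (rule sum.cong) (simp_all add: c')
    ultimately have "(\<Sum>y\<in>set Ys. c' y *\<^sub>C y) = 0" by simp
    then have "c' (Ys ! j) = 0"
      using cmat.independentD[OF indep finite_set subset_refl, of c' "Ys ! j"] j by simp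
    then show ?thesis using c' j by simp
  qed
  show "\<exists>C. (\<forall>i<length Ys. \<forall>j<length Ys. C i j \<in> S) \<and>
     (\<forall>j<length Ys. \<forall>h\<in>S. \<forall>x\<in>M. Pi_act D Y ((map (Omega3 D) Ys ! j) h) x - (map (Omega3 D) Ys ! j) (Pi_act D Y h) x
        = (\<Sum>i<length Ys. C i j x * (map (Omega3 D) Ys ! i) h x))" if Y: "Y \<in> so8" for Y
  proof -
    define rep where "rep l d y = cmat.representation (set Ys) (wedge (v d) (f l)) y" for l d y
    have rep: "wedge (v d) (f l) = (\<Sum>y\<in>set Ys. rep l d y *\<^sub>C y)" for l d
      unfolding rep_def using cmat.sum_representation_eq[OF indep _ finite_set subset_refl, of "wedge (v d) (f l)"] wedge_grades(2) span by simp
    have O: "Omega3 D (wedge (v d) (f l)) h n = (\<Sum>i<length Ys. rep l d (Ys ! i) * Omega3 D (Ys ! i) h n)" if h: "h \<in> S" for l d h n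
    proof -
      have "Omega3 D (wedge (v d) (f l)) h n = Omega3 D (\<Sum>y\<in>set Ys. rep l d y *\<^sub>C y) h n" by (simp flip: rep)
      also have "\<dots> = (\<Sum>y\<in>set Ys. rep l d y * Omega3 D y h n)"
        by (rule Omega3_sum[OF h]) (use span cmat.span_superset[of "set Ys"] in auto)
      finally show ?thesis by (simp add: reindex[of "\<lambda>y. rep l d y * Omega3 D y h n"])
    qed
    define C where "C i j x = (\<Sum>l\<in>UNIV. \<Sum>d\<in>UNIV. rep l d (Ys ! i) * mult_coef Y (Ys ! j) l d x)" for i j x
    show ?thesis
    proof (intro exI[of _ C] conjI allI impI ballI)
      fix i j assume "i < length Ys" "j < length Ys"
      show "C i j \<in> S" unfolding C_def[abs_def] by (intro S_sum_fun smooth_funs_cmult mult_coef_S)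
    next
      fix j h x assume j: "j < length Ys" and h: "h \<in> S" and x: "x \<in> M"
      have "(\<Sum>l\<in>UNIV. \<Sum>d\<in>UNIV. mult_coef Y (Ys ! j) l d x * Omega3 D (wedge (v d) (f l)) h x) =
        (\<Sum>l\<in>UNIV. \<Sum>d\<in>UNIV. \<Sum>i<length Ys. rep l d (Ys ! i) * mult_coef Y (Ys ! j) l d x * Omega3 D (Ys ! i) h x)"
        unfolding O[OF h] by (simp add: sum_distrib_left mult_ac)
      also have "\<dots> = (\<Sum>l\<in>UNIV. \<Sum>i<length Ys. \<Sum>d\<in>UNIV. rep l d (Ys ! i) * mult_coef Y (Ys ! j) l d x * Omega3 D (Ys ! i) h x)"
        by (intro sum.cong refl sum.swap)
      also have "\<dots> = (\<Sum>i<length Ys. C i j x * Omega3 D (Ys ! i) h x)"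
        by (subst sum.swap) (simp add: C_def sum_distrib_right)
      finally show "Pi_act D Y ((map (Omega3 D) Ys ! j) h) x - (map (Omega3 D) Ys ! j) (Pi_act D Y h) x
        = (\<Sum>i<length Ys. C i j x * (map (Omega3 D) Ys ! i) h x)"
        using Omega3_bracket[OF Y Ys[OF j] h] j by simp
    qed
  qed
qed

end

theorem theorem3p13:
  fixes D :: heis_data and Ys :: "mat8 list"
  assumes "heisenberg_setting D"
    and "distinct Ys" and "\<not> cmat.dependent (set Ys)" and "cmat.span (set Ys) = Vminus D"
  shows "conformally_invariant_system (Nbar0 D) so8 (Pi_act D) (map (Omega3 D) Ys)"
proof -
  have "cartan_subalgebra (csa D)" using assms(1) by (simp add: heisenberg_setting_def)
  then obtain u where "cartan_frame (csa D) u" by (rule cartan_frame_exists)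
  then interpret cartan_frame "csa D" u .
  have "hroot D \<in> roots (csa D)" using assms(1) by (simp add: heisenberg_setting_def highest_root_def)
  then obtain c d where cd: "(c, d) \<in> RI" "hroot D = rt c d" by (auto simp: roots_eq)
  obtain u' where u': "cartan_frame (csa D) u'" "cartan_frame.rt (csa D) u' 1 2 = rt c d"
    using relabel[OF cd(1)] by blast
  then interpret F: cartan_frame "csa D" u' by simp
  interpret heis D u'
    by unfold_locales (use assms(1) u'(2) cd(2) in simp_all)
  show ?thesis using conformal assms(2-4) by blast
qed

end
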